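(* Let $n\ge1$ be an integer, let $k$ be a field with $\operatorname{char}(k)\nmid n!$, let $D=D_n$ or $D=\mathrm{UD}(n)$, and let $m\geq 1$ be an integer divisible by $\operatorname{sqf}(n)$. (a) (For $m\le n$.) $\sigma^{(m)}(x)\ne 0$ for any $x\in D-\{0\}$. (b) If $\det(x_1)=\dots=\det(x_m)$ for some $x_1,\dots,x_m\in D-\{0\}$, then $\operatorname{tr}(x_1\cdots x_m)\neq 0$. (c) $D$ does not have an element of reduced norm $1$ and reduced trace $0$.
   Context: Characteristic $0$ is regarded as dividing no positive integer. $\operatorname{sqf}(n)$ denotes the product of the distinct primes dividing $n$. For a central simple algebra $A$ of degree $n$ with center $F$ and $x\in A$, the elements $\sigma^{(i)}(x)\in F$ ($1\le i\le n$) are defined by $\det(\lambda 1-x)=\lambda^n+\sigma^{(1)}(x)\lambda^{n-1}+\dots+\sigma^{(n)}(x)$, where $\det$ is the reduced norm (of $A\otimes_F F(\lambda)$). $\sigma^{(i)}$ is only considered for $1\le i\le n$. On $D$, $\det$ denotes the reduced norm and $\operatorname{tr}=-\sigma^{(1)}$ the reduced trace. The algebra $D_n$: write $n=p_1\cdots p_s$ as a product of (not necessarily distinct) primes, and let $K=k(z_1,w_1,\dots,z_s,w_s)$ with $z_1,w_1,\dots,z_s,w_s$ independent variables over $k$. Then $D_n=(z_1,w_1)_{p_1}\otimes_K\dots\otimes_K(z_s,w_s)_{p_s}$, where the symbol algebra is $(z,w)_r=K\{x,y\}/(x^r=z,\ y^r=w,\ yx=\zeta_r xy)$ and $\zeta_r$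 is a primitive $r$th root of unity in $K$ (so when $D=D_n$ it is assumed that $k$ contains primitive $p_i$th roots of unity for each $i$). $D_n$ is a division algebra of degree $n$ with center $K$. The universal division algebra $\mathrm{UD}(n)$ is the subalgebra of $\mathrm{M}_n(k(s_{ij},t_{ij}))$ generated, as a division algebra, by the two generic $n\times n$ matrices $(s_{ij})$ and $(t_{ij})$, where $s_{ij},t_{ij}$ are $2n^2$ independent variables over $k$. *)

theory Defs
  imports
    "HOL-Algebra.Algebraic_Closure_Type"
    "HOL-Algebra.Product_Groups"
    "HOL-Algebra.QuotRing"
    "HOL-Library.Poly_Mapping"
    "HOL-Computational_Algebra.Fraction_Field"
    "Jordan_Normal_Form.Char_Poly"
begin

definition sqf :: "nat \<Rightarrow> nat" where
  "sqf n = (\<Prod>p\<in>prime_factors n. p)"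

definition primitive_root_of_unity :: "nat \<Rightarrow> 'a::field \<Rightarrow> bool" where
  "primitive_root_of_unity r a \<longleftrightarrow> a ^ r = 1 \<and> (\<forall>j. 0 < j \<and> j < r \<longrightarrow> a ^ j \<noteq> 1)"


text \<open>
  The type \<open>'k ratfun\<close> is the rational function field over \<open>'k\<close> in countably many independent
  variables \<open>rvar 0, rvar 1, \<dots>\<close>. The fields of rational functions in finitely many
  variables are the subfields \<open>ratfun_field V\<close>, for finite sets \<open>V\<close> of variable indices.
\<close>

type_synonym 'k mvpoly = "(nat \<Rightarrow>\<^sub>0 nat) \<Rightarrow>\<^sub>0 'k"
type_synonym 'k ratfun = "'k mvpoly fract"

definition rconst :: "'k::field \<Rightarrow> 'k ratfun" where
  "rconst c = Fract (Poly_Mapping.single 0 c) 1"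

definition rvar :: "nat \<Rightarrow> 'k::field ratfun" where
  "rvar i = Fract (Poly_Mapping.single (Poly_Mapping.single i 1) 1) 1"

definition polys_in :: "nat set \<Rightarrow> 'k::field mvpoly set" where
  "polys_in V = {p. \<forall>\<mu>\<in>Poly_Mapping.keys p. Poly_Mapping.keys \<mu> \<subseteq> V}"

definition ratfun_field :: "nat set \<Rightarrow> 'k::field ratfun set" where
  "ratfun_field V = {Fract p q | p q. p \<in> polys_in V \<and> q \<in> polys_in V \<and> q \<noteq> 0}"


text \<open>
  \<open>splitting A n \<phi>\<close>: \<open>\<phi>\<close> sends the center \<open>F\<close> of \<open>A\<close> to scalar matrices, so it induces a field
  embedding of \<open>F\<close> into \<open>'e\<close> and an \<open>'e\<close>-algebra homomorphism from the scalar extension of \<open>A\<close>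
  along it to the \<open>n \<times> n\<close> matrices over \<open>'e\<close>. The last condition says that this homomorphism is
  surjective; it is injective as soon as \<open>A\<close> is central simple over \<open>F\<close>.
\<close>

definition ring_center :: "('a, 'b) ring_scheme \<Rightarrow> 'a set" where
  "ring_center A = {z \<in> carrier A. \<forall>x\<in>carrier A. z \<otimes>\<^bsub>A\<^esub> x = x \<otimes>\<^bsub>A\<^esub> z}"

definition splitting :: "('a, 'b) ring_scheme \<Rightarrow> nat \<Rightarrow> ('a \<Rightarrow> 'e::field mat) \<Rightarrow> bool" where
  "splitting A n \<phi> \<longleftrightarrow>
     \<phi> \<in> Ring.ring_hom A (ring_mat TYPE('e) n ()) \<and>
     (\<forall>z\<in>ring_center A. \<exists>c. \<phi> z = c \<cdot>\<^sub>m 1\<^sub>m n) \<and>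
     (\<forall>M\<in>carrier_mat n n. \<exists>S c. finite S \<and> S \<subseteq> carrier A \<and>
        M = (\<Oplus>\<^bsub>ring_mat TYPE('e) n ()\<^esub>a\<in>S. c a \<cdot>\<^sub>m \<phi> a))"

text \<open>
  For a central simple algebra \<open>A\<close> of degree \<open>n\<close>, \<open>reduced f A n x\<close> is the element of the center
  that is mapped to \<open>f (\<phi> x)\<close> by a splitting \<open>\<phi>\<close> of \<open>A\<close> over the field \<open>'e\<close>. This is meant for
  \<open>f\<close> the determinant or a coefficient of the characteristic polynomial, when the result does
  not depend on \<open>\<phi>\<close>, and for \<open>'e\<close> large enough to split \<open>A\<close>, e.g.\ algebraically closed and
  containing a copy of the center.
\<close>

definition reduced :: "('e::field mat \<Rightarrow> 'e) \<Rightarrow> ('a, 'b) ring_scheme \<Rightarrow> nat \<Rightarrow> 'a \<Rightarrow> 'a" where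
  "reduced f A n x =
     (THE c. c \<in> ring_center A \<and>
        (\<exists>\<phi>. splitting A n \<phi> \<and> \<phi> c = f (\<phi> x) \<cdot>\<^sub>m 1\<^sub>m n))"

definition red_norm :: "'e::field itself \<Rightarrow> ('a, 'b) ring_scheme \<Rightarrow> nat \<Rightarrow> 'a \<Rightarrow> 'a" where
  "red_norm _ A n x = reduced (det :: 'e mat \<Rightarrow> 'e) A n x"

text \<open>
  \<open>red_sigma _ A n i x\<close> is the coefficient of \<open>\<lambda>\<^sup>n\<^sup>-\<^sup>i\<close> in the reduced norm of \<open>\<lambda> - x\<close>; it is
  only meaningful for \<open>1 \<le> i \<le> n\<close>. There are no signs: \<open>char_poly M\<close> is \<open>det (\<lambda> - M)\<close>.
\<close>

definition red_sigma :: "'e::field itself \<Rightarrow> ('a, 'b) ring_scheme \<Rightarrow> nat \<Rightarrow> nat \<Rightarrow> 'a \<Rightarrow> 'a" where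
  "red_sigma _ A n i x = reduced (\<lambda>M :: 'e mat. coeff (char_poly M) (n - i)) A n x"

definition red_trace :: "'e::field itself \<Rightarrow> ('a, 'b) ring_scheme \<Rightarrow> nat \<Rightarrow> 'a \<Rightarrow> 'a" where
  "red_trace E A n x = \<ominus>\<^bsub>A\<^esub> (red_sigma E A n 1 x)"

definition list_mult :: "('a, 'b) monoid_scheme \<Rightarrow> 'a list \<Rightarrow> 'a" where
  "list_mult A xs = foldr (\<otimes>\<^bsub>A\<^esub>) xs \<one>\<^bsub>A\<^esub>"


text \<open>
  The monoid algebra \<open>K[G]\<close>, for a subfield \<open>K\<close> of \<open>'f\<close>. Its elements are the finitely supported
  functions from \<open>G\<close> to \<open>K\<close>.
\<close>

definition monoid_algebra :: "'f::field set \<Rightarrow> ('g, 'b) monoid_scheme \<Rightarrow> ('g \<Rightarrow> 'f) ring" where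
  "monoid_algebra K G =
     \<lparr>carrier = {f. finite {g. f g \<noteq> 0} \<and> (\<forall>g. f g \<in> K) \<and> (\<forall>g. g \<notin> carrier G \<longrightarrow> f g = 0)},
      monoid.mult = (\<lambda>f h g. \<Sum>(a, b) | f a \<noteq> 0 \<and> h b \<noteq> 0 \<and> a \<otimes>\<^bsub>G\<^esub> b = g. f a * h b),
      one = (\<lambda>g. if g = \<one>\<^bsub>G\<^esub> then 1 else 0),
      zero = (\<lambda>g. 0),
      add = (\<lambda>f h g. f g + h g)\<rparr>"

definition mono_term :: "'f::field \<Rightarrow> 'g \<Rightarrow> 'g \<Rightarrow> 'f" where
  "mono_term c g = (\<lambda>g'. if g' = g then c else 0)"

text \<open>The free algebra \<open>K{x, y}\<close> is the monoid algebra of the free monoid on two generators.\<close>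

datatype sym_gen = GenX | GenY

definition word_monoid :: "'g list monoid" where
  "word_monoid = \<lparr>carrier = UNIV, monoid.mult = (@), one = []\<rparr>"

definition symbol_relations :: "nat \<Rightarrow> 'f::field \<Rightarrow> 'f \<Rightarrow> 'f \<Rightarrow> (sym_gen list \<Rightarrow> 'f) set" where
  "symbol_relations r \<zeta> z w =
     {mono_term 1 (replicate r GenX) - mono_term z [],
      mono_term 1 (replicate r GenY) - mono_term w [],
      mono_term 1 [GenY, GenX] - mono_term \<zeta> [GenX, GenY]}"

definition symbol_ideal ::
  "'f::field set \<Rightarrow> nat \<Rightarrow> 'f \<Rightarrow> 'f \<Rightarrow> 'f \<Rightarrow> (sym_gen list \<Rightarrow> 'f) set" where
  "symbol_ideal K r \<zeta> z w =
     genideal (monoid_algebra K word_monoid) (symbol_relations r \<zeta> z w)"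

text \<open>The symbol algebra \<open>(z, w)\<^sub>r\<close> over \<open>K\<close>, and its structure map from \<open>K\<close>.\<close>

definition symbol_algebra ::
  "'f::field set \<Rightarrow> nat \<Rightarrow> 'f \<Rightarrow> 'f \<Rightarrow> 'f \<Rightarrow> (sym_gen list \<Rightarrow> 'f) set ring" where
  "symbol_algebra K r \<zeta> z w = monoid_algebra K word_monoid Quot symbol_ideal K r \<zeta> z w"

definition symbol_scalar ::
  "'f::field set \<Rightarrow> nat \<Rightarrow> 'f \<Rightarrow> 'f \<Rightarrow> 'f \<Rightarrow> 'f \<Rightarrow> (sym_gen list \<Rightarrow> 'f) set" where
  "symbol_scalar K r \<zeta> z w c =
     symbol_ideal K r \<zeta> z w +>\<^bsub>monoid_algebra K word_monoid\<^esub> mono_term c []"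


text \<open>
  The tensor product over \<open>K\<close> of the algebras \<open>A i\<close> (\<open>i < s\<close>) with structure maps \<open>\<iota> i\<close> from \<open>K\<close>:
  the free \<open>K\<close>-module on the product of the sets \<open>A i\<close>, modulo the multilinearity relations, with
  componentwise multiplication of pure tensors. The submodule spanned by these relations is closed
  under multiplication by basis elements, so it coincides with the ideal they generate.
\<close>

definition tensor_relations ::
  "'f::field set \<Rightarrow> nat \<Rightarrow> (nat \<Rightarrow> ('a, 'b) ring_scheme) \<Rightarrow> (nat \<Rightarrow> 'f \<Rightarrow> 'a)
     \<Rightarrow> ((nat \<Rightarrow> 'a) \<Rightarrow> 'f) set" where
  "tensor_relations K s A \<iota> =
     {mono_term 1 (a(i := b \<oplus>\<^bsub>A i\<^esub> c)) - mono_term 1 (a(i := b)) - mono_term 1 (a(i := c)) | a i b c.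
        i < s \<and> a \<in> (\<Pi>\<^sub>E j\<in>{..<s}. carrier (A j)) \<and> b \<in> carrier (A i) \<and> c \<in> carrier (A i)} \<union>
     {mono_term 1 (a(i := \<iota> i c \<otimes>\<^bsub>A i\<^esub> b)) - mono_term c (a(i := b)) | a i b c.
        i < s \<and> a \<in> (\<Pi>\<^sub>E j\<in>{..<s}. carrier (A j)) \<and> b \<in> carrier (A i) \<and> c \<in> K}"

definition tensor_algebra ::
  "'f::field set \<Rightarrow> nat \<Rightarrow> (nat \<Rightarrow> ('a, 'b) ring_scheme) \<Rightarrow> (nat \<Rightarrow> 'f \<Rightarrow> 'a)
     \<Rightarrow> ((nat \<Rightarrow> 'a) \<Rightarrow> 'f) set ring" where
  "tensor_algebra K s A \<iota> =
     (let R = monoid_algebra K (product_group {..<s} A)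
      in R Quot genideal R (tensor_relations K s A \<iota>))"

text \<open>
  The algebra \<open>D\<^sub>n\<close> for the factorization \<open>n = prod_list ps\<close> into primes: its base field is
  \<open>K = k(z\<^sub>i, w\<^sub>i)\<close> with \<open>z\<^sub>i = rvar (2 * i)\<close> and \<open>w\<^sub>i = rvar (2 * i + 1)\<close> for \<open>i < length ps\<close>, and
  \<open>\<zeta> r\<close> is the chosen primitive \<open>r\<close>-th root of unity, for each \<open>r\<close> in \<open>ps\<close>.
\<close>

definition D_algebra ::
  "nat list \<Rightarrow> (nat \<Rightarrow> 'k::field)
     \<Rightarrow> ((nat \<Rightarrow> (sym_gen list \<Rightarrow> 'k ratfun) set) \<Rightarrow> 'k ratfun) set ring" where
  "D_algebra ps \<zeta> =
     (let s = length ps; K = ratfun_field {..<2 * s}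
      in tensor_algebra K s
           (\<lambda>i. symbol_algebra K (ps ! i) (rconst (\<zeta> (ps ! i))) (rvar (2 * i)) (rvar (2 * i + 1)))
           (\<lambda>i. symbol_scalar K (ps ! i) (rconst (\<zeta> (ps ! i))) (rvar (2 * i)) (rvar (2 * i + 1))))"


definition generic_mat_s :: "nat \<Rightarrow> 'k::field ratfun mat" where
  "generic_mat_s n = mat n n (\<lambda>(i, j). rvar (2 * (i * n + j)))"

definition generic_mat_t :: "nat \<Rightarrow> 'k::field ratfun mat" where
  "generic_mat_t n = mat n n (\<lambda>(i, j). rvar (2 * (i * n + j) + 1))"

text \<open>
  The \<open>k\<close>-subalgebra of the matrix algebra generated by the two generic matrices under the ring
  operations and inversion. By Amitsur's theorem every nonzero element of it is invertible, so
  this is the division algebra generated by them. All its elements have entries in the field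
  generated by the entries of the two generic matrices.
\<close>

inductive_set UD_set :: "nat \<Rightarrow> 'k::field ratfun mat set" for n :: nat where
  scalar: "rconst c \<cdot>\<^sub>m 1\<^sub>m n \<in> UD_set n"
| gen_s: "generic_mat_s n \<in> UD_set n"
| gen_t: "generic_mat_t n \<in> UD_set n"
| add: "A \<in> UD_set n \<Longrightarrow> B \<in> UD_set n \<Longrightarrow> A + B \<in> UD_set n"
| mult: "A \<in> UD_set n \<Longrightarrow> B \<in> UD_set n \<Longrightarrow> A * B \<in> UD_set n"
| inverse: "A \<in> UD_set n \<Longrightarrow> B \<in> carrier_mat n n \<Longrightarrow> A * B = 1\<^sub>m n \<Longrightarrow> B * A = 1\<^sub>m n \<Longrightarrow> B \<in> UD_set n"

definition UD_algebra :: "nat \<Rightarrow> 'k::field ratfun mat ring" where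
  "UD_algebra n = (ring_mat TYPE('k ratfun) n ())\<lparr>carrier := UD_set n\<rparr>"

end

theory Submission
  imports Defs
begin

text \<open>Both algebras embed into matrices over a field of rational functions whose variables come in
  pairs, one pair for each prime factor \<open>p\<close> of \<open>n\<close>, in such a way that the image is equivariant:
  conjugating an element of it by the clock or the shift matrix belonging to \<open>p\<close> amounts to
  multiplying one of the variables by a primitive \<open>p\<close>-th root of unity. For \<open>D\<^sub>n\<close> the generators of
  the symbol algebras go to multiples of the shift and the clock matrices, and for \<open>UD(n)\<close> one
  specializes the generic matrices, since every constant matrix is the value at \<open>1\<close> of an
  equivariant matrix of polynomials. The coefficient matrix \<open>C\<close> of the lowest monomial of a nonzero
  equivariant matrix is a common eigenvector of all these conjugations, hence is an invertible
  matrix some power of which is scalar, while the smaller powers have trace zero. So the coefficient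
  of \<open>\<lambda>\<^sup>n\<^sup>-\<^sup>m\<close> in its characteristic polynomial is nonzero, and it is the leading coefficient
  of the one in question, which gives (a). If \<open>x\<^sub>1, \<dots>, x\<^sub>m\<close> have the same norm, then their lowest
  monomials coincide, the leading coefficients of the \<open>x\<^sub>i\<close> are proportional, and the leading
  coefficient of \<open>x\<^sub>1 \<cdots> x\<^sub>m\<close> is a nonzero scalar matrix. That the reduced
  values exist at all follows from Newton's identities, as soon as each element is congruent to a
  central one modulo elements on which every splitting has trace zero.\<close>

text \<open>\<open>reduced\<close> ranges over all splittings with values in one algebraically
  closed field, and two of them may embed the center differently. So an invariant makes sense only
  once a single central element is shown to compute it under every splitting; this is why the traces
  of both algebras are described explicitly, by commutators for UD(n) and by the monomial basis for
  D_n. Recovering characteristic coefficients from power traces divides by 1, ..., n, hence the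
  hypothesis on n!. For UD(n) the field k may lack roots of unity, so the constants of the
  equivariant matrices are taken from an algebraic closure. Fractions are handled by a common
  denominator q; it is not invariant under the rescalings, and its lowest monomial enters the
  eigenvalues as a correction by roots of unity. With e the common order of the eigenvalues, the
  power traces are those of a matrix with characteristic polynomial (X^e - t)^(n/e), whose
  coefficients at X^(n - j e) do not vanish. The eigenvalues are roots of unity of orders dividing
  the primes p, so e divides sqf(n), and therefore m.\<close>

definition mat_tr :: "'a::comm_monoid_add mat \<Rightarrow> 'a" where
  "mat_tr M = (\<Sum>i<dim_row M. M $$ (i, i))"

lemma mat_tr_mult_comm:
  fixes M N :: "'a::comm_ring_1 mat"
  assumes "M \<in> carrier_mat n n" "N \<in> carrier_mat n n"
  shows "mat_tr (M * N) = mat_tr (N * M)"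
proof -
  have "mat_tr (M * N) = (\<Sum>i<n. \<Sum>j<n. M $$ (i, j) * N $$ (j, i))"
    using assms by (simp add: mat_tr_def scalar_prod_def atLeast0LessThan)
  also have "\<dots> = (\<Sum>j<n. \<Sum>i<n. N $$ (j, i) * M $$ (i, j))"
    by (subst sum.swap) (simp add: mult.commute)
  also have "\<dots> = mat_tr (N * M)"
    using assms by (simp add: mat_tr_def scalar_prod_def atLeast0LessThan)
  finally show ?thesis .
qed

lemma mat_tr_add:
  assumes "M \<in> carrier_mat n n" "N \<in> carrier_mat n n"
  shows "mat_tr (M + N) = mat_tr M + mat_tr N"
  using assms by (simp add: mat_tr_def sum.distrib)

lemma mat_tr_smult:
  fixes c :: "'a::semiring_0"
  assumes "M \<in> carrier_mat n n"
  shows "mat_tr (c \<cdot>\<^sub>m M) = c * mat_tr M"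
  using assms by (simp add: mat_tr_def sum_distrib_left)

lemma mat_tr_scalar: "mat_tr (c \<cdot>\<^sub>m 1\<^sub>m n) = of_nat n * (c::'a::comm_ring_1)"
  by (simp add: mat_tr_def)

text \<open>The derivative of det(X - A) is the sum of the characteristic polynomials of the
  principal submatrices (\<open>pderiv_char_poly\<close>), and each of these is a diagonal cofactor
  of X - A.\<close>

lemma pderiv_char_poly_adj:
  fixes A :: "'a::idom mat"
  assumes A: "A \<in> carrier_mat n n"
  shows "pderiv (char_poly A) = mat_tr (adj_mat (char_poly_matrix A))"
proof -
  have "char_poly (mat_delete A i i) = adj_mat (char_poly_matrix A) $$ (i, i)" if "i < n" for i
  proof -
    have "char_poly_matrix (mat_delete A i i) = mat_delete (char_poly_matrix A) i i"
      using A that by (intro eq_matI) (auto simp: char_poly_matrix_def mat_delete_def insert_index_def)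
    then show ?thesis
      using A that by (simp add: adj_mat_def cofactor_def char_poly_def char_poly_matrix_def)
  qed
  then show ?thesis
    using A adj_mat(1)[of "char_poly_matrix A" n]
    by (simp add: pderiv_char_poly[OF A] mat_tr_def)
qed

text \<open>This splits (X - A) B as X B - A B. Multiplication by X is \<open>pCons 0\<close>, a
  shift of coefficients, so the coefficients of the adjugate can be compared one degree at a
  time.\<close>

lemma char_poly_matrix_mult_entry:
  fixes A :: "'a::comm_ring_1 mat"
  assumes A: "A \<in> carrier_mat n n" and B: "B \<in> carrier_mat n n" and ij: "i < n" "j < n"
  shows "(char_poly_matrix A * B) $$ (i, j) = pCons 0 (B $$ (i, j)) - (\<Sum>k<n. smult (A $$ (i, k)) (B $$ (k, j)))"
proof -
  have "(char_poly_matrix A * B) $$ (i, j) = (\<Sum>k<n. char_poly_matrix A $$ (i, k) * B $$ (k, j))"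
    using A B ij carrier_matD[OF char_poly_matrix_closed[OF A]] by (simp add: scalar_prod_def atLeast0LessThan)
  also have "\<dots> = (\<Sum>k<n. (if i = k then pCons 0 (B $$ (k, j)) else 0) - smult (A $$ (i, k)) (B $$ (k, j)))"
    using A ij by (intro sum.cong) (auto simp: char_poly_matrix_def)
  also have "\<dots> = pCons 0 (B $$ (i, j)) - (\<Sum>k<n. smult (A $$ (i, k)) (B $$ (k, j)))"
    using ij by (simp add: sum_subtractf)
  finally show ?thesis .
qed

text \<open>The element \<open>\<sigma>^(i)\<close> of a matrix, counted down from the leading
  coefficient. Truncated subtraction returns the constant coefficient when i > n, hence the bound on
  i in the identities for it.\<close>

abbreviation char_coeff :: "'a::comm_ring_1 mat \<Rightarrow> nat \<Rightarrow> nat \<Rightarrow> 'a" where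
  "char_coeff A n i \<equiv> coeff (char_poly A) (n - i)"

lemma mult_pow_mat:
  fixes A :: "'a::comm_ring_1 mat"
  assumes A: "A \<in> carrier_mat n n"
  shows "A * A ^\<^sub>m k = A ^\<^sub>m Suc k"
proof (induction k)
  case (Suc k)
  then show ?case
    using assoc_mult_mat[OF A pow_carrier_mat[OF A, of k] A] by simp
qed (use A in simp)

lemma sum_mult_pow_mat:
  fixes A :: "'a::comm_ring_1 mat"
  assumes A: "A \<in> carrier_mat n n" and ij: "i < n" "j < n"
  shows "(\<Sum>m<n. A $$ (i, m) * (\<Sum>l<k. c l * (A ^\<^sub>m (k - 1 - l)) $$ (m, j))) =
         (\<Sum>l<k. c l * (A ^\<^sub>m (k - l)) $$ (i, j))"
proof -
  have "(\<Sum>m<n. A $$ (i, m) * (\<Sum>l<k. c l * (A ^\<^sub>m (k - 1 - l)) $$ (m, j))) =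
    (\<Sum>m<n. \<Sum>l<k. c l * (A $$ (i, m) * (A ^\<^sub>m (k - 1 - l)) $$ (m, j)))"
    by (simp add: sum_distrib_left mult.left_commute)
  also have "\<dots> = (\<Sum>l<k. c l * (\<Sum>m<n. A $$ (i, m) * (A ^\<^sub>m (k - 1 - l)) $$ (m, j)))"
    by (subst sum.swap) (simp add: sum_distrib_left)
  also have "\<dots> = (\<Sum>l<k. c l * (A ^\<^sub>m (k - l)) $$ (i, j))"
  proof (intro sum.cong refl arg_cong2[where f = "(*)"])
    fix l assume l: "l \<in> {..<k}"
    then have "A ^\<^sub>m (k - l) = A * A ^\<^sub>m (k - 1 - l)"
      using mult_pow_mat[OF A, of "k - 1 - l"] by (simp add: Suc_diff_Suc)
    then show "(\<Sum>m<n. A $$ (i, m) * (A ^\<^sub>m (k - 1 - l)) $$ (m, j)) = (A ^\<^sub>m (k - l)) $$ (i, j)"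
      using A ij pow_carrier_mat[OF A, of "k - 1 - l"] by (simp add: scalar_prod_def atLeast0LessThan)
  qed
  finally show ?thesis .
qed

text \<open>The Faddeev--LeVerrier recursion.\<close>

lemma adj_char_poly_matrix_coeff:
  fixes A :: "'a::idom mat"
  assumes A: "A \<in> carrier_mat n n" and "k \<le> n"
  shows "mat n n (\<lambda>(i, j). coeff (adj_mat (char_poly_matrix A) $$ (i, j)) (n - k)) =
         mat n n (\<lambda>(i, j). \<Sum>l<k. char_coeff A n l * (A ^\<^sub>m (k - 1 - l)) $$ (i, j))"
  using \<open>k \<le> n\<close>
proof (induction k)
  case 0
  define B where "B = adj_mat (char_poly_matrix A)"
  have "coeff (B $$ (i, j)) n = 0" if "i < n" "j < n" for i j
  proof -
    \<comment> \<open>A minor of X - A of size n - 1 has entries of degree at most 1, so the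
      adjugate has no term in X^n.\<close>
    have "degree (cofactor (char_poly_matrix A) j i) \<le> n - 1"
    proof -
      let ?M = "mat_delete (char_poly_matrix A) j i"
      have "degree (det ?M) \<le> 1 * (n - 1)"
      proof (rule degree_det_le)
        show "?M \<in> carrier_mat (n - 1) (n - 1)"
          using A by (intro mat_delete_carrier char_poly_matrix_closed)
        fix a b assume "a < n - 1" "b < n - 1"
        then show "degree (?M $$ (a, b)) \<le> 1"
          using A by (auto simp: mat_delete_def char_poly_matrix_def)
      qed
      moreover have "degree (((- 1) ^ (j + i)) :: 'a poly) = 0"
        by (cases "even (j + i)") simp_all
      ultimately show ?thesis
        using degree_mult_le[of "(- 1) ^ (j + i)" "det ?M"] by (simp add: cofactor_def)
    qed
    then show ?thesis
      using A that by (intro coeff_eq_0) (simp add: B_def adj_mat_def char_poly_matrix_def)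
  qed
  then show ?case by (intro eq_matI) (auto simp: B_def)
next
  case (Suc k)
  define B where "B = adj_mat (char_poly_matrix A)"
  have B: "B \<in> carrier_mat n n" and prod: "char_poly_matrix A * B = char_poly A \<cdot>\<^sub>m 1\<^sub>m n"
    using adj_mat[of "char_poly_matrix A" n] A by (auto simp: B_def char_poly_def)
  have IH: "coeff (B $$ (i, j)) (n - k) = (\<Sum>l<k. char_coeff A n l * (A ^\<^sub>m (k - 1 - l)) $$ (i, j))"
    if "i < n" "j < n" for i j
    using arg_cong[OF Suc.IH, of "\<lambda>M. M $$ (i, j)"] Suc.prems that by (simp add: B_def)
  have "coeff (B $$ (i, j)) (n - Suc k) = (\<Sum>l<Suc k. char_coeff A n l * (A ^\<^sub>m (k - l)) $$ (i, j))"
    if ij: "i < n" "j < n" for i j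
  proof -
    \<comment> \<open>The coefficient of X^(n-k) in (X - A) B = det(X - A) I is computed twice. The
      factor X lowers the index at B by one, which isolates the next coefficient of the
      adjugate.\<close>
    have "coeff ((char_poly_matrix A * B) $$ (i, j)) (n - k) = coeff (char_poly A) (n - k) * (if i = j then 1 else 0)"
      unfolding prod using ij by simp
    moreover have "coeff ((char_poly_matrix A * B) $$ (i, j)) (n - k) =
      coeff (B $$ (i, j)) (n - Suc k) - (\<Sum>m<n. A $$ (i, m) * coeff (B $$ (m, j)) (n - k))"
    proof -
      obtain d where d: "n - k = Suc d" "n - Suc k = d"
        using Suc.prems by (metis Suc_diff_Suc Suc_le_lessD)
      show ?thesis
        unfolding char_poly_matrix_mult_entry[OF A B ij] d by (simp add: coeff_sum)
    qed
    moreover have "(\<Sum>m<n. A $$ (i, m) * coeff (B $$ (m, j)) (n - k)) =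
      (\<Sum>l<k. char_coeff A n l * (A ^\<^sub>m (k - l)) $$ (i, j))"
      using sum_mult_pow_mat[OF A ij] ij by (simp add: IH)
    ultimately show ?thesis using A ij by (simp add: algebra_simps)
  qed
  then show ?case by (intro eq_matI) (auto simp: B_def)
qed

text \<open>Take traces in (X - A) adj(X - A) = det(X - A) I and compare coefficients of X^(n-i):
  the trace of the adjugate is the derivative of det(X - A), which contributes n - i times the
  coefficient, and the rest comes from the recursion. The identity involves no division, so it also
  holds for matrices of polynomials, where it transports leading terms.\<close>

lemma char_poly_newton:
  fixes A :: "'a::idom mat"
  assumes A: "A \<in> carrier_mat n n" and i: "1 \<le> i" "i \<le> n"
  shows "of_nat i * char_coeff A n i = - (\<Sum>l<i. char_coeff A n l * mat_tr (A ^\<^sub>m (i - l)))"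
proof -
  define B where "B = adj_mat (char_poly_matrix A)"
  have B: "B \<in> carrier_mat n n" and prod: "char_poly_matrix A * B = char_poly A \<cdot>\<^sub>m 1\<^sub>m n"
    using adj_mat[of "char_poly_matrix A" n] A by (auto simp: B_def char_poly_def)
  have coeff_B: "coeff (B $$ (m, j)) (n - i) = (\<Sum>l<i. char_coeff A n l * (A ^\<^sub>m (i - 1 - l)) $$ (m, j))"
    if "m < n" "j < n" for m j
    using arg_cong[OF adj_char_poly_matrix_coeff[OF A i(2)], of "\<lambda>M. M $$ (m, j)"] that by (simp add: B_def)
  have "of_nat n * char_coeff A n i = (\<Sum>j<n. coeff ((char_poly_matrix A * B) $$ (j, j)) (n - i))"
    unfolding prod by simp
  also have "\<dots> = (\<Sum>j<n. coeff (pCons 0 (B $$ (j, j))) (n - i)) -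
      (\<Sum>j<n. \<Sum>m<n. A $$ (j, m) * coeff (B $$ (m, j)) (n - i))"
    by (simp add: char_poly_matrix_mult_entry[OF A B] coeff_sum sum_subtractf)
  also have "(\<Sum>j<n. coeff (pCons 0 (B $$ (j, j))) (n - i)) = coeff (pCons 0 (mat_tr B)) (n - i)"
    using B by (cases "n - i") (simp_all add: mat_tr_def coeff_sum)
  also have "mat_tr B = pderiv (char_poly A)"
    by (simp add: pderiv_char_poly_adj[OF A] B_def)
  also have "coeff (pCons 0 (pderiv (char_poly A))) (n - i) = of_nat (n - i) * char_coeff A n i"
    by (cases "n - i") (simp_all add: coeff_pderiv)
  also have "(\<Sum>j<n. \<Sum>m<n. A $$ (j, m) * coeff (B $$ (m, j)) (n - i)) =
      (\<Sum>j<n. \<Sum>l<i. char_coeff A n l * (A ^\<^sub>m (i - l)) $$ (j, j))"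
    using sum_mult_pow_mat[OF A] by (simp add: coeff_B)
  also have "\<dots> = (\<Sum>l<i. char_coeff A n l * mat_tr (A ^\<^sub>m (i - l)))"
    using A by (subst sum.swap) (simp add: mat_tr_def sum_distrib_left pow_mat_dim_square[OF A])
  finally show ?thesis
    using i by (simp add: of_nat_diff eq_neg_iff_add_eq_0 algebra_simps)
qed

section \<open>Evaluation of polynomials in countably many variables\<close>

definition mono_val :: "(nat \<Rightarrow> 'b::comm_monoid_mult) \<Rightarrow> (nat \<Rightarrow>\<^sub>0 nat) \<Rightarrow> 'b" where
  "mono_val v \<mu> = (\<Prod>i\<in>Poly_Mapping.keys \<mu>. v i ^ Poly_Mapping.lookup \<mu> i)"

definition mp_eval :: "('a::zero \<Rightarrow> 'b::comm_semiring_1) \<Rightarrow> (nat \<Rightarrow> 'b) \<Rightarrow> ((nat \<Rightarrow>\<^sub>0 nat) \<Rightarrow>\<^sub>0 'a) \<Rightarrow> 'b" where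
  "mp_eval h v p = (\<Sum>\<mu>\<in>Poly_Mapping.keys p. h (Poly_Mapping.lookup p \<mu>) * mono_val v \<mu>)"

abbreviation mp_const :: "'a::zero \<Rightarrow> (nat \<Rightarrow>\<^sub>0 nat) \<Rightarrow>\<^sub>0 'a" where
  "mp_const c \<equiv> Poly_Mapping.single 0 c"

abbreviation mp_var :: "nat \<Rightarrow> (nat \<Rightarrow>\<^sub>0 nat) \<Rightarrow>\<^sub>0 'a::zero_neq_one" where
  "mp_var i \<equiv> Poly_Mapping.single (Poly_Mapping.single i 1) 1"

lemma mono_val_superset:
  assumes "finite S" "Poly_Mapping.keys \<mu> \<subseteq> S"
  shows "mono_val v \<mu> = (\<Prod>i\<in>S. v i ^ Poly_Mapping.lookup \<mu> i)"
  unfolding mono_val_def using assms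
  by (intro prod.mono_neutral_left) (auto simp: in_keys_iff)

lemma mono_val_0 [simp]: "mono_val v 0 = 1"
  by (simp add: mono_val_def)

lemma mono_val_single [simp]: "mono_val v (Poly_Mapping.single i k) = v i ^ k"
  by (subst mono_val_superset[of "{i}"]) auto

lemma mono_val_add: "mono_val v (\<mu> + \<nu>) = mono_val v \<mu> * mono_val v \<nu>"
proof -
  let ?S = "Poly_Mapping.keys \<mu> \<union> Poly_Mapping.keys \<nu>"
  have "mono_val v (\<mu> + \<nu>) = (\<Prod>i\<in>?S. v i ^ Poly_Mapping.lookup (\<mu> + \<nu>) i)"
    by (rule mono_val_superset) (auto simp: keys_add)
  also have "\<dots> = (\<Prod>i\<in>?S. v i ^ Poly_Mapping.lookup \<mu> i) * (\<Prod>i\<in>?S. v i ^ Poly_Mapping.lookup \<nu> i)"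
    by (simp add: lookup_add power_add prod.distrib)
  also have "\<dots> = mono_val v \<mu> * mono_val v \<nu>"
    by (subst (1 2) mono_val_superset[of ?S]) auto
  finally show ?thesis .
qed

lemma mp_eval_superset:
  assumes "finite S" "Poly_Mapping.keys p \<subseteq> S" "h 0 = 0"
  shows "mp_eval h v p = (\<Sum>\<mu>\<in>S. h (Poly_Mapping.lookup p \<mu>) * mono_val v \<mu>)"
  unfolding mp_eval_def using assms
  by (intro sum.mono_neutral_left) (auto simp: in_keys_iff)

lemma mp_eval_single: "h 0 = 0 \<Longrightarrow> mp_eval h v (Poly_Mapping.single \<mu> c) = h c * mono_val v \<mu>"
  by (subst mp_eval_superset[of "{\<mu>}"]) auto

lemma poly_mapping_sum_singles: "p = (\<Sum>\<mu>\<in>Poly_Mapping.keys p. Poly_Mapping.single \<mu> (Poly_Mapping.lookup p \<mu>))"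
  by (rule poly_mapping_eqI) (auto simp: lookup_sum lookup_single when_def in_keys_iff)

lemma poly_mapping_mult_sum:
  fixes p q :: "'a::monoid_add \<Rightarrow>\<^sub>0 'b::semiring_0"
  shows "p * q = (\<Sum>\<mu>\<in>Poly_Mapping.keys p. \<Sum>\<nu>\<in>Poly_Mapping.keys q.
                   Poly_Mapping.single (\<mu> + \<nu>) (Poly_Mapping.lookup p \<mu> * Poly_Mapping.lookup q \<nu>))"
proof -
  have "p * q = (\<Sum>\<mu>\<in>Poly_Mapping.keys p. Poly_Mapping.single \<mu> (Poly_Mapping.lookup p \<mu>)) *
    (\<Sum>\<nu>\<in>Poly_Mapping.keys q. Poly_Mapping.single \<nu> (Poly_Mapping.lookup q \<nu>))"
    by (simp flip: poly_mapping_sum_singles)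
  also have "\<dots> = (\<Sum>\<mu>\<in>Poly_Mapping.keys p. \<Sum>\<nu>\<in>Poly_Mapping.keys q.
                   Poly_Mapping.single (\<mu> + \<nu>) (Poly_Mapping.lookup p \<mu> * Poly_Mapping.lookup q \<nu>))"
    by (simp only: sum_product mult_single)
  finally show ?thesis .
qed

lemma comm_ring_hom_mp_eval:
  fixes h :: "'a::comm_ring_1 \<Rightarrow> 'b::comm_ring_1"
  assumes "comm_ring_hom h"
  shows "comm_ring_hom (mp_eval h v)"
proof -
  interpret h: comm_ring_hom h by fact
  have add: "mp_eval h v (p + q) = mp_eval h v p + mp_eval h v q" for p q
  proof -
    let ?S = "Poly_Mapping.keys p \<union> Poly_Mapping.keys q"
    have "mp_eval h v (p + q) = (\<Sum>\<mu>\<in>?S. h (Poly_Mapping.lookup (p + q) \<mu>) * mono_val v \<mu>)"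
      by (rule mp_eval_superset) (auto simp: keys_add)
    also have "\<dots> = (\<Sum>\<mu>\<in>?S. h (Poly_Mapping.lookup p \<mu>) * mono_val v \<mu>) + (\<Sum>\<mu>\<in>?S. h (Poly_Mapping.lookup q \<mu>) * mono_val v \<mu>)"
      by (simp add: lookup_add h.hom_add distrib_right sum.distrib)
    also have "\<dots> = mp_eval h v p + mp_eval h v q"
      by (subst (1 2) mp_eval_superset[of ?S]) auto
    finally show ?thesis .
  qed
  have zero: "mp_eval h v 0 = 0"
    by (simp add: mp_eval_def)
  have sum: "mp_eval h v (sum f S) = (\<Sum>x\<in>S. mp_eval h v (f x))" for f :: "'c \<Rightarrow> _" and S
    by (induction S rule: infinite_finite_induct) (auto simp: zero add)
  show ?thesis
  proof
    show "mp_eval h v 1 = 1"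
      by (subst single_one[symmetric], subst mp_eval_single) simp_all
    show "mp_eval h v (p * q) = mp_eval h v p * mp_eval h v q" for p q
    proof -
      have "mp_eval h v (p * q) = (\<Sum>\<mu>\<in>Poly_Mapping.keys p. \<Sum>\<nu>\<in>Poly_Mapping.keys q.
          (h (Poly_Mapping.lookup p \<mu>) * mono_val v \<mu>) * (h (Poly_Mapping.lookup q \<nu>) * mono_val v \<nu>))"
        by (subst poly_mapping_mult_sum)
          (simp add: sum mp_eval_single mono_val_add h.hom_mult mult_ac)
      then show ?thesis
        by (simp add: mp_eval_def sum_product)
    qed
  qed (simp_all add: zero add)
qed

lemma mono_val_mp_var: "mono_val mp_var \<mu> = Poly_Mapping.single \<mu> (1::'a::comm_semiring_1)"
proof -
  have pow: "mp_var i ^ k = Poly_Mapping.single (Poly_Mapping.single i k) (1::'a)" for i k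
    by (induction k) (simp_all add: mult_single single_add[symmetric])
  have "(\<Prod>i\<in>S. Poly_Mapping.single (f i) (1::'a)) = Poly_Mapping.single (\<Sum>i\<in>S. f i) 1"
    if "finite S" for S and f :: "nat \<Rightarrow> nat \<Rightarrow>\<^sub>0 nat"
    using that by induction (simp_all add: mult_single)
  then show ?thesis
    by (simp only: mono_val_def pow finite_keys flip: poly_mapping_sum_singles)
qed

lemma mono_val_mult: "mono_val (\<lambda>i. v i * w i) \<mu> = mono_val v \<mu> * mono_val w \<mu>"
  by (simp add: mono_val_def power_mult_distrib prod.distrib)

lemma comm_ring_hom_mp_const: "comm_ring_hom (mp_const :: 'a::comm_ring_1 \<Rightarrow> _)"
  by standard (simp_all add: single_add mult_single)

definition mp_scale :: "(nat \<Rightarrow> 'a) \<Rightarrow> ((nat \<Rightarrow>\<^sub>0 nat) \<Rightarrow>\<^sub>0 'a::comm_ring_1) \<Rightarrow> ((nat \<Rightarrow>\<^sub>0 nat) \<Rightarrow>\<^sub>0 'a)" where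
  "mp_scale \<omega> = mp_eval mp_const (\<lambda>i. mp_const (\<omega> i) * mp_var i)"

lemma mono_val_hom:
  assumes "comm_ring_hom h"
  shows "mono_val (\<lambda>i. h (v i)) \<mu> = h (mono_val v \<mu>)"
proof -
  interpret comm_ring_hom h by fact
  show ?thesis by (simp add: mono_val_def hom_prod hom_power)
qed

text \<open>Rescaling the variables acts diagonally on the monomials, so it only multiplies
  coefficients and creates no new monomials.\<close>

lemma lookup_mp_scale: "Poly_Mapping.lookup (mp_scale \<omega> p) \<mu> = mono_val \<omega> \<mu> * Poly_Mapping.lookup p \<mu>"
proof -
  have "mp_scale \<omega> p = (\<Sum>\<nu>\<in>Poly_Mapping.keys p. Poly_Mapping.single \<nu> (Poly_Mapping.lookup p \<nu> * mono_val \<omega> \<nu>))"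
    unfolding mp_scale_def mp_eval_def mono_val_mult mono_val_mp_var
      mono_val_hom[OF comm_ring_hom_mp_const] by (simp add: mult_single)
  then show ?thesis
    by (auto simp: lookup_sum lookup_single when_def in_keys_iff mult.commute)
qed

text \<open>Not a Frobenius in the sense of characteristic p: coefficients are kept and each
  variable is replaced by a power of itself. Seen from the original ring this adjoins roots, since
  every old variable becomes a perfect power.\<close>

definition mp_frob :: "(nat \<Rightarrow> nat) \<Rightarrow> ((nat \<Rightarrow>\<^sub>0 nat) \<Rightarrow>\<^sub>0 'a::comm_ring_1) \<Rightarrow> ((nat \<Rightarrow>\<^sub>0 nat) \<Rightarrow>\<^sub>0 'a)" where
  "mp_frob e = mp_eval mp_const (\<lambda>i. mp_var i ^ e i)"

text \<open>Multiplying exponents by positive numbers is injective on monomials, so distinct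
  monomials do not collide and each coefficient of p reappears at \<open>s \<mu>\<close>.\<close>

lemma inj_mp_frob:
  assumes e: "\<And>i. e i > 0"
  shows "mp_frob e p = 0 \<Longrightarrow> p = (0 :: (nat \<Rightarrow>\<^sub>0 nat) \<Rightarrow>\<^sub>0 'a::comm_ring_1)"
proof -
  assume zero: "mp_frob e p = 0"
  define s where "s = Poly_Mapping.mapp (\<lambda>i n. e i * n)"
  have s: "Poly_Mapping.lookup (s \<mu>) i = e i * Poly_Mapping.lookup \<mu> i" for \<mu> i
    by (auto simp: s_def lookup_mapp when_def in_keys_iff)
  have keys_s: "Poly_Mapping.keys (s \<mu>) = Poly_Mapping.keys \<mu>" for \<mu>
    using e by (auto simp: in_keys_iff s)
  have "inj s"
    using e by (auto intro!: injI poly_mapping_eqI simp: poly_mapping_eq_iff fun_eq_iff s) (metis mult_cancel1 less_numeral_extra(3))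
  have "mono_val (\<lambda>i. mp_var i ^ e i) \<mu> = mono_val mp_var (s \<mu>)" for \<mu>
    unfolding mono_val_def keys_s by (simp add: s power_mult)
  then have "mono_val (\<lambda>i. mp_var i ^ e i) \<mu> = Poly_Mapping.single (s \<mu>) (1::'a)" for \<mu>
    by (simp only: mono_val_mp_var)
  then have eq: "mp_frob e p = (\<Sum>\<nu>\<in>Poly_Mapping.keys p. Poly_Mapping.single (s \<nu>) (Poly_Mapping.lookup p \<nu>))"
    by (simp only: mp_frob_def mp_eval_def mult_single) simp
  show "p = 0"
  proof (rule poly_mapping_eqI)
    fix \<mu>
    have "0 = Poly_Mapping.lookup (mp_frob e p) (s \<mu>)" by (simp add: zero)
    also have "\<dots> = Poly_Mapping.lookup p \<mu>"
      using \<open>inj s\<close> by (simp add: eq lookup_sum lookup_single when_def inj_eq in_keys_iff)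
    finally show "Poly_Mapping.lookup p \<mu> = Poly_Mapping.lookup 0 \<mu>" by simp
  qed
qed

section \<open>Homomorphisms between fraction fields\<close>

definition fract_lift :: "('a::idom \<Rightarrow> 'b::field) \<Rightarrow> 'a fract \<Rightarrow> 'b" where
  "fract_lift f x = (THE y. \<exists>a b. b \<noteq> 0 \<and> x = Fract a b \<and> y = f a / f b)"

text \<open>The description in \<open>fract_lift\<close> mentions an arbitrary representing
  fraction. Injectivity of f keeps the denominators nonzero, and cross multiplication makes the
  quotient independent of the choice.\<close>

lemma fract_lift_Fract:
  assumes "inj_comm_ring_hom f" "b \<noteq> 0"
  shows "fract_lift f (Fract a b) = f a / f b"
proof -
  interpret inj_comm_ring_hom f by fact
  show ?thesis
    unfolding fract_lift_def
  proof (rule the_equality)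
    fix y assume "\<exists>a' b'. b' \<noteq> 0 \<and> Fract a b = Fract a' b' \<and> y = f a' / f b'"
    then obtain a' b' where *: "b' \<noteq> 0" "Fract a b = Fract a' b'" "y = f a' / f b'" by blast
    then have "a * b' = a' * b" using assms by (simp add: eq_fract)
    then have "f a * f b' = f a' * f b" by (metis hom_mult)
    then show "y = f a / f b"
      unfolding *(3) using *(1) assms(2) by (simp add: frac_eq_eq)
  qed (use assms in blast)
qed

lemma field_hom_fract_lift:
  assumes "inj_comm_ring_hom f"
  shows "field_hom (fract_lift f)"
proof -
  interpret inj_comm_ring_hom f by fact
  note [simp] = fract_lift_Fract[OF assms]
  show ?thesis
  proof
    show "fract_lift f 0 = 0" "fract_lift f 1 = 1"
      by (simp_all add: Zero_fract_def One_fract_def)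
    fix x y
    show "fract_lift f (x + y) = fract_lift f x + fract_lift f y"
      by (cases x; cases y) (simp add: hom_add hom_mult field_simps)
    show "fract_lift f (x * y) = fract_lift f x * fract_lift f y"
      by (cases x; cases y) (simp add: hom_mult)
  qed
qed

lemma inj_comm_ring_hom_Fract: "inj_comm_ring_hom (\<lambda>p :: 'a::idom. Fract p 1)"
  by standard (simp_all add: Zero_fract_def One_fract_def eq_fract)

lemma common_denominator:
  fixes S :: "'a::idom fract set"
  assumes "finite S"
  shows "\<exists>q. q \<noteq> 0 \<and> (\<forall>x\<in>S. \<exists>p. Fract q 1 * x = Fract p 1)"
  using assms
proof induction
  case (insert x S)
  then obtain q where q: "q \<noteq> 0" "\<And>y. y \<in> S \<Longrightarrow> \<exists>p. Fract q 1 * y = Fract p 1" by blast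
  obtain a b where x: "x = Fract a b" "b \<noteq> 0" by (cases x)
  have "\<exists>p. Fract (b * q) 1 * y = Fract p 1" if y: "y \<in> insert x S" for y
  proof (cases "y = x")
    case True
    have "Fract (b * q) 1 * x = Fract (q * a) 1"
      using x by (simp add: eq_fract)
    then show ?thesis using True by blast
  next
    case False
    then obtain p where "Fract q 1 * y = Fract p 1" using y q(2) by blast
    then have "Fract b 1 * (Fract q 1 * y) = Fract (b * p) 1" by simp
    then show ?thesis by (simp flip: mult.assoc) blast
  qed
  then show ?case using x q(1) by (intro exI[of _ "b * q"]) simp
qed (auto intro: exI[of _ 1])

text \<open>The coefficient c may be 0: the condition says that no monomial below
  \<open>\<alpha>\<close> occurs and that c stands at \<open>\<alpha>\<close>. In this form it
  passes through sums, products and Newton's identities without case distinctions;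
  \<open>\<alpha>\<close> is the true lowest monomial as soon as c is nonzero.\<close>

definition lead :: "('a::{comm_monoid_add,linorder} \<Rightarrow>\<^sub>0 'b::zero) \<Rightarrow> 'a \<Rightarrow> 'b \<Rightarrow> bool" where
  "lead f \<alpha> c \<longleftrightarrow> (\<forall>\<mu>\<in>Poly_Mapping.keys f. \<alpha> \<le> \<mu>) \<and> Poly_Mapping.lookup f \<alpha> = c"

lemma lead_unique:
  assumes "lead f \<alpha> c" "lead f \<beta> d" "c \<noteq> 0" "d \<noteq> 0"
  shows "\<alpha> = \<beta>" "c = d"
proof -
  show "\<alpha> = \<beta>"
    using assms by (intro antisym) (auto simp: lead_def in_keys_iff)
  then show "c = d" using assms by (simp add: lead_def)
qed

lemma lead_nonzero: "lead f \<alpha> c \<Longrightarrow> c \<noteq> 0 \<Longrightarrow> f \<noteq> 0"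
  by (auto simp: lead_def)

lemma lead_0 [simp]: "lead 0 \<alpha> 0"
  by (simp add: lead_def)

lemma lead_const: "lead (Poly_Mapping.single 0 c) 0 c"
  by (auto simp: lead_def)

lemma lead_add: "lead f \<alpha> c \<Longrightarrow> lead g \<alpha> d \<Longrightarrow> lead (f + g) \<alpha> (c + d)"
  using keys_add[of f g] by (auto simp: lead_def lookup_add)

lemma lead_uminus:
  fixes f :: "'a::{comm_monoid_add,linorder} \<Rightarrow>\<^sub>0 'b::ab_group_add"
  shows "lead f \<alpha> c \<Longrightarrow> lead (- f) \<alpha> (- c)"
  by (auto simp: lead_def in_keys_iff)

lemma lead_sum: "(\<And>i. i \<in> I \<Longrightarrow> lead (f i) \<alpha> (c i)) \<Longrightarrow> lead (sum f I) \<alpha> (sum c I)"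
  by (induction I rule: infinite_finite_induct) (auto intro: lead_add)

text \<open>In an ordered cancellative monoid a sum of exponents bounded below by
  \<open>\<alpha>\<close> and \<open>\<beta>\<close> equals \<open>\<alpha> + \<beta>\<close> only
  if both are minimal, so a single product contributes to that coefficient.\<close>

lemma lead_mult:
  fixes f g :: "'a::{ordered_cancel_comm_monoid_add,linorder} \<Rightarrow>\<^sub>0 'b::comm_ring_1"
  assumes f: "lead f \<alpha> c" and g: "lead g \<beta> d"
  shows "lead (f * g) (\<alpha> + \<beta>) (c * d)"
proof -
  have "Poly_Mapping.lookup (f * g) (\<alpha> + \<beta>) = (\<Sum>\<mu>\<in>Poly_Mapping.keys f. \<Sum>\<nu>\<in>Poly_Mapping.keys g.
      if \<mu> = \<alpha> \<and> \<nu> = \<beta> then Poly_Mapping.lookup f \<alpha> * Poly_Mapping.lookup g \<beta> else 0)"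
    unfolding poly_mapping_mult_sum lookup_sum
  proof (intro sum.cong refl)
    fix \<mu> \<nu> assume "\<mu> \<in> Poly_Mapping.keys f" "\<nu> \<in> Poly_Mapping.keys g"
    then have "\<alpha> \<le> \<mu>" "\<beta> \<le> \<nu>" using f g by (auto simp: lead_def)
    then have "\<mu> + \<nu> = \<alpha> + \<beta> \<longleftrightarrow> \<mu> = \<alpha> \<and> \<nu> = \<beta>"
      by (metis add_le_less_mono add_less_le_mono order_le_less less_irrefl)
    then show "Poly_Mapping.lookup (Poly_Mapping.single (\<mu> + \<nu>) (Poly_Mapping.lookup f \<mu> * Poly_Mapping.lookup g \<nu>)) (\<alpha> + \<beta>) =
        (if \<mu> = \<alpha> \<and> \<nu> = \<beta> then Poly_Mapping.lookup f \<alpha> * Poly_Mapping.lookup g \<beta> else 0)"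
      by (auto simp: lookup_single when_def)
  qed
  also have "\<dots> = (\<Sum>\<mu>\<in>Poly_Mapping.keys f. if \<mu> = \<alpha> then \<Sum>\<nu>\<in>Poly_Mapping.keys g. if \<nu> = \<beta> then Poly_Mapping.lookup f \<alpha> * Poly_Mapping.lookup g \<beta> else 0 else 0)"
    by (intro sum.cong refl) auto
  also have "\<dots> = c * d"
    using f g by (auto simp: lead_def in_keys_iff)
  finally show ?thesis
    using f g keys_mult[of f g] by (auto simp: lead_def intro: add_mono dest!: subsetD)
qed

section \<open>Rationality of the reduced invariants\<close>

lemma det_char_coeff:
  fixes A :: "'a::field mat"
  assumes A: "A \<in> carrier_mat n n"
  shows "det A = (-1) ^ n * char_coeff A n n"
proof -
  have "char_coeff A n n = poly (char_poly A) 0" by (simp add: poly_0_coeff_0)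
  also have "\<dots> = det (- char_matrix A 0)" by (rule char_poly_matrix[OF A])
  also have "- char_matrix A 0 = (-1) \<cdot>\<^sub>m A"
    using A by (intro eq_matI) (auto simp: char_matrix_def)
  also have "det \<dots> = (-1) ^ n * det A" using A by simp
  finally show ?thesis by (simp flip: power_mult_distrib)
qed

lemma char_coeff_0: "(A::'a::comm_ring_1 mat) \<in> carrier_mat n n \<Longrightarrow> char_coeff A n 0 = 1"
  using degree_monic_char_poly by auto

lemma char_coeff_1:
  fixes A :: "'a::idom mat"
  assumes "A \<in> carrier_mat n n" "n \<ge> 1"
  shows "char_coeff A n 1 = - mat_tr A"
  using char_poly_newton[OF assms(1), of 1] assms char_coeff_0[OF assms(1)] by simp

lemma scalar_mat_eq_iff:
  assumes "n \<ge> 1"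
  shows "c \<cdot>\<^sub>m 1\<^sub>m n = d \<cdot>\<^sub>m 1\<^sub>m n \<longleftrightarrow> c = (d :: 'a::comm_ring_1)"
proof
  assume "c \<cdot>\<^sub>m 1\<^sub>m n = d \<cdot>\<^sub>m 1\<^sub>m n"
  then have "(c \<cdot>\<^sub>m 1\<^sub>m n) $$ (0, 0) = (d \<cdot>\<^sub>m 1\<^sub>m n) $$ (0, 0)" by (rule arg_cong)
  then show "c = d" using assms by simp
qed simp

lemma smult_one_mat': "(1 :: 'a::comm_ring_1) \<cdot>\<^sub>m M = M"
  by (intro eq_matI) auto

lemma mat_add_self_eq:
  fixes M :: "'a::ring_1 mat"
  assumes M: "M \<in> carrier_mat n n" and eq: "M + M = M"
  shows "M = 0\<^sub>m n n"
proof (rule eq_matI)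
  fix i j assume ij: "i < dim_row (0\<^sub>m n n :: 'a mat)" "j < dim_col (0\<^sub>m n n :: 'a mat)"
  have "(M + M) $$ (i, j) = M $$ (i, j)" by (simp only: eq)
  then show "M $$ (i, j) = 0\<^sub>m n n $$ (i, j)" using M ij by simp
qed (use M in auto)

lemma mat_eq_uminus:
  fixes M N :: "'a::ring_1 mat"
  assumes "M \<in> carrier_mat n n" "N \<in> carrier_mat n n" and eq: "M + N = 0\<^sub>m n n"
  shows "M = - N"
proof (rule eq_matI)
  fix i j assume ij: "i < dim_row (- N)" "j < dim_col (- N)"
  have "(M + N) $$ (i, j) = 0\<^sub>m n n $$ (i, j)" by (simp only: eq)
  then show "M $$ (i, j) = (- N) $$ (i, j)" using assms(1,2) ij by (simp add: eq_neg_iff_add_eq_0)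
qed (use assms(1,2) in auto)

lemma splitting_hom:
  fixes \<psi> :: "'a \<Rightarrow> 'e::field mat"
  assumes "ring A" and \<psi>: "splitting A n \<psi>"
  shows "\<And>x. x \<in> carrier A \<Longrightarrow> \<psi> x \<in> carrier_mat n n"
    "\<And>x y. x \<in> carrier A \<Longrightarrow> y \<in> carrier A \<Longrightarrow> \<psi> (x \<otimes>\<^bsub>A\<^esub> y) = \<psi> x * \<psi> y"
    "\<And>x y. x \<in> carrier A \<Longrightarrow> y \<in> carrier A \<Longrightarrow> \<psi> (x \<oplus>\<^bsub>A\<^esub> y) = \<psi> x + \<psi> y"
    "\<psi> \<one>\<^bsub>A\<^esub> = 1\<^sub>m n" "\<psi> \<zero>\<^bsub>A\<^esub> = 0\<^sub>m n n"
    "\<And>x. x \<in> carrier A \<Longrightarrow> \<psi> (\<ominus>\<^bsub>A\<^esub> x) = - \<psi> x"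
    "\<And>x k. x \<in> carrier A \<Longrightarrow> \<psi> (x [^]\<^bsub>A\<^esub> (k::nat)) = \<psi> x ^\<^sub>m k"
    "\<And>x. x \<in> ring_center A \<Longrightarrow> \<exists>c. \<psi> x = c \<cdot>\<^sub>m 1\<^sub>m n"
proof -
  interpret A: ring A by fact
  note h = \<psi>[unfolded splitting_def, THEN conjunct1]
  show c: "\<psi> x \<in> carrier_mat n n" if "x \<in> carrier A" for x
    using ring_hom_closed[OF h that] by (simp add: ring_mat_simps)
  show m: "\<psi> (x \<otimes>\<^bsub>A\<^esub> y) = \<psi> x * \<psi> y" if "x \<in> carrier A" "y \<in> carrier A" for x y
    using ring_hom_mult[OF h that] by (simp add: ring_mat_simps)
  show a: "\<psi> (x \<oplus>\<^bsub>A\<^esub> y) = \<psi> x + \<psi> y" if "x \<in> carrier A" "y \<in> carrier A" for x y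
    using ring_hom_add[OF h that] by (simp add: ring_mat_simps)
  show o: "\<psi> \<one>\<^bsub>A\<^esub> = 1\<^sub>m n"
    using ring_hom_one[OF h] by (simp add: ring_mat_simps)
  show z: "\<psi> \<zero>\<^bsub>A\<^esub> = 0\<^sub>m n n"
  proof -
    have "\<psi> \<zero>\<^bsub>A\<^esub> = \<psi> \<zero>\<^bsub>A\<^esub> + \<psi> \<zero>\<^bsub>A\<^esub>" by (simp flip: a)
    then show ?thesis using mat_add_self_eq[OF c[OF A.zero_closed]] by simp
  qed
  show "\<psi> (\<ominus>\<^bsub>A\<^esub> x) = - \<psi> x" if x: "x \<in> carrier A" for x
  proof (rule mat_eq_uminus)
    show "\<psi> (\<ominus>\<^bsub>A\<^esub> x) + \<psi> x = 0\<^sub>m n n" using x by (simp flip: a add: A.l_neg z)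
  qed (use c x in auto)
  show "\<psi> (x [^]\<^bsub>A\<^esub> (k::nat)) = \<psi> x ^\<^sub>m k" if x: "x \<in> carrier A" for x k
    using c[OF x] x by (induction k) (auto simp: o m)
  show "\<exists>c. \<psi> x = c \<cdot>\<^sub>m 1\<^sub>m n" if "x \<in> ring_center A" for x
    using \<psi> that by (simp add: splitting_def)
qed

text \<open>Here \<open>Z\<close> is a field of central elements, later shown to be the whole
  center, and \<open>\<phi>\<close> is one injective splitting. The essential assumption is
  \<open>trace\<close>: the element f does not depend on \<open>\<psi>\<close>, although the
  splittings \<open>\<psi>\<close> are arbitrary and may embed \<open>Z\<close> in different
  ways.\<close>

locale trace_algebra = ring A for A (structure) +
  fixes n :: nat and Z :: "'a set" and \<phi> :: "'a \<Rightarrow> 'e::field mat"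
  assumes n: "n \<ge> 1"
    and char: "\<And>i. 1 \<le> i \<Longrightarrow> i \<le> n \<Longrightarrow> of_nat i \<noteq> (0 :: 'e)"
    and Z_center: "Z \<subseteq> ring_center A"
    and Z_zero: "\<zero> \<in> Z" and Z_one: "\<one> \<in> Z"
    and Z_add: "\<And>x y. x \<in> Z \<Longrightarrow> y \<in> Z \<Longrightarrow> x \<oplus> y \<in> Z"
    and Z_mult: "\<And>x y. x \<in> Z \<Longrightarrow> y \<in> Z \<Longrightarrow> x \<otimes> y \<in> Z"
    and Z_minus: "\<And>x. x \<in> Z \<Longrightarrow> \<ominus> x \<in> Z"
    and Z_inv: "\<And>x. x \<in> Z \<Longrightarrow> x \<noteq> \<zero> \<Longrightarrow> \<exists>y\<in>Z. x \<otimes> y = \<one>"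
    and trace: "\<And>x. x \<in> carrier A \<Longrightarrow>
      \<exists>f\<in>Z. \<forall>\<psi> :: 'a \<Rightarrow> 'e mat. splitting A n \<psi> \<longrightarrow> mat_tr (\<psi> x) = mat_tr (\<psi> f)"
    and split: "splitting A n \<phi>"
    and inj: "inj_on \<phi> (carrier A)"
begin

lemmas hom = splitting_hom[OF ring_axioms]

lemma Z_carrier: "x \<in> Z \<Longrightarrow> x \<in> carrier A"
  using Z_center by (auto simp: ring_center_def)

lemma Z_scalar: "x \<in> Z \<Longrightarrow> splitting A n \<psi> \<Longrightarrow> \<exists>c. \<psi> x = c \<cdot>\<^sub>m 1\<^sub>m n" for \<psi> :: "'a \<Rightarrow> 'e mat"
  using Z_center hom(8) by blast

text \<open>A splitting is unital and n is positive, so no unit goes to zero, and every nonzero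
  element of \<open>Z\<close> is a unit. This is the uniqueness needed for the description in
  \<open>reduced\<close>.\<close>

lemma splitting_inj_Z:
  fixes \<psi> :: "'a \<Rightarrow> 'e mat"
  assumes \<psi>: "splitting A n \<psi>" and "x \<in> Z" "y \<in> Z" "\<psi> x = \<psi> y"
  shows "x = y"
proof (rule ccontr)
  assume "x \<noteq> y"
  note carr = Z_carrier[OF \<open>x \<in> Z\<close>] Z_carrier[OF \<open>y \<in> Z\<close>]
  let ?d = "x \<oplus> \<ominus> y"
  have "?d \<noteq> \<zero>" using \<open>x \<noteq> y\<close> carr by (metis minus_eq r_right_minus_eq)
  moreover have "?d \<in> Z" using assms Z_add Z_minus by blast
  ultimately obtain w where w: "w \<in> Z" "?d \<otimes> w = \<one>" using Z_inv by blast
  have "\<psi> ?d = 0\<^sub>m n n"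
    using carr assms(4) hom(1)[OF \<psi> carr(2)] by (auto simp: hom(3,6)[OF \<psi>] intro!: eq_matI)
  moreover have "\<psi> (?d \<otimes> w) = \<psi> ?d * \<psi> w"
    by (rule hom(2)[OF \<psi>]) (use carr Z_carrier[OF w(1)] in auto)
  ultimately have "1\<^sub>m n = (0\<^sub>m n n :: 'e mat)"
    unfolding w(2) hom(4)[OF \<psi>] using hom(1)[OF \<psi> Z_carrier[OF w(1)]] by simp
  then have "(1\<^sub>m n :: 'e mat) $$ (0, 0) = 0\<^sub>m n n $$ (0, 0)" by (rule arg_cong)
  then show False using n by simp
qed

text \<open>A central x and the element f of \<open>Z\<close> with the same trace both become scalar
  matrices under \<open>\<phi>\<close>; as n is invertible the scalars agree, and
  \<open>\<phi>\<close> is injective.\<close>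

lemma center_eq_Z: "ring_center A = Z"
proof (intro equalityI subsetI)
  fix x assume x: "x \<in> ring_center A"
  then have xc: "x \<in> carrier A" by (simp add: ring_center_def)
  obtain f where f: "f \<in> Z" "mat_tr (\<phi> x) = mat_tr (\<phi> f)"
    using trace[OF xc] split by blast
  obtain c d where cd: "\<phi> x = c \<cdot>\<^sub>m 1\<^sub>m n" "\<phi> f = d \<cdot>\<^sub>m 1\<^sub>m n"
    using hom(8)[OF split x] Z_scalar[OF f(1) split] by blast
  then have "of_nat n * c = of_nat n * d" using f(2) by (simp only: mat_tr_scalar)
  then have "c = d" using char[of n] n by simp
  then have "\<phi> x = \<phi> f" using cd by simp
  then have "x = f" by (rule inj_onD[OF inj _ xc Z_carrier[OF f(1)]])
  then show "x \<in> Z" using f by simp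
qed (use Z_center in blast)

text \<open>Uniformity is the point: one element of \<open>Z\<close> has to represent the value g
  for all splittings simultaneously. Such functions form a ring, in which 1, ..., n are
  invertible.\<close>

definition rational :: "(('a \<Rightarrow> 'e mat) \<Rightarrow> 'e) \<Rightarrow> bool" where
  "rational g \<longleftrightarrow> (\<exists>c\<in>Z. \<forall>\<psi>. splitting A n \<psi> \<longrightarrow> \<psi> c = g \<psi> \<cdot>\<^sub>m 1\<^sub>m n)"

lemma rational_cong: "rational g \<Longrightarrow> (\<And>\<psi>. splitting A n \<psi> \<Longrightarrow> g \<psi> = h \<psi>) \<Longrightarrow> rational h"
  by (auto simp: rational_def)

lemma rational_0: "rational (\<lambda>_. 0)"
  unfolding rational_def by (rule bexI[OF _ Z_zero]) (auto simp: hom(5))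

lemma rational_1: "rational (\<lambda>_. 1)"
  unfolding rational_def by (rule bexI[OF _ Z_one]) (auto simp: hom(4))

lemma rationalE:
  assumes "rational g"
  obtains c where "c \<in> Z" "c \<in> carrier A" "\<And>\<psi>. splitting A n \<psi> \<Longrightarrow> \<psi> c = g \<psi> \<cdot>\<^sub>m 1\<^sub>m n"
  using assms Z_carrier unfolding rational_def by blast

lemma rationalI:
  assumes "c \<in> Z" "\<And>\<psi>. splitting A n \<psi> \<Longrightarrow> \<psi> c = g \<psi> \<cdot>\<^sub>m 1\<^sub>m n"
  shows "rational g"
  using assms unfolding rational_def by blast

lemma rational_add:
  assumes "rational g" "rational h"
  shows "rational (\<lambda>\<psi>. g \<psi> + h \<psi>)"
proof -
  obtain c where c: "c \<in> Z" "c \<in> carrier A" "\<And>\<psi>. splitting A n \<psi> \<Longrightarrow> \<psi> c = g \<psi> \<cdot>\<^sub>m 1\<^sub>m n"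
    using rationalE[OF assms(1)] by blast
  obtain d where d: "d \<in> Z" "d \<in> carrier A" "\<And>\<psi>. splitting A n \<psi> \<Longrightarrow> \<psi> d = h \<psi> \<cdot>\<^sub>m 1\<^sub>m n"
    using rationalE[OF assms(2)] by blast
  show ?thesis
  proof (rule rationalI[OF Z_add[OF c(1) d(1)]])
    fix \<psi> :: "'a \<Rightarrow> 'e mat" assume \<psi>: "splitting A n \<psi>"
    show "\<psi> (c \<oplus> d) = (g \<psi> + h \<psi>) \<cdot>\<^sub>m 1\<^sub>m n"
      unfolding hom(3)[OF \<psi> c(2) d(2)] c(3)[OF \<psi>] d(3)[OF \<psi>] by (intro eq_matI) auto
  qed
qed

lemma rational_mult:
  assumes "rational g" "rational h"
  shows "rational (\<lambda>\<psi>. g \<psi> * h \<psi>)"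
proof -
  obtain c where c: "c \<in> Z" "c \<in> carrier A" "\<And>\<psi>. splitting A n \<psi> \<Longrightarrow> \<psi> c = g \<psi> \<cdot>\<^sub>m 1\<^sub>m n"
    using rationalE[OF assms(1)] by blast
  obtain d where d: "d \<in> Z" "d \<in> carrier A" "\<And>\<psi>. splitting A n \<psi> \<Longrightarrow> \<psi> d = h \<psi> \<cdot>\<^sub>m 1\<^sub>m n"
    using rationalE[OF assms(2)] by blast
  show ?thesis
  proof (rule rationalI[OF Z_mult[OF c(1) d(1)]])
    fix \<psi> :: "'a \<Rightarrow> 'e mat" assume \<psi>: "splitting A n \<psi>"
    show "\<psi> (c \<otimes> d) = (g \<psi> * h \<psi>) \<cdot>\<^sub>m 1\<^sub>m n"
      unfolding hom(2)[OF \<psi> c(2) d(2)] c(3)[OF \<psi>] d(3)[OF \<psi>] by (intro eq_matI) auto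
  qed
qed

lemma rational_uminus:
  assumes "rational g"
  shows "rational (\<lambda>\<psi>. - g \<psi>)"
proof -
  obtain c where c: "c \<in> Z" "c \<in> carrier A" "\<And>\<psi>. splitting A n \<psi> \<Longrightarrow> \<psi> c = g \<psi> \<cdot>\<^sub>m 1\<^sub>m n"
    using rationalE[OF assms(1)] by blast
  show ?thesis
  proof (rule rationalI[OF Z_minus[OF c(1)]])
    fix \<psi> :: "'a \<Rightarrow> 'e mat" assume \<psi>: "splitting A n \<psi>"
    show "\<psi> (\<ominus> c) = (- g \<psi>) \<cdot>\<^sub>m 1\<^sub>m n"
      unfolding hom(6)[OF \<psi> c(2)] c(3)[OF \<psi>] by (intro eq_matI) auto
  qed
qed

lemma rational_sum: "(\<And>i. i \<in> I \<Longrightarrow> rational (g i)) \<Longrightarrow> rational (\<lambda>\<psi>. \<Sum>i\<in>I. g i \<psi>)"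
  by (induction I rule: infinite_finite_induct) (auto intro: rational_0 rational_add)

lemma rational_of_nat: "rational (\<lambda>_. of_nat k)"
  by (induction k) (auto intro: rational_0 rational_add rational_1)

lemma rational_power: "rational g \<Longrightarrow> rational (\<lambda>\<psi>. g \<psi> ^ k)"
  by (induction k) (auto intro: rational_1 rational_mult)

text \<open>The element of \<open>Z\<close> representing k is nonzero because its image under
  \<open>\<phi>\<close> is, and its inverse in \<open>Z\<close> represents 1/k under every
  splitting.\<close>

lemma rational_inverse_of_nat:
  assumes "1 \<le> k" "k \<le> n"
  shows "rational (\<lambda>_. 1 / of_nat k)"
proof -
  obtain c where c: "c \<in> Z" "\<And>\<psi> :: 'a \<Rightarrow> 'e mat. splitting A n \<psi> \<Longrightarrow> \<psi> c = of_nat k \<cdot>\<^sub>m 1\<^sub>m n"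
    using rationalE[OF rational_of_nat[of k]] by blast
  have "c \<noteq> \<zero>"
  proof
    assume "c = \<zero>"
    then have "of_nat k \<cdot>\<^sub>m 1\<^sub>m n = (0\<^sub>m n n :: 'e mat)"
      using c(2)[OF split] hom(5)[OF split] by simp
    also have "\<dots> = 0 \<cdot>\<^sub>m 1\<^sub>m n" by auto
    finally have "of_nat k \<cdot>\<^sub>m 1\<^sub>m n = (0 :: 'e) \<cdot>\<^sub>m 1\<^sub>m n" .
    then show False using char[OF assms] n by (simp add: scalar_mat_eq_iff)
  qed
  then obtain w where w: "w \<in> Z" "c \<otimes> w = \<one>" using Z_inv c(1) by blast
  have "\<psi> w = (1 / of_nat k) \<cdot>\<^sub>m 1\<^sub>m n" if \<psi>: "splitting A n \<psi>" for \<psi> :: "'a \<Rightarrow> 'e mat"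
  proof -
    have carr: "\<psi> w \<in> carrier_mat n n" using hom(1)[OF \<psi>] Z_carrier[OF w(1)] by blast
    have "\<psi> (c \<otimes> w) = \<psi> c * \<psi> w"
      by (rule hom(2)[OF \<psi> Z_carrier[OF c(1)] Z_carrier[OF w(1)]])
    then have "(of_nat k \<cdot>\<^sub>m 1\<^sub>m n) * \<psi> w = 1\<^sub>m n"
      unfolding w(2) c(2)[OF \<psi>] hom(4)[OF \<psi>] by (rule sym)
    then have "of_nat k \<cdot>\<^sub>m \<psi> w = 1\<^sub>m n"
      unfolding mult_smult_assoc_mat[OF one_carrier_mat carr] left_mult_one_mat[OF carr] .
    then have "(1 / of_nat k) \<cdot>\<^sub>m (of_nat k \<cdot>\<^sub>m \<psi> w) = (1 / of_nat k) \<cdot>\<^sub>m 1\<^sub>m n" by (simp only:)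
    moreover have "(1 / of_nat k) \<cdot>\<^sub>m (of_nat k \<cdot>\<^sub>m \<psi> w) = \<psi> w"
      using char[OF assms] carr by (intro eq_matI) auto
    ultimately show ?thesis by simp
  qed
  then show ?thesis using w unfolding rational_def by blast
qed

lemma rational_trace:
  assumes x: "x \<in> carrier A"
  shows "rational (\<lambda>\<psi>. mat_tr (\<psi> x))"
proof -
  obtain f where f: "f \<in> Z" "\<And>\<psi> :: 'a \<Rightarrow> 'e mat. splitting A n \<psi> \<Longrightarrow> mat_tr (\<psi> x) = mat_tr (\<psi> f)"
    using trace[OF x] by blast
  \<comment> \<open>\<open>\<psi> f\<close> is a scalar matrix, so its corner entry is the scalar
    and its trace is n times that entry.\<close>
  have "rational (\<lambda>\<psi>. \<psi> f $$ (0, 0))"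
    unfolding rational_def
  proof (intro bexI[OF _ f(1)] allI impI)
    fix \<psi> :: "'a \<Rightarrow> 'e mat" assume "splitting A n \<psi>"
    then obtain c where "\<psi> f = c \<cdot>\<^sub>m 1\<^sub>m n" using Z_scalar f(1) by blast
    then show "\<psi> f = \<psi> f $$ (0, 0) \<cdot>\<^sub>m 1\<^sub>m n" using n by simp
  qed
  then have "rational (\<lambda>\<psi>. of_nat n * \<psi> f $$ (0, 0))"
    by (intro rational_mult rational_of_nat)
  then show ?thesis
  proof (rule rational_cong)
    fix \<psi> :: "'a \<Rightarrow> 'e mat" assume \<psi>: "splitting A n \<psi>"
    then obtain c where "\<psi> f = c \<cdot>\<^sub>m 1\<^sub>m n" using Z_scalar f(1) by blast
    then show "of_nat n * \<psi> f $$ (0, 0) = mat_tr (\<psi> x)"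
      using n f(2)[OF \<psi>] by (simp add: mat_tr_scalar)
  qed
qed

text \<open>Newton's identities express i times the coefficient through earlier coefficients and
  traces of powers of x, all of which are rational; then i is divided out.\<close>

lemma rational_char_coeff:
  assumes x: "x \<in> carrier A"
  shows "i \<le> n \<Longrightarrow> rational (\<lambda>\<psi>. char_coeff (\<psi> x) n i)"
proof (induction i rule: less_induct)
  case (less i)
  show ?case
  proof (cases "i = 0")
    case True
    show ?thesis
      by (rule rational_cong[OF rational_1]) (simp only: True char_coeff_0[OF hom(1)[OF _ x]])
  next
    case False
    have "rational (\<lambda>\<psi>. (1 / of_nat i) * (- (\<Sum>l<i. char_coeff (\<psi> x) n l * mat_tr (\<psi> (x [^] (i - l))))))"
      using False less x
      by (intro rational_mult rational_inverse_of_nat rational_uminus rational_sum rational_trace) auto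
    then show ?thesis
    proof (rule rational_cong)
      fix \<psi> :: "'a \<Rightarrow> 'e mat" assume \<psi>: "splitting A n \<psi>"
      show "(1 / of_nat i) * (- (\<Sum>l<i. char_coeff (\<psi> x) n l * mat_tr (\<psi> (x [^] (i - l))))) = char_coeff (\<psi> x) n i"
        using char_poly_newton[OF hom(1)[OF \<psi> x], of i] False less.prems char[of i]
        by (simp add: hom(7)[OF \<psi> x] field_simps)
    qed
  qed
qed

lemma reduced_rational:
  assumes "rational g" and g: "\<And>\<psi>. splitting A n \<psi> \<Longrightarrow> g \<psi> = f (\<psi> x)"
  shows "reduced f A n x \<in> Z" "\<phi> (reduced f A n x) = f (\<phi> x) \<cdot>\<^sub>m 1\<^sub>m n"
proof -
  obtain c where c: "c \<in> Z" "\<And>\<psi>. splitting A n \<psi> \<Longrightarrow> \<psi> c = g \<psi> \<cdot>\<^sub>m 1\<^sub>m n"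
    using assms unfolding rational_def by blast
  have "reduced f A n x = c"
    unfolding reduced_def center_eq_Z
  proof (rule the_equality)
    show "c \<in> Z \<and> (\<exists>\<psi>. splitting A n \<psi> \<and> \<psi> c = f (\<psi> x) \<cdot>\<^sub>m 1\<^sub>m n)"
      using c split g by auto
    \<comment> \<open>The competitor d may come with a different splitting, but c has the right
      value under that splitting as well.\<close>
    fix d assume "d \<in> Z \<and> (\<exists>\<psi>. splitting A n \<psi> \<and> \<psi> d = f (\<psi> x) \<cdot>\<^sub>m 1\<^sub>m n)"
    then show "d = c"
      using splitting_inj_Z[OF _ _ c(1)] c(2) g by metis
  qed
  then show "reduced f A n x \<in> Z" "\<phi> (reduced f A n x) = f (\<phi> x) \<cdot>\<^sub>m 1\<^sub>m n"
    using c split g by auto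
qed

lemma red_sigma:
  assumes "x \<in> carrier A" "i \<le> n"
  shows "red_sigma TYPE('e) A n i x \<in> Z"
    "\<phi> (red_sigma TYPE('e) A n i x) = char_coeff (\<phi> x) n i \<cdot>\<^sub>m 1\<^sub>m n"
  unfolding red_sigma_def using reduced_rational[OF rational_char_coeff[OF assms]] by auto

lemma red_norm:
  assumes x: "x \<in> carrier A"
  shows "red_norm TYPE('e) A n x \<in> Z"
    "\<phi> (red_norm TYPE('e) A n x) = det (\<phi> x) \<cdot>\<^sub>m 1\<^sub>m n"
proof -
  have r: "rational (\<lambda>\<psi>. (- 1) ^ n * char_coeff (\<psi> x) n n)"
    by (intro rational_mult rational_power rational_uminus rational_1 rational_char_coeff x) simp
  have "(- 1) ^ n * char_coeff (\<psi> x) n n = det (\<psi> x)" if "splitting A n \<psi>" for \<psi> :: "'a \<Rightarrow> 'e mat"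
    using det_char_coeff[OF hom(1)[OF that x]] by simp
  then have r': "rational (\<lambda>\<psi>. det (\<psi> x))"
    by (rule rational_cong[OF r])
  show "red_norm TYPE('e) A n x \<in> Z" "\<phi> (red_norm TYPE('e) A n x) = det (\<phi> x) \<cdot>\<^sub>m 1\<^sub>m n"
    using reduced_rational[of "\<lambda>\<psi>. det (\<psi> x)" det x, OF r']
    unfolding red_norm_def by auto
qed

lemma red_trace:
  assumes x: "x \<in> carrier A"
  shows "\<phi> (red_trace TYPE('e) A n x) = mat_tr (\<phi> x) \<cdot>\<^sub>m 1\<^sub>m n"
proof -
  have "\<phi> (red_trace TYPE('e) A n x) = - (char_coeff (\<phi> x) n 1 \<cdot>\<^sub>m 1\<^sub>m n)"
    unfolding red_trace_def using red_sigma[OF x n] Z_carrier by (simp add: hom(6)[OF split])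
  also have "\<dots> = mat_tr (\<phi> x) \<cdot>\<^sub>m 1\<^sub>m n"
    using char_coeff_1[OF hom(1)[OF split x] n] by (intro eq_matI) auto
  finally show ?thesis .
qed

lemma list_mult_hom:
  assumes "set xs \<subseteq> carrier A"
  shows "list_mult A xs \<in> carrier A \<and> \<phi> (list_mult A xs) = foldr (*) (map \<phi> xs) (1\<^sub>m n)"
  using assms unfolding list_mult_def by (induction xs) (auto simp: hom(2,4)[OF split])

text \<open>Part (c) is part (b) for the list \<open>x, 1, \<dots>, 1\<close>.\<close>

lemma nonvanishing:
  assumes m: "m \<ge> 1"
    and sigma: "\<And>x. m \<le> n \<Longrightarrow> x \<in> carrier A \<Longrightarrow> \<phi> x \<noteq> 0\<^sub>m n n \<Longrightarrow> char_coeff (\<phi> x) n m \<noteq> 0"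
    and tr: "\<And>xs. length xs = m \<Longrightarrow> set xs \<subseteq> carrier A \<Longrightarrow> (\<forall>x\<in>set xs. \<phi> x \<noteq> 0\<^sub>m n n) \<Longrightarrow>
      (\<forall>x\<in>set xs. \<forall>y\<in>set xs. det (\<phi> x) = det (\<phi> y)) \<Longrightarrow> mat_tr (foldr (*) (map \<phi> xs) (1\<^sub>m n)) \<noteq> 0"
  shows "(m \<le> n \<longrightarrow> (\<forall>x\<in>carrier A - {\<zero>}. red_sigma TYPE('e) A n m x \<noteq> \<zero>)) \<and>
    (\<forall>xs. length xs = m \<and> set xs \<subseteq> carrier A - {\<zero>} \<and>
       (\<forall>x\<in>set xs. \<forall>y\<in>set xs. red_norm TYPE('e) A n x = red_norm TYPE('e) A n y) \<longrightarrow>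
       red_trace TYPE('e) A n (list_mult A xs) \<noteq> \<zero>) \<and>
    \<not> (\<exists>x\<in>carrier A. red_norm TYPE('e) A n x = \<one> \<and> red_trace TYPE('e) A n x = \<zero>)"
proof -
  have zero_scalar: "0\<^sub>m n n = (0 :: 'e) \<cdot>\<^sub>m 1\<^sub>m n" by auto
  have nz: "\<phi> x \<noteq> 0\<^sub>m n n" if "x \<in> carrier A" "x \<noteq> \<zero>" for x
  proof
    assume "\<phi> x = 0\<^sub>m n n"
    then have "\<phi> x = \<phi> \<zero>" by (simp only: hom(5)[OF split])
    then have "x = \<zero>" by (rule inj_onD[OF inj _ that(1) zero_closed])
    then show False using that(2) by simp
  qed
  have nonzero: "y \<noteq> \<zero>" if "\<phi> y = c \<cdot>\<^sub>m 1\<^sub>m n" "c \<noteq> 0" for y c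
  proof
    assume "y = \<zero>"
    then have "c \<cdot>\<^sub>m 1\<^sub>m n = (0 :: 'e) \<cdot>\<^sub>m 1\<^sub>m n"
      using that(1) by (simp only: hom(5)[OF split] zero_scalar)
    then show False using that(2) by (simp only: scalar_mat_eq_iff[OF n])
  qed
  have a: "red_sigma TYPE('e) A n m x \<noteq> \<zero>" if "m \<le> n" "x \<in> carrier A - {\<zero>}" for x
  proof -
    have x: "x \<in> carrier A" "x \<noteq> \<zero>" using that(2) by auto
    show ?thesis
      by (rule nonzero[OF red_sigma(2)[OF x(1) that(1)] sigma[OF that(1) x(1) nz[OF x]]])
  qed
  have b: "red_trace TYPE('e) A n (list_mult A xs) \<noteq> \<zero>"
    if xs: "length xs = m" "set xs \<subseteq> carrier A - {\<zero>}"
      "\<forall>x\<in>set xs. \<forall>y\<in>set xs. red_norm TYPE('e) A n x = red_norm TYPE('e) A n y" for xs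
  proof -
    have "det (\<phi> x) = det (\<phi> y)" if "x \<in> set xs" "y \<in> set xs" for x y
    proof -
      have "x \<in> carrier A" "y \<in> carrier A" "red_norm TYPE('e) A n x = red_norm TYPE('e) A n y"
        using xs that by blast+
      then show ?thesis
        using red_norm(2)[of x] red_norm(2)[of y] by (simp add: scalar_mat_eq_iff[OF n])
    qed
    then have dets: "\<forall>x\<in>set xs. \<forall>y\<in>set xs. det (\<phi> x) = det (\<phi> y)" by blast
    have "\<forall>x\<in>set xs. \<phi> x \<noteq> 0\<^sub>m n n" "set xs \<subseteq> carrier A" using xs(2) nz by auto
    from tr[OF xs(1) this(2,1) dets] have "mat_tr (foldr (*) (map \<phi> xs) (1\<^sub>m n)) \<noteq> 0" .
    moreover have "list_mult A xs \<in> carrier A" "\<phi> (list_mult A xs) = foldr (*) (map \<phi> xs) (1\<^sub>m n)"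
      using list_mult_hom[of xs] xs(2) by auto
    ultimately show ?thesis
      using nonzero[OF red_trace[of "list_mult A xs"]] by simp
  qed
  have c: "red_trace TYPE('e) A n x \<noteq> \<zero>" if x: "x \<in> carrier A" "red_norm TYPE('e) A n x = \<one>" for x
  proof -
    have "det (\<phi> x) = 1"
    proof -
      have "det (\<phi> x) \<cdot>\<^sub>m 1\<^sub>m n = 1 \<cdot>\<^sub>m 1\<^sub>m n"
        using red_norm(2)[OF x(1)] unfolding x(2) hom(4)[OF split] smult_one_mat' by (rule sym)
      then show ?thesis by (simp only: scalar_mat_eq_iff[OF n])
    qed
    have "x \<noteq> \<zero>"
    proof
      assume "x = \<zero>"
      then have "\<phi> x = 0\<^sub>m n n" by (simp only: hom(5)[OF split])
      then show False using \<open>det (\<phi> x) = 1\<close> n by simp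
    qed
    then have nx: "\<phi> x \<noteq> 0\<^sub>m n n" by (rule nz[OF x(1)])
    let ?xs = "x # replicate (m - 1) \<one>"
    have one: "(1\<^sub>m n :: 'e mat) \<noteq> 0\<^sub>m n n"
    proof
      assume "(1\<^sub>m n :: 'e mat) = 0\<^sub>m n n"
      then have "(1\<^sub>m n :: 'e mat) $$ (0, 0) = 0\<^sub>m n n $$ (0, 0)" by (rule arg_cong)
      then show False using n by simp
    qed
    have f: "((*) (1\<^sub>m n) ^^ k) (1\<^sub>m n) = (1\<^sub>m n :: 'e mat)" for k
      by (induction k) auto
    have "mat_tr (foldr (*) (map \<phi> ?xs) (1\<^sub>m n)) \<noteq> 0"
    proof (rule tr)
      show "\<forall>y\<in>set ?xs. \<phi> y \<noteq> 0\<^sub>m n n"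
        using nx one hom(4)[OF split] by auto
      show "\<forall>y\<in>set ?xs. \<forall>z\<in>set ?xs. det (\<phi> y) = det (\<phi> z)"
        using \<open>det (\<phi> x) = 1\<close> hom(4)[OF split] by auto
    qed (use m x in auto)
    then have "mat_tr (\<phi> x) \<noteq> 0"
      using hom(1)[OF split x(1)] by (simp add: hom(4)[OF split] f)
    then show ?thesis
      by (rule nonzero[OF red_trace[OF x(1)]])
  qed
  show ?thesis
  proof (intro conjI allI impI ballI notI)
    fix xs assume "length xs = m \<and> set xs \<subseteq> carrier A - {\<zero>} \<and>
       (\<forall>x\<in>set xs. \<forall>y\<in>set xs. red_norm TYPE('e) A n x = red_norm TYPE('e) A n y)"
      and "red_trace TYPE('e) A n (list_mult A xs) = \<zero>"
    then show False using b[of xs] by blast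
  next
    fix x assume "m \<le> n" "x \<in> carrier A - {\<zero>}" "red_sigma TYPE('e) A n m x = \<zero>"
    then show False using a[of x] by blast
  next
    assume "\<exists>x\<in>carrier A. red_norm TYPE('e) A n x = \<one> \<and> red_trace TYPE('e) A n x = \<zero>"
    then show False using c by blast
  qed
qed

end

section \<open>Clock and shift matrices\<close>

text \<open>Any bijection of the index set with the product of the ranges \<open>{..<ps ! i}\<close>
  will do; it stands for the identification of K^n with the tensor product of the spaces K^(p_i), on
  which clock and shift matrices of different factors commute. No positional numeral system is
  involved.\<close>

definition digits :: "nat list \<Rightarrow> nat \<Rightarrow> nat \<Rightarrow> nat" where
  "digits ps = (SOME e. bij_betw e {..<prod_list ps} (\<Pi>\<^sub>E i\<in>{..<length ps}. {..<ps ! i}))"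

definition shift_ix :: "nat list \<Rightarrow> nat \<Rightarrow> nat \<Rightarrow> nat" where
  "shift_ix ps i a = inv_into {..<prod_list ps} (digits ps)
     ((digits ps a)(i := Suc (digits ps a i) mod (ps ! i)))"

definition clock_mat :: "nat list \<Rightarrow> (nat \<Rightarrow> 'a::comm_semiring_1) \<Rightarrow> nat \<Rightarrow> 'a mat" where
  "clock_mat ps w i = mat (prod_list ps) (prod_list ps) (\<lambda>(a, b). if a = b then w i ^ digits ps a i else 0)"

definition shift_mat :: "nat list \<Rightarrow> nat \<Rightarrow> 'a::comm_semiring_1 mat" where
  "shift_mat ps i = mat (prod_list ps) (prod_list ps) (\<lambda>(a, b). if a = shift_ix ps i b then 1 else 0)"

lemma mat_mult_entry:
  assumes "M \<in> carrier_mat n n" "N \<in> carrier_mat n n" "a < n" "b < n"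
  shows "(M * N) $$ (a, b) = (\<Sum>c<n. M $$ (a, c) * N $$ (c, b))"
  using assms by (simp add: scalar_prod_def atLeast0LessThan)

locale radix =
  fixes ps :: "nat list" and n s :: nat
  assumes n_def: "n = prod_list ps" and s_def: "s = length ps" and primes: "\<And>p. p \<in> set ps \<Longrightarrow> prime p"
begin

lemma prime_nth: "i < s \<Longrightarrow> prime (ps ! i)"
  using primes by (simp add: s_def)

lemma nth_pos: "i < s \<Longrightarrow> 0 < ps ! i"
  using prime_nth prime_gt_0_nat by blast

lemma digits_bij: "bij_betw (digits ps) {..<n} (\<Pi>\<^sub>E i\<in>{..<s}. {..<ps ! i})"
proof -
  have "card (\<Pi>\<^sub>E i\<in>{..<s}. {..<ps ! i}) = n"
    by (simp add: card_PiE n_def s_def prod.list_conv_set_nth atLeast0LessThan)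
  then have "\<exists>e. bij_betw e {..<n} (\<Pi>\<^sub>E i\<in>{..<s}. {..<ps ! i})"
    by (intro finite_same_card_bij) (auto intro: finite_PiE)
  then show ?thesis
    unfolding digits_def n_def[symmetric] s_def[symmetric] by (rule someI_ex)
qed

lemma digits_less: "a < n \<Longrightarrow> i < s \<Longrightarrow> digits ps a i < ps ! i"
  using bij_betwE[OF digits_bij] by (auto simp: PiE_iff)

lemma digits_eqI:
  assumes "a < n" "b < n" "\<And>i. i < s \<Longrightarrow> digits ps a i = digits ps b i"
  shows "a = b"
proof -
  have "digits ps a = digits ps b"
  proof (rule PiE_ext)
    show "digits ps a \<in> (\<Pi>\<^sub>E i\<in>{..<s}. {..<ps ! i})" "digits ps b \<in> (\<Pi>\<^sub>E i\<in>{..<s}. {..<ps ! i})"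
      using assms(1,2) bij_betwE[OF digits_bij] by auto
  qed (use assms(3) in auto)
  then show ?thesis
    using digits_bij assms(1,2) by (auto simp: bij_betw_def dest: inj_onD)
qed

lemma shift_ix:
  assumes a: "a < n" and i: "i < s"
  shows shift_ix_less: "shift_ix ps i a < n"
    and digits_shift_ix: "digits ps (shift_ix ps i a) = (digits ps a)(i := Suc (digits ps a i) mod (ps ! i))"
proof -
  have "digits ps a \<in> (\<Pi>\<^sub>E i\<in>{..<s}. {..<ps ! i})"
    using a bij_betwE[OF digits_bij] by auto
  then have "(digits ps a)(i := Suc (digits ps a i) mod (ps ! i)) \<in> (\<Pi>\<^sub>E i\<in>{..<s}. {..<ps ! i})"
    using i nth_pos[OF i] by (auto simp: PiE_iff extensional_def)
  then have *: "(digits ps a)(i := Suc (digits ps a i) mod (ps ! i)) \<in> digits ps ` {..<n}"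
    using digits_bij by (simp add: bij_betw_def)
  show "shift_ix ps i a < n"
    using inv_into_into[OF *] by (simp add: shift_ix_def n_def)
  show "digits ps (shift_ix ps i a) = (digits ps a)(i := Suc (digits ps a i) mod (ps ! i))"
    using f_inv_into_f[OF *] by (simp add: shift_ix_def n_def)
qed

lemma shift_ix_bij: assumes i: "i < s" shows "bij_betw (shift_ix ps i) {..<n} {..<n}"
proof -
  have "inj_on (shift_ix ps i) {..<n}"
  proof (rule inj_onI)
    fix a b assume ab: "a \<in> {..<n}" "b \<in> {..<n}" and eq: "shift_ix ps i a = shift_ix ps i b"
    then have d: "(digits ps a)(i := Suc (digits ps a i) mod (ps ! i)) =
      (digits ps b)(i := Suc (digits ps b i) mod (ps ! i))"
      using digits_shift_ix[OF _ i] by (metis lessThan_iff)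
    show "a = b"
    proof (rule digits_eqI)
      fix j assume "j < s"
      show "digits ps a j = digits ps b j"
      proof (cases "j = i")
        case True
        have "Suc (digits ps a i) mod (ps ! i) = Suc (digits ps b i) mod (ps ! i)"
          using fun_cong[OF d, of i] by simp
        moreover have "digits ps a i < ps ! i" "digits ps b i < ps ! i"
          using digits_less i ab by auto
        ultimately show ?thesis
          using True by (auto simp: mod_Suc split: if_splits)
      next
        case False
        then show ?thesis using fun_cong[OF d, of j] by simp
      qed
    qed (use ab in auto)
  qed
  moreover have "shift_ix ps i ` {..<n} \<subseteq> {..<n}" using shift_ix_less i by auto
  ultimately show ?thesis
    by (simp add: bij_betw_def endo_inj_surj)
qed

lemma shift_ix_eq_iff: "i < s \<Longrightarrow> a < n \<Longrightarrow> b < n \<Longrightarrow> shift_ix ps i a = shift_ix ps i b \<longleftrightarrow> a = b"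
  using shift_ix_bij[of i] by (auto simp: bij_betw_def dest: inj_onD)

lemma sum_shift_ix: "i < s \<Longrightarrow> (\<Sum>a<n. f (shift_ix ps i a)) = (\<Sum>a<n. f a)"
  using sum.reindex_bij_betw[OF shift_ix_bij] by blast

lemma digits_shift_iter:
  assumes i: "i < s" and a: "a < n"
  shows "(shift_ix ps i ^^ k) a < n \<and>
    digits ps ((shift_ix ps i ^^ k) a) = (digits ps a)(i := (digits ps a i + k) mod (ps ! i))"
proof (induction k)
  case 0
  then show ?case using a digits_less[OF a i] by simp
next
  case (Suc k)
  then show ?case using i by (auto simp: shift_ix mod_Suc_eq fun_eq_iff)
qed

text \<open>Iterating the shift number k changes only digit k and reaches each of its values, so the
  digits of b can be set one after the other while P is preserved.\<close>

lemma shift_transitive: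
  assumes P: "\<And>i a. i < s \<Longrightarrow> a < n \<Longrightarrow> P a \<Longrightarrow> P (shift_ix ps i a)"
    and a: "a < n" "P a" and b: "b < n"
  shows "P b"
proof -
  have "\<exists>c<n. P c \<and> (\<forall>j<k. digits ps c j = digits ps b j)" if "k \<le> s" for k
    using that
  proof (induction k)
    case 0
    then show ?case using a by blast
  next
    case (Suc k)
    then obtain c where c: "c < n" "P c" "\<And>j. j < k \<Longrightarrow> digits ps c j = digits ps b j" by auto
    have k: "k < s" using Suc.prems by simp
    \<comment> \<open>The number of shifts that carry digit k of c to that of b modulo
      \<open>ps ! k\<close>; starting from \<open>ps ! k\<close> keeps the subtraction in the
      naturals.\<close>
    define t where "t = ps ! k - digits ps c k + digits ps b k"
    have iter: "(shift_ix ps k ^^ m) c < n \<and> P ((shift_ix ps k ^^ m) c)" for m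
      by (induction m) (use c k P shift_ix_less in auto)
    have "(digits ps c k + t) mod (ps ! k) = digits ps b k"
      using digits_less[OF c(1) k] digits_less[OF b k] by (simp add: t_def)
    then have "digits ps ((shift_ix ps k ^^ t) c) j = digits ps b j" if "j < Suc k" for j
      using that digits_shift_iter[OF k c(1), of t] c(3) by (cases "j = k") auto
    then show ?case using iter by blast
  qed
  from this[of s] show ?thesis using digits_eqI b by (metis order_refl)
qed

lemma clock_mat_carrier [simp]: "clock_mat ps w i \<in> carrier_mat n n"
  by (simp add: clock_mat_def n_def)

lemma shift_mat_carrier [simp]: "shift_mat ps i \<in> carrier_mat n n"
  by (simp add: shift_mat_def n_def)

lemma mult_carrier_square: "M \<in> carrier_mat n n \<Longrightarrow> N \<in> carrier_mat n n \<Longrightarrow> M * N \<in> carrier_mat n n"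
  by (rule mult_carrier_mat)

lemma clock_mult_entry:
  fixes M :: "'a::comm_ring_1 mat"
  assumes "M \<in> carrier_mat n n" "a < n" "b < n"
  shows "(clock_mat ps w i * M) $$ (a, b) = w i ^ digits ps a i * M $$ (a, b)"
proof -
  have "(clock_mat ps w i * M) $$ (a, b) = (\<Sum>c<n. (if a = c then w i ^ digits ps a i * M $$ (c, b) else 0))"
    by (subst mat_mult_entry[OF clock_mat_carrier assms(1-3)], rule sum.cong)
      (use assms in \<open>auto simp: clock_mat_def simp flip: n_def\<close>)
  then show ?thesis using assms by simp
qed

lemma mult_clock_entry:
  fixes M :: "'a::comm_ring_1 mat"
  assumes "M \<in> carrier_mat n n" "a < n" "b < n"
  shows "(M * clock_mat ps w i) $$ (a, b) = M $$ (a, b) * w i ^ digits ps b i"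
proof -
  have "(M * clock_mat ps w i) $$ (a, b) = (\<Sum>c<n. (if c = b then M $$ (a, c) * w i ^ digits ps b i else 0))"
    by (subst mat_mult_entry[OF assms(1) clock_mat_carrier assms(2,3)], rule sum.cong)
      (use assms in \<open>auto simp: clock_mat_def simp flip: n_def\<close>)
  then show ?thesis using assms by simp
qed

text \<open>Reading the product at a shifted row avoids the inverse of the index permutation; by
  \<open>mat_eq_shiftI\<close> the shifted rows are all rows.\<close>

lemma shift_mult_entry:
  fixes M :: "'a::comm_ring_1 mat"
  assumes "M \<in> carrier_mat n n" "a < n" "b < n" "i < s"
  shows "(shift_mat ps i * M) $$ (shift_ix ps i a, b) = M $$ (a, b)"
proof -
  have "(shift_mat ps i * M) $$ (shift_ix ps i a, b) = (\<Sum>c<n. (if c = a then M $$ (c, b) else 0))"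
    by (subst mat_mult_entry[OF shift_mat_carrier assms(1) shift_ix_less[OF assms(2,4)] assms(3)], rule sum.cong)
      (use assms shift_ix_less[OF assms(2,4)] in \<open>auto simp: shift_mat_def shift_ix_eq_iff simp flip: n_def\<close>)
  then show ?thesis using assms by simp
qed

lemma mult_shift_entry:
  fixes M :: "'a::comm_ring_1 mat"
  assumes "M \<in> carrier_mat n n" "a < n" "b < n" "i < s"
  shows "(M * shift_mat ps i) $$ (a, b) = M $$ (a, shift_ix ps i b)"
proof -
  have "(M * shift_mat ps i) $$ (a, b) = (\<Sum>c<n. (if c = shift_ix ps i b then M $$ (a, c) else 0))"
    by (subst mat_mult_entry[OF assms(1) shift_mat_carrier assms(2,3)], rule sum.cong)
      (use assms in \<open>auto simp: shift_mat_def simp flip: n_def\<close>)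
  then show ?thesis using assms shift_ix_less[OF assms(3,4)] by simp
qed

lemma mat_eq_shiftI:
  assumes "M \<in> carrier_mat n n" "N \<in> carrier_mat n n" "i < s"
    and eq: "\<And>a b. a < n \<Longrightarrow> b < n \<Longrightarrow> M $$ (shift_ix ps i a, b) = N $$ (shift_ix ps i a, b)"
  shows "M = N"
proof (rule eq_matI)
  fix a b assume "a < dim_row N" "b < dim_col N"
  then have ab: "a < n" "b < n" using assms(2) by auto
  then have "a \<in> shift_ix ps i ` {..<n}"
    using shift_ix_bij[OF assms(3)] by (simp add: bij_betw_def)
  then show "M $$ (a, b) = N $$ (a, b)" using eq ab by auto
qed (use assms(1,2) in auto)

text \<open>The Weyl relation between clock and shift. The wrap-around of digit i is absorbed by
  \<open>w i ^ (ps ! i) = 1\<close>; for different factors the digit is untouched and the factor is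
  1.\<close>

lemma clock_shift_comm:
  fixes w :: "nat \<Rightarrow> 'a::comm_ring_1"
  assumes ij: "i < s" "j < s" and w: "w i ^ (ps ! i) = 1"
  shows "clock_mat ps w i * shift_mat ps j = (if i = j then w i else 1) \<cdot>\<^sub>m (shift_mat ps j * clock_mat ps w i)"
proof (rule mat_eq_shiftI[OF _ _ ij(2)])
  fix a b assume ab: "a < n" "b < n"
  note sa = shift_ix_less[OF ab(1) ij(2)]
  have "w i ^ digits ps (shift_ix ps j a) i = (if i = j then w i else 1) * w i ^ digits ps a i"
  proof (cases "i = j")
    case True
    have "w i ^ (Suc (digits ps a i) mod (ps ! i)) = w i ^ Suc (digits ps a i)"
      using w by (metis mod_mult_div_eq power_add power_mult power_one mult.right_neutral)
    then show ?thesis using True ab ij by (simp add: shift_ix)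
  qed (use ab ij in \<open>simp add: shift_ix\<close>)
  moreover have "(shift_mat ps j :: 'a mat) $$ (shift_ix ps j a, b) = (if a = b then 1 else 0)"
    using ab sa shift_ix_eq_iff[OF ij(2)] by (simp add: shift_mat_def flip: n_def)
  moreover have "(shift_mat ps j * clock_mat ps w i) $$ (shift_ix ps j a, b) =
     (if a = b then w i ^ digits ps a i else 0)"
    unfolding shift_mult_entry[OF clock_mat_carrier ab ij(2)] using ab by (simp add: clock_mat_def flip: n_def)
  moreover have "((if i = j then w i else 1) \<cdot>\<^sub>m (shift_mat ps j * clock_mat ps w i)) $$ (shift_ix ps j a, b) =
     (if i = j then w i else 1) * (shift_mat ps j * clock_mat ps w i) $$ (shift_ix ps j a, b)"
    using ab sa by (intro index_smult_mat) (auto simp: shift_mat_def clock_mat_def simp flip: n_def)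
  ultimately show "(clock_mat ps w i * shift_mat ps j) $$ (shift_ix ps j a, b) =
      ((if i = j then w i else 1) \<cdot>\<^sub>m (shift_mat ps j * clock_mat ps w i)) $$ (shift_ix ps j a, b)"
    unfolding clock_mult_entry[OF shift_mat_carrier sa ab(2)] by simp
qed (auto intro!: smult_carrier_mat mult_carrier_square)

lemma clock_clock_comm:
  fixes w :: "nat \<Rightarrow> 'a::comm_ring_1"
  shows "clock_mat ps w i * clock_mat ps w j = clock_mat ps w j * clock_mat ps w i"
proof (rule eq_matI)
  fix a b assume "a < dim_row (clock_mat ps w j * clock_mat ps w i)" "b < dim_col (clock_mat ps w j * clock_mat ps w i)"
  then have ab: "a < n" "b < n" by (auto simp: clock_mat_def n_def)
  show "(clock_mat ps w i * clock_mat ps w j) $$ (a, b) = (clock_mat ps w j * clock_mat ps w i) $$ (a, b)"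
    unfolding clock_mult_entry[OF clock_mat_carrier ab] using ab by (simp add: clock_mat_def flip: n_def)
qed (auto simp: clock_mat_def)

lemma shift_shift_comm:
  assumes ij: "i < s" "j < s"
  shows "shift_mat ps i * shift_mat ps j = (shift_mat ps j * shift_mat ps i :: 'a::comm_ring_1 mat)"
proof (rule mat_eq_shiftI[OF _ _ ij(1)])
  fix a b assume ab: "a < n" "b < n"
  note sa = shift_ix_less[OF ab(1) ij(1)] and sb = shift_ix_less[OF ab(2) ij(1)]
  have comm: "shift_ix ps i (shift_ix ps j b) = shift_ix ps j (shift_ix ps i b)"
    by (rule digits_eqI) (use ab ij in \<open>auto simp: shift_ix shift_ix_less\<close>)
  show "(shift_mat ps i * shift_mat ps j) $$ (shift_ix ps i a, b) =
     (shift_mat ps j * shift_mat ps i :: 'a mat) $$ (shift_ix ps i a, b)"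
    unfolding shift_mult_entry[OF shift_mat_carrier ab ij(1)] mult_shift_entry[OF shift_mat_carrier sa ab(2) ij(1)]
    using ab sa sb shift_ix_less[OF ab(2) ij(2)] by (simp add: shift_mat_def shift_ix_eq_iff[OF ij(1)] flip: n_def comm)
qed (auto intro!: mult_carrier_square)

lemma clock_pow:
  fixes w :: "nat \<Rightarrow> 'a::comm_ring_1"
  shows "clock_mat ps w i ^\<^sub>m k = clock_mat ps (\<lambda>i. w i ^ k) i"
proof (induction k)
  case (Suc k)
  show ?case
  proof (rule eq_matI)
    fix a b assume "a < dim_row (clock_mat ps (\<lambda>i. w i ^ Suc k) i)" "b < dim_col (clock_mat ps (\<lambda>i. w i ^ Suc k) i)"
    then have ab: "a < n" "b < n" by (auto simp: clock_mat_def n_def)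
    show "(clock_mat ps w i ^\<^sub>m Suc k) $$ (a, b) = clock_mat ps (\<lambda>i. w i ^ Suc k) i $$ (a, b)"
      unfolding pow_mat.simps Suc mult_clock_entry[OF clock_mat_carrier ab]
      using ab by (simp add: clock_mat_def power_mult_distrib flip: n_def)
  qed (auto simp: clock_mat_def)
qed (auto simp: clock_mat_def n_def)

lemma clock_pow_order:
  fixes w :: "nat \<Rightarrow> 'a::comm_ring_1"
  assumes "w i ^ (ps ! i) = 1"
  shows "clock_mat ps w i ^\<^sub>m (ps ! i) = 1\<^sub>m n"
  unfolding clock_pow using assms by (auto simp: clock_mat_def n_def)

lemma shift_pow_entry:
  assumes i: "i < s" and ab: "a < n" "b < n"
  shows "(shift_mat ps i ^\<^sub>m k :: 'a::comm_ring_1 mat) $$ (a, b) = (if a = (shift_ix ps i ^^ k) b then 1 else 0)"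
  using ab
proof (induction k arbitrary: b)
  case (Suc k)
  have "(shift_mat ps i ^\<^sub>m Suc k :: 'a mat) $$ (a, b) = (shift_mat ps i ^\<^sub>m k :: 'a mat) $$ (a, shift_ix ps i b)"
    using mult_shift_entry[OF pow_carrier_mat[OF shift_mat_carrier] Suc.prems i] by simp
  then show ?case
    using Suc shift_ix_less[OF Suc.prems(2) i] by (simp add: funpow_swap1)
qed (simp add: shift_mat_def flip: n_def)

lemma shift_pow_order:
  assumes i: "i < s"
  shows "shift_mat ps i ^\<^sub>m (ps ! i) = (1\<^sub>m n :: 'a::comm_ring_1 mat)"
proof (rule eq_matI)
  fix a b assume "a < dim_row (1\<^sub>m n :: 'a mat)" "b < dim_col (1\<^sub>m n :: 'a mat)"
  then have ab: "a < n" "b < n" by auto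
  have "(shift_ix ps i ^^ (ps ! i)) b = b"
    using digits_shift_iter[OF i ab(2), of "ps ! i"] ab digits_less[OF ab(2) i]
    by - (rule digits_eqI, auto)
  then show "(shift_mat ps i ^\<^sub>m (ps ! i)) $$ (a, b) = (1\<^sub>m n :: 'a mat) $$ (a, b)"
    using ab by (simp add: shift_pow_entry[OF i ab])
qed (simp_all add: shift_mat_def pow_mat_dim n_def)

end

lemma primitive_root_distinct:
  assumes "primitive_root_of_unity r (w::'a::field)" "u < r" "v < r" "w ^ u = w ^ v"
  shows "u = v"
proof -
  have *: "u = v" if "u \<le> v" "v < r" "w ^ u = w ^ v" for u v
  proof (rule ccontr)
    assume "u \<noteq> v"
    have "w \<noteq> 0"
    proof
      assume "w = 0"
      then have "(0::'a) ^ r = 1" using assms(1) by (simp add: primitive_root_of_unity_def)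
      then show False using that(2) by (cases r) auto
    qed
    have "w ^ v = w ^ u * w ^ (v - u)" using that(1) by (simp flip: power_add)
    then have "w ^ (v - u) = 1" using that(3) \<open>w \<noteq> 0\<close> by simp
    moreover have "0 < v - u" "v - u < r" using that \<open>u \<noteq> v\<close> by auto
    ultimately show False using assms(1) by (auto simp: primitive_root_of_unity_def)
  qed
  show ?thesis using *[of u v] *[of v u] assms by (cases "u \<le> v") auto
qed

section \<open>Eigenmatrices of the clock and shift matrices\<close>

lemma (in radix) n_pos: "0 < n"
proof -
  have "0 \<notin> set ps" using primes not_prime_0 by blast
  then show ?thesis unfolding n_def neq0_conv[symmetric] prod_list_zero_iff .
qed

locale weyl = radix +
  fixes w :: "nat \<Rightarrow> 'e::field"
  assumes w: "\<And>i. i < s \<Longrightarrow> primitive_root_of_unity (ps ! i) (w i)"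
begin

lemma w_pow: "i < s \<Longrightarrow> w i ^ (ps ! i) = 1"
  using w by (simp add: primitive_root_of_unity_def)

lemma w_nonzero: "i < s \<Longrightarrow> w i \<noteq> 0"
  using w_pow[of i] nth_pos[of i] by (metis power_0_left not_gr_zero zero_neq_one)

lemma w_distinct: "i < s \<Longrightarrow> a < n \<Longrightarrow> b < n \<Longrightarrow> w i ^ digits ps a i = w i ^ digits ps b i \<Longrightarrow>
    digits ps a i = digits ps b i"
  using primitive_root_distinct[OF w] digits_less by blast

text \<open>Lagrange interpolation on the digits yields the matrix units on the diagonal; the shifts
  move them around.\<close>

lemma generation:
  fixes S :: "'e mat set"
  assumes clock: "\<And>i. i < s \<Longrightarrow> clock_mat ps w i \<in> S" and shift: "\<And>i. i < s \<Longrightarrow> shift_mat ps i \<in> S"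
    and one: "1\<^sub>m n \<in> S" and add: "\<And>M N. M \<in> S \<Longrightarrow> N \<in> S \<Longrightarrow> M + N \<in> S"
    and mult: "\<And>M N. M \<in> S \<Longrightarrow> N \<in> S \<Longrightarrow> M * N \<in> S"
    and smult: "\<And>c M. M \<in> S \<Longrightarrow> c \<cdot>\<^sub>m M \<in> S"
    and M: "M \<in> carrier_mat n n"
  shows "M \<in> S"
proof -
  define dg where "dg f = mat n n (\<lambda>(a, b). if a = b then f a else 0)" for f :: "nat \<Rightarrow> 'e"
  define un where "un c d = mat n n (\<lambda>(a, b). if a = c \<and> b = d then 1 else (0 :: 'e))" for c d
  have dg_const: "dg (\<lambda>_. c) \<in> S" for c
  proof -
    have "dg (\<lambda>_. c) = c \<cdot>\<^sub>m 1\<^sub>m n" by (intro eq_matI) (auto simp: dg_def)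
    then show ?thesis using smult one by simp
  qed
  have dg_mult: "dg (\<lambda>a. f a * g a) \<in> S" if "dg f \<in> S" "dg g \<in> S" for f g
  proof -
    have "dg f * dg g = dg (\<lambda>a. f a * g a)"
    proof (rule eq_matI)
      fix a b assume "a < dim_row (dg (\<lambda>a. f a * g a))" "b < dim_col (dg (\<lambda>a. f a * g a))"
      then have ab: "a < n" "b < n" by (auto simp: dg_def)
      have "(dg f * dg g) $$ (a, b) = (\<Sum>c<n. dg f $$ (a, c) * dg g $$ (c, b))"
        by (rule mat_mult_entry[OF _ _ ab]) (auto simp: dg_def)
      also have "\<dots> = (\<Sum>c<n. if c = a then (if a = b then f a * g a else 0) else 0)"
        by (intro sum.cong refl) (use ab in \<open>auto simp: dg_def\<close>)
      finally show "(dg f * dg g) $$ (a, b) = dg (\<lambda>a. f a * g a) $$ (a, b)"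
        using ab by (simp add: dg_def)
    qed (auto simp: dg_def)
    then show ?thesis using mult[OF that] by simp
  qed
  have dg_prod: "dg (\<lambda>b. \<Prod>x\<in>T. f x b) \<in> S" if "\<And>x. x \<in> T \<Longrightarrow> dg (f x) \<in> S"
    for T :: "nat set" and f :: "nat \<Rightarrow> nat \<Rightarrow> 'e"
    using that
  proof (induction T rule: infinite_finite_induct)
    case (insert x T)
    then show ?case using dg_mult[of "f x" "\<lambda>b. \<Prod>x\<in>T. f x b"] by simp
  qed (use dg_const in auto)
  have un_diag: "un a a \<in> S" if a: "a < n" for a
  proof -
    \<comment> \<open>Factor i vanishes precisely when digit i of b differs from that of a, so g is
      supported at the single index a.\<close>
    define g where "g b = (\<Prod>i<s. \<Prod>v\<in>{..<ps ! i} - {digits ps a i}. w i ^ digits ps b i - w i ^ v)" for b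
    have lin: "dg (\<lambda>b. w i ^ digits ps b i - w i ^ v) \<in> S" if "i < s" for i v
    proof -
      have "dg (\<lambda>b. w i ^ digits ps b i - w i ^ v) = clock_mat ps w i + dg (\<lambda>_. - (w i ^ v))"
        by (intro eq_matI) (auto simp: dg_def clock_mat_def n_def)
      then show ?thesis using add[OF clock[OF that] dg_const] by simp
    qed
    have "dg g \<in> S"
      unfolding g_def by (rule dg_prod, rule dg_prod, rule lin) simp
    have "g a \<noteq> 0"
      using primitive_root_distinct[OF w] digits_less[OF a] by (auto simp: g_def)
    have g0: "g b = 0" if b: "b < n" "b \<noteq> a" for b
    proof -
      obtain i where i: "i < s" "digits ps b i \<noteq> digits ps a i"
        using digits_eqI[OF b(1) a] b(2) by blast
      have "(\<Prod>v\<in>{..<ps ! i} - {digits ps a i}. w i ^ digits ps b i - w i ^ v) = 0"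
        using i digits_less[OF b(1) i(1)] by (intro prod_zero) auto
      then show ?thesis unfolding g_def using i(1) by (intro prod_zero) auto
    qed
    have "(1 / g a) \<cdot>\<^sub>m dg g = un a a"
      using \<open>g a \<noteq> 0\<close> g0 by (intro eq_matI) (auto simp: dg_def un_def)
    then show ?thesis using smult[OF \<open>dg g \<in> S\<close>] by metis
  qed
  have un: "un b a \<in> S" if ab: "a < n" "b < n" for a b
  proof (rule shift_transitive[of "\<lambda>b. un b a \<in> S", OF _ ab(1) un_diag[OF ab(1)] ab(2)])
    fix i c assume i: "i < s" and c: "c < n" and "un c a \<in> S"
    have un_carr: "un c a \<in> carrier_mat n n" for c by (simp add: un_def)
    have "shift_mat ps i * un c a = un (shift_ix ps i c) a"
    proof (rule mat_eq_shiftI[OF mult_carrier_square[OF shift_mat_carrier un_carr] un_carr i])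
      fix d b assume db: "d < n" "b < n"
      show "(shift_mat ps i * un c a) $$ (shift_ix ps i d, b) = un (shift_ix ps i c) a $$ (shift_ix ps i d, b)"
        unfolding shift_mult_entry[OF un_carr db i]
        using db c i shift_ix_less[OF db(1) i] by (simp add: un_def shift_ix_eq_iff)
    qed
    then show "un (shift_ix ps i c) a \<in> S" using mult[OF shift[OF i] \<open>un c a \<in> S\<close>] by simp
  qed
  have part: "mat n n (\<lambda>x. if x \<in> T then M $$ x else 0) \<in> S" if "finite T" "T \<subseteq> {..<n} \<times> {..<n}" for T
    using that
  proof induction
    case empty
    have "mat n n (\<lambda>x. if x \<in> {} then M $$ x else 0) = 0 \<cdot>\<^sub>m 1\<^sub>m n"
      by (intro eq_matI) auto
    then show ?case using smult[OF one] by simp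
  next
    case (insert x T)
    obtain a b where x: "x = (a, b)" by (cases x)
    have "mat n n (\<lambda>y. if y \<in> insert x T then M $$ y else 0) =
        mat n n (\<lambda>y. if y \<in> T then M $$ y else 0) + M $$ (a, b) \<cdot>\<^sub>m un a b"
      using insert.hyps(2) by (intro eq_matI) (auto simp: x un_def)
    then show ?case using insert x by (auto intro!: add smult un)
  qed
  have "M = mat n n (\<lambda>x. if x \<in> {..<n} \<times> {..<n} then M $$ x else 0)"
    using M by (intro eq_matI) auto
  then show ?thesis using part[of "{..<n} \<times> {..<n}"] by simp
qed

text \<open>In matrix form both clauses say that G C is an eigenvalue times C G, with G the clock or
  the shift matrix of factor i. The entrywise form is what a comparison of coefficients delivers,
  and it avoids inverses.\<close>

definition eigen :: "'e mat \<Rightarrow> (nat \<Rightarrow> 'e) \<Rightarrow> (nat \<Rightarrow> 'e) \<Rightarrow> bool" where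
  "eigen C \<omega> \<omega>' \<longleftrightarrow> C \<in> carrier_mat n n \<and>
     (\<forall>i<s. \<forall>a<n. \<forall>b<n. w i ^ digits ps a i * C $$ (a, b) = \<omega> i * (w i ^ digits ps b i * C $$ (a, b)) \<and>
        C $$ (a, b) = \<omega>' i * C $$ (shift_ix ps i a, shift_ix ps i b))"

lemma eigenD:
  assumes "eigen C \<omega> \<omega>'"
  shows "C \<in> carrier_mat n n"
    "\<And>i a b. i < s \<Longrightarrow> a < n \<Longrightarrow> b < n \<Longrightarrow>
      w i ^ digits ps a i * C $$ (a, b) = \<omega> i * (w i ^ digits ps b i * C $$ (a, b))"
    "\<And>i a b. i < s \<Longrightarrow> a < n \<Longrightarrow> b < n \<Longrightarrow> C $$ (a, b) = \<omega>' i * C $$ (shift_ix ps i a, shift_ix ps i b)"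
  using assms unfolding eigen_def by blast+

lemma eigen_one: "eigen (1\<^sub>m n) (\<lambda>_. 1) (\<lambda>_. 1)"
  unfolding eigen_def by (auto simp: shift_ix_less shift_ix_eq_iff)

lemma eigen_mult:
  assumes C: "eigen C \<omega> \<omega>'" and D: "eigen D \<tau> \<tau>'"
  shows "eigen (C * D) (\<lambda>i. \<omega> i * \<tau> i) (\<lambda>i. \<omega>' i * \<tau>' i)"
  unfolding eigen_def
proof (intro conjI allI impI)
  note carr = eigenD(1)[OF C] eigenD(1)[OF D]
  show "C * D \<in> carrier_mat n n" using mult_carrier_square[OF carr] .
  fix i a b assume i: "i < s" and ab: "a < n" "b < n"
  have "w i ^ digits ps a i * (C * D) $$ (a, b) = (\<Sum>c<n. (w i ^ digits ps a i * C $$ (a, c)) * D $$ (c, b))"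
    unfolding mat_mult_entry[OF carr ab] sum_distrib_left by (simp add: mult.assoc)
  also have "\<dots> = (\<Sum>c<n. (\<omega> i * (w i ^ digits ps c i * C $$ (a, c))) * D $$ (c, b))"
    by (intro sum.cong refl) (use eigenD(2)[OF C i ab(1)] in simp)
  also have "\<dots> = (\<Sum>c<n. \<omega> i * C $$ (a, c) * (w i ^ digits ps c i * D $$ (c, b)))"
    by (intro sum.cong refl) (simp only: mult_ac)
  also have "\<dots> = (\<Sum>c<n. \<omega> i * C $$ (a, c) * (\<tau> i * (w i ^ digits ps b i * D $$ (c, b))))"
    by (intro sum.cong refl) (use eigenD(2)[OF D i _ ab(2)] in simp)
  also have "\<dots> = \<omega> i * \<tau> i * (w i ^ digits ps b i * (C * D) $$ (a, b))"
    unfolding mat_mult_entry[OF carr ab] sum_distrib_left by (intro sum.cong refl) (simp only: mult_ac)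
  finally show "w i ^ digits ps a i * (C * D) $$ (a, b) = \<omega> i * \<tau> i * (w i ^ digits ps b i * (C * D) $$ (a, b))" .
  have "(C * D) $$ (shift_ix ps i a, shift_ix ps i b) =
    (\<Sum>c<n. C $$ (shift_ix ps i a, c) * D $$ (c, shift_ix ps i b))"
    by (rule mat_mult_entry[OF carr shift_ix_less[OF ab(1) i] shift_ix_less[OF ab(2) i]])
  also have "\<dots> = (\<Sum>c<n. C $$ (shift_ix ps i a, shift_ix ps i c) * D $$ (shift_ix ps i c, shift_ix ps i b))"
    by (rule sum_shift_ix[OF i, symmetric])
  finally have "\<omega>' i * \<tau>' i * (C * D) $$ (shift_ix ps i a, shift_ix ps i b) =
    (\<Sum>c<n. (\<omega>' i * C $$ (shift_ix ps i a, shift_ix ps i c)) * (\<tau>' i * D $$ (shift_ix ps i c, shift_ix ps i b)))"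
    by (simp add: sum_distrib_left mult_ac)
  also have "\<dots> = (\<Sum>c<n. C $$ (a, c) * D $$ (c, b))"
    by (intro sum.cong refl) (use eigenD(3)[OF C i ab(1)] eigenD(3)[OF D i _ ab(2)] in simp)
  finally show "(C * D) $$ (a, b) = \<omega>' i * \<tau>' i * (C * D) $$ (shift_ix ps i a, shift_ix ps i b)"
    unfolding mat_mult_entry[OF carr ab] by simp
qed

lemma eigen_pow:
  assumes "eigen C \<omega> \<omega>'"
  shows "eigen (C ^\<^sub>m k) (\<lambda>i. \<omega> i ^ k) (\<lambda>i. \<omega>' i ^ k)"
proof (induction k)
  case 0
  then show ?case using eigen_one eigenD(1)[OF assms] by simp
next
  case (Suc k)
  show ?case using eigen_mult[OF Suc assms] by (simp add: mult.commute)
qed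

text \<open>Commuting with all clock matrices makes C diagonal, because distinct indices differ in a
  digit; commuting with all shifts makes the diagonal constant, because the shifts are transitive on
  the indices.\<close>

lemma eigen_scalar:
  assumes C: "eigen C \<omega> \<omega>'" and 1: "\<And>i. i < s \<Longrightarrow> \<omega> i = 1 \<and> \<omega>' i = 1"
  shows "\<exists>t. C = t \<cdot>\<^sub>m 1\<^sub>m n"
proof -
  have off: "C $$ (a, b) = 0" if ab: "a < n" "b < n" "a \<noteq> b" for a b
  proof -
    obtain i where i: "i < s" "digits ps a i \<noteq> digits ps b i"
      using digits_eqI ab by blast
    then have "w i ^ digits ps a i \<noteq> w i ^ digits ps b i" using w_distinct ab by blast
    then show ?thesis using eigenD(2)[OF C i(1) ab(1,2)] 1[OF i(1)] by simp
  qed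
  have diag: "C $$ (b, b) = C $$ (0, 0)" if "b < n" for b
  proof (rule shift_transitive[of "\<lambda>b. C $$ (b, b) = C $$ (0, 0)", OF _ n_pos refl that])
    fix i a assume "i < s" "a < n" "C $$ (a, a) = C $$ (0, 0)"
    then show "C $$ (shift_ix ps i a, shift_ix ps i a) = C $$ (0, 0)"
      using eigenD(3)[OF C, of i a a] 1[of i] by simp
  qed
  have "C = C $$ (0, 0) \<cdot>\<^sub>m 1\<^sub>m n"
  proof (rule eq_matI)
    fix a b assume "a < dim_row (C $$ (0, 0) \<cdot>\<^sub>m 1\<^sub>m n)" "b < dim_col (C $$ (0, 0) \<cdot>\<^sub>m 1\<^sub>m n)"
    then show "C $$ (a, b) = (C $$ (0, 0) \<cdot>\<^sub>m 1\<^sub>m n) $$ (a, b)"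
      using off[of a b] diag[of a] by (cases "a = b") auto
  qed (use eigenD(1)[OF C] in auto)
  then show ?thesis by blast
qed

text \<open>The trace is invariant under conjugation, while conjugation multiplies C by an
  eigenvalue different from 1. For the clock matrices the diagonal entries already vanish one by
  one.\<close>

lemma eigen_trace_zero:
  assumes C: "eigen C \<omega> \<omega>'" and i: "i < s" and ne: "\<omega> i \<noteq> 1 \<or> \<omega>' i \<noteq> 1"
  shows "mat_tr C = 0"
  using ne
proof
  assume ne: "\<omega> i \<noteq> 1"
  have "C $$ (a, a) = 0" if "a < n" for a
    using eigenD(2)[OF C i that that] w_nonzero[OF i] ne by simp
  then show ?thesis using eigenD(1)[OF C] by (simp add: mat_tr_def)
next
  assume ne: "\<omega>' i \<noteq> 1"
  have "mat_tr C = (\<Sum>a<n. C $$ (a, a))" using eigenD(1)[OF C] by (simp add: mat_tr_def)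
  also have "\<dots> = (\<Sum>a<n. \<omega>' i * C $$ (shift_ix ps i a, shift_ix ps i a))"
    by (intro sum.cong refl) (use eigenD(3)[OF C i] in simp)
  also have "\<dots> = \<omega>' i * (\<Sum>a<n. C $$ (a, a))"
    using sum_shift_ix[OF i, of "\<lambda>a. C $$ (a, a)"] by (simp flip: sum_distrib_left)
  also have "\<dots> = \<omega>' i * mat_tr C" using eigenD(1)[OF C] by (simp add: mat_tr_def)
  finally show ?thesis using ne by simp
qed

text \<open>C is a permutation matrix up to nonzero factors: the clock relations determine the
  digits of the row from those of the column and conversely, and the shifts carry a nonzero column
  to all others. The inverse B is the transpose with inverted entries.\<close>

lemma eigen_det:
  assumes C: "eigen C \<omega> \<omega>'" and nz: "C \<noteq> 0\<^sub>m n n"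
  shows "det C \<noteq> 0"
proof -
  note carr = eigenD(1)[OF C]
  have uniq_row: "a = a'" if "a < n" "a' < n" "b < n" "C $$ (a, b) \<noteq> 0" "C $$ (a', b) \<noteq> 0" for a a' b
  proof (rule digits_eqI[OF that(1,2)])
    fix i assume i: "i < s"
    have "w i ^ digits ps a i = \<omega> i * w i ^ digits ps b i" "w i ^ digits ps a' i = \<omega> i * w i ^ digits ps b i"
      using eigenD(2)[OF C i that(1,3)] eigenD(2)[OF C i that(2,3)] that(4,5) by simp_all
    then show "digits ps a i = digits ps a' i" using w_distinct[OF i that(1,2)] by simp
  qed
  have uniq_col: "b = b'" if "a < n" "b < n" "b' < n" "C $$ (a, b) \<noteq> 0" "C $$ (a, b') \<noteq> 0" for a b b'
  proof (rule digits_eqI[OF that(2,3)])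
    fix i assume i: "i < s"
    have eq: "w i ^ digits ps a i = \<omega> i * w i ^ digits ps b i" "w i ^ digits ps a i = \<omega> i * w i ^ digits ps b' i"
      using eigenD(2)[OF C i that(1,2)] eigenD(2)[OF C i that(1,3)] that(4,5) by simp_all
    \<comment> \<open>A zero eigenvalue is excluded by the nonzero entry, since w i is a
      unit.\<close>
    then have "\<omega> i \<noteq> 0" using w_nonzero[OF i] by auto
    then have "w i ^ digits ps b i = w i ^ digits ps b' i" using eq by simp
    then show "digits ps b i = digits ps b' i" using w_distinct[OF i that(2,3)] by simp
  qed
  obtain a0 b0 where ab0: "a0 < n" "b0 < n" "C $$ (a0, b0) \<noteq> 0"
    using nz carr by (metis eq_matI carrier_matD index_zero_mat)
  have ex: "\<exists>a<n. C $$ (a, b) \<noteq> 0" if "b < n" for b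
  proof (rule shift_transitive[of "\<lambda>b. \<exists>a<n. C $$ (a, b) \<noteq> 0", OF _ ab0(2) _ that])
    show "\<exists>a<n. C $$ (a, b0) \<noteq> 0" using ab0 by blast
    fix i b assume i: "i < s" and b: "b < n" and "\<exists>a<n. C $$ (a, b) \<noteq> 0"
    then obtain a where a: "a < n" "C $$ (a, b) \<noteq> 0" by blast
    then have "C $$ (shift_ix ps i a, shift_ix ps i b) \<noteq> 0" using eigenD(3)[OF C i a(1) b] by auto
    then show "\<exists>a<n. C $$ (a, shift_ix ps i b) \<noteq> 0" using shift_ix_less[OF a(1) i] by blast
  qed
  define B where "B = mat n n (\<lambda>(b, a). if C $$ (a, b) \<noteq> 0 then 1 / C $$ (a, b) else 0)"
  have B: "B \<in> carrier_mat n n" by (simp add: B_def)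
  have "B * C = 1\<^sub>m n"
  proof (rule eq_matI)
    fix b c assume "b < dim_row (1\<^sub>m n :: 'e mat)" "c < dim_col (1\<^sub>m n :: 'e mat)"
    then have bc: "b < n" "c < n" by auto
    obtain a0 where a0: "a0 < n" "C $$ (a0, b) \<noteq> 0" using ex[OF bc(1)] by blast
    have "(B * C) $$ (b, c) = (\<Sum>a<n. B $$ (b, a) * C $$ (a, c))"
      by (rule mat_mult_entry[OF B carr bc])
    also have "\<dots> = (\<Sum>a<n. if a = a0 then (if b = c then 1 else 0) else 0)"
    proof (intro sum.cong refl)
      fix a assume "a \<in> {..<n}"
      then have a: "a < n" by simp
      show "B $$ (b, a) * C $$ (a, c) = (if a = a0 then (if b = c then 1 else 0) else 0)"
      proof (cases "a = a0")
        case True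
        then show ?thesis
          using uniq_col[OF a0(1) bc a0(2)] bc a0 by (cases "b = c") (auto simp: B_def)
      next
        case False
        then have "C $$ (a, b) = 0" using uniq_row[OF a a0(1) bc(1) _ a0(2)] by blast
        then show ?thesis using False a bc by (simp add: B_def)
      qed
    qed
    also have "\<dots> = (1\<^sub>m n :: 'e mat) $$ (b, c)" using bc a0 by simp
    finally show "(B * C) $$ (b, c) = (1\<^sub>m n :: 'e mat) $$ (b, c)" .
  qed (use B carr in auto)
  then have "det B * det C = 1" using det_mult[OF B carr] by simp
  then show ?thesis by auto
qed

end

text \<open>Only the power traces of C enter. Newton's identities reduce to (q+1) e c_(q+1) = - t (n
  - q e) c_q, where c_q is the coefficient number q e; this is the recursion for the coefficients of
  (X^e - t)^(n/e). For (q+1) e \<le> n the factor n - q e lies between 1 and n, so it does not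
  vanish.\<close>

lemma char_coeff_root_of_scalar:
  fixes C :: "'a::field mat"
  assumes C: "C \<in> carrier_mat n n" and e: "e \<ge> 1" and t: "t \<noteq> 0"
    and tr1: "\<And>r. mat_tr (C ^\<^sub>m (r * e)) = of_nat n * t ^ r"
    and tr0: "\<And>j. \<not> e dvd j \<Longrightarrow> mat_tr (C ^\<^sub>m j) = 0"
    and char: "\<And>i. 1 \<le> i \<Longrightarrow> i \<le> n \<Longrightarrow> of_nat i \<noteq> (0 :: 'a)"
  shows "q * e \<le> n \<Longrightarrow> char_coeff C n (q * e) \<noteq> 0"
proof -
  \<comment> \<open>The sum in Newton's identity of index q e, after dropping the summands whose
    power trace is zero.\<close>
  define S where "S q = (\<Sum>r<q. char_coeff C n (r * e) * (of_nat n * t ^ (q - r)))" for q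
  have newton: "of_nat (q * e) * char_coeff C n (q * e) = - S q" if q: "q * e \<le> n" for q
  proof (cases "q = 0")
    case False
    have "(\<Sum>l<q * e. char_coeff C n l * mat_tr (C ^\<^sub>m (q * e - l))) =
      (\<Sum>l\<in>(\<lambda>r. r * e) ` {..<q}. char_coeff C n l * mat_tr (C ^\<^sub>m (q * e - l)))"
    proof (intro sum.mono_neutral_right ballI)
      show "(\<lambda>r. r * e) ` {..<q} \<subseteq> {..<q * e}" using e by auto
      fix l assume l: "l \<in> {..<q * e} - (\<lambda>r. r * e) ` {..<q}"
      have "\<not> e dvd l"
      proof
        assume "e dvd l"
        then obtain r where "l = r * e" by (metis dvdE mult.commute)
        then show False using l by auto
      qed
      then have "\<not> e dvd q * e - l" using l by (metis DiffD1 dvd_diffD1 dvd_triv_right lessThan_iff less_imp_le)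
      then show "char_coeff C n l * mat_tr (C ^\<^sub>m (q * e - l)) = 0" using tr0 by simp
    qed simp
    also have "\<dots> = (\<Sum>r<q. char_coeff C n (r * e) * mat_tr (C ^\<^sub>m ((q - r) * e)))"
      using e by (subst sum.reindex) (auto intro!: inj_onI simp: diff_mult_distrib)
    also have "\<dots> = S q" by (simp add: tr1 S_def)
    finally show ?thesis using char_poly_newton[OF C _ q] False e by simp
  qed (simp add: S_def)
  have step: "S (Suc q) = t * (S q + of_nat n * char_coeff C n (q * e))" for q
  proof -
    have "(\<Sum>r<q. char_coeff C n (r * e) * (of_nat n * t ^ (Suc q - r))) = t * S q"
      unfolding S_def sum_distrib_left by (intro sum.cong refl) (simp add: Suc_diff_le mult_ac)
    then show ?thesis by (simp add: S_def algebra_simps)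
  qed
  show "char_coeff C n (q * e) \<noteq> 0" if "q * e \<le> n"
    using that
  proof (induction q)
    case 0
    then show ?case using char_coeff_0[OF C] by simp
  next
    case (Suc q)
    have le: "q * e < n" "q * e \<le> n" using Suc.prems e by auto
    have "S q = - (of_nat (q * e) * char_coeff C n (q * e))"
      using newton[OF le(2)] by (simp only: minus_minus)
    then have "S (Suc q) = t * (of_nat n * char_coeff C n (q * e) - of_nat (q * e) * char_coeff C n (q * e))"
      unfolding step by simp
    also have "\<dots> = t * (of_nat (n - q * e) * char_coeff C n (q * e))"
      using le(2) by (simp only: of_nat_diff left_diff_distrib)
    finally have "S (Suc q) \<noteq> 0" using t Suc.IH[OF le(2)] char[of "n - q * e"] le by simp
    then show ?case using newton[OF Suc.prems] by (metis mult_zero_right neg_equal_0_iff_equal)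
  qed
qed

lemma (in weyl) eigen_char_coeff:
  assumes C: "eigen C \<omega> \<omega>'" and nz: "C \<noteq> 0\<^sub>m n n"
    and m: "\<And>i. i < s \<Longrightarrow> \<omega> i ^ m = 1 \<and> \<omega>' i ^ m = 1" "1 \<le> m" "m \<le> n"
    and char: "\<And>i. 1 \<le> i \<Longrightarrow> i \<le> n \<Longrightarrow> of_nat i \<noteq> (0 :: 'e)"
  shows "char_coeff C n m \<noteq> 0"
proof -
  note carr = eigenD(1)[OF C]
  define good where "good j \<longleftrightarrow> (\<forall>i<s. \<omega> i ^ j = 1 \<and> \<omega>' i ^ j = 1)" for j
  \<comment> \<open>The common order of all eigenvalues; m itself is a candidate, so the minimum
    exists, and it divides m.\<close>
  define e where "e = (LEAST j. 1 \<le> j \<and> good j)"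
  have e: "1 \<le> e" "good e"
    using LeastI[of "\<lambda>j. 1 \<le> j \<and> good j" m] m by (auto simp: e_def good_def)
  have mod: "x ^ (j mod e) = x ^ j" if "x ^ e = 1" for x :: 'e and j
  proof -
    have "x ^ j = x ^ (e * (j div e) + j mod e)" by simp
    also have "\<dots> = x ^ (j mod e)" unfolding power_add power_mult that by simp
    finally show ?thesis by simp
  qed
  have dvd: "e dvd j" if "good j" for j
  proof -
    have "good (j mod e)" using that e(2) by (auto simp: good_def mod)
    moreover have "j mod e < e" using e(1) by simp
    ultimately have "\<not> 1 \<le> j mod e" using not_less_Least[of "j mod e" "\<lambda>j. 1 \<le> j \<and> good j"] by (auto simp: e_def)
    then have "j mod e = 0" by linarith
    then show ?thesis by (rule dvd_eq_mod_eq_0[THEN iffD2])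
  qed
  have "\<exists>t. C ^\<^sub>m e = t \<cdot>\<^sub>m 1\<^sub>m n"
    by (rule eigen_scalar[OF eigen_pow[OF C]]) (use e(2) in \<open>simp add: good_def\<close>)
  then obtain t where t: "C ^\<^sub>m e = t \<cdot>\<^sub>m 1\<^sub>m n" by blast
  have detpow: "det (C ^\<^sub>m k) = det C ^ k" for k
  proof (induction k)
    case 0
    then show ?case using carr by simp
  next
    case (Suc k)
    then show ?case using det_mult[OF pow_carrier_mat[OF carr, of k] carr] by simp
  qed
  have "t \<noteq> 0"
  proof
    assume "t = 0"
    then have "det (C ^\<^sub>m e) = 0" unfolding t using n_pos by simp
    then show False using eigen_det[OF C nz] by (simp add: detpow)
  qed
  have pow: "C ^\<^sub>m (r * e) = t ^ r \<cdot>\<^sub>m 1\<^sub>m n" for r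
  proof (induction r)
    case 0
    show ?case using carr smult_one_mat'[of "1\<^sub>m n :: 'e mat"] by simp
  next
    case (Suc r)
    have add: "C ^\<^sub>m (k + l) = C ^\<^sub>m k * C ^\<^sub>m l" for k l
    proof (induction l)
      case 0
      then show ?case using carr pow_carrier_mat[OF carr, of k] by simp
    next
      case (Suc l)
      then show ?case
        using assoc_mult_mat[OF pow_carrier_mat[OF carr, of k] pow_carrier_mat[OF carr, of l] carr] by simp
    qed
    have "C ^\<^sub>m (Suc r * e) = C ^\<^sub>m e * C ^\<^sub>m (r * e)" by (simp add: add)
    also have "\<dots> = t ^ Suc r \<cdot>\<^sub>m 1\<^sub>m n" unfolding t Suc by (intro eq_matI) auto
    finally show ?case .
  qed
  obtain q where q: "m = q * e" using dvd[of m] m by (metis good_def dvdE mult.commute)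
  show ?thesis
    unfolding q
  proof (rule char_coeff_root_of_scalar[OF carr e(1) \<open>t \<noteq> 0\<close>])
    show "mat_tr (C ^\<^sub>m (r * e)) = of_nat n * t ^ r" for r
      unfolding pow by (rule mat_tr_scalar)
    show "mat_tr (C ^\<^sub>m j) = 0" if "\<not> e dvd j" for j
    proof -
      have "\<not> good j" using dvd[of j] that by blast
      then obtain i where i: "i < s" "\<omega> i ^ j \<noteq> 1 \<or> \<omega>' i ^ j \<noteq> 1"
        unfolding good_def by blast
      show ?thesis by (rule eigen_trace_zero[OF eigen_pow[OF C] i])
    qed
    show "q * e \<le> n" using m q by simp
  qed (use char in auto)
qed

section \<open>Leading terms of matrices of polynomials\<close>

lemma lookup_of_nat_mult:
  fixes f :: "'a::monoid_add \<Rightarrow>\<^sub>0 'b::semiring_1"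
  shows "Poly_Mapping.lookup (of_nat k * f) i = of_nat k * Poly_Mapping.lookup f i"
  by (induction k) (simp_all add: distrib_right lookup_add)

lemma lead_of_nat_cancel:
  fixes f :: "'a::{ordered_cancel_comm_monoid_add,linorder} \<Rightarrow>\<^sub>0 'b::field"
  assumes "lead (of_nat k * f) \<alpha> (of_nat k * c)" "of_nat k \<noteq> (0 :: 'b)"
  shows "lead f \<alpha> c"
  using assms by (auto simp: lead_def lookup_of_nat_mult in_keys_iff)

text \<open>One order \<open>\<alpha>\<close> serves all entries, so C has a zero wherever an entry
  of N starts later. Since \<open>lead\<close> tolerates zero coefficients, sums and products of
  such matrices need no case distinction about cancellation.\<close>

definition mat_lead :: "nat \<Rightarrow> (('a::{comm_monoid_add,linorder}) \<Rightarrow>\<^sub>0 'b::zero) mat \<Rightarrow> 'a \<Rightarrow> 'b mat \<Rightarrow> bool" where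
  "mat_lead n N \<alpha> C \<longleftrightarrow> N \<in> carrier_mat n n \<and> C \<in> carrier_mat n n \<and>
     (\<forall>a<n. \<forall>b<n. lead (N $$ (a, b)) \<alpha> (C $$ (a, b)))"

lemma mat_leadD:
  assumes "mat_lead n N \<alpha> C"
  shows "N \<in> carrier_mat n n" "C \<in> carrier_mat n n"
    "\<And>a b. a < n \<Longrightarrow> b < n \<Longrightarrow> lead (N $$ (a, b)) \<alpha> (C $$ (a, b))"
  using assms by (auto simp: mat_lead_def)

lemma mat_lead_one: "mat_lead n (1\<^sub>m n) 0 (1\<^sub>m n :: 'b::comm_ring_1 mat)"
  using lead_const[of "1::'b"] by (auto simp: mat_lead_def)

lemma mat_lead_mult:
  fixes N M :: "(('a::{ordered_cancel_comm_monoid_add,linorder}) \<Rightarrow>\<^sub>0 'b::comm_ring_1) mat"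
  assumes N: "mat_lead n N \<alpha> C" and M: "mat_lead n M \<beta> D"
  shows "mat_lead n (N * M) (\<alpha> + \<beta>) (C * D)"
  unfolding mat_lead_def
proof (intro conjI allI impI)
  note carr = mat_leadD(1,2)[OF N] mat_leadD(1,2)[OF M]
  show "N * M \<in> carrier_mat n n" "C * D \<in> carrier_mat n n" using carr by auto
  fix a b assume ab: "a < n" "b < n"
  have "lead (\<Sum>c<n. N $$ (a, c) * M $$ (c, b)) (\<alpha> + \<beta>) (\<Sum>c<n. C $$ (a, c) * D $$ (c, b))"
    by (intro lead_sum lead_mult) (use ab mat_leadD(3)[OF N] mat_leadD(3)[OF M] in auto)
  then show "lead ((N * M) $$ (a, b)) (\<alpha> + \<beta>) ((C * D) $$ (a, b))"
    using carr ab by (simp add: scalar_prod_def atLeast0LessThan)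
qed

text \<open>Exponent vectors form a semiring under convolution, in which
  \<open>of_nat k * \<alpha>\<close> is the k-fold sum of \<open>\<alpha>\<close>; this is the
  exponent of a k-th power.\<close>

lemma mat_lead_pow:
  fixes N :: "((nat \<Rightarrow>\<^sub>0 nat) \<Rightarrow>\<^sub>0 'b::comm_ring_1) mat"
  assumes N: "mat_lead n N \<alpha> C"
  shows "mat_lead n (N ^\<^sub>m k) (of_nat k * \<alpha>) (C ^\<^sub>m k)"
proof (induction k)
  case 0
  then show ?case using mat_lead_one mat_leadD(1,2)[OF N] by simp
next
  case (Suc k)
  show ?case using mat_lead_mult[OF Suc N] by (simp add: distrib_right add.commute)
qed

lemma lead_tr: "mat_lead n N \<alpha> C \<Longrightarrow> lead (mat_tr N) \<alpha> (mat_tr C)"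
  unfolding mat_tr_def using lead_sum[of "{..<n}" "\<lambda>a. N $$ (a, a)" \<alpha> "\<lambda>a. C $$ (a, a)"]
  by (auto simp: mat_lead_def)

text \<open>Newton's identities have the same shape for N and for C. By induction all summands of
  index i have order i times \<open>\<alpha>\<close>, so the leading parts satisfy the identity of
  C; the factor i cancels because it is nonzero in the coefficient field.\<close>

lemma lead_char_coeff:
  fixes N :: "((nat \<Rightarrow>\<^sub>0 nat) \<Rightarrow>\<^sub>0 'b::field) mat"
  assumes N: "mat_lead n N \<alpha> C" and char: "\<And>i. 1 \<le> i \<Longrightarrow> i \<le> n \<Longrightarrow> of_nat i \<noteq> (0 :: 'b)"
  shows "i \<le> n \<Longrightarrow> lead (char_coeff N n i) (of_nat i * \<alpha>) (char_coeff C n i)"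
proof (induction i rule: less_induct)
  case (less i)
  note carr = mat_leadD(1,2)[OF N]
  show ?case
  proof (cases "i = 0")
    case True
    then show ?thesis using char_coeff_0[OF carr(1)] char_coeff_0[OF carr(2)] lead_const[of "1::'b"] by simp
  next
    case False
    then have i: "1 \<le> i" by simp
    have "lead (char_coeff N n l * mat_tr (N ^\<^sub>m (i - l))) (of_nat i * \<alpha>)
        (char_coeff C n l * mat_tr (C ^\<^sub>m (i - l)))" if "l < i" for l
    proof -
      have "of_nat i = (of_nat (l + (i - l)) :: nat \<Rightarrow>\<^sub>0 nat)"
        using that by simp
      then have "of_nat i = of_nat l + (of_nat (i - l) :: nat \<Rightarrow>\<^sub>0 nat)"
        by (simp only: of_nat_add)
      then have "of_nat i * \<alpha> = of_nat l * \<alpha> + of_nat (i - l) * \<alpha>"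
        by (simp only: distrib_right)
      then show ?thesis
        using lead_mult[OF less.IH[OF that] lead_tr[OF mat_lead_pow[OF N, of "i - l"]]] less.prems that
        by (metis less_le_trans less_imp_le)
    qed
    then have "lead (- (\<Sum>l<i. char_coeff N n l * mat_tr (N ^\<^sub>m (i - l)))) (of_nat i * \<alpha>)
        (- (\<Sum>l<i. char_coeff C n l * mat_tr (C ^\<^sub>m (i - l))))"
      by (intro lead_uminus lead_sum) auto
    then have "lead (of_nat i * char_coeff N n i) (of_nat i * \<alpha>) (of_nat i * char_coeff C n i)"
      by (simp only: char_poly_newton[OF carr(1) i less.prems] char_poly_newton[OF carr(2) i less.prems])
    then show ?thesis by (rule lead_of_nat_cancel) (rule char[OF i less.prems])
  qed
qed

lemma pow_smult_mat:
  fixes M :: "'a::comm_ring_1 mat"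
  assumes M: "M \<in> carrier_mat n n"
  shows "(c \<cdot>\<^sub>m M) ^\<^sub>m k = c ^ k \<cdot>\<^sub>m M ^\<^sub>m k"
proof (induction k)
  case 0
  then show ?case using M smult_one_mat' by auto
next
  case (Suc k)
  have "(c \<cdot>\<^sub>m M) ^\<^sub>m Suc k = (c ^ k \<cdot>\<^sub>m M ^\<^sub>m k) * (c \<cdot>\<^sub>m M)" by (simp add: Suc)
  also have "\<dots> = c ^ Suc k \<cdot>\<^sub>m M ^\<^sub>m Suc k"
    using M pow_carrier_mat[OF M, of k]
    by (intro eq_matI) (auto simp: scalar_prod_def sum_distrib_left mult_ac)
  finally show ?case .
qed

text \<open>Homogeneity of degree i, by induction along Newton's identities.\<close>

lemma char_coeff_smult:
  fixes M :: "'a::field mat"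
  assumes M: "M \<in> carrier_mat n n" and char: "\<And>i. 1 \<le> i \<Longrightarrow> i \<le> n \<Longrightarrow> of_nat i \<noteq> (0 :: 'a)"
  shows "i \<le> n \<Longrightarrow> char_coeff (q \<cdot>\<^sub>m M) n i = q ^ i * char_coeff M n i"
proof (induction i rule: less_induct)
  case (less i)
  have qM: "q \<cdot>\<^sub>m M \<in> carrier_mat n n" using M by simp
  note pow = pow_smult_mat[OF M]
  show ?case
  proof (cases "i = 0")
    case True
    then show ?thesis using char_coeff_0[OF M] char_coeff_0[OF qM] by simp
  next
    case False
    then have i: "1 \<le> i" by simp
    have "of_nat i * char_coeff (q \<cdot>\<^sub>m M) n i = - (\<Sum>l<i. char_coeff (q \<cdot>\<^sub>m M) n l * mat_tr ((q \<cdot>\<^sub>m M) ^\<^sub>m (i - l)))"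
      by (rule char_poly_newton[OF qM i less.prems])
    also have "(\<Sum>l<i. char_coeff (q \<cdot>\<^sub>m M) n l * mat_tr ((q \<cdot>\<^sub>m M) ^\<^sub>m (i - l))) =
      (\<Sum>l<i. q ^ i * (char_coeff M n l * mat_tr (M ^\<^sub>m (i - l))))"
    proof (intro sum.cong refl)
      fix l assume "l \<in> {..<i}"
      then have l: "l < i" by simp
      then have "q ^ i = q ^ l * q ^ (i - l)" by (simp flip: power_add)
      then show "char_coeff (q \<cdot>\<^sub>m M) n l * mat_tr ((q \<cdot>\<^sub>m M) ^\<^sub>m (i - l)) =
          q ^ i * (char_coeff M n l * mat_tr (M ^\<^sub>m (i - l)))"
        using less.IH[OF l] l less.prems
        by (simp add: pow mat_tr_smult[OF pow_carrier_mat[OF M]])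
    qed
    also have "- \<dots> = q ^ i * (of_nat i * char_coeff M n i)"
      unfolding char_poly_newton[OF M i less.prems] by (simp add: sum_distrib_left)
    finally show ?thesis using char[OF i less.prems] by simp
  qed
qed

lemma (in comm_ring_hom) char_coeff_hom:
  "A \<in> carrier_mat n n \<Longrightarrow> char_coeff (mat\<^sub>h A) n i = hom (char_coeff A n i)"
  by (simp add: char_poly_hom coeff_map_poly_hom)

lemma (in comm_ring_hom) mat_tr_hom: "mat_tr (mat\<^sub>h A) = hom (mat_tr A)" if "A \<in> carrier_mat n n"
  using that by (simp add: mat_tr_def hom_sum)

section \<open>Rescaling automorphisms of the field of rational functions\<close>

lemma field_hom_rconst: "field_hom rconst"
  by standard (simp_all add: rconst_def single_add mult_single Zero_fract_def One_fract_def)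

definition fract_map :: "('a::idom \<Rightarrow> 'b::idom) \<Rightarrow> 'a fract \<Rightarrow> 'b fract" where
  "fract_map f = fract_lift (\<lambda>p. Fract (f p) 1)"

lemma
  assumes f: "inj_comm_ring_hom f"
  shows field_hom_fract_map: "field_hom (fract_map f)"
    and fract_map_Fract: "b \<noteq> 0 \<Longrightarrow> fract_map f (Fract a b) = Fract (f a) (f b)"
proof -
  interpret f: inj_comm_ring_hom f by fact
  have *: "inj_comm_ring_hom (\<lambda>p. Fract (f p) 1)"
    by standard (simp_all add: f.hom_add f.hom_mult Zero_fract_def One_fract_def eq_fract)
  show "field_hom (fract_map f)" unfolding fract_map_def by (rule field_hom_fract_lift[OF *])
  show "b \<noteq> 0 \<Longrightarrow> fract_map f (Fract a b) = Fract (f a) (f b)"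
    unfolding fract_map_def by (simp add: fract_lift_Fract[OF *])
qed

definition scale_at :: "nat \<Rightarrow> 'a::one \<Rightarrow> nat \<Rightarrow> 'a" where
  "scale_at j c v = (if v = j then c else 1)"

lemma mono_val_scale_at: "mono_val (scale_at j c) \<mu> = (c :: 'a::comm_semiring_1) ^ Poly_Mapping.lookup \<mu> j"
proof -
  have "mono_val (scale_at j c) \<mu> = (\<Prod>i\<in>insert j (Poly_Mapping.keys \<mu>). scale_at j c i ^ Poly_Mapping.lookup \<mu> i)"
    by (rule mono_val_superset) auto
  also have "\<dots> = scale_at j c j ^ Poly_Mapping.lookup \<mu> j *
      (\<Prod>i\<in>insert j (Poly_Mapping.keys \<mu>) - {j}. scale_at j c i ^ Poly_Mapping.lookup \<mu> i)"
    by (rule prod.remove) auto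
  also have "\<dots> = c ^ Poly_Mapping.lookup \<mu> j"
    by (simp add: scale_at_def)
  finally show ?thesis .
qed

lemma comm_ring_hom_mp_scale: "comm_ring_hom (mp_scale \<omega> :: _ \<Rightarrow> (nat \<Rightarrow>\<^sub>0 nat) \<Rightarrow>\<^sub>0 'a::comm_ring_1)"
  unfolding mp_scale_def by (rule comm_ring_hom_mp_eval, rule comm_ring_hom_mp_const)

lemma inj_comm_ring_hom_mp_scale:
  assumes "c \<noteq> (0 :: 'a::field)"
  shows "inj_comm_ring_hom (mp_scale (scale_at j c))"
proof -
  interpret comm_ring_hom "mp_scale (scale_at j c)"
    by (rule comm_ring_hom_mp_scale)
  have "p = 0" if "mp_scale (scale_at j c) p = 0" for p
  proof (rule poly_mapping_eqI)
    fix \<mu>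
    have "Poly_Mapping.lookup (mp_scale (scale_at j c) p) \<mu> = 0" using that by simp
    then show "Poly_Mapping.lookup p \<mu> = Poly_Mapping.lookup 0 \<mu>"
      using assms by (simp add: lookup_mp_scale mono_val_scale_at)
  qed
  then show ?thesis by unfold_locales
qed

lemma lead_mp_scale:
  fixes f :: "(nat \<Rightarrow>\<^sub>0 nat) \<Rightarrow>\<^sub>0 'a::field"
  assumes "lead f \<alpha> c"
  shows "lead (mp_scale (scale_at j d) f) \<alpha> (d ^ Poly_Mapping.lookup \<alpha> j * c)"
  using assms by (auto simp: lead_def lookup_mp_scale mono_val_scale_at in_keys_iff)

text \<open>The homomorphism that multiplies variable j by c and fixes the other variables. For c a
  p-th root of unity it fixes every function in which variable j occurs only through its p-th
  power.\<close>

definition chi :: "nat \<Rightarrow> 'a::field \<Rightarrow> 'a ratfun \<Rightarrow> 'a ratfun" where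
  "chi j c = fract_map (mp_scale (scale_at j c))"

lemma field_hom_chi: "c \<noteq> 0 \<Longrightarrow> field_hom (chi j c)"
  unfolding chi_def by (intro field_hom_fract_map inj_comm_ring_hom_mp_scale)

lemma chi_rconst:
  assumes "c \<noteq> 0"
  shows "chi j c (rconst a) = rconst a"
proof -
  interpret inj_comm_ring_hom "mp_scale (scale_at j c)" by (rule inj_comm_ring_hom_mp_scale[OF assms])
  have "mp_scale (scale_at j c) (mp_const a) = mp_const a"
    by (rule poly_mapping_eqI) (auto simp: lookup_mp_scale mono_val_scale_at lookup_single when_def)
  then show ?thesis
    by (simp add: chi_def rconst_def fract_map_Fract[OF inj_comm_ring_hom_mp_scale[OF assms]])
qed

lemma chi_rvar:
  assumes "c \<noteq> 0"
  shows "chi j c (rvar i) = (if i = j then rconst c else 1) * rvar i"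
proof -
  interpret inj_comm_ring_hom "mp_scale (scale_at j c)" by (rule inj_comm_ring_hom_mp_scale[OF assms])
  have "mp_scale (scale_at j c) (mp_var i) = (if i = j then mp_const c else 1) * mp_var i"
    by (rule poly_mapping_eqI)
      (auto simp: lookup_mp_scale mono_val_scale_at mult_single lookup_single when_def simp del: One_nat_def)
  then show ?thesis
    by (simp add: chi_def rconst_def rvar_def fract_map_Fract[OF inj_comm_ring_hom_mp_scale[OF assms]] One_fract_def del: One_nat_def)
qed

section \<open>Equivariant matrices\<close>

text \<open>For invertible G this is the condition G M G^(-1) = h(M), written without an inverse: M
  is a fixed point of a semilinear automorphism, as in Galois descent.\<close>

definition twisted :: "'a::comm_ring_1 mat \<Rightarrow> ('a \<Rightarrow> 'a) \<Rightarrow> 'a mat \<Rightarrow> bool" where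
  "twisted G h M \<longleftrightarrow> G * M = map_mat h M * G"

lemma twisted_mult:
  fixes G M N :: "'a::comm_ring_1 mat"
  assumes h: "comm_ring_hom h" and carr: "G \<in> carrier_mat n n" "M \<in> carrier_mat n n" "N \<in> carrier_mat n n"
    and M: "twisted G h M" and N: "twisted G h N"
  shows "twisted G h (M * N)"
proof -
  interpret comm_ring_hom h by fact
  have hM: "map_mat h M \<in> carrier_mat n n" and hN: "map_mat h N \<in> carrier_mat n n" using carr by auto
  have "G * (M * N) = (G * M) * N" by (rule assoc_mult_mat[OF carr, symmetric])
  also have "\<dots> = map_mat h M * (G * N)"
    unfolding M[unfolded twisted_def] by (rule assoc_mult_mat[OF hM carr(1,3)])
  also have "\<dots> = (map_mat h M * map_mat h N) * G"
    unfolding N[unfolded twisted_def] by (rule assoc_mult_mat[OF hM hN carr(1), symmetric])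
  also have "map_mat h M * map_mat h N = map_mat h (M * N)" by (rule mat_hom_mult[OF carr(2,3), symmetric])
  finally show ?thesis by (simp add: twisted_def)
qed

lemma twisted_add:
  fixes G M N :: "'a::comm_ring_1 mat"
  assumes h: "comm_ring_hom h" and carr: "G \<in> carrier_mat n n" "M \<in> carrier_mat n n" "N \<in> carrier_mat n n"
    and M: "twisted G h M" and N: "twisted G h N"
  shows "twisted G h (M + N)"
proof -
  interpret comm_ring_hom h by fact
  have hM: "map_mat h M \<in> carrier_mat n n" and hN: "map_mat h N \<in> carrier_mat n n" using carr by auto
  have "map_mat h (M + N) = map_mat h M + map_mat h N"
    using carr by (intro eq_matI) (auto simp: hom_add)
  then show ?thesis
    using M N mult_add_distrib_mat[OF carr] add_mult_distrib_mat[OF hM hN carr(1)] by (simp add: twisted_def)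
qed

lemma twisted_smult:
  fixes G M :: "'a::comm_ring_1 mat"
  assumes h: "comm_ring_hom h" and carr: "G \<in> carrier_mat n n" "M \<in> carrier_mat n n"
    and M: "twisted G h M" and c: "h c = d"
    and d: "d \<cdot>\<^sub>m (G * M) = c \<cdot>\<^sub>m (G * M)"
  shows "twisted G h (c \<cdot>\<^sub>m M)"
proof -
  interpret comm_ring_hom h by fact
  have hM: "map_mat h M \<in> carrier_mat n n" using carr by auto
  have "map_mat h (c \<cdot>\<^sub>m M) = d \<cdot>\<^sub>m map_mat h M"
    using carr c by (intro eq_matI) (auto simp: hom_mult)
  then show ?thesis
    using M mult_smult_distrib[OF carr, of c] mult_smult_assoc_mat[OF hM carr(1), of d] d by (simp add: twisted_def)
qed

lemma twisted_one:
  fixes G :: "'a::comm_ring_1 mat"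
  assumes h: "comm_ring_hom h" and G: "G \<in> carrier_mat n n"
  shows "twisted G h (1\<^sub>m n)"
proof -
  interpret comm_ring_hom h by fact
  show ?thesis using G by (simp add: twisted_def mat_hom_one)
qed

lemma twisted_inverse:
  fixes G M N :: "'a::comm_ring_1 mat"
  assumes h: "comm_ring_hom h" and carr: "G \<in> carrier_mat n n" "M \<in> carrier_mat n n" "N \<in> carrier_mat n n"
    and M: "twisted G h M" and inv: "M * N = 1\<^sub>m n" "N * M = 1\<^sub>m n"
  shows "twisted G h N"
proof -
  interpret comm_ring_hom h by fact
  have hM: "map_mat h M \<in> carrier_mat n n" and hN: "map_mat h N \<in> carrier_mat n n" using carr by auto
  have "map_mat h N * map_mat h M = 1\<^sub>m n"
    unfolding mat_hom_mult[OF carr(3,2), symmetric] inv by (rule mat_hom_one)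
  then have "G * N = map_mat h N * map_mat h M * (G * N)"
    by (simp only: left_mult_one_mat[OF mult_carrier_mat[OF carr(1,3)]])
  also have "\<dots> = map_mat h N * ((map_mat h M * G) * N)"
    by (simp only: assoc_mult_mat[OF hN hM mult_carrier_mat[OF carr(1,3)]] assoc_mult_mat[OF hM carr(1,3)])
  also have "\<dots> = map_mat h N * (G * (M * N))"
    unfolding M[unfolded twisted_def, symmetric] assoc_mult_mat[OF carr] by (rule refl)
  also have "\<dots> = map_mat h N * G" by (simp only: inv right_mult_one_mat[OF carr(1)])
  finally show ?thesis by (simp add: twisted_def)
qed

context weyl
begin

text \<open>Conjugation by the clock and shift matrices, combined with a rescaling of the variables,
  defines semilinear automorphisms; the image of the division algebra is fixed by all of them.\<close>

definition equivariant :: "'e ratfun mat \<Rightarrow> bool" where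
  "equivariant M \<longleftrightarrow> M \<in> carrier_mat n n \<and>
     (\<forall>i<s. twisted (clock_mat ps (\<lambda>i. rconst (w i)) i) (chi (2 * i) (w i)) M \<and>
        twisted (shift_mat ps i) (chi (2 * i + 1) (inverse (w i))) M)"

lemma chi_hom:
  assumes "i < s"
  shows "comm_ring_hom (chi j (w i))" "comm_ring_hom (chi j (inverse (w i)))"
proof -
  interpret a: field_hom "chi j (w i)" using field_hom_chi[OF w_nonzero[OF assms]] .
  interpret b: field_hom "chi j (inverse (w i))" using field_hom_chi[OF nonzero_imp_inverse_nonzero[OF w_nonzero[OF assms]]] .
  show "comm_ring_hom (chi j (w i))" "comm_ring_hom (chi j (inverse (w i)))" by unfold_locales
qed

lemma equivariantI:
  assumes "M \<in> carrier_mat n n"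
    and "\<And>i. i < s \<Longrightarrow> twisted (clock_mat ps (\<lambda>i. rconst (w i)) i) (chi (2 * i) (w i)) M"
    and "\<And>i. i < s \<Longrightarrow> twisted (shift_mat ps i) (chi (2 * i + 1) (inverse (w i))) M"
  shows "equivariant M"
  using assms by (simp add: equivariant_def)

lemma equivariantD:
  assumes "equivariant M"
  shows "M \<in> carrier_mat n n"
    and "\<And>i. i < s \<Longrightarrow> twisted (clock_mat ps (\<lambda>i. rconst (w i)) i) (chi (2 * i) (w i)) M"
    and "\<And>i. i < s \<Longrightarrow> twisted (shift_mat ps i) (chi (2 * i + 1) (inverse (w i))) M"
  using assms by (simp_all add: equivariant_def)

lemma equivariant_mult: "equivariant M \<Longrightarrow> equivariant N \<Longrightarrow> equivariant (M * N)"
  by (intro equivariantI mult_carrier_square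
      twisted_mult[OF chi_hom(1) clock_mat_carrier] twisted_mult[OF chi_hom(2) shift_mat_carrier])
    (auto dest: equivariantD)

lemma equivariant_add: "equivariant M \<Longrightarrow> equivariant N \<Longrightarrow> equivariant (M + N)"
  by (intro equivariantI add_carrier_mat
      twisted_add[OF chi_hom(1) clock_mat_carrier] twisted_add[OF chi_hom(2) shift_mat_carrier])
    (auto dest: equivariantD)

lemma equivariant_one: "equivariant (1\<^sub>m n)"
  by (intro equivariantI twisted_one[OF chi_hom(1) clock_mat_carrier] twisted_one[OF chi_hom(2) shift_mat_carrier])
    auto

lemma equivariant_inverse:
  assumes M: "equivariant M" and N: "N \<in> carrier_mat n n" "M * N = 1\<^sub>m n" "N * M = 1\<^sub>m n"
  shows "equivariant N"
proof (rule equivariantI[OF N(1)])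
  fix i assume i: "i < s"
  show "twisted (clock_mat ps (\<lambda>i. rconst (w i)) i) (chi (2 * i) (w i)) N"
    by (rule twisted_inverse[OF chi_hom(1)[OF i] clock_mat_carrier equivariantD(1)[OF M] N(1) equivariantD(2)[OF M i] N(2,3)])
  show "twisted (shift_mat ps i) (chi (2 * i + 1) (inverse (w i))) N"
    by (rule twisted_inverse[OF chi_hom(2)[OF i] shift_mat_carrier equivariantD(1)[OF M] N(1) equivariantD(3)[OF M i] N(2,3)])
qed

lemma equivariant_smult:
  assumes M: "equivariant M" and c: "\<And>i. i < s \<Longrightarrow> chi (2 * i) (w i) c = c"
    "\<And>i. i < s \<Longrightarrow> chi (2 * i + 1) (inverse (w i)) c = c"
  shows "equivariant (c \<cdot>\<^sub>m M)"
proof (rule equivariantI[OF smult_carrier_mat[OF equivariantD(1)[OF M]]])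
  fix i assume i: "i < s"
  show "twisted (clock_mat ps (\<lambda>i. rconst (w i)) i) (chi (2 * i) (w i)) (c \<cdot>\<^sub>m M)"
    by (rule twisted_smult[OF chi_hom(1)[OF i] clock_mat_carrier equivariantD(1)[OF M] equivariantD(2)[OF M i] c(1)[OF i] refl])
  show "twisted (shift_mat ps i) (chi (2 * i + 1) (inverse (w i))) (c \<cdot>\<^sub>m M)"
    by (rule twisted_smult[OF chi_hom(2)[OF i] shift_mat_carrier equivariantD(1)[OF M] equivariantD(3)[OF M i] c(2)[OF i] refl])
qed

lemma equivariant_rconst: "equivariant M \<Longrightarrow> equivariant (rconst c \<cdot>\<^sub>m M)"
  by (rule equivariant_smult) (simp_all add: chi_rconst w_nonzero)

end

context weyl
begin

lemma equivariant_entry: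
  assumes M: "equivariant M" and i: "i < s" and ab: "a < n" "b < n"
  shows "rconst (w i) ^ digits ps a i * M $$ (a, b) = chi (2 * i) (w i) (M $$ (a, b)) * rconst (w i) ^ digits ps b i"
    and "M $$ (a, b) = chi (2 * i + 1) (inverse (w i)) (M $$ (shift_ix ps i a, shift_ix ps i b))"
proof -
  note carr = equivariantD(1)[OF M]
  have carr': "map_mat h M \<in> carrier_mat n n" for h :: "'e ratfun \<Rightarrow> 'e ratfun" using carr by auto
  have "(clock_mat ps (\<lambda>i. rconst (w i)) i * M) $$ (a, b) =
      (map_mat (chi (2 * i) (w i)) M * clock_mat ps (\<lambda>i. rconst (w i)) i) $$ (a, b)"
    using equivariantD(2)[OF M i] by (simp only: twisted_def)
  then show "rconst (w i) ^ digits ps a i * M $$ (a, b) = chi (2 * i) (w i) (M $$ (a, b)) * rconst (w i) ^ digits ps b i"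
    unfolding clock_mult_entry[OF carr ab] mult_clock_entry[OF carr' ab] using carr ab by simp
  have "(shift_mat ps i * M) $$ (shift_ix ps i a, b) =
      (map_mat (chi (2 * i + 1) (inverse (w i))) M * shift_mat ps i) $$ (shift_ix ps i a, b)"
    using equivariantD(3)[OF M i] by (simp only: twisted_def)
  then show "M $$ (a, b) = chi (2 * i + 1) (inverse (w i)) (M $$ (shift_ix ps i a, shift_ix ps i b))"
    unfolding shift_mult_entry[OF carr ab i] mult_shift_entry[OF carr' shift_ix_less[OF ab(1) i] ab(2) i]
    using carr shift_ix_less[OF ab(1) i] shift_ix_less[OF ab(2) i] by simp
qed

lemma chi_Fract:
  assumes "c \<noteq> 0" "q \<noteq> 0"
  shows "chi j c (Fract p q) = Fract (mp_scale (scale_at j c) p) (mp_scale (scale_at j c) q)"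
    "mp_scale (scale_at j c) q \<noteq> 0"
proof -
  interpret inj_comm_ring_hom "mp_scale (scale_at j c)" by (rule inj_comm_ring_hom_mp_scale[OF assms(1)])
  show "chi j c (Fract p q) = Fract (mp_scale (scale_at j c) p) (mp_scale (scale_at j c) q)"
    unfolding chi_def by (rule fract_map_Fract[OF inj_comm_ring_hom_mp_scale[OF assms(1)] assms(2)])
  show "mp_scale (scale_at j c) q \<noteq> 0" using assms(2) by simp
qed

lemma lead_value: "lead f \<alpha> c \<Longrightarrow> lead f \<alpha> d \<Longrightarrow> c = d"
  by (simp add: lead_def)

text \<open>The lowest-order coefficient matrix of an equivariant matrix, with denominator \<open>q\<close> of order
  \<open>\<gamma>\<close>, is an eigenmatrix whose eigenvalues only depend on its order \<open>\<alpha>\<close>.\<close>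

lemma equivariant_leading:
  fixes q :: "'e mvpoly"
  assumes M: "equivariant M" and nz: "M \<noteq> 0\<^sub>m n n" and q: "lead q \<gamma> d" "d \<noteq> 0"
    and N: "N \<in> carrier_mat n n" "map_mat (\<lambda>p. Fract p 1) N = Fract q 1 \<cdot>\<^sub>m M"
  shows "\<exists>\<alpha> C. mat_lead n N \<alpha> C \<and> C \<noteq> 0\<^sub>m n n \<and>
    eigen C (\<lambda>i. w i ^ Poly_Mapping.lookup \<alpha> (2 * i) / w i ^ Poly_Mapping.lookup \<gamma> (2 * i))
      (\<lambda>i. inverse (w i) ^ Poly_Mapping.lookup \<alpha> (2 * i + 1) / inverse (w i) ^ Poly_Mapping.lookup \<gamma> (2 * i + 1))"
proof -
  note carr = equivariantD(1)[OF M]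
  have q0: "q \<noteq> 0" by (rule lead_nonzero[OF q])
  have M_entry: "M $$ (a, b) = Fract (N $$ (a, b)) q" if ab: "a < n" "b < n" for a b
  proof -
    have "map_mat (\<lambda>p. Fract p 1) N $$ (a, b) = (Fract q 1 \<cdot>\<^sub>m M) $$ (a, b)" by (simp only: N(2))
    then have eq: "Fract (N $$ (a, b)) 1 = Fract q 1 * M $$ (a, b)" using ab carr N(1) by simp
    have "Fract q 1 \<noteq> 0" using q0 by (simp add: Zero_fract_def eq_fract)
    then have "M $$ (a, b) = Fract (N $$ (a, b)) 1 / Fract q 1" unfolding eq by simp
    then show ?thesis by simp
  qed
  define KS where "KS = (\<Union>a<n. \<Union>b<n. Poly_Mapping.keys (N $$ (a, b)))"
  have fin: "finite KS" by (auto simp: KS_def)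
  have "KS \<noteq> {}"
  proof
    assume "KS = {}"
    then have "N $$ (a, b) = 0" if "a < n" "b < n" for a b
      using that by (auto simp: KS_def)
    then have "M = 0\<^sub>m n n" using M_entry carr by (intro eq_matI) (auto simp: fract_collapse)
    then show False using nz by simp
  qed
  \<comment> \<open>The lowest monomial occurring in any entry, so that the coefficient matrix at it
    is nonzero as a whole while single entries may vanish.\<close>
  define \<alpha> where "\<alpha> = Min KS"
  define C where "C = mat n n (\<lambda>x. Poly_Mapping.lookup (N $$ x) \<alpha>)"
  have \<alpha>: "\<alpha> \<in> KS" "\<And>\<mu>. \<mu> \<in> KS \<Longrightarrow> \<alpha> \<le> \<mu>"
    using Min_in[OF fin \<open>KS \<noteq> {}\<close>] Min_le[OF fin] by (auto simp: \<alpha>_def)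
  have leadN: "lead (N $$ (a, b)) \<alpha> (C $$ (a, b))" if "a < n" "b < n" for a b
    using that \<alpha>(2) by (auto simp: lead_def C_def KS_def)
  have "C \<noteq> 0\<^sub>m n n"
  proof
    assume "C = 0\<^sub>m n n"
    obtain a b where ab: "a < n" "b < n" "Poly_Mapping.lookup (N $$ (a, b)) \<alpha> \<noteq> 0"
      using \<alpha>(1) by (auto simp: KS_def in_keys_iff)
    then have "C $$ (a, b) \<noteq> 0" by (simp add: C_def)
    then show False using ab unfolding \<open>C = 0\<^sub>m n n\<close> by simp
  qed
  have div_eq: "A = Y / Z * B" if "A * (Z * d) = Y * B * d" "d \<noteq> 0" "Z \<noteq> 0" for A B Y Z d :: 'e
    using that by (simp add: field_simps)
  have rconst_pow: "rconst c ^ k = Fract (mp_const (c ^ k)) (1 :: 'e mvpoly)" for c :: 'e and k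
  proof -
    interpret r: field_hom "rconst :: 'e \<Rightarrow> _" by (rule field_hom_rconst)
    have "rconst c ^ k = rconst (c ^ k)" by (rule r.hom_power[symmetric])
    then show ?thesis by (simp only: rconst_def)
  qed
  have "eigen C (\<lambda>i. w i ^ Poly_Mapping.lookup \<alpha> (2 * i) / w i ^ Poly_Mapping.lookup \<gamma> (2 * i))
      (\<lambda>i. inverse (w i) ^ Poly_Mapping.lookup \<alpha> (2 * i + 1) / inverse (w i) ^ Poly_Mapping.lookup \<gamma> (2 * i + 1))"
    unfolding eigen_def
  proof (intro conjI allI impI)
    show "C \<in> carrier_mat n n" by (simp add: C_def)
    fix i a b assume i: "i < s" and ab: "a < n" "b < n"
    note sab = shift_ix_less[OF ab(1) i] shift_ix_less[OF ab(2) i]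
    let ?X = "scale_at (2 * i) (w i)" and ?Y = "scale_at (2 * i + 1) (inverse (w i))"
    have w0: "w i \<noteq> 0" "inverse (w i) \<noteq> 0" using w_nonzero[OF i] by auto
    have "Fract (mp_const (w i ^ digits ps a i) * N $$ (a, b)) q =
        Fract (mp_scale ?X (N $$ (a, b)) * mp_const (w i ^ digits ps b i)) (mp_scale ?X q)"
      using equivariant_entry(1)[OF M i ab] unfolding M_entry[OF ab] chi_Fract(1)[OF w0(1) q0] rconst_pow by simp
    \<comment> \<open>The denominator q is rescaled too. After cross multiplication both sides are
      polynomials with no monomial below \<open>\<alpha> + \<gamma>\<close>, and equating their
      coefficients there gives the clock eigenvalue; because of q it is a quotient of two powers of
      w i.\<close>
    then have eq: "mp_const (w i ^ digits ps a i) * N $$ (a, b) * mp_scale ?X q =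
        mp_scale ?X (N $$ (a, b)) * mp_const (w i ^ digits ps b i) * q"
      by (rule iffD1[OF eq_fract(1)[OF q0 chi_Fract(2)[OF w0(1) q0]]])
    have l1: "lead (mp_const (w i ^ digits ps a i) * N $$ (a, b) * mp_scale ?X q) (\<alpha> + \<gamma>)
      (w i ^ digits ps a i * C $$ (a, b) * (w i ^ Poly_Mapping.lookup \<gamma> (2 * i) * d))"
      by (rule lead_mult[OF lead_mult[OF lead_const leadN[OF ab]] lead_mp_scale[OF q(1)], unfolded add_0_left])
    have l2: "lead (mp_scale ?X (N $$ (a, b)) * mp_const (w i ^ digits ps b i) * q) (\<alpha> + \<gamma>)
      (w i ^ Poly_Mapping.lookup \<alpha> (2 * i) * C $$ (a, b) * w i ^ digits ps b i * d)"
      by (rule lead_mult[OF lead_mult[OF lead_mp_scale[OF leadN[OF ab]] lead_const] q(1), unfolded add_0_right])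
    have val: "w i ^ digits ps a i * C $$ (a, b) * (w i ^ Poly_Mapping.lookup \<gamma> (2 * i) * d) =
        w i ^ Poly_Mapping.lookup \<alpha> (2 * i) * C $$ (a, b) * w i ^ digits ps b i * d"
      by (rule lead_value[OF l1[unfolded eq] l2])
    show "w i ^ digits ps a i * C $$ (a, b) = w i ^ Poly_Mapping.lookup \<alpha> (2 * i) /
        w i ^ Poly_Mapping.lookup \<gamma> (2 * i) * (w i ^ digits ps b i * C $$ (a, b))"
      by (rule div_eq[OF _ q(2) power_not_zero[OF w0(1)]]) (use val in \<open>simp only: mult_ac\<close>)
    have "Fract (N $$ (a, b)) q = Fract (mp_scale ?Y (N $$ (shift_ix ps i a, shift_ix ps i b))) (mp_scale ?Y q)"
      using equivariant_entry(2)[OF M i ab] unfolding M_entry[OF ab] M_entry[OF sab] chi_Fract(1)[OF w0(2) q0] .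
    then have eq: "N $$ (a, b) * mp_scale ?Y q = mp_scale ?Y (N $$ (shift_ix ps i a, shift_ix ps i b)) * q"
      by (rule iffD1[OF eq_fract(1)[OF q0 chi_Fract(2)[OF w0(2) q0]]])
    have l1: "lead (N $$ (a, b) * mp_scale ?Y q) (\<alpha> + \<gamma>)
      (C $$ (a, b) * (inverse (w i) ^ Poly_Mapping.lookup \<gamma> (2 * i + 1) * d))"
      by (rule lead_mult[OF leadN[OF ab] lead_mp_scale[OF q(1)]])
    have l2: "lead (mp_scale ?Y (N $$ (shift_ix ps i a, shift_ix ps i b)) * q) (\<alpha> + \<gamma>)
      (inverse (w i) ^ Poly_Mapping.lookup \<alpha> (2 * i + 1) * C $$ (shift_ix ps i a, shift_ix ps i b) * d)"
      by (rule lead_mult[OF lead_mp_scale[OF leadN[OF sab]] q(1)])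
    have val: "C $$ (a, b) * (inverse (w i) ^ Poly_Mapping.lookup \<gamma> (2 * i + 1) * d) =
        inverse (w i) ^ Poly_Mapping.lookup \<alpha> (2 * i + 1) * C $$ (shift_ix ps i a, shift_ix ps i b) * d"
      by (rule lead_value[OF l1[unfolded eq] l2])
    show "C $$ (a, b) = inverse (w i) ^ Poly_Mapping.lookup \<alpha> (2 * i + 1) /
        inverse (w i) ^ Poly_Mapping.lookup \<gamma> (2 * i + 1) * C $$ (shift_ix ps i a, shift_ix ps i b)"
      by (rule div_eq[OF _ q(2) power_not_zero[OF w0(2)]]) (rule val)
  qed
  moreover have "mat_lead n N \<alpha> C" using N(1) leadN by (auto simp: mat_lead_def C_def)
  ultimately show ?thesis using \<open>C \<noteq> 0\<^sub>m n n\<close> by blast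
qed

lemma exists_denominator:
  assumes "finite \<M>" "\<And>M. M \<in> \<M> \<Longrightarrow> M \<in> carrier_mat n n"
  shows "\<exists>q::'e mvpoly. q \<noteq> 0 \<and> (\<forall>M\<in>\<M>. \<exists>N\<in>carrier_mat n n. map_mat (\<lambda>p. Fract p 1) N = Fract q 1 \<cdot>\<^sub>m M)"
proof -
  have "finite (\<Union>M\<in>\<M>. (\<lambda>x. M $$ x) ` ({..<n} \<times> {..<n}))" using assms(1) by auto
  from common_denominator[OF this] obtain q :: "'e mvpoly" where q: "q \<noteq> 0"
    "\<And>M x. M \<in> \<M> \<Longrightarrow> x \<in> {..<n} \<times> {..<n} \<Longrightarrow> \<exists>p. Fract q 1 * M $$ x = Fract p 1" by blast
  have "\<exists>N\<in>carrier_mat n n. map_mat (\<lambda>p. Fract p 1) N = Fract q 1 \<cdot>\<^sub>m M" if M: "M \<in> \<M>" for M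
  proof -
    define N where "N = mat n n (\<lambda>x. SOME p. Fract q 1 * M $$ x = Fract p 1)"
    have "Fract q 1 * M $$ (a, b) = Fract (N $$ (a, b)) 1" if "a < n" "b < n" for a b
      using someI_ex[OF q(2)[OF M, of "(a, b)"]] that by (simp add: N_def)
    then have "map_mat (\<lambda>p. Fract p 1) N = Fract q 1 \<cdot>\<^sub>m M"
      using assms(2)[OF M] by (intro eq_matI) (auto simp: N_def)
    then show ?thesis by (intro bexI[of _ N]) (auto simp: N_def)
  qed
  then show ?thesis using q(1) by blast
qed

end

section \<open>Nonvanishing of invariants of equivariant matrices\<close>

locale weyl_char = weyl ps n s w for ps n s and w :: "nat \<Rightarrow> 'e::field" +
  assumes char: "\<And>i. 1 \<le> i \<Longrightarrow> i \<le> n \<Longrightarrow> of_nat i \<noteq> (0 :: 'e)"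
begin

lemma char_ratfun:
  assumes "1 \<le> i" "i \<le> n"
  shows "of_nat i \<noteq> (0 :: 'e ratfun)"
proof
  interpret r: field_hom "rconst :: 'e \<Rightarrow> _" by (rule field_hom_rconst)
  assume "of_nat i = (0 :: 'e ratfun)"
  then have "rconst (of_nat i :: 'e) = 0" by (simp only: r.hom_of_nat)
  then have "of_nat i = (0 :: 'e)" by (rule r.hom_0)
  then show False using char[OF assms] by simp
qed

text \<open>All matrices in the family are handled with one denominator \<open>q\<close>, so that the orders of their
  determinants can be compared.\<close>

definition leading_data where
  "leading_data \<M> q \<omega> \<omega>' N \<alpha> C \<longleftrightarrow> (q :: 'e mvpoly) \<noteq> 0 \<and>
     (\<forall>\<beta>. \<forall>i<s. \<omega> \<beta> i ^ (ps ! i) = 1 \<and> \<omega>' \<beta> i ^ (ps ! i) = 1) \<and>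
     (\<forall>M\<in>\<M>. mat_lead n (N M) (\<alpha> M) (C M) \<and> C M \<noteq> 0\<^sub>m n n \<and>
        eigen (C M) (\<omega> (\<alpha> M)) (\<omega>' (\<alpha> M)) \<and> map_mat (\<lambda>p. Fract p 1) (N M) = Fract q 1 \<cdot>\<^sub>m M)"

lemma leading_dataD:
  assumes "leading_data \<M> q \<omega> \<omega>' N \<alpha> C"
  shows "q \<noteq> 0" "\<And>\<beta> i. i < s \<Longrightarrow> \<omega> \<beta> i ^ (ps ! i) = 1 \<and> \<omega>' \<beta> i ^ (ps ! i) = 1"
    "\<And>M. M \<in> \<M> \<Longrightarrow> mat_lead n (N M) (\<alpha> M) (C M)"
    "\<And>M. M \<in> \<M> \<Longrightarrow> C M \<noteq> 0\<^sub>m n n"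
    "\<And>M. M \<in> \<M> \<Longrightarrow> eigen (C M) (\<omega> (\<alpha> M)) (\<omega>' (\<alpha> M))"
    "\<And>M. M \<in> \<M> \<Longrightarrow> map_mat (\<lambda>p. Fract p 1) (N M) = Fract q 1 \<cdot>\<^sub>m M"
  using assms unfolding leading_data_def by blast+

text \<open>The eigenvalues are quotients of powers of roots of unity, with exponents taken from the
  order \<open>\<beta>\<close> and from the fixed order \<open>\<gamma>\<close> of q. Hence their
  powers with exponent \<open>ps ! i\<close> are 1, and equal orders have equal eigenvalues; this is
  why \<open>\<omega>\<close> and \<open>\<omega>'\<close> are functions of
  \<open>\<beta>\<close>.\<close>

lemma leading_terms:
  assumes "finite \<M>" and \<M>: "\<And>M. M \<in> \<M> \<Longrightarrow> equivariant M \<and> M \<noteq> 0\<^sub>m n n"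
  shows "\<exists>q \<omega> \<omega>' N \<alpha> C. leading_data \<M> q \<omega> \<omega>' N \<alpha> C"
proof -
  obtain q :: "'e mvpoly" where q: "q \<noteq> 0"
    and "\<forall>M\<in>\<M>. \<exists>N\<in>carrier_mat n n. map_mat (\<lambda>p. Fract p 1) N = Fract q 1 \<cdot>\<^sub>m M"
    using exists_denominator[OF assms(1)] \<M> equivariantD(1) by blast
  then obtain N where N: "\<And>M. M \<in> \<M> \<Longrightarrow> N M \<in> carrier_mat n n"
    "\<And>M. M \<in> \<M> \<Longrightarrow> map_mat (\<lambda>p. Fract p 1) (N M) = Fract q 1 \<cdot>\<^sub>m M" by metis
  define \<gamma> where "\<gamma> = Min (Poly_Mapping.keys q)"
  have ne: "Poly_Mapping.keys q \<noteq> {}" using q by simp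
  have "\<gamma> \<in> Poly_Mapping.keys q" "\<And>\<mu>. \<mu> \<in> Poly_Mapping.keys q \<Longrightarrow> \<gamma> \<le> \<mu>"
    using Min_in[OF finite_keys ne] Min_le[OF finite_keys] by (auto simp: \<gamma>_def)
  then have lq: "lead q \<gamma> (Poly_Mapping.lookup q \<gamma>)" "Poly_Mapping.lookup q \<gamma> \<noteq> 0"
    by (auto simp: lead_def in_keys_iff)
  define \<omega> where "\<omega> \<beta> i = w i ^ Poly_Mapping.lookup \<beta> (2 * i) / w i ^ Poly_Mapping.lookup \<gamma> (2 * i)" for \<beta> i
  define \<omega>' where "\<omega>' \<beta> i = inverse (w i) ^ Poly_Mapping.lookup \<beta> (2 * i + 1) /
    inverse (w i) ^ Poly_Mapping.lookup \<gamma> (2 * i + 1)" for \<beta> i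
  have "\<forall>M\<in>\<M>. \<exists>\<alpha> C. mat_lead n (N M) \<alpha> C \<and> C \<noteq> 0\<^sub>m n n \<and> eigen C (\<omega> \<alpha>) (\<omega>' \<alpha>)"
    using equivariant_leading[OF _ _ lq N(1) N(2)] \<M> unfolding \<omega>_def \<omega>'_def by blast
  then obtain \<alpha> C where "\<forall>M\<in>\<M>. mat_lead n (N M) (\<alpha> M) (C M) \<and> C M \<noteq> 0\<^sub>m n n \<and>
      eigen (C M) (\<omega> (\<alpha> M)) (\<omega>' (\<alpha> M))" by metis
  note aC = this[rule_format]
  have pow: "(x ^ k / x ^ l) ^ p = 1" if "x ^ p = 1" for x :: 'e and k l p
  proof -
    have "(x ^ k) ^ p = 1" for k by (metis that power_mult mult.commute power_one)
    then show ?thesis by (simp add: power_divide)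
  qed
  have "\<omega> \<beta> i ^ (ps ! i) = 1 \<and> \<omega>' \<beta> i ^ (ps ! i) = 1" if "i < s" for \<beta> i
    unfolding \<omega>_def \<omega>'_def using pow[OF w_pow[OF that]] pow[of "inverse (w i)" "ps ! i"] w_pow[OF that]
    by (simp add: power_inverse)
  then have "leading_data \<M> q \<omega> \<omega>' N \<alpha> C"
    unfolding leading_data_def using q aC N(2) by blast
  then show ?thesis by blast
qed

lemma hom_Fract: "inj_comm_ring_hom (\<lambda>p :: 'e mvpoly. Fract p 1)"
  by (rule inj_comm_ring_hom_Fract)

lemma char_coeff_scaled:
  fixes q :: "'e mvpoly"
  assumes "M \<in> carrier_mat n n" "N \<in> carrier_mat n n" "map_mat (\<lambda>p. Fract p 1) N = Fract q 1 \<cdot>\<^sub>m M" "i \<le> n"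
  shows "Fract (char_coeff N n i) 1 = Fract q 1 ^ i * char_coeff M n i"
proof -
  interpret F: inj_comm_ring_hom "\<lambda>p :: 'e mvpoly. Fract p 1" by (rule hom_Fract)
  have "Fract (char_coeff N n i) 1 = char_coeff (map_mat (\<lambda>p. Fract p 1) N) n i"
    by (rule F.char_coeff_hom[OF assms(2), symmetric])
  also have "\<dots> = char_coeff (Fract q 1 \<cdot>\<^sub>m M) n i" by (simp only: assms(3))
  also have "\<dots> = Fract q 1 ^ i * char_coeff M n i"
    by (rule char_coeff_smult[OF assms(1) char_ratfun assms(4)])
  finally show ?thesis .
qed

text \<open>Multiplying M by q changes its coefficient number i by the nonzero factor q^i, and the
  lowest term of the new coefficient is the corresponding coefficient of the leading matrix C. For
  the index m this is nonzero since all eigenvalues are m-th roots of unity, and for the index n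
  since C is invertible. The second half makes nonzero equivariant matrices invertible.\<close>

lemma equivariant_char_coeff_and_det:
  assumes M: "equivariant M" "M \<noteq> 0\<^sub>m n n"
  shows "\<And>m. (\<And>i. i < s \<Longrightarrow> ps ! i dvd m) \<Longrightarrow> 1 \<le> m \<Longrightarrow> m \<le> n \<Longrightarrow> char_coeff M n m \<noteq> 0"
    and "det M \<noteq> 0"
proof -
  note carr = equivariantD(1)[OF M(1)]
  obtain q \<omega> \<omega>' N \<alpha> C where data: "leading_data {M} q \<omega> \<omega>' N \<alpha> C"
    using leading_terms[of "{M}"] M by blast
  note root = leading_dataD(2)[OF data] and N = leading_dataD(3)[OF data] and C = leading_dataD(4)[OF data]
    and eig = leading_dataD(5)[OF data] and NM = leading_dataD(6)[OF data]
  have coeff: "char_coeff M n i \<noteq> 0" if i: "i \<le> n" and "char_coeff (C M) n i \<noteq> 0" for i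
  proof -
    have "lead (char_coeff (N M) n i) (of_nat i * \<alpha> M) (char_coeff (C M) n i)"
      by (rule lead_char_coeff[OF N char i]) auto
    then have "char_coeff (N M) n i \<noteq> 0" using that(2) by (rule lead_nonzero)
    then have "Fract (char_coeff (N M) n i) 1 \<noteq> 0" by (simp add: Zero_fract_def eq_fract)
    then show ?thesis
      unfolding char_coeff_scaled[OF carr mat_leadD(1)[OF N] NM i, OF singletonI singletonI] by auto
  qed
  show "char_coeff M n m \<noteq> 0" if dvd: "\<And>i. i < s \<Longrightarrow> ps ! i dvd m" and m: "1 \<le> m" "m \<le> n" for m
  proof (rule coeff[OF m(2)])
    have "x ^ m = 1" if "x ^ p = 1" "p dvd m" for x :: 'e and p
      using that by (metis dvdE power_mult power_one)
    then show "char_coeff (C M) n m \<noteq> 0"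
      using eigen_char_coeff[OF eig C _ m char, OF singletonI singletonI] root dvd by blast
  qed
  have "char_coeff (C M) n n \<noteq> 0"
    using eigen_det[OF eig C, OF singletonI singletonI] mat_leadD(2)[OF N, OF singletonI]
    by (auto simp: det_char_coeff[of _ n])
  then show "det M \<noteq> 0" using coeff[of n] carr by (simp add: det_char_coeff[of _ n])
qed

lemma equivariant_trace_prod:
  assumes Ms: "length Ms = m" "\<And>M. M \<in> set Ms \<Longrightarrow> equivariant M \<and> M \<noteq> 0\<^sub>m n n"
    and dets: "\<And>M M'. M \<in> set Ms \<Longrightarrow> M' \<in> set Ms \<Longrightarrow> det M = det M'"
    and m: "\<And>i. i < s \<Longrightarrow> ps ! i dvd m" "1 \<le> m"
  shows "mat_tr (foldr (*) Ms (1\<^sub>m n)) \<noteq> 0"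
proof -
  interpret F: inj_comm_ring_hom "\<lambda>p :: 'e mvpoly. Fract p 1" by (rule hom_Fract)
  obtain q \<omega> \<omega>' N \<alpha> C where data: "leading_data (set Ms) q \<omega> \<omega>' N \<alpha> C"
    using leading_terms[of "set Ms"] Ms by blast
  note root = leading_dataD(2)[OF data] and N = leading_dataD(3)[OF data] and C = leading_dataD(4)[OF data]
    and eig = leading_dataD(5)[OF data] and NM = leading_dataD(6)[OF data]
  note carr = equivariantD(1)[OF conjunct1[OF Ms(2)]]
  have \<alpha>_eq: "\<alpha> M = \<alpha> M'" if MM: "M \<in> set Ms" "M' \<in> set Ms" for M M'
  proof -
    have "char_coeff M n n = char_coeff M' n n"
      using dets[OF MM] carr[OF MM(1)] carr[OF MM(2)] by (simp add: det_char_coeff[of _ n])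
    then have "Fract (char_coeff (N M) n n) 1 = Fract (char_coeff (N M') n n) 1"
      unfolding char_coeff_scaled[OF carr[OF MM(1)] mat_leadD(1)[OF N[OF MM(1)]] NM[OF MM(1)] order_refl]
        char_coeff_scaled[OF carr[OF MM(2)] mat_leadD(1)[OF N[OF MM(2)]] NM[OF MM(2)] order_refl] by simp
    then have eq: "char_coeff (N M) n n = char_coeff (N M') n n" by (simp add: eq_fract)
    have lead: "lead (char_coeff (N M) n n) (of_nat n * \<alpha> M) (char_coeff (C M) n n)"
      "char_coeff (C M) n n \<noteq> 0" if "M \<in> set Ms" for M
    proof -
      show "lead (char_coeff (N M) n n) (of_nat n * \<alpha> M) (char_coeff (C M) n n)"
        by (rule lead_char_coeff[OF N[OF that] char order_refl])
      show "char_coeff (C M) n n \<noteq> 0"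
        using eigen_det[OF eig[OF that] C[OF that]] mat_leadD(2)[OF N[OF that]]
        by (auto simp: det_char_coeff[of _ n])
    qed
    \<comment> \<open>The determinants of the leading matrices are nonzero, so these are the true
      orders of two equal polynomials; exponents are naturals, so n can be cancelled.\<close>
    have "of_nat n * \<alpha> M = of_nat n * \<alpha> M'"
      by (rule lead_unique(1)[OF lead(1)[OF MM(1)] _ lead(2)[OF MM(1)] lead(2)[OF MM(2)]])
        (use lead(1)[OF MM(2)] in \<open>simp only: eq\<close>)
    then have "of_nat n * Poly_Mapping.lookup (\<alpha> M) i = of_nat n * Poly_Mapping.lookup (\<alpha> M') i" for i
      by (metis lookup_of_nat_mult)
    then show ?thesis using n_pos by (intro poly_mapping_eqI) simp
  qed
  obtain M0 where M0: "M0 \<in> set Ms" using Ms(1) m(2) by (cases Ms) auto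
  define \<beta> where "\<beta> = \<alpha> M0"
  have lead: "mat_lead n (foldr (*) (map N L) (1\<^sub>m n)) (of_nat (length L) * \<beta>) (foldr (*) (map C L) (1\<^sub>m n)) \<and>
      eigen (foldr (*) (map C L) (1\<^sub>m n)) (\<lambda>i. \<omega> \<beta> i ^ length L) (\<lambda>i. \<omega>' \<beta> i ^ length L) \<and>
      det (foldr (*) (map C L) (1\<^sub>m n)) \<noteq> 0 \<and>
      foldr (*) L (1\<^sub>m n) \<in> carrier_mat n n \<and>
      map_mat (\<lambda>p. Fract p 1) (foldr (*) (map N L) (1\<^sub>m n)) = Fract q 1 ^ length L \<cdot>\<^sub>m foldr (*) L (1\<^sub>m n)"
    if "set L \<subseteq> set Ms" for L
    using that
  proof (induction L)
    case Nil
    show ?case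
      using mat_lead_one eigen_one F.mat_hom_one smult_one_mat'[of "1\<^sub>m n :: 'e ratfun mat"] by auto
  next
    case (Cons M L)
    then have M: "M \<in> set Ms" by simp
    have \<alpha>M: "\<alpha> M = \<beta>" unfolding \<beta>_def by (rule \<alpha>_eq[OF M M0])
    let ?N = "foldr (*) (map N L) (1\<^sub>m n)" and ?C = "foldr (*) (map C L) (1\<^sub>m n)" and ?M = "foldr (*) L (1\<^sub>m n)"
    from Cons have IH: "mat_lead n ?N (of_nat (length L) * \<beta>) ?C"
      "eigen ?C (\<lambda>i. \<omega> \<beta> i ^ length L) (\<lambda>i. \<omega>' \<beta> i ^ length L)" "det ?C \<noteq> 0" "?M \<in> carrier_mat n n"
      "map_mat (\<lambda>p. Fract p 1) ?N = Fract q 1 ^ length L \<cdot>\<^sub>m ?M" by auto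
    have 1: "mat_lead n (N M * ?N) (of_nat (Suc (length L)) * \<beta>) (C M * ?C)"
      using mat_lead_mult[OF N[OF M] IH(1)] by (simp add: \<alpha>M distrib_right)
    have 2: "eigen (C M * ?C) (\<lambda>i. \<omega> \<beta> i ^ Suc (length L)) (\<lambda>i. \<omega>' \<beta> i ^ Suc (length L))"
      using eigen_mult[OF eig[OF M] IH(2)] by (simp add: \<alpha>M)
    have 3: "det (C M * ?C) \<noteq> 0"
      using det_mult[OF mat_leadD(2)[OF N[OF M]] mat_leadD(2)[OF IH(1)]] IH(3) eigen_det[OF eig[OF M] C[OF M]] by simp
    have "map_mat (\<lambda>p. Fract p 1) (N M * ?N) = map_mat (\<lambda>p. Fract p 1) (N M) * map_mat (\<lambda>p. Fract p 1) ?N"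
      by (rule F.mat_hom_mult[OF mat_leadD(1)[OF N[OF M]] mat_leadD(1)[OF IH(1)]])
    also have "\<dots> = Fract q 1 \<cdot>\<^sub>m (M * (Fract q 1 ^ length L \<cdot>\<^sub>m ?M))"
      unfolding NM[OF M] IH(5) by (rule mult_smult_assoc_mat[OF carr[OF M] smult_carrier_mat[OF IH(4)]])
    also have "M * (Fract q 1 ^ length L \<cdot>\<^sub>m ?M) = Fract q 1 ^ length L \<cdot>\<^sub>m (M * ?M)"
      by (rule mult_smult_distrib[OF carr[OF M] IH(4)])
    also have "Fract q 1 \<cdot>\<^sub>m (Fract q 1 ^ length L \<cdot>\<^sub>m (M * ?M)) = Fract q 1 ^ Suc (length L) \<cdot>\<^sub>m (M * ?M)"
      by (intro eq_matI) (auto simp: mult.assoc)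
    finally show ?case
      using 1 2 3 mult_carrier_square[OF carr[OF M] IH(4)] by simp
  qed
  note L = lead[of Ms, unfolded Ms(1), OF order_refl]
  note L1 = L[THEN conjunct1] and L2 = L[THEN conjunct2, THEN conjunct1]
    and L3 = L[THEN conjunct2, THEN conjunct2, THEN conjunct1]
    and L4 = L[THEN conjunct2, THEN conjunct2, THEN conjunct2, THEN conjunct1]
    and L5 = L[THEN conjunct2, THEN conjunct2, THEN conjunct2, THEN conjunct2]
  let ?N = "foldr (*) (map N Ms) (1\<^sub>m n)" and ?C = "foldr (*) (map C Ms) (1\<^sub>m n)" and ?M = "foldr (*) Ms (1\<^sub>m n)"
  have "x ^ m = 1" if "x ^ p = 1" "p dvd m" for x :: 'e and p
    using that by (metis dvdE power_mult power_one)
  \<comment> \<open>All m factors have the same eigenvalues, so the product has their m-th powers,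
    which are 1; it commutes with every clock and shift.\<close>
  then have "\<exists>t. ?C = t \<cdot>\<^sub>m 1\<^sub>m n"
    using eigen_scalar[OF L2] root m(1) by blast
  then obtain t where t: "?C = t \<cdot>\<^sub>m 1\<^sub>m n" by blast
  have "t \<noteq> 0" using L3 unfolding t using n_pos by (auto simp: power_0_left)
  then have "mat_tr ?C \<noteq> 0" unfolding t mat_tr_scalar using char[of n] n_pos by simp
  then have "mat_tr ?N \<noteq> 0" using lead_nonzero[OF lead_tr[OF L1]] by blast
  then have "Fract (mat_tr ?N) 1 \<noteq> 0" using F.hom_0 by blast
  moreover have "Fract (mat_tr ?N) 1 = Fract q 1 ^ m * mat_tr ?M"
  proof -
    have "Fract (mat_tr ?N) 1 = mat_tr (map_mat (\<lambda>p. Fract p 1) ?N)"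
      by (rule F.mat_tr_hom[OF mat_leadD(1)[OF L1], symmetric])
    also have "\<dots> = Fract q 1 ^ m * mat_tr ?M"
      unfolding L5 by (rule mat_tr_smult[OF L4])
    finally show ?thesis .
  qed
  ultimately show ?thesis by auto
qed

end

section \<open>Division algebras of matrices\<close>

definition mat_unit :: "nat \<Rightarrow> nat \<Rightarrow> nat \<Rightarrow> 'a::zero_neq_one mat" where
  "mat_unit n a b = mat n n (\<lambda>(i, j). if i = a \<and> j = b then 1 else 0)"

lemma mat_unit_carrier [simp]: "mat_unit n a b \<in> carrier_mat n n"
  by (simp add: mat_unit_def)

lemma mat_minus_entry:
  assumes "M \<in> carrier_mat n n" "N \<in> carrier_mat n n" "a < n" "b < n"
  shows "(M - N) $$ (a, b) = M $$ (a, b) - N $$ (a, b)"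
  using assms by simp

lemma mat_unit_mult_entry:
  fixes M :: "'a::comm_ring_1 mat"
  assumes "M \<in> carrier_mat n n" "i < n" "j < n" "b < n"
  shows "(mat_unit n a b * M) $$ (i, j) = (if i = a then M $$ (b, j) else 0)"
proof -
  have "(mat_unit n a b * M) $$ (i, j) = (\<Sum>k<n. (if k = b then if i = a then M $$ (b, j) else 0 else 0))"
    by (subst mat_mult_entry[OF mat_unit_carrier assms(1-3)], rule sum.cong)
      (use assms in \<open>auto simp: mat_unit_def\<close>)
  then show ?thesis using assms by simp
qed

lemma mult_mat_unit_entry:
  fixes M :: "'a::comm_ring_1 mat"
  assumes "M \<in> carrier_mat n n" "i < n" "j < n" "a < n"
  shows "(M * mat_unit n a b) $$ (i, j) = (if j = b then M $$ (i, a) else 0)"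
proof -
  have "(M * mat_unit n a b) $$ (i, j) = (\<Sum>k<n. (if k = a then if j = b then M $$ (i, a) else 0 else 0))"
    by (subst mat_mult_entry[OF assms(1) mat_unit_carrier assms(2,3)], rule sum.cong)
      (use assms in \<open>auto simp: mat_unit_def\<close>)
  then show ?thesis using assms by simp
qed

lemma mat_unit_mult:
  assumes "a < n" "b < n" "c < n" "d < n"
  shows "mat_unit n a b * mat_unit n c d = (if b = c then mat_unit n a d else 0\<^sub>m n n :: 'a::comm_ring_1 mat)"
proof (rule eq_matI)
  fix i j assume "i < dim_row (if b = c then mat_unit n a d else 0\<^sub>m n n :: 'a mat)"
    "j < dim_col (if b = c then mat_unit n a d else 0\<^sub>m n n :: 'a mat)"
  then have ij: "i < n" "j < n" by (auto simp: mat_unit_def split: if_splits)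
  show "(mat_unit n a b * mat_unit n c d) $$ (i, j) = (if b = c then mat_unit n a d else 0\<^sub>m n n :: 'a mat) $$ (i, j)"
    unfolding mat_unit_mult_entry[OF mat_unit_carrier ij assms(2)] using assms ij by (auto simp: mat_unit_def)
qed (use assms in \<open>auto simp: mat_unit_def\<close>)

lemma commutes_all_scalar:
  fixes M :: "'a::comm_ring_1 mat"
  assumes M: "M \<in> carrier_mat n n" and n: "0 < n"
    and comm: "\<And>N. N \<in> carrier_mat n n \<Longrightarrow> M * N = N * M"
  shows "M = M $$ (0, 0) \<cdot>\<^sub>m 1\<^sub>m n"
proof -
  have eq: "M $$ (i, a) = (if i = a then M $$ (b, b) else 0)" if "i < n" "a < n" "b < n" for i a b
  proof -
    have "(M * mat_unit n a b) $$ (i, b) = (mat_unit n a b * M) $$ (i, b)"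
      by (simp only: comm[OF mat_unit_carrier])
    then show ?thesis
      unfolding mult_mat_unit_entry[OF M that(1,3,2)] mat_unit_mult_entry[OF M that(1,3,3)] by simp
  qed
  show ?thesis
  proof (rule eq_matI)
    fix i j assume "i < dim_row (M $$ (0, 0) \<cdot>\<^sub>m 1\<^sub>m n)" "j < dim_col (M $$ (0, 0) \<cdot>\<^sub>m 1\<^sub>m n)"
    then show "M $$ (i, j) = (M $$ (0, 0) \<cdot>\<^sub>m 1\<^sub>m n) $$ (i, j)"
      using eq[of i j 0] n by auto
  qed (use M in auto)
qed

lemma mat_unit_generate:
  fixes V :: "'a::comm_ring_1 mat set"
  assumes unit: "\<And>a b. a < n \<Longrightarrow> b < n \<Longrightarrow> mat_unit n a b \<in> V"
    and add: "\<And>M N. M \<in> V \<Longrightarrow> N \<in> V \<Longrightarrow> M + N \<in> V"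
    and smult: "\<And>M c. M \<in> V \<Longrightarrow> c \<cdot>\<^sub>m M \<in> V" and zero: "0\<^sub>m n n \<in> V"
    and M: "M \<in> carrier_mat n n"
  shows "M \<in> V"
proof -
  have part: "mat n n (\<lambda>x. if x \<in> S then M $$ x else 0) \<in> V" if "finite S" "S \<subseteq> {..<n} \<times> {..<n}" for S
    using that
  proof induction
    case empty
    have "mat n n (\<lambda>x. if x \<in> {} then M $$ x else 0) = 0\<^sub>m n n" by (intro eq_matI) auto
    then show ?case using zero by simp
  next
    case (insert x S)
    obtain a b where x: "x = (a, b)" by (cases x)
    have "mat n n (\<lambda>y. if y \<in> insert x S then M $$ y else 0) =
        mat n n (\<lambda>y. if y \<in> S then M $$ y else 0) + M $$ (a, b) \<cdot>\<^sub>m mat_unit n a b"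
      using insert.hyps(2) by (intro eq_matI) (auto simp: x mat_unit_def)
    then show ?case using insert x by (auto intro!: add smult unit)
  qed
  have "M = mat n n (\<lambda>x. if x \<in> {..<n} \<times> {..<n} then M $$ x else 0)"
    using M by (intro eq_matI) auto
  then show ?thesis using part[of "{..<n} \<times> {..<n}"] by simp
qed

text \<open>The span over the ambient field, even when T is an algebra over a smaller center. Adding
  one multiple at a time gives an induction principle and makes repetitions of elements
  harmless.\<close>

inductive_set lspan :: "nat \<Rightarrow> 'a::comm_ring_1 mat set \<Rightarrow> 'a mat set" for n T where
  lspan_zero: "0\<^sub>m n n \<in> lspan n T"
| lspan_step: "M \<in> lspan n T \<Longrightarrow> x \<in> T \<Longrightarrow> M + c \<cdot>\<^sub>m x \<in> lspan n T"

lemma lspan_carrier: "M \<in> lspan n T \<Longrightarrow> T \<subseteq> carrier_mat n n \<Longrightarrow> M \<in> carrier_mat n n"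
  by (induction rule: lspan.induct) auto

lemma lspan_add:
  assumes "N \<in> lspan n T" "T \<subseteq> carrier_mat n n" "M \<in> lspan n T"
  shows "M + N \<in> lspan n T"
  using assms
proof (induction rule: lspan.induct)
  case lspan_zero
  then show ?case using lspan_carrier[OF lspan_zero(2,1)] by simp
next
  case (lspan_step N x c)
  have "M + (N + c \<cdot>\<^sub>m x) = (M + N) + c \<cdot>\<^sub>m x"
    using lspan_carrier[OF lspan_step.prems(2,1)] lspan_carrier[OF lspan_step.hyps(1) lspan_step.prems(1)]
      lspan_step.hyps(2) lspan_step.prems(1) by (intro eq_matI) (auto simp: add.assoc)
  then show ?case using lspan.lspan_step[OF lspan_step.IH[OF lspan_step.prems] lspan_step.hyps(2)] by simp
qed

lemma lspan_smult:
  assumes "M \<in> lspan n T" "T \<subseteq> carrier_mat n n"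
  shows "c \<cdot>\<^sub>m M \<in> lspan n T"
  using assms
proof (induction rule: lspan.induct)
  case lspan_zero
  have "c \<cdot>\<^sub>m 0\<^sub>m n n = (0\<^sub>m n n :: 'a mat)" by (intro eq_matI) auto
  then show ?case by (simp add: lspan.lspan_zero)
next
  case (lspan_step M x d)
  have "c \<cdot>\<^sub>m (M + d \<cdot>\<^sub>m x) = c \<cdot>\<^sub>m M + (c * d) \<cdot>\<^sub>m x"
    using lspan_carrier[OF lspan_step.hyps(1) lspan_step.prems] lspan_step.hyps(2) lspan_step.prems
    by (intro eq_matI) (auto simp: distrib_left mult.assoc)
  then show ?case using lspan.lspan_step[OF lspan_step.IH[OF lspan_step.prems] lspan_step.hyps(2)] by simp
qed

lemma lspan_base: "x \<in> T \<Longrightarrow> T \<subseteq> carrier_mat n n \<Longrightarrow> x \<in> lspan n T"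
  using lspan_step[OF lspan_zero, of x T n 1] by (simp add: smult_one_mat' subset_iff)

lemma lspan_induct_closed:
  assumes "M \<in> lspan n T" "T \<subseteq> V" "0\<^sub>m n n \<in> V"
    and "\<And>M N. M \<in> V \<Longrightarrow> N \<in> V \<Longrightarrow> M + N \<in> V" "\<And>c M. M \<in> V \<Longrightarrow> c \<cdot>\<^sub>m M \<in> V"
  shows "M \<in> V"
  using assms(1) by (induction rule: lspan.induct) (use assms(2-) in auto)

definition lincomb :: "nat \<Rightarrow> nat \<Rightarrow> (nat \<Rightarrow> 'a::comm_ring_1) \<Rightarrow> (nat \<Rightarrow> 'a mat) \<Rightarrow> 'a mat" where
  "lincomb n r e d = mat n n (\<lambda>x. \<Sum>k<r. e k * d k $$ x)"

lemma lincomb_carrier [simp]: "lincomb n r e d \<in> carrier_mat n n"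
  by (simp add: lincomb_def)

lemma lincomb_entry: "i < n \<Longrightarrow> j < n \<Longrightarrow> lincomb n r e d $$ (i, j) = (\<Sum>k<r. e k * d k $$ (i, j))"
  by (simp add: lincomb_def)

lemma lincomb_Suc:
  "d r \<in> carrier_mat n n \<Longrightarrow> lincomb n (Suc r) e d = lincomb n r e d + e r \<cdot>\<^sub>m d r"
  by (intro eq_matI) (auto simp: lincomb_def)

lemma lincomb_mult:
  assumes "\<And>k. k < r \<Longrightarrow> d k \<in> carrier_mat n n" "M \<in> carrier_mat n n"
  shows "lincomb n r e d * M = lincomb n r e (\<lambda>k. d k * M)"
proof (rule eq_matI)
  fix i j assume "i < dim_row (lincomb n r e (\<lambda>k. d k * M))" "j < dim_col (lincomb n r e (\<lambda>k. d k * M))"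
  then have ij: "i < n" "j < n" by (auto simp: lincomb_def)
  have "(lincomb n r e d * M) $$ (i, j) = (\<Sum>l<n. \<Sum>k<r. e k * (d k $$ (i, l) * M $$ (l, j)))"
    using assms(2) ij by (simp add: lincomb_def scalar_prod_def atLeast0LessThan sum_distrib_right mult.assoc)
  also have "\<dots> = (\<Sum>k<r. \<Sum>l<n. e k * (d k $$ (i, l) * M $$ (l, j)))"
    by (rule sum.swap)
  also have "\<dots> = (\<Sum>k<r. e k * (d k * M) $$ (i, j))"
    by (intro sum.cong refl) (simp only: sum_distrib_left[symmetric] mat_mult_entry[OF assms(1) assms(2) ij] lessThan_iff)
  finally show "(lincomb n r e d * M) $$ (i, j) = lincomb n r e (\<lambda>k. d k * M) $$ (i, j)"
    using ij by (simp add: lincomb_def)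
qed (use assms(2) in \<open>auto simp: lincomb_def\<close>)

lemma mult_lincomb:
  assumes "\<And>k. k < r \<Longrightarrow> d k \<in> carrier_mat n n" "M \<in> carrier_mat n n"
  shows "M * lincomb n r e d = lincomb n r e (\<lambda>k. M * d k)"
proof (rule eq_matI)
  fix i j assume "i < dim_row (lincomb n r e (\<lambda>k. M * d k))" "j < dim_col (lincomb n r e (\<lambda>k. M * d k))"
  then have ij: "i < n" "j < n" by (auto simp: lincomb_def)
  have "(M * lincomb n r e d) $$ (i, j) = (\<Sum>l<n. \<Sum>k<r. e k * (M $$ (i, l) * d k $$ (l, j)))"
    using assms(2) ij by (simp add: lincomb_def scalar_prod_def atLeast0LessThan sum_distrib_left mult.left_commute)
  also have "\<dots> = (\<Sum>k<r. \<Sum>l<n. e k * (M $$ (i, l) * d k $$ (l, j)))"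
    by (rule sum.swap)
  also have "\<dots> = (\<Sum>k<r. e k * (M * d k) $$ (i, j))"
    by (intro sum.cong refl) (simp only: sum_distrib_left[symmetric] mat_mult_entry[OF assms(2) assms(1) ij] lessThan_iff)
  finally show "(M * lincomb n r e d) $$ (i, j) = lincomb n r e (\<lambda>k. M * d k) $$ (i, j)"
    using ij by (simp add: lincomb_def)
qed (use assms(2) in \<open>auto simp: lincomb_def\<close>)

lemma lspan_lincomb:
  assumes "M \<in> lspan n T" "T \<subseteq> carrier_mat n n"
  shows "\<exists>r e d. (\<forall>k<r. d k \<in> T) \<and> M = lincomb n r e d"
  using assms
proof (induction rule: lspan.induct)
  case lspan_zero
  have "0\<^sub>m n n = lincomb n 0 e d" for e :: "nat \<Rightarrow> 'a" and d by (intro eq_matI) (auto simp: lincomb_def)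
  then show ?case by (intro exI[of _ 0]) auto
next
  case (lspan_step M x c)
  then obtain r e d where M: "\<forall>k<r. d k \<in> T" "M = lincomb n r e d" by blast
  have "lincomb n r (e(r := c)) (d(r := x)) = lincomb n r e d"
    unfolding lincomb_def by (intro cong_mat) auto
  moreover have "x \<in> carrier_mat n n" using lspan_step by blast
  ultimately have "M + c \<cdot>\<^sub>m x = lincomb n (Suc r) (e(r := c)) (d(r := x))"
    using lincomb_Suc[of "d(r := x)" r n "e(r := c)"] M(2) by simp
  moreover have "\<forall>k<Suc r. (d(r := x)) k \<in> T" using M(1) lspan_step.hyps(2) by (simp add: less_Suc_eq)
  ultimately show ?case by blast
qed

text \<open>A division ring of matrices that spans the full matrix ring over the ambient field, that
  is, a central division algebra of degree n presented inside one of its splittings. That n is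
  nonzero in the field makes the identity complement the commutators.\<close>

locale division_matrices =
  fixes A :: "'a::field mat set" and n :: nat
  assumes n_pos: "0 < n" and char_n: "of_nat n \<noteq> (0 :: 'a)"
    and carr: "A \<subseteq> carrier_mat n n" and one: "1\<^sub>m n \<in> A"
    and add: "\<And>M N. M \<in> A \<Longrightarrow> N \<in> A \<Longrightarrow> M + N \<in> A"
    and mult: "\<And>M N. M \<in> A \<Longrightarrow> N \<in> A \<Longrightarrow> M * N \<in> A"
    and uminus: "\<And>M. M \<in> A \<Longrightarrow> - M \<in> A"
    and inv: "\<And>M. M \<in> A \<Longrightarrow> M \<noteq> 0\<^sub>m n n \<Longrightarrow> \<exists>N\<in>A. M * N = 1\<^sub>m n \<and> N * M = 1\<^sub>m n"
    and span: "carrier_mat n n \<subseteq> lspan n A"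
begin

text \<open>The center, read as a subfield of the ambient field; \<open>commutes_scalar\<close>
  shows that no central element is missed.\<close>

definition scal :: "'a set" where "scal = {c. c \<cdot>\<^sub>m 1\<^sub>m n \<in> A}"

lemma carrD: "M \<in> A \<Longrightarrow> M \<in> carrier_mat n n"
  using carr by blast

lemma diff: "M \<in> A \<Longrightarrow> N \<in> A \<Longrightarrow> M - N \<in> A"
proof -
  assume MN: "M \<in> A" "N \<in> A"
  have "M - N = M + - N" using carrD[OF MN(1)] carrD[OF MN(2)] by (intro eq_matI) auto
  then show ?thesis using add[OF MN(1) uminus[OF MN(2)]] by simp
qed

lemma zero: "0\<^sub>m n n \<in> A"
proof -
  have eq: "1\<^sub>m n - 1\<^sub>m n = (0\<^sub>m n n :: 'a mat)" by (intro eq_matI) auto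
  show ?thesis using diff[OF one one] unfolding eq .
qed

lemma scal_smult: "c \<in> scal \<Longrightarrow> M \<in> A \<Longrightarrow> c \<cdot>\<^sub>m M \<in> A"
proof -
  assume c: "c \<in> scal" and M: "M \<in> A"
  have "(c \<cdot>\<^sub>m 1\<^sub>m n) * M = c \<cdot>\<^sub>m M"
    unfolding mult_smult_assoc_mat[OF one_carrier_mat carrD[OF M]] left_mult_one_mat[OF carrD[OF M]] ..
  then show ?thesis using mult[OF _ M, of "c \<cdot>\<^sub>m 1\<^sub>m n"] c by (simp add: scal_def)
qed

lemma scal_0: "0 \<in> scal"
proof -
  have "0 \<cdot>\<^sub>m 1\<^sub>m n = (0\<^sub>m n n :: 'a mat)" by (intro eq_matI) auto
  then show ?thesis using zero by (simp add: scal_def)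
qed

lemma scal_1: "1 \<in> scal"
  using one by (simp add: scal_def smult_one_mat')

lemma scal_add: "c \<in> scal \<Longrightarrow> d \<in> scal \<Longrightarrow> c + d \<in> scal"
  using add[of "c \<cdot>\<^sub>m 1\<^sub>m n" "d \<cdot>\<^sub>m 1\<^sub>m n"] by (simp add: scal_def add_smult_distrib_right_mat[of _ n n])

lemma scal_uminus: "c \<in> scal \<Longrightarrow> - c \<in> scal"
proof -
  have "- (c \<cdot>\<^sub>m 1\<^sub>m n) = (- c) \<cdot>\<^sub>m (1\<^sub>m n :: 'a mat)" by (intro eq_matI) auto
  then show "c \<in> scal \<Longrightarrow> - c \<in> scal" using uminus[of "c \<cdot>\<^sub>m 1\<^sub>m n"] by (simp add: scal_def)
qed

lemma scal_mult: "c \<in> scal \<Longrightarrow> d \<in> scal \<Longrightarrow> c * d \<in> scal"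
proof -
  have eq: "c \<cdot>\<^sub>m (d \<cdot>\<^sub>m 1\<^sub>m n) = (c * d) \<cdot>\<^sub>m (1\<^sub>m n :: 'a mat)" by (intro eq_matI) auto
  show "c \<in> scal \<Longrightarrow> d \<in> scal \<Longrightarrow> c * d \<in> scal"
    using scal_smult[of c "d \<cdot>\<^sub>m 1\<^sub>m n"] unfolding eq by (simp add: scal_def)
qed

lemma scal_inverse: "c \<in> scal \<Longrightarrow> inverse c \<in> scal"
proof (cases "c = 0")
  case False
  assume c: "c \<in> scal"
  have "c \<cdot>\<^sub>m 1\<^sub>m n \<noteq> (0\<^sub>m n n :: 'a mat)"
  proof
    assume "c \<cdot>\<^sub>m 1\<^sub>m n = (0\<^sub>m n n :: 'a mat)"
    then have "(c \<cdot>\<^sub>m 1\<^sub>m n) $$ (0, 0) = (0\<^sub>m n n :: 'a mat) $$ (0, 0)" by (simp only:)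
    then show False using False n_pos by simp
  qed
  then obtain N where N: "N \<in> A" "(c \<cdot>\<^sub>m 1\<^sub>m n) * N = 1\<^sub>m n" using inv c by (auto simp: scal_def)
  then have "c \<cdot>\<^sub>m N = 1\<^sub>m n"
    unfolding mult_smult_assoc_mat[OF one_carrier_mat carrD[OF N(1)]] left_mult_one_mat[OF carrD[OF N(1)]] by simp
  then have "inverse c \<cdot>\<^sub>m 1\<^sub>m n = inverse c \<cdot>\<^sub>m (c \<cdot>\<^sub>m N)" by simp
  also have "\<dots> = N" using False by (intro eq_matI) auto
  finally show "inverse c \<in> scal" using N(1) by (simp add: scal_def)
qed simp

lemma lincomb_mem: "(\<And>k. k < r \<Longrightarrow> e k \<in> scal) \<Longrightarrow> (\<And>k. k < r \<Longrightarrow> d k \<in> A) \<Longrightarrow> lincomb n r e d \<in> A"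
proof (induction r)
  case 0
  have "lincomb n 0 e d = 0\<^sub>m n n" by (intro eq_matI) (auto simp: lincomb_def)
  then show ?case using zero by simp
next
  case (Suc r)
  then show ?case using lincomb_Suc[of d r n e] carrD[of "d r"] add scal_smult by simp
qed

text \<open>Commuting with M is a linear condition, so M commutes with the span of A, which is the
  whole matrix ring.\<close>

lemma commutes_scalar:
  assumes M: "M \<in> A" and comm: "\<And>N. N \<in> A \<Longrightarrow> M * N = N * M"
  shows "\<exists>c\<in>scal. M = c \<cdot>\<^sub>m 1\<^sub>m n"
proof -
  note Mc = carrD[OF M]
  have all: "N \<in> {N \<in> carrier_mat n n. M * N = N * M}" if "N \<in> lspan n A" for N
  proof (rule lspan_induct_closed[OF that])
    show "A \<subseteq> {N \<in> carrier_mat n n. M * N = N * M}" using comm carr by blast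
  qed (use Mc in \<open>auto simp: mult_add_distrib_mat[OF Mc] add_mult_distrib_mat[OF _ _ Mc]
        mult_smult_distrib[OF Mc] mult_smult_assoc_mat[OF _ Mc]\<close>)
  have "M = M $$ (0, 0) \<cdot>\<^sub>m 1\<^sub>m n"
    by (rule commutes_all_scalar[OF Mc n_pos]) (use all span in blast)
  then show ?thesis using M by (intro bexI[of _ "M $$ (0, 0)"]) (simp_all add: scal_def)
qed

definition scal_independent :: "nat \<Rightarrow> (nat \<Rightarrow> 'a) \<Rightarrow> bool" where
  "scal_independent t \<epsilon> \<longleftrightarrow> (\<forall>f. (\<forall>k<t. f k \<in> scal) \<longrightarrow> (\<Sum>k<t. f k * \<epsilon> k) = 0 \<longrightarrow> (\<forall>k<t. f k = 0))"

text \<open>Scalars that are independent over the center stay independent over the whole algebra: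
  a shortest relation can be normalized to have a coefficient 1, and then commutators with it
  are shorter.\<close>

lemma independent_lincomb:
  assumes "scal_independent r \<epsilon>" "\<And>k. k < r \<Longrightarrow> d k \<in> A" "lincomb n r \<epsilon> d = 0\<^sub>m n n"
  shows "\<forall>k<r. d k = 0\<^sub>m n n"
  using assms
proof (induction r arbitrary: d)
  case (Suc r)
  have ind: "scal_independent r \<epsilon>"
    unfolding scal_independent_def
  proof (intro allI impI)
    fix f k assume f: "\<forall>k<r. f k \<in> scal" "(\<Sum>k<r. f k * \<epsilon> k) = 0" and k: "k < r"
    have "\<forall>k<Suc r. (f(r := 0)) k \<in> scal" using f(1) scal_0 by (simp add: less_Suc_eq)
    moreover have "(\<Sum>k<Suc r. (f(r := 0)) k * \<epsilon> k) = 0" using f(2) by simp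
    ultimately have "\<forall>k<Suc r. (f(r := 0)) k = 0"
      using Suc.prems(1) unfolding scal_independent_def by blast
    then have "(f(r := 0)) k = 0" using less_SucI[OF k] by blast
    then show "f k = 0" using k by simp
  qed
  note dr = Suc.prems(2)[of r, OF lessI]
  show ?case
  proof (cases "d r = 0\<^sub>m n n")
    case True
    have "lincomb n r \<epsilon> d = lincomb n (Suc r) \<epsilon> d"
      by (intro eq_matI) (auto simp: lincomb_def True)
    then have "\<forall>k<r. d k = 0\<^sub>m n n" using Suc.IH[OF ind] Suc.prems(2,3) by simp
    then show ?thesis using True by (simp add: less_Suc_eq)
  next
    case False
    obtain g where g: "g \<in> A" "d r * g = 1\<^sub>m n" using inv[OF dr False] by blast
    define d' where "d' k = d k * g" for k
    have d': "d' k \<in> A" if "k < Suc r" for k using Suc.prems(2)[OF that] g(1) mult by (simp add: d'_def)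
    have d'c: "d' k \<in> carrier_mat n n" if "k < Suc r" for k using d'[OF that] carrD by blast
    have zero': "lincomb n (Suc r) \<epsilon> d' = 0\<^sub>m n n"
    proof -
      have "lincomb n (Suc r) \<epsilon> d' = lincomb n (Suc r) \<epsilon> d * g"
        unfolding d'_def by (rule lincomb_mult[symmetric]) (use Suc.prems(2) g(1) carrD in auto)
      then show ?thesis unfolding Suc.prems(3) using carrD[OF g(1)] by simp
    qed
    have comm: "d' k * y = y * d' k" if k: "k < r" and y: "y \<in> A" for k y
    proof -
      have cc: "d' k * y - y * d' k \<in> A" if "k < r" for k
        using that d' y mult diff by simp
      have "(lincomb n (Suc r) \<epsilon> d' * y) $$ x = (y * lincomb n (Suc r) \<epsilon> d') $$ x" for x
        unfolding zero' using carrD[OF y] by simp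
      then have eq: "lincomb n (Suc r) \<epsilon> (\<lambda>k. d' k * y) $$ x = lincomb n (Suc r) \<epsilon> (\<lambda>k. y * d' k) $$ x" for x
        by (simp only: lincomb_mult[OF d'c carrD[OF y]] mult_lincomb[OF d'c carrD[OF y]])
      have "d' r = 1\<^sub>m n" using g(2) by (simp add: d'_def)
      then have r: "d' r * y = y * d' r" using carrD[OF y] by simp
      have "lincomb n r \<epsilon> (\<lambda>k. d' k * y - y * d' k) = 0\<^sub>m n n"
      proof (rule eq_matI)
        fix i j assume "i < dim_row (0\<^sub>m n n :: 'a mat)" "j < dim_col (0\<^sub>m n n :: 'a mat)"
        then have ij: "i < n" "j < n" by auto
        have "(\<Sum>k<r. \<epsilon> k * (d' k * y) $$ (i, j)) = (\<Sum>k<r. \<epsilon> k * (y * d' k) $$ (i, j))"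
          using eq[of "(i, j)"] unfolding lincomb_entry[OF ij] by (simp add: r del: index_mult_mat(1))
        moreover have "(\<Sum>k<r. \<epsilon> k * (d' k * y - y * d' k) $$ (i, j)) =
          (\<Sum>k<r. \<epsilon> k * (d' k * y) $$ (i, j)) - (\<Sum>k<r. \<epsilon> k * (y * d' k) $$ (i, j))"
          unfolding sum_subtractf[symmetric]
        proof (intro sum.cong refl)
          fix k assume "k \<in> {..<r}"
          then have "d' k * y \<in> carrier_mat n n" "y * d' k \<in> carrier_mat n n"
            using d'c[of k] carrD[OF y] by auto
          then have "(d' k * y - y * d' k) $$ (i, j) = (d' k * y) $$ (i, j) - (y * d' k) $$ (i, j)"
            by (rule mat_minus_entry[OF _ _ ij])
          then show "\<epsilon> k * (d' k * y - y * d' k) $$ (i, j) = \<epsilon> k * (d' k * y) $$ (i, j) - \<epsilon> k * (y * d' k) $$ (i, j)"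
            by (simp only: right_diff_distrib)
        qed
        ultimately show "lincomb n r \<epsilon> (\<lambda>k. d' k * y - y * d' k) $$ (i, j) = 0\<^sub>m n n $$ (i, j)"
          unfolding lincomb_entry[OF ij] using ij by (simp del: index_mult_mat(1))
      qed (auto simp: lincomb_def)
      then have "d' k * y - y * d' k = 0\<^sub>m n n"
        using Suc.IH[OF ind, of "\<lambda>k. d' k * y - y * d' k"] cc k by blast
      then have zero_entry: "(d' k * y - y * d' k) $$ (i, j) = 0\<^sub>m n n $$ (i, j)" for i j by (simp only:)
      have dk: "d' k * y \<in> carrier_mat n n" "y * d' k \<in> carrier_mat n n"
        using d'c[OF less_SucI[OF k]] carrD[OF y] by auto
      show ?thesis
      proof (rule eq_matI)
        fix i j assume "i < dim_row (y * d' k)" "j < dim_col (y * d' k)"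
        then have ij: "i < n" "j < n" using dk(2) by auto
        show "(d' k * y) $$ (i, j) = (y * d' k) $$ (i, j)"
          using zero_entry[of i j] ij by (simp add: mat_minus_entry[OF dk ij] del: index_mult_mat(1))
      qed (use d'c[OF less_SucI[OF k]] carrD[OF y] in auto)
    qed
    have "\<forall>k<r. \<exists>c\<in>scal. d' k = c \<cdot>\<^sub>m 1\<^sub>m n"
      using commutes_scalar[OF d'] comm by simp
    then obtain f where f: "\<And>k. k < r \<Longrightarrow> f k \<in> scal \<and> d' k = f k \<cdot>\<^sub>m 1\<^sub>m n" by metis
    have "d' r = 1\<^sub>m n" using g(2) by (simp add: d'_def)
    moreover have "lincomb n (Suc r) \<epsilon> d' $$ (0, 0) = 0" using zero' n_pos by simp
    ultimately have "(\<Sum>k<r. \<epsilon> k * f k) + \<epsilon> r = 0"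
      using n_pos f by (simp add: lincomb_def)
    then have "(\<Sum>k<Suc r. (f(r := 1)) k * \<epsilon> k) = 0" by (simp add: mult.commute)
    moreover have "\<forall>k<Suc r. (f(r := 1)) k \<in> scal" using f scal_1 by (simp add: less_Suc_eq)
    ultimately have "(f(r := 1)) r = 0" using Suc.prems(1) unfolding scal_independent_def by blast
    then show ?thesis by simp
  qed
qed simp

text \<open>The values e j are expanded over a family independent over the center and starting with
  1, so that the coordinate along 1 is meaningful. A new value is adjoined only if it is not yet in
  the span.\<close>

lemma exists_independent:
  fixes r :: nat
  shows "\<exists>t \<epsilon> c. 0 < t \<and> \<epsilon> 0 = 1 \<and> scal_independent t \<epsilon> \<and>
     (\<forall>j<r. (\<forall>k<t. c j k \<in> scal) \<and> e j = (\<Sum>k<t. c j k * \<epsilon> k))"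
proof (induction r)
  case 0
  have "scal_independent 1 (\<lambda>_. 1)" by (simp add: scal_independent_def)
  then show ?case by (intro exI[of _ 1] exI[of _ "\<lambda>_. 1"]) auto
next
  case (Suc r)
  then obtain t \<epsilon> c where t: "0 < t" "\<epsilon> 0 = 1" and ind: "scal_independent t \<epsilon>"
    and c: "\<And>j k. j < r \<Longrightarrow> k < t \<Longrightarrow> c j k \<in> scal" "\<And>j. j < r \<Longrightarrow> e j = (\<Sum>k<t. c j k * \<epsilon> k)" by blast
  show ?case
  proof (cases "\<exists>f. (\<forall>k<t. f k \<in> scal) \<and> e r = (\<Sum>k<t. f k * \<epsilon> k)")
    case True
    then obtain f where f: "\<forall>k<t. f k \<in> scal" "e r = (\<Sum>k<t. f k * \<epsilon> k)" by blast
    have "\<forall>j<Suc r. (\<forall>k<t. (c(r := f)) j k \<in> scal) \<and> e j = (\<Sum>k<t. (c(r := f)) j k * \<epsilon> k)"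
      using f c by (simp add: less_Suc_eq)
    then show ?thesis
      using t ind by (intro exI[of _ t] exI[of _ \<epsilon>] exI[of _ "c(r := f)"] conjI)
  next
    case False
    define \<epsilon>' where "\<epsilon>' = \<epsilon>(t := e r)"
    define c' where "c' j = (if j = r then (\<lambda>k. if k = t then 1 else 0) else (c j)(t := 0))" for j
    have "scal_independent (Suc t) \<epsilon>'"
      unfolding scal_independent_def
    proof (intro allI impI)
      fix f k assume f: "\<forall>k<Suc t. f k \<in> scal" "(\<Sum>k<Suc t. f k * \<epsilon>' k) = 0" and k: "k < Suc t"
      have sum: "(\<Sum>k<t. f k * \<epsilon> k) + f t * e r = 0" using f(2) by (simp add: \<epsilon>'_def)
      have ft: "f t = 0"
      proof (rule ccontr)
        assume "f t \<noteq> 0"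
        have "f t * e r = - (\<Sum>k<t. f k * \<epsilon> k)"
          using sum by (simp add: eq_neg_iff_add_eq_0 add.commute)
        then have "inverse (f t) * (f t * e r) = inverse (f t) * - (\<Sum>k<t. f k * \<epsilon> k)" by (simp only:)
        moreover have "inverse (f t) * (f t * e r) = e r" using \<open>f t \<noteq> 0\<close> by simp
        moreover have "inverse (f t) * - (\<Sum>k<t. f k * \<epsilon> k) = (\<Sum>k<t. (- (inverse (f t) * f k)) * \<epsilon> k)"
          by (simp add: sum_distrib_left sum_negf mult.assoc)
        ultimately have "e r = (\<Sum>k<t. (- (inverse (f t) * f k)) * \<epsilon> k)" by (simp only:)
        moreover have "\<forall>k<t. - (inverse (f t) * f k) \<in> scal"
          using f(1) scal_uminus scal_mult scal_inverse by simp
        ultimately have "\<exists>f. (\<forall>k<t. f k \<in> scal) \<and> e r = (\<Sum>k<t. f k * \<epsilon> k)"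
          by (intro exI[of _ "\<lambda>k. - (inverse (f t) * f k)"] conjI)
        with False show False by (rule notE)
      qed
      then have "(\<Sum>k<t. f k * \<epsilon> k) = 0" using sum by simp
      then have "\<forall>k<t. f k = 0" using ind f(1) unfolding scal_independent_def by simp
      then show "f k = 0" using ft k by (cases "k = t") auto
    qed
    moreover have "\<forall>j<Suc r. (\<forall>k<Suc t. c' j k \<in> scal) \<and> e j = (\<Sum>k<Suc t. c' j k * \<epsilon>' k)"
    proof (intro allI impI)
      fix j assume j: "j < Suc r"
      show "(\<forall>k<Suc t. c' j k \<in> scal) \<and> e j = (\<Sum>k<Suc t. c' j k * \<epsilon>' k)"
      proof (cases "j = r")
        case True
        then show ?thesis using scal_0 scal_1 by (simp add: c'_def \<epsilon>'_def)
      next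
        case False
        then show ?thesis using j c scal_0 by (simp add: c'_def \<epsilon>'_def less_Suc_eq)
      qed
    qed
    moreover have "\<epsilon>' 0 = 1" using t by (simp add: \<epsilon>'_def)
    ultimately show ?thesis by (intro exI[of _ "Suc t"] exI[of _ \<epsilon>'] exI[of _ c'] conjI) simp_all
  qed
qed

text \<open>A linear relation between elements of A over the ambient field descends to the center.
  Expanding its coefficients over the family \<open>\<epsilon>\<close> turns it into a combination
  of the \<open>\<epsilon> k\<close> with coefficients \<open>y k\<close> in A; these all vanish,
  and \<open>y 0\<close>, which belongs to \<open>\<epsilon> 0 = 1\<close>, is the relation
  sought.\<close>

lemma lincomb_rational:
  assumes M: "M \<in> A" and d: "\<And>j. j < r \<Longrightarrow> d j \<in> A" and eq: "M = lincomb n r e d"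
  shows "\<exists>f. (\<forall>j<r. f j \<in> scal) \<and> M = lincomb n r f d"
proof -
  obtain t \<epsilon> c where t: "0 < t" "\<epsilon> 0 = 1" and ind: "scal_independent t \<epsilon>"
    and c: "\<And>j k. j < r \<Longrightarrow> k < t \<Longrightarrow> c j k \<in> scal" "\<And>j. j < r \<Longrightarrow> e j = (\<Sum>k<t. c j k * \<epsilon> k)"
    using exists_independent[of r e] by blast
  define y where "y k = lincomb n r (\<lambda>j. c j k) d - (if k = 0 then M else 0\<^sub>m n n)" for k
  have y: "y k \<in> A" if "k < t" for k
    unfolding y_def using c d that M zero by (auto intro!: diff lincomb_mem)
  have Mc: "M \<in> carrier_mat n n" using carrD[OF M] .
  have "lincomb n t \<epsilon> y = 0\<^sub>m n n"
  proof (rule eq_matI)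
    fix i j assume "i < dim_row (0\<^sub>m n n :: 'a mat)" "j < dim_col (0\<^sub>m n n :: 'a mat)"
    then have ij: "i < n" "j < n" by auto
    have "(\<Sum>k<t. \<epsilon> k * y k $$ (i, j)) =
        (\<Sum>k<t. \<Sum>l<r. c l k * \<epsilon> k * d l $$ (i, j)) - (\<Sum>k<t. if k = 0 then M $$ (i, j) else 0)"
      unfolding sum_subtractf[symmetric] using ij Mc t
      by (intro sum.cong refl) (auto simp: y_def lincomb_def right_diff_distrib sum_distrib_left mult_ac)
    also have "(\<Sum>k<t. \<Sum>l<r. c l k * \<epsilon> k * d l $$ (i, j)) = (\<Sum>l<r. e l * d l $$ (i, j))"
      by (subst sum.swap) (simp add: c(2) sum_distrib_right)
    also have "\<dots> = M $$ (i, j)" unfolding eq using ij by (simp add: lincomb_def)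
    finally show "lincomb n t \<epsilon> y $$ (i, j) = 0\<^sub>m n n $$ (i, j)"
      using ij t by (simp add: lincomb_def)
  qed (auto simp: lincomb_def)
  then have "y 0 = 0\<^sub>m n n" using independent_lincomb[OF ind, of y] y t(1) by blast
  then have y0: "y 0 $$ (i, j) = 0\<^sub>m n n $$ (i, j)" for i j by (simp only:)
  have "lincomb n r (\<lambda>j. c j 0) d $$ (i, j) = M $$ (i, j)" if "i < n" "j < n" for i j
    using y0[of i j] that Mc by (simp add: y_def lincomb_def)
  then have "M = lincomb n r (\<lambda>j. c j 0) d" using Mc by (intro eq_matI) (auto simp: lincomb_def)
  then show ?thesis using c(1) t(1) by (intro exI[of _ "\<lambda>j. c j 0"]) auto
qed

definition commutators :: "'a mat set" where
  "commutators = {x * y - y * x | x y. x \<in> A \<and> y \<in> A}"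

lemma commutators_A: "commutators \<subseteq> A"
  using mult diff by (auto simp: commutators_def)

text \<open>Bilinearity extends the brackets from A to all matrices, and there they produce the
  off-diagonal matrix units and the differences of diagonal ones, i.e. everything of trace zero. The
  identity supplies the missing direction because n is invertible.\<close>

lemma span_commutators: "carrier_mat n n \<subseteq> lspan n (insert (1\<^sub>m n) commutators)"
proof -
  define V where "V = lspan n (insert (1\<^sub>m n) commutators)"
  have T: "insert (1\<^sub>m n) commutators \<subseteq> carrier_mat n n"
    using commutators_A carr by auto
  have V_add: "M + N \<in> V" if "M \<in> V" "N \<in> V" for M N
    using lspan_add[OF _ T] that by (simp add: V_def)
  have V_smult: "c \<cdot>\<^sub>m M \<in> V" if "M \<in> V" for M c
    using lspan_smult[OF _ T] that by (simp add: V_def)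
  have V_zero: "0\<^sub>m n n \<in> V" by (simp add: V_def lspan_zero)
  have V_one: "1\<^sub>m n \<in> V" unfolding V_def by (rule lspan_base[OF _ T]) simp
  have V_base: "x * y - y * x \<in> V" if "x \<in> A" "y \<in> A" for x y
    unfolding V_def by (rule lspan_base[OF _ T]) (use that in \<open>auto simp: commutators_def\<close>)
  have add_eq: "x * (M + N) - (M + N) * x = (x * M - M * x) + (x * N - N * x)"
    if "x \<in> carrier_mat n n" "M \<in> carrier_mat n n" "N \<in> carrier_mat n n" for x M N :: "'a mat"
    unfolding mult_add_distrib_mat[OF that] add_mult_distrib_mat[OF that(2,3,1)]
    using that by (intro eq_matI) auto
  have smult_eq: "x * (c \<cdot>\<^sub>m M) - (c \<cdot>\<^sub>m M) * x = c \<cdot>\<^sub>m (x * M - M * x)"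
    if "x \<in> carrier_mat n n" "M \<in> carrier_mat n n" for x M :: "'a mat" and c
    unfolding mult_smult_distrib[OF that] mult_smult_assoc_mat[OF that(2,1)]
    using that by (intro eq_matI) (auto simp: right_diff_distrib)
  have zero_eq: "x * 0\<^sub>m n n - 0\<^sub>m n n * x = 0\<^sub>m n n" if "x \<in> carrier_mat n n" for x :: "'a mat"
    using that by (intro eq_matI) auto
  have neg: "x * y - y * x = (- 1) \<cdot>\<^sub>m (y * x - x * y)"
    if "x \<in> carrier_mat n n" "y \<in> carrier_mat n n" for x y :: "'a mat"
    using that by (intro eq_matI) auto
  have step: "x * M - M * x \<in> V"
    if x: "x \<in> carrier_mat n n" and base: "\<And>y. y \<in> A \<Longrightarrow> x * y - y * x \<in> V" and M: "M \<in> carrier_mat n n" for x M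
  proof -
    have "M \<in> lspan n A" using span M by blast
    then have "M \<in> {M \<in> carrier_mat n n. x * M - M * x \<in> V}"
    proof (rule lspan_induct_closed)
      show "A \<subseteq> {M \<in> carrier_mat n n. x * M - M * x \<in> V}" using base carr by blast
      show "0\<^sub>m n n \<in> {M \<in> carrier_mat n n. x * M - M * x \<in> V}" using zero_eq[OF x] V_zero by simp
      show "M + N \<in> {M \<in> carrier_mat n n. x * M - M * x \<in> V}"
        if "M \<in> {M \<in> carrier_mat n n. x * M - M * x \<in> V}" "N \<in> {M \<in> carrier_mat n n. x * M - M * x \<in> V}" for M N
        using that add_eq[OF x] V_add by simp
      show "c \<cdot>\<^sub>m M \<in> {M \<in> carrier_mat n n. x * M - M * x \<in> V}"
        if "M \<in> {M \<in> carrier_mat n n. x * M - M * x \<in> V}" for M c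
        using that smult_eq[OF x] V_smult by simp
    qed
    then show ?thesis by simp
  qed
  \<comment> \<open>The extension from A to all matrices is carried out in the second argument first
    and then, by antisymmetry, in the other one.\<close>
  have comm: "x * M - M * x \<in> V" if x: "x \<in> carrier_mat n n" and M: "M \<in> carrier_mat n n" for x M
  proof (rule step[OF x _ M])
    fix y assume y: "y \<in> A"
    have "y * x - x * y \<in> V" by (rule step[OF carrD[OF y] V_base[OF y] x])
    then show "x * y - y * x \<in> V" unfolding neg[OF x carrD[OF y]] by (rule V_smult)
  qed
  have off: "mat_unit n a b \<in> V" if ab: "a < n" "b < n" "a \<noteq> b" for a b
  proof -
    have "mat_unit n a a * mat_unit n a b - mat_unit n a b * mat_unit n a a = (mat_unit n a b :: 'a mat)"
      unfolding mat_unit_mult[OF ab(1,1,1,2)] mat_unit_mult[OF ab(1,2,1,1)] using ab(3) by (auto intro!: eq_matI simp: mat_unit_def)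
    then show ?thesis using comm[OF mat_unit_carrier mat_unit_carrier] by metis
  qed
  have diff_V: "mat_unit n a a - mat_unit n b b \<in> V" if ab: "a < n" "b < n" for a b
  proof -
    have "mat_unit n a b * mat_unit n b a - mat_unit n b a * mat_unit n a b = (mat_unit n a a - mat_unit n b b :: 'a mat)"
      unfolding mat_unit_mult[OF ab(1,2,2,1)] mat_unit_mult[OF ab(2,1,1,2)] by simp
    then show ?thesis using comm[OF mat_unit_carrier mat_unit_carrier] by metis
  qed
  have diag: "mat_unit n a a \<in> V" if a: "a < n" for a
  proof -
    \<comment> \<open>The partial sum of the differences
      \<open>mat_unit n a a - mat_unit n i i\<close> over i < k; for k = n it is n times the matrix
      unit minus the identity.\<close>
    have part: "mat n n (\<lambda>(i, j). if i = j then (if i = a then of_nat k else 0) - (if i < k then 1 else 0) else 0) \<in> V"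
      if "k \<le> n" for k
      using that
    proof (induction k)
      case 0
      have "mat n n (\<lambda>(i, j). if i = j then (if i = a then of_nat 0 else 0) - (if i < 0 then 1 else 0) else 0) = (0\<^sub>m n n :: 'a mat)"
        by (intro eq_matI) auto
      then show ?case using V_zero by simp
    next
      case (Suc k)
      have "mat n n (\<lambda>(i, j). if i = j then (if i = a then of_nat (Suc k) else 0) - (if i < Suc k then 1 else 0) else 0) =
        mat n n (\<lambda>(i, j). if i = j then (if i = a then of_nat k else 0) - (if i < k then 1 else 0) else 0) +
        (mat_unit n a a - mat_unit n k k :: 'a mat)"
        using Suc.prems by (intro eq_matI) (auto simp: mat_unit_def less_Suc_eq)
      then show ?case using V_add[OF Suc.IH diff_V[OF a, of k]] Suc.prems by simp
    qed
    have "mat_unit n a a = inverse (of_nat n) \<cdot>\<^sub>m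
      (mat n n (\<lambda>(i, j). if i = j then (if i = a then of_nat n else 0) - (if i < n then 1 else 0) else 0) + 1\<^sub>m n :: 'a mat)"
      using char_n by (intro eq_matI) (auto simp: mat_unit_def)
    then show ?thesis using V_smult[OF V_add[OF part[OF order_refl] V_one], of "inverse (of_nat n)"] by simp
  qed
  have unit: "mat_unit n a b \<in> V" if "a < n" "b < n" for a b
    using off diag that by (cases "a = b") auto
  show ?thesis
    using mat_unit_generate[of n V, OF unit V_add V_smult V_zero] by (auto simp: V_def)
qed

text \<open>Spanning by the identity and commutators over the ambient field becomes spanning over
  the center by \<open>lincomb_rational\<close>. This is the decomposition that fixes the trace
  under every splitting.\<close>

lemma scalar_plus_commutators:
  assumes "M \<in> A"
  shows "\<exists>r f d. (\<forall>j<r. f j \<in> scal \<and> d j \<in> insert (1\<^sub>m n) commutators) \<and> M = lincomb n r f d"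
proof -
  have T: "insert (1\<^sub>m n) commutators \<subseteq> carrier_mat n n"
    using commutators_A carr by auto
  have "M \<in> lspan n (insert (1\<^sub>m n) commutators)" using span_commutators carrD[OF assms] by blast
  from lspan_lincomb[OF this T] obtain r e d where
    d: "\<forall>k<r. d k \<in> insert (1\<^sub>m n) commutators" and M: "M = lincomb n r e d" by blast
  have "d k \<in> A" if "k < r" for k using d that commutators_A one by auto
  from lincomb_rational[OF assms this M] d show ?thesis by blast
qed

end

section \<open>Splittings of division algebras of matrices\<close>

lemma finsum_ring_mat:
  fixes f :: "'b \<Rightarrow> 'a::comm_ring_1 mat"
  assumes "finite S" "\<And>a. a \<in> S \<Longrightarrow> f a \<in> carrier_mat n n"
  shows "(\<Oplus>\<^bsub>ring_mat TYPE('a) n ()\<^esub>a\<in>S. f a) = mat n n (\<lambda>x. \<Sum>a\<in>S. f a $$ x)"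
  using assms
proof induction
  interpret ring "ring_mat TYPE('a) n ()" by (rule ring_mat)
  case empty
  have "(\<Oplus>\<^bsub>ring_mat TYPE('a) n ()\<^esub>a\<in>{}. f a) = 0\<^sub>m n n" by (simp add: ring_mat_simps)
  then show ?case by (auto intro: eq_matI)
next
  interpret ring "ring_mat TYPE('a) n ()" by (rule ring_mat)
  case (insert a S)
  have IH: "(\<Oplus>\<^bsub>ring_mat TYPE('a) n ()\<^esub>a\<in>S. f a) = mat n n (\<lambda>x. \<Sum>a\<in>S. f a $$ x)"
    by (rule insert.IH) (use insert.prems in auto)
  have "f \<in> S \<rightarrow> carrier (ring_mat TYPE('a) n ())" "f a \<in> carrier (ring_mat TYPE('a) n ())"
    using insert.prems by (auto simp: ring_mat_simps)
  then have "(\<Oplus>\<^bsub>ring_mat TYPE('a) n ()\<^esub>a\<in>insert a S. f a) =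
      f a + (\<Oplus>\<^bsub>ring_mat TYPE('a) n ()\<^esub>a\<in>S. f a)"
    using finsum_insert[OF insert.hyps] by (simp add: ring_mat_simps)
  also have "\<dots> = mat n n (\<lambda>x. \<Sum>a\<in>insert a S. f a $$ x)"
    unfolding IH using insert.hyps insert.prems[OF insertI1] by (intro eq_matI) auto
  finally show ?case .
qed

lemma lspan_finsum:
  fixes \<phi> :: "'b \<Rightarrow> 'a::comm_ring_1 mat"
  assumes "M \<in> lspan n (\<phi> ` T)" "\<And>x. x \<in> T \<Longrightarrow> \<phi> x \<in> carrier_mat n n"
  shows "\<exists>S c. finite S \<and> S \<subseteq> T \<and> M = (\<Oplus>\<^bsub>ring_mat TYPE('a) n ()\<^esub>a\<in>S. c a \<cdot>\<^sub>m \<phi> a)"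
  using assms(1)
proof (induction rule: lspan.induct)
  case lspan_zero
  have "0\<^sub>m n n = mat n n (\<lambda>x. 0)" by (auto intro: eq_matI)
  then show ?case
    using finsum_ring_mat[of "{}" "\<lambda>a. 0 \<cdot>\<^sub>m \<phi> a" n]
    by (intro exI[of _ "{}"] exI[of _ "\<lambda>_. 0"]) simp
next
  case (lspan_step M x d)
  then obtain S c where S: "finite S" "S \<subseteq> T"
    and M: "M = (\<Oplus>\<^bsub>ring_mat TYPE('a) n ()\<^esub>a\<in>S. c a \<cdot>\<^sub>m \<phi> a)" by blast
  obtain y where y: "y \<in> T" "x = \<phi> y" using lspan_step.hyps(2) by blast
  have M': "M = mat n n (\<lambda>x. \<Sum>a\<in>S. (c a \<cdot>\<^sub>m \<phi> a) $$ x)"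
    unfolding M by (rule finsum_ring_mat) (use S assms(2) in auto)
  \<comment> \<open>The new element y may already belong to S; the two coefficients are then
    added.\<close>
  define c' where "c' a = (if a \<in> S then c a else 0) + (if a = y then d else 0)" for a
  have "(\<Oplus>\<^bsub>ring_mat TYPE('a) n ()\<^esub>a\<in>insert y S. c' a \<cdot>\<^sub>m \<phi> a) =
      mat n n (\<lambda>x. \<Sum>a\<in>insert y S. (c' a \<cdot>\<^sub>m \<phi> a) $$ x)"
    by (rule finsum_ring_mat) (use S y assms(2) in auto)
  also have "\<dots> = M + d \<cdot>\<^sub>m x"
  proof (rule eq_matI)
    fix i j assume "i < dim_row (M + d \<cdot>\<^sub>m x)" "j < dim_col (M + d \<cdot>\<^sub>m x)"
    then have ij: "i < n" "j < n" using y assms(2)[of y] by auto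
    have dim: "dim_row (\<phi> a) = n" "dim_col (\<phi> a) = n" if "a \<in> T" for a using assms(2)[OF that] by auto
    have "(\<Sum>a\<in>insert y S. (c' a \<cdot>\<^sub>m \<phi> a) $$ (i, j)) =
        (\<Sum>a\<in>insert y S. (if a \<in> S then c a * \<phi> a $$ (i, j) else 0) + (if a = y then d * \<phi> y $$ (i, j) else 0))"
      using ij S y by (intro sum.cong refl) (auto simp: c'_def dim distrib_right)
    also have "\<dots> = (\<Sum>a\<in>insert y S. if a \<in> S then c a * \<phi> a $$ (i, j) else 0) + d * \<phi> y $$ (i, j)"
      using S(1) by (simp add: sum.distrib)
    also have "(\<Sum>a\<in>insert y S. if a \<in> S then c a * \<phi> a $$ (i, j) else 0) = (\<Sum>a\<in>S. c a * \<phi> a $$ (i, j))"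
      using S(1) by (intro sum.mono_neutral_cong_right) auto
    also have "\<dots> = (\<Sum>a\<in>S. (c a \<cdot>\<^sub>m \<phi> a) $$ (i, j))"
      using ij S by (intro sum.cong refl) (auto simp: dim)
    finally show "mat n n (\<lambda>x. \<Sum>a\<in>insert y S. (c' a \<cdot>\<^sub>m \<phi> a) $$ x) $$ (i, j) = (M + d \<cdot>\<^sub>m x) $$ (i, j)"
      using ij y by (simp add: M' dim)
  qed (use y assms(2)[of y] in auto)
  finally show ?case using S y by (intro exI[of _ "insert y S"] exI[of _ c']) auto
qed

lemma splittingI:
  fixes \<phi> :: "'b \<Rightarrow> 'e::field mat"
  assumes hom: "\<phi> \<in> Ring.ring_hom A (ring_mat TYPE('e) n ())"
    and center: "\<And>z. z \<in> ring_center A \<Longrightarrow> \<exists>c. \<phi> z = c \<cdot>\<^sub>m 1\<^sub>m n"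
    and units: "\<And>a b. a < n \<Longrightarrow> b < n \<Longrightarrow> mat_unit n a b \<in> lspan n (\<phi> ` carrier A)"
  shows "splitting A n \<phi>"
  unfolding splitting_def
proof (intro conjI ballI hom center)
  have carr: "\<phi> x \<in> carrier_mat n n" if "x \<in> carrier A" for x
    using ring_hom_closed[OF hom that] by (simp add: ring_mat_simps)
  then have T: "\<phi> ` carrier A \<subseteq> carrier_mat n n" by blast
  fix M :: "'e mat" assume M: "M \<in> carrier_mat n n"
  have "M \<in> lspan n (\<phi> ` carrier A)"
    by (rule mat_unit_generate[OF units _ _ _ M]) (auto intro: lspan_add[OF _ T] lspan_smult[OF _ T] lspan_zero)
  then show "\<exists>S c. finite S \<and> S \<subseteq> carrier A \<and> M = (\<Oplus>\<^bsub>ring_mat TYPE('e) n ()\<^esub>a\<in>S. c a \<cdot>\<^sub>m \<phi> a)"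
    using carr by (rule lspan_finsum)
qed

lemma lspan_hom:
  assumes h: "comm_ring_hom h" and "M \<in> lspan n T" "T \<subseteq> carrier_mat n n"
  shows "map_mat h M \<in> lspan n (map_mat h ` T)"
proof -
  interpret comm_ring_hom h by fact
  from assms(2) show ?thesis
  proof (induction rule: lspan.induct)
    case lspan_zero
    have "map_mat h (0\<^sub>m n n) = 0\<^sub>m n n" by (intro eq_matI) auto
    then show ?case by (simp add: lspan.lspan_zero)
  next
    case (lspan_step M x c)
    have "map_mat h (M + c \<cdot>\<^sub>m x) = map_mat h M + h c \<cdot>\<^sub>m map_mat h x"
      using lspan_carrier[OF lspan_step.hyps(1) assms(3)] lspan_step.hyps(2) assms(3)
      by (intro eq_matI) (auto simp: hom_add hom_mult)
    then show ?case using lspan.lspan_step[OF lspan_step.IH] lspan_step.hyps(2) by simp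
  qed
qed

lemma map_mat_unit: "comm_ring_hom h \<Longrightarrow> map_mat h (mat_unit n a b) = mat_unit n a b"
proof -
  assume "comm_ring_hom h"
  then interpret comm_ring_hom h .
  show ?thesis by (intro eq_matI) (auto simp: mat_unit_def)
qed

lemma map_mat_smult_one: "comm_ring_hom h \<Longrightarrow> map_mat h (c \<cdot>\<^sub>m 1\<^sub>m n) = h c \<cdot>\<^sub>m 1\<^sub>m n"
proof -
  assume "comm_ring_hom h"
  then interpret comm_ring_hom h .
  show ?thesis by (intro eq_matI) auto
qed

lemma ring_mat_minus: "x \<in> carrier_mat n n \<Longrightarrow> \<ominus>\<^bsub>ring_mat TYPE('a::comm_ring_1) n b\<^esub> x = - x"
proof -
  assume x: "x \<in> carrier_mat n n"
  interpret ring "ring_mat TYPE('a) n b" by (rule ring_mat)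
  show ?thesis
    by (rule minus_equality) (use x in \<open>auto simp: ring_mat_simps intro: eq_matI\<close>)
qed

context division_matrices
begin

definition mat_ring :: "'a mat ring" where
  "mat_ring = (ring_mat TYPE('a) n ())\<lparr>carrier := A\<rparr>"

lemma mat_ring_simps:
  "carrier mat_ring = A" "\<one>\<^bsub>mat_ring\<^esub> = 1\<^sub>m n" "\<zero>\<^bsub>mat_ring\<^esub> = 0\<^sub>m n n"
  "x \<otimes>\<^bsub>mat_ring\<^esub> y = x * y" "x \<oplus>\<^bsub>mat_ring\<^esub> y = x + y"
  by (simp_all add: mat_ring_def ring_mat_simps)

lemma ring_mat_ring: "ring mat_ring"
proof -
  interpret R: ring "ring_mat TYPE('a) n ()" by (rule ring_mat)
  have "subring A (ring_mat TYPE('a) n ())"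
    by (rule R.subringI) (use carr one add mult uminus ring_mat_minus[OF carrD, where b = "()"] in \<open>auto simp: ring_mat_simps\<close>)
  then show ?thesis unfolding mat_ring_def by (rule R.subring_is_ring)
qed

lemma mat_ring_minus: "x \<in> A \<Longrightarrow> \<ominus>\<^bsub>mat_ring\<^esub> x = - x"
proof -
  assume x: "x \<in> A"
  interpret ring mat_ring by (rule ring_mat_ring)
  show ?thesis
    by (rule minus_equality) (use x uminus carrD[OF x] in \<open>auto simp: mat_ring_simps intro: eq_matI\<close>)
qed

lemma scalar_center: "c \<in> scal \<Longrightarrow> c \<cdot>\<^sub>m 1\<^sub>m n \<in> ring_center mat_ring"
proof -
  assume c: "c \<in> scal"
  have "(c \<cdot>\<^sub>m 1\<^sub>m n) * x = x * (c \<cdot>\<^sub>m 1\<^sub>m n)" if "x \<in> A" for x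
    unfolding mult_smult_assoc_mat[OF one_carrier_mat carrD[OF that]] mult_smult_distrib[OF carrD[OF that] one_carrier_mat]
    using carrD[OF that] by simp
  then show ?thesis using c by (simp add: ring_center_def mat_ring_simps scal_def)
qed

lemma center_scalar:
  assumes "z \<in> ring_center mat_ring"
  shows "\<exists>c\<in>scal. z = c \<cdot>\<^sub>m 1\<^sub>m n"
  using assms by (intro commutes_scalar) (auto simp: ring_center_def mat_ring_simps)

text \<open>A splitting \<open>\<psi>\<close> is not assumed linear over the ambient field, but it
  maps central elements to scalar matrices. So a central multiple of a commutator has trace zero,
  and F is the sum of the central coefficients of the identity, whatever \<open>\<psi>\<close>
  is.\<close>

lemma trace_scalar:
  assumes x: "x \<in> A"
  shows "\<exists>F\<in>scal. \<forall>\<psi> :: 'a mat \<Rightarrow> 'e::field mat. splitting mat_ring n \<psi> \<longrightarrow> mat_tr (\<psi> x) = mat_tr (\<psi> (F \<cdot>\<^sub>m 1\<^sub>m n))"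
proof -
  obtain r f d where fd: "\<And>j. j < r \<Longrightarrow> f j \<in> scal \<and> d j \<in> insert (1\<^sub>m n) commutators"
    and x: "x = lincomb n r f d"
    using scalar_plus_commutators[OF x] by blast
  note hom = splitting_hom[OF ring_mat_ring, unfolded mat_ring_simps]
  have "k \<le> r \<Longrightarrow> \<exists>F\<in>scal. \<forall>\<psi> :: 'a mat \<Rightarrow> 'e mat. splitting mat_ring n \<psi> \<longrightarrow>
      mat_tr (\<psi> (lincomb n k f d)) = mat_tr (\<psi> (F \<cdot>\<^sub>m 1\<^sub>m n))" for k
  proof (induction k)
    case 0
    have "lincomb n 0 f d = 0 \<cdot>\<^sub>m 1\<^sub>m n" by (intro eq_matI) (auto simp: lincomb_def)
    then show ?case using scal_0 by auto
  next
    case (Suc k)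
    then obtain F where F: "F \<in> scal" "\<And>\<psi> :: 'a mat \<Rightarrow> 'e mat. splitting mat_ring n \<psi> \<Longrightarrow>
      mat_tr (\<psi> (lincomb n k f d)) = mat_tr (\<psi> (F \<cdot>\<^sub>m 1\<^sub>m n))" by auto
    have dA: "d j \<in> A" if "j < r" for j using fd[OF that] commutators_A one by auto
    have k: "k < r" using Suc.prems by simp
    have fk: "f k \<in> scal" using fd[OF k] by blast
    have lk: "lincomb n k f d \<in> A" by (rule lincomb_mem) (use fd dA k in auto)
    have fkA: "f k \<cdot>\<^sub>m 1\<^sub>m n \<in> A" using fk by (simp add: scal_def)
    have lS: "lincomb n (Suc k) f d = lincomb n k f d + (f k \<cdot>\<^sub>m 1\<^sub>m n) * d k"
      using carrD[OF dA[OF k]] by (simp add: lincomb_Suc mult_smult_assoc_mat[OF one_carrier_mat carrD[OF dA[OF k]]])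
    have tr: "mat_tr (\<psi> (lincomb n (Suc k) f d)) = mat_tr (\<psi> (F \<cdot>\<^sub>m 1\<^sub>m n)) + mat_tr (\<psi> (f k \<cdot>\<^sub>m 1\<^sub>m n) * \<psi> (d k))"
      if \<psi>: "splitting mat_ring n \<psi>" for \<psi> :: "'a mat \<Rightarrow> 'e mat"
    proof -
      have "\<psi> (lincomb n (Suc k) f d) = \<psi> (lincomb n k f d) + \<psi> (f k \<cdot>\<^sub>m 1\<^sub>m n) * \<psi> (d k)"
        unfolding lS hom(3)[OF \<psi> lk mult[OF fkA dA[OF k]]] hom(2)[OF \<psi> fkA dA[OF k]] ..
      then show ?thesis
        using mat_tr_add[OF hom(1)[OF \<psi> lk] mult_carrier_mat[OF hom(1)[OF \<psi> fkA] hom(1)[OF \<psi> dA[OF k]]]] F(2)[OF \<psi>]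
        by simp
    qed
    show ?case
    proof (cases "d k = 1\<^sub>m n")
      case True
      have FA: "F \<cdot>\<^sub>m 1\<^sub>m n \<in> A" using F(1) by (simp add: scal_def)
      have "mat_tr (\<psi> (lincomb n (Suc k) f d)) = mat_tr (\<psi> ((F + f k) \<cdot>\<^sub>m 1\<^sub>m n))"
        if \<psi>: "splitting mat_ring n \<psi>" for \<psi> :: "'a mat \<Rightarrow> 'e mat"
      proof -
        have "(F + f k) \<cdot>\<^sub>m 1\<^sub>m n = F \<cdot>\<^sub>m 1\<^sub>m n + f k \<cdot>\<^sub>m (1\<^sub>m n :: 'a mat)" by (intro eq_matI) auto
        then have "\<psi> ((F + f k) \<cdot>\<^sub>m 1\<^sub>m n) = \<psi> (F \<cdot>\<^sub>m 1\<^sub>m n) + \<psi> (f k \<cdot>\<^sub>m 1\<^sub>m n)"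
          using hom(3)[OF \<psi> FA fkA] by simp
        then have "mat_tr (\<psi> ((F + f k) \<cdot>\<^sub>m 1\<^sub>m n)) = mat_tr (\<psi> (F \<cdot>\<^sub>m 1\<^sub>m n)) + mat_tr (\<psi> (f k \<cdot>\<^sub>m 1\<^sub>m n))"
          using mat_tr_add[OF hom(1)[OF \<psi> FA] hom(1)[OF \<psi> fkA]] by simp
        then show ?thesis
          unfolding tr[OF \<psi>] True hom(4)[OF \<psi>] right_mult_one_mat[OF hom(1)[OF \<psi> fkA]] by simp
      qed
      then show ?thesis using scal_add[OF F(1) fk] by blast
    next
      case False
      then obtain u v where uv: "u \<in> A" "v \<in> A" "d k = u * v - v * u"
        using fd[OF k] by (auto simp: commutators_def)
      have "mat_tr (\<psi> (lincomb n (Suc k) f d)) = mat_tr (\<psi> (F \<cdot>\<^sub>m 1\<^sub>m n))"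
        if \<psi>: "splitting mat_ring n \<psi>" for \<psi> :: "'a mat \<Rightarrow> 'e mat"
      proof -
        have "d k = u * v + - (v * u)"
          unfolding uv(3) using carrD[OF uv(1)] carrD[OF uv(2)] by (intro eq_matI) auto
        then have "\<psi> (d k) = \<psi> (u * v) + \<psi> (- (v * u))"
          using hom(3)[OF \<psi> mult[OF uv(1,2)] uminus[OF mult[OF uv(2,1)]]] by simp
        also have "\<psi> (- (v * u)) = - \<psi> (v * u)"
          using hom(6)[OF \<psi> mult[OF uv(2,1)]] mat_ring_minus[OF mult[OF uv(2,1)]] by simp
        finally have dk: "\<psi> (d k) = \<psi> u * \<psi> v + - (\<psi> v * \<psi> u)"
          unfolding hom(2)[OF \<psi> uv(1,2)] hom(2)[OF \<psi> uv(2,1)] .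
        note cu = hom(1)[OF \<psi> uv(1)] and cv = hom(1)[OF \<psi> uv(2)]
        have "mat_tr (\<psi> u * \<psi> v + - (\<psi> v * \<psi> u)) = mat_tr (\<psi> u * \<psi> v) + mat_tr (- (\<psi> v * \<psi> u))"
          by (rule mat_tr_add) (use cu cv in auto)
        also have "mat_tr (- (\<psi> v * \<psi> u)) = - mat_tr (\<psi> v * \<psi> u)"
          using cu cv by (simp add: mat_tr_def sum_negf del: index_mult_mat(1))
        also have "mat_tr (\<psi> u * \<psi> v) = mat_tr (\<psi> v * \<psi> u)" by (rule mat_tr_mult_comm[OF cu cv])
        finally have tr0: "mat_tr (\<psi> (d k)) = 0" by (simp add: dk)
        obtain c where c: "\<psi> (f k \<cdot>\<^sub>m 1\<^sub>m n) = c \<cdot>\<^sub>m 1\<^sub>m n"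
          using hom(8)[OF \<psi> scalar_center[OF fk]] by blast
        note cd = hom(1)[OF \<psi> dA[OF k]]
        have "mat_tr (\<psi> (f k \<cdot>\<^sub>m 1\<^sub>m n) * \<psi> (d k)) = 0"
          unfolding c mult_smult_assoc_mat[OF one_carrier_mat cd] left_mult_one_mat[OF cd] mat_tr_smult[OF cd] tr0 by simp
        then show ?thesis unfolding tr[OF \<psi>] by simp
      qed
      then show ?thesis using F(1) by blast
    qed
  qed
  then show ?thesis using x by blast
qed

lemma trace_algebra_mat_ring:
  fixes h :: "'a \<Rightarrow> 'e::field"
  assumes h: "field_hom h" and char: "\<And>i. 1 \<le> i \<Longrightarrow> i \<le> n \<Longrightarrow> of_nat i \<noteq> (0 :: 'e)"
  shows "trace_algebra mat_ring n ((\<lambda>c. c \<cdot>\<^sub>m 1\<^sub>m n) ` scal) (map_mat h)"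
proof -
  interpret R: ring mat_ring by (rule ring_mat_ring)
  interpret h: field_hom h by fact
  have h': "comm_ring_hom h" by unfold_locales
  have units: "mat_unit n a b \<in> lspan n (map_mat h ` A)" if "a < n" "b < n" for a b
  proof -
    have "mat_unit n a b \<in> lspan n A" using span by auto
    from lspan_hom[OF h' this carr] show ?thesis by (simp only: map_mat_unit[OF h'])
  qed
  have hom: "map_mat h \<in> Ring.ring_hom mat_ring (ring_mat TYPE('e) n ())"
  proof (rule ring_hom_memI; unfold mat_ring_simps ring_mat_simps)
    fix x y assume xy: "x \<in> A" "y \<in> A"
    note c = carrD[OF xy(1)] carrD[OF xy(2)]
    show "map_mat h x \<in> carrier_mat n n" using c by simp
    show "map_mat h (x * y) = map_mat h x * map_mat h y" by (rule h.mat_hom_mult[OF c])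
    show "map_mat h (x + y) = map_mat h x + map_mat h y" using c by (intro eq_matI) (auto simp: h.hom_add)
  qed (rule h.mat_hom_one)
  have split: "splitting mat_ring n (map_mat h)"
  proof (rule splittingI[OF hom])
    fix z assume "z \<in> ring_center mat_ring"
    then obtain c where "z = c \<cdot>\<^sub>m 1\<^sub>m n" using center_scalar by blast
    then show "\<exists>c. map_mat h z = c \<cdot>\<^sub>m 1\<^sub>m n" using map_mat_smult_one[OF h'] by blast
  qed (use units in \<open>simp add: mat_ring_simps\<close>)
  show ?thesis
  proof
    show "1 \<le> n" using n_pos by simp
    show "of_nat i \<noteq> (0 :: 'e)" if "1 \<le> i" "i \<le> n" for i by (rule char[OF that])
    show "(\<lambda>c. c \<cdot>\<^sub>m 1\<^sub>m n) ` scal \<subseteq> ring_center mat_ring" using scalar_center by blast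
    show "\<zero>\<^bsub>mat_ring\<^esub> \<in> (\<lambda>c. c \<cdot>\<^sub>m 1\<^sub>m n) ` scal"
    proof -
      have "0\<^sub>m n n = 0 \<cdot>\<^sub>m (1\<^sub>m n :: 'a mat)" by (intro eq_matI) auto
      then show ?thesis using scal_0 by (auto simp: mat_ring_simps)
    qed
    show "\<one>\<^bsub>mat_ring\<^esub> \<in> (\<lambda>c. c \<cdot>\<^sub>m 1\<^sub>m n) ` scal"
      using scal_1 smult_one_mat'[of "1\<^sub>m n :: 'a mat"] by (auto simp: mat_ring_simps intro!: image_eqI[of _ _ 1])
    fix x assume x: "x \<in> (\<lambda>c. c \<cdot>\<^sub>m 1\<^sub>m n) ` scal"
    then obtain c where c: "c \<in> scal" "x = c \<cdot>\<^sub>m 1\<^sub>m n" by blast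
    have xA: "x \<in> A" using c by (simp add: scal_def)
    show "\<ominus>\<^bsub>mat_ring\<^esub> x \<in> (\<lambda>c. c \<cdot>\<^sub>m 1\<^sub>m n) ` scal"
    proof -
      have "- (c \<cdot>\<^sub>m 1\<^sub>m n) = (- c) \<cdot>\<^sub>m (1\<^sub>m n :: 'a mat)" by (intro eq_matI) auto
      then show ?thesis using mat_ring_minus[OF xA] scal_uminus[OF c(1)] c(2) by auto
    qed
    show "\<exists>y\<in>(\<lambda>c. c \<cdot>\<^sub>m 1\<^sub>m n) ` scal. x \<otimes>\<^bsub>mat_ring\<^esub> y = \<one>\<^bsub>mat_ring\<^esub>" if "x \<noteq> \<zero>\<^bsub>mat_ring\<^esub>"
    proof -
      have "c \<noteq> 0"
      proof
        assume "c = 0"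
        then have "x = 0\<^sub>m n n" unfolding c(2) by (intro eq_matI) auto
        then show False using that by (simp add: mat_ring_simps)
      qed
      then have "(c \<cdot>\<^sub>m 1\<^sub>m n) * (inverse c \<cdot>\<^sub>m 1\<^sub>m n) = (1\<^sub>m n :: 'a mat)" by (intro eq_matI) auto
      then show ?thesis using scal_inverse[OF c(1)] by (auto simp: mat_ring_simps c(2))
    qed
    fix y assume y: "y \<in> (\<lambda>c. c \<cdot>\<^sub>m 1\<^sub>m n) ` scal"
    then obtain d where d: "d \<in> scal" "y = d \<cdot>\<^sub>m 1\<^sub>m n" by blast
    have "c \<cdot>\<^sub>m 1\<^sub>m n + d \<cdot>\<^sub>m 1\<^sub>m n = (c + d) \<cdot>\<^sub>m (1\<^sub>m n :: 'a mat)" by (intro eq_matI) auto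
    then show "x \<oplus>\<^bsub>mat_ring\<^esub> y \<in> (\<lambda>c. c \<cdot>\<^sub>m 1\<^sub>m n) ` scal"
      using scal_add[OF c(1) d(1)] by (auto simp: mat_ring_simps c(2) d(2))
    have "(c \<cdot>\<^sub>m 1\<^sub>m n) * (d \<cdot>\<^sub>m 1\<^sub>m n) = (c * d) \<cdot>\<^sub>m (1\<^sub>m n :: 'a mat)" by (intro eq_matI) auto
    then show "x \<otimes>\<^bsub>mat_ring\<^esub> y \<in> (\<lambda>c. c \<cdot>\<^sub>m 1\<^sub>m n) ` scal"
      using scal_mult[OF c(1) d(1)] by (auto simp: mat_ring_simps c(2) d(2))
  next
    fix x assume "x \<in> carrier mat_ring"
    then show "\<exists>f\<in>(\<lambda>c. c \<cdot>\<^sub>m 1\<^sub>m n) ` scal. \<forall>\<psi> :: 'a mat \<Rightarrow> 'e mat. splitting mat_ring n \<psi> \<longrightarrow> mat_tr (\<psi> x) = mat_tr (\<psi> f)"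
      using trace_scalar[of x] by (auto simp: mat_ring_simps)
  next
    show "splitting mat_ring n (map_mat h)" by (rule split)
    show "inj_on (map_mat h) (carrier mat_ring)"
      by (rule inj_onI) (rule h.mat_hom_inj)
  qed
qed

end

section \<open>Equivariance of the basic generators\<close>

lemma map_mat_smult: "comm_ring_hom h \<Longrightarrow> map_mat h (c \<cdot>\<^sub>m M) = h c \<cdot>\<^sub>m map_mat h M"
proof -
  assume "comm_ring_hom h"
  then interpret comm_ring_hom h .
  show ?thesis by (intro eq_matI) (auto simp: hom_mult)
qed

lemma map_mat_add:
  assumes h: "comm_ring_hom h" and "M \<in> carrier_mat n n" "N \<in> carrier_mat n n"
  shows "map_mat h (M + N) = map_mat h M + map_mat h N"
proof -
  interpret comm_ring_hom h by fact
  show ?thesis using assms(2,3) by (intro eq_matI) (auto simp: hom_add)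
qed

lemma map_mat_clock: "comm_ring_hom h \<Longrightarrow> map_mat h (clock_mat ps w i) = clock_mat ps (\<lambda>i. h (w i)) i"
proof -
  assume "comm_ring_hom h"
  then interpret comm_ring_hom h .
  show ?thesis by (intro eq_matI) (auto simp: clock_mat_def hom_power)
qed

lemma map_mat_shift: "comm_ring_hom h \<Longrightarrow> map_mat h (shift_mat ps i) = shift_mat ps i"
proof -
  assume "comm_ring_hom h"
  then interpret comm_ring_hom h .
  show ?thesis by (intro eq_matI) (auto simp: shift_mat_def)
qed

lemma map_mat_foldr:
  assumes h: "comm_ring_hom h" and "set xs \<subseteq> carrier_mat n n"
  shows "foldr (*) xs (1\<^sub>m n) \<in> carrier_mat n n \<and>
    map_mat h (foldr (*) xs (1\<^sub>m n)) = foldr (*) (map (map_mat h) xs) (1\<^sub>m n)"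
proof -
  interpret comm_ring_hom h by fact
  show ?thesis
    using assms(2)
  proof (induction xs)
    case (Cons x xs)
    then have x: "x \<in> carrier_mat n n" and IH: "foldr (*) xs (1\<^sub>m n) \<in> carrier_mat n n"
      "map_mat h (foldr (*) xs (1\<^sub>m n)) = foldr (*) (map (map_mat h) xs) (1\<^sub>m n)" by auto
    show ?case
      using mat_hom_mult[OF x IH(1)] IH(2) mult_carrier_mat[OF x IH(1)] by simp
  qed (simp add: mat_hom_one)
qed

lemma twisted_smult_comm:
  fixes G M :: "'a::comm_ring_1 mat"
  assumes h: "comm_ring_hom h" and carr: "G \<in> carrier_mat n n" "M \<in> carrier_mat n n"
    and M: "map_mat h M = M" and comm: "G * M = e \<cdot>\<^sub>m (M * G)" and c: "h c = e * c"
  shows "twisted G h (c \<cdot>\<^sub>m M)"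
proof -
  have "G * (c \<cdot>\<^sub>m M) = c \<cdot>\<^sub>m (e \<cdot>\<^sub>m (M * G))"
    unfolding mult_smult_distrib[OF carr] comm ..
  also have "\<dots> = (e * c) \<cdot>\<^sub>m (M * G)" by (intro eq_matI) (auto simp: mult_ac)
  also have "\<dots> = map_mat h (c \<cdot>\<^sub>m M) * G"
    unfolding map_mat_smult[OF h] M c mult_smult_assoc_mat[OF carr(2,1)] ..
  finally show ?thesis by (simp add: twisted_def)
qed

context weyl
begin

lemma rconst_w_pow: "i < s \<Longrightarrow> rconst (w i) ^ (ps ! i) = 1"
proof -
  interpret r: field_hom "rconst :: 'e \<Rightarrow> _" by (rule field_hom_rconst)
  assume "i < s"
  then have "rconst (w i ^ (ps ! i)) = 1" using w_pow by simp
  then show ?thesis by (simp only: r.hom_power)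
qed

abbreviation rclock :: "nat \<Rightarrow> 'e ratfun mat" where
  "rclock \<equiv> clock_mat ps (\<lambda>i. rconst (w i))"

lemma chi_rclock:
  assumes "i < s"
  shows "map_mat (chi j (w i)) (rclock k) = rclock k" "map_mat (chi j (inverse (w i))) (rclock k) = rclock k"
  using w_nonzero[OF assms] by (simp_all add: map_mat_clock chi_hom[OF assms] chi_rconst)

lemma rclock_shift_comm:
  "i < s \<Longrightarrow> j < s \<Longrightarrow>
    rclock i * shift_mat ps j = (if i = j then rconst (w i) else 1) \<cdot>\<^sub>m (shift_mat ps j * rclock i)"
  using clock_shift_comm[of i j "\<lambda>i. rconst (w i)"] rconst_w_pow by simp

text \<open>Conjugation by clock i multiplies shift i by w i, and this factor is matched by the
  rescaling of the variable 2 i; every other clock and every shift commutes with shift i, and the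
  rescaling paired with it fixes that variable.\<close>

lemma equivariant_shift:
  assumes i: "i < s"
  shows "equivariant (rvar (2 * i) \<cdot>\<^sub>m shift_mat ps i)"
proof (rule equivariantI)
  fix j assume j: "j < s"
  show "twisted (rclock j) (chi (2 * j) (w j)) (rvar (2 * i) \<cdot>\<^sub>m shift_mat ps i)"
  proof (rule twisted_smult_comm[OF chi_hom(1)[OF j] clock_mat_carrier shift_mat_carrier map_mat_shift[OF chi_hom(1)[OF j]]
        rclock_shift_comm[OF j i]])
    show "chi (2 * j) (w j) (rvar (2 * i)) = (if j = i then rconst (w j) else 1) * rvar (2 * i)"
      using chi_rvar[OF w_nonzero[OF j], of "2 * j" "2 * i"] by auto
  qed
  show "twisted (shift_mat ps j) (chi (2 * j + 1) (inverse (w j))) (rvar (2 * i) \<cdot>\<^sub>m shift_mat ps i)"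
  proof (rule twisted_smult_comm[OF chi_hom(2)[OF j] shift_mat_carrier shift_mat_carrier map_mat_shift[OF chi_hom(2)[OF j]]])
    show "shift_mat ps j * shift_mat ps i = 1 \<cdot>\<^sub>m (shift_mat ps i * shift_mat ps j :: 'e ratfun mat)"
      unfolding smult_one_mat' by (rule shift_shift_comm[OF j i])
    have "2 * i \<noteq> 2 * j + 1" by presburger
    then show "chi (2 * j + 1) (inverse (w j)) (rvar (2 * i)) = 1 * rvar (2 * i)"
      using chi_rvar[OF nonzero_imp_inverse_nonzero[OF w_nonzero[OF j]], of "2 * j + 1" "2 * i"] by simp
  qed
qed (simp add: smult_carrier_mat)

text \<open>Conjugation by shift i multiplies clock i by the inverse of w i; this is why the odd
  variables are rescaled by inverses in \<open>equivariant\<close>.\<close>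

lemma equivariant_clock:
  assumes i: "i < s"
  shows "equivariant (rvar (2 * i + 1) \<cdot>\<^sub>m rclock i)"
proof (rule equivariantI)
  fix j assume j: "j < s"
  show "twisted (rclock j) (chi (2 * j) (w j)) (rvar (2 * i + 1) \<cdot>\<^sub>m rclock i)"
  proof (rule twisted_smult_comm[OF chi_hom(1)[OF j] clock_mat_carrier clock_mat_carrier chi_rclock(1)[OF j]])
    show "rclock j * rclock i = 1 \<cdot>\<^sub>m (rclock i * rclock j)"
      unfolding smult_one_mat' by (rule clock_clock_comm)
    have "2 * i + 1 \<noteq> 2 * j" by presburger
    then show "chi (2 * j) (w j) (rvar (2 * i + 1)) = 1 * rvar (2 * i + 1)"
      using chi_rvar[OF w_nonzero[OF j], of "2 * j" "2 * i + 1"] by simp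
  qed
  show "twisted (shift_mat ps j) (chi (2 * j + 1) (inverse (w j))) (rvar (2 * i + 1) \<cdot>\<^sub>m rclock i)"
  proof (rule twisted_smult_comm[OF chi_hom(2)[OF j] shift_mat_carrier clock_mat_carrier chi_rclock(2)[OF j]])
    interpret r: field_hom "rconst :: 'e \<Rightarrow> _" by (rule field_hom_rconst)
    have inv: "rconst (inverse (w j)) * rconst (w j) = 1"
      unfolding r.hom_mult[symmetric] using w_nonzero[OF j] by simp
    show "shift_mat ps j * rclock i = (if i = j then rconst (inverse (w i)) else 1) \<cdot>\<^sub>m (rclock i * shift_mat ps j)"
    proof (cases "i = j")
      case True
      have "rconst (inverse (w j)) \<cdot>\<^sub>m (rconst (w j) \<cdot>\<^sub>m (shift_mat ps j * rclock j)) =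
          (rconst (inverse (w j)) * rconst (w j)) \<cdot>\<^sub>m (shift_mat ps j * rclock j)"
        by (intro eq_matI) (auto simp: mult.assoc)
      then show ?thesis
        unfolding rclock_shift_comm[OF i j] inv smult_one_mat' using True by simp
    next
      case False
      then show ?thesis unfolding rclock_shift_comm[OF i j] by (simp add: smult_one_mat')
    qed
    show "chi (2 * j + 1) (inverse (w j)) (rvar (2 * i + 1)) =
        (if i = j then rconst (inverse (w i)) else 1) * rvar (2 * i + 1)"
      using chi_rvar[OF nonzero_imp_inverse_nonzero[OF w_nonzero[OF j]], of "2 * j + 1" "2 * i + 1"] by auto
  qed
qed (simp add: smult_carrier_mat)

end

section \<open>Lifting constant matrices to equivariant ones\<close>

lemma mp_eval_comp:
  assumes "comm_ring_hom g"
  shows "g (mp_eval h v p) = mp_eval (\<lambda>c. g (h c)) (\<lambda>i. g (v i)) p"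
proof -
  interpret comm_ring_hom g by fact
  show ?thesis by (simp add: mp_eval_def hom_sum hom_mult mono_val_hom[OF assms])
qed

lemma mp_eval_id: "mp_eval mp_const mp_var p = (p :: (nat \<Rightarrow>\<^sub>0 nat) \<Rightarrow>\<^sub>0 'a::comm_ring_1)"
  unfolding mp_eval_def mono_val_mp_var by (subst (3) poly_mapping_sum_singles) (simp add: mult_single)

lemma hom_eq_mp_eval:
  fixes H :: "((nat \<Rightarrow>\<^sub>0 nat) \<Rightarrow>\<^sub>0 'a::comm_ring_1) \<Rightarrow> 'b::comm_ring_1"
  assumes "comm_ring_hom H"
  shows "H p = mp_eval (\<lambda>c. H (mp_const c)) (\<lambda>i. H (mp_var i)) p"
  using mp_eval_comp[OF assms, of mp_const mp_var p] unfolding mp_eval_id .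

lemma comm_ring_hom_id: "comm_ring_hom (\<lambda>x :: 'a::comm_ring_1. x)"
  by standard auto

context weyl
begin

definition at_one :: "'e mvpoly \<Rightarrow> 'e" where
  "at_one = mp_eval (\<lambda>c. c) (\<lambda>_. 1)"

lemma at_one_hom: "comm_ring_hom at_one"
  unfolding at_one_def by (rule comm_ring_hom_mp_eval[OF comm_ring_hom_id])

lemma at_one_const: "at_one (mp_const c) = c"
  by (simp add: at_one_def mp_eval_single)

lemma at_one_var: "at_one (mp_var i) = 1"
  by (simp add: at_one_def mp_eval_single)

text \<open>Every matrix over the base field is the value at \<open>X = 1\<close> of an equivariant polynomial matrix.
  This embeds the algebra of generic matrices into the algebra of equivariant matrices.\<close>

lemma equivariant_lift:
  fixes M :: "'e mat"
  assumes "M \<in> carrier_mat n n"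
  shows "\<exists>M'\<in>carrier_mat n n. equivariant (map_mat (\<lambda>p. Fract p 1) M') \<and> map_mat at_one M' = M"
proof -
  interpret F: inj_comm_ring_hom "\<lambda>p :: 'e mvpoly. Fract p 1" by (rule inj_comm_ring_hom_Fract)
  interpret o: comm_ring_hom at_one by (rule at_one_hom)
  have F: "comm_ring_hom (\<lambda>p :: 'e mvpoly. Fract p 1)" by unfold_locales
  define S where "S = {M. \<exists>M'\<in>carrier_mat n n. equivariant (map_mat (\<lambda>p. Fract p 1) M') \<and> map_mat at_one M' = M}"
  have "M \<in> S"
  \<comment> \<open>The matrices possessing a lift form an algebra. It contains every clock and
    shift matrix, since the variable in front of an equivariant generator becomes 1.\<close>
  proof (rule generation[OF _ _ _ _ _ _ assms])
    fix i assume i: "i < s"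
    have "map_mat (\<lambda>p. Fract p 1) (mp_var (2 * i + 1) \<cdot>\<^sub>m clock_mat ps (\<lambda>i. mp_const (w i)) i) = rvar (2 * i + 1) \<cdot>\<^sub>m rclock i"
      unfolding map_mat_smult[OF F] map_mat_clock[OF F] rvar_def rconst_def ..
    moreover have "map_mat at_one (mp_var (2 * i + 1) \<cdot>\<^sub>m clock_mat ps (\<lambda>i. mp_const (w i)) i) = clock_mat ps w i"
      unfolding map_mat_smult[OF at_one_hom] map_mat_clock[OF at_one_hom] at_one_const at_one_var by (rule smult_one_mat')
    ultimately show "clock_mat ps w i \<in> S"
      unfolding S_def using equivariant_clock[OF i]
      by (intro CollectI bexI[of _ "mp_var (2 * i + 1) \<cdot>\<^sub>m clock_mat ps (\<lambda>i. mp_const (w i)) i"] conjI) (simp_all del: One_nat_def)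
    have "map_mat (\<lambda>p. Fract p 1) (mp_var (2 * i) \<cdot>\<^sub>m shift_mat ps i) = (rvar (2 * i) \<cdot>\<^sub>m shift_mat ps i :: 'e ratfun mat)"
      unfolding map_mat_smult[OF F] map_mat_shift[OF F] rvar_def ..
    moreover have "map_mat at_one (mp_var (2 * i) \<cdot>\<^sub>m shift_mat ps i) = shift_mat ps i"
      unfolding map_mat_smult[OF at_one_hom] map_mat_shift[OF at_one_hom] at_one_var by (rule smult_one_mat')
    ultimately show "shift_mat ps i \<in> S"
      unfolding S_def using equivariant_shift[OF i]
      by (intro CollectI bexI[of _ "mp_var (2 * i) \<cdot>\<^sub>m shift_mat ps i"] conjI) (simp_all del: One_nat_def)
  next
    show "1\<^sub>m n \<in> S"
      unfolding S_def using equivariant_one F.mat_hom_one o.mat_hom_one by (intro CollectI bexI[of _ "1\<^sub>m n"]) auto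
  next
    fix M N assume "M \<in> S" "N \<in> S"
    then obtain M' N' where M': "M' \<in> carrier_mat n n" "equivariant (map_mat (\<lambda>p. Fract p 1) M')" "map_mat at_one M' = M"
      and N': "N' \<in> carrier_mat n n" "equivariant (map_mat (\<lambda>p. Fract p 1) N')" "map_mat at_one N' = N"
      unfolding S_def by blast
    show "M + N \<in> S"
      unfolding S_def
    proof (intro CollectI bexI conjI)
      show "equivariant (map_mat (\<lambda>p. Fract p 1) (M' + N'))"
        unfolding map_mat_add[OF F M'(1) N'(1)] by (rule equivariant_add[OF M'(2) N'(2)])
      show "map_mat at_one (M' + N') = M + N"
        unfolding map_mat_add[OF at_one_hom M'(1) N'(1)] M'(3) N'(3) ..
    qed (rule add_carrier_mat[OF N'(1)])
    show "M * N \<in> S"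
      unfolding S_def
    proof (intro CollectI bexI conjI)
      show "equivariant (map_mat (\<lambda>p. Fract p 1) (M' * N'))"
        unfolding F.mat_hom_mult[OF M'(1) N'(1)] by (rule equivariant_mult[OF M'(2) N'(2)])
      show "map_mat at_one (M' * N') = M * N"
        unfolding o.mat_hom_mult[OF M'(1) N'(1)] M'(3) N'(3) ..
    qed (rule mult_carrier_mat[OF M'(1) N'(1)])
  next
    fix M c assume "M \<in> S"
    then obtain M' where M': "M' \<in> carrier_mat n n" "equivariant (map_mat (\<lambda>p. Fract p 1) M')" "map_mat at_one M' = M"
      unfolding S_def by blast
    show "c \<cdot>\<^sub>m M \<in> S"
      unfolding S_def
    proof (intro CollectI bexI conjI)
      show "equivariant (map_mat (\<lambda>p. Fract p 1) (mp_const c \<cdot>\<^sub>m M'))"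
        unfolding map_mat_smult[OF F] using equivariant_rconst[OF M'(2), of c] unfolding rconst_def .
      show "map_mat at_one (mp_const c \<cdot>\<^sub>m M') = c \<cdot>\<^sub>m M"
        unfolding map_mat_smult[OF at_one_hom] M'(3) at_one_const ..
    qed (rule smult_carrier_mat[OF M'(1)])
  qed
  then show ?thesis by (simp add: S_def)
qed

end

section \<open>Inverses, roots of unity and transfer between fields\<close>

lemma mat_inverse_of_det:
  fixes M :: "'a::field mat"
  assumes M: "M \<in> carrier_mat n n" and "det M \<noteq> 0"
  shows "\<exists>N\<in>carrier_mat n n. M * N = 1\<^sub>m n \<and> N * M = 1\<^sub>m n"
proof (intro bexI conjI)
  let ?N = "inverse (det M) \<cdot>\<^sub>m adj_mat M"
  note adj = adj_mat[OF M]
  have *: "inverse (det M) \<cdot>\<^sub>m (det M \<cdot>\<^sub>m 1\<^sub>m n) = 1\<^sub>m n" using assms(2) by (intro eq_matI) auto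
  show "M * ?N = 1\<^sub>m n" unfolding mult_smult_distrib[OF M adj(1)] adj(2) by (rule *)
  show "?N * M = 1\<^sub>m n" unfolding mult_smult_assoc_mat[OF adj(1) M] adj(3) by (rule *)
  show "?N \<in> carrier_mat n n" using adj(1) by simp
qed

text \<open>A root of 1 + X + ... + X^(p-1) is a p-th root of unity, and it differs from 1 because p
  is nonzero in the field. As p is prime, a smaller positive exponent j with x^j = 1 would be
  coprime to p and force x = 1 by Bezout.\<close>

lemma exists_primitive_root:
  assumes p: "prime p" and char: "of_nat p \<noteq> (0 :: 'a::alg_closed_field)"
  shows "\<exists>w :: 'a. primitive_root_of_unity p w"
proof -
  have p2: "2 \<le> p" using p by (rule prime_ge_2_nat)
  obtain x :: 'a where x: "(\<Sum>k\<le>p - 1. 1 * x ^ k) = 0"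
    using alg_closed[of "p - 1" "\<lambda>_. 1"] p2 by auto
  have "{..p - 1} = {..<p}" using p2 by auto
  then have x0: "(\<Sum>k<p. x ^ k) = 0" using x by simp
  have xp: "x ^ p = 1"
    using power_diff_1_eq[of x p] x0 by (cases "p = 0") auto
  have "x \<noteq> 1" using x0 char by auto
  have "x ^ j \<noteq> 1" if j: "0 < j" "j < p" for j
  proof
    assume xj: "x ^ j = 1"
    have "gcd j p = 1"
      using p j by (metis coprime_iff_gcd_eq_1 coprime_commute nat_dvd_not_less prime_imp_coprime)
    then obtain u v where "j * u = p * v + 1" using bezout_nat[of j p] j by auto
    then have "(x ^ j) ^ u = (x ^ p) ^ v * x" by (simp flip: power_mult)
    then show False using xj xp \<open>x \<noteq> 1\<close> by simp
  qed
  then show ?thesis using xp unfolding primitive_root_of_unity_def by blast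
qed

text \<open>The matrices \<open>\<Phi> x\<close> have entries in one field with two embeddings: g
  into the field over which the reduced invariants are computed, \<open>\<tau>\<close> into the one
  where equivariance makes sense. Vanishing of coefficients and traces and equality of determinants
  are insensitive to both, since field homomorphisms are injective.\<close>

lemma (in weyl_char) nonvanishing_transfer:
  fixes A (structure) and \<Phi> :: "'b \<Rightarrow> 'l::field mat" and g :: "'l \<Rightarrow> 'x::field" and \<tau> :: "'l \<Rightarrow> 'e ratfun"
  assumes "trace_algebra A n Z (\<lambda>x. map_mat g (\<Phi> x))"
    and g: "field_hom g" and \<tau>: "field_hom \<tau>"
    and \<Phi>: "\<And>x. x \<in> carrier A \<Longrightarrow> \<Phi> x \<in> carrier_mat n n"
      "\<And>x. x \<in> carrier A \<Longrightarrow> equivariant (map_mat \<tau> (\<Phi> x))"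
    and m: "1 \<le> m" "\<And>i. i < s \<Longrightarrow> ps ! i dvd m"
  shows "(m \<le> n \<longrightarrow> (\<forall>x\<in>carrier A - {\<zero>}. red_sigma TYPE('x) A n m x \<noteq> \<zero>)) \<and>
    (\<forall>xs. length xs = m \<and> set xs \<subseteq> carrier A - {\<zero>} \<and>
       (\<forall>x\<in>set xs. \<forall>y\<in>set xs. red_norm TYPE('x) A n x = red_norm TYPE('x) A n y) \<longrightarrow>
       red_trace TYPE('x) A n (list_mult A xs) \<noteq> \<zero>) \<and>
    \<not> (\<exists>x\<in>carrier A. red_norm TYPE('x) A n x = \<one> \<and> red_trace TYPE('x) A n x = \<zero>)"
proof -
  interpret T: trace_algebra A n Z "\<lambda>x. map_mat g (\<Phi> x)" by fact
  interpret g: field_hom g by fact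
  interpret t: field_hom \<tau> by fact
  have g': "comm_ring_hom g" and t': "comm_ring_hom \<tau>" by unfold_locales
  have nz: "map_mat \<tau> (\<Phi> x) \<noteq> 0\<^sub>m n n" if "x \<in> carrier A" "map_mat g (\<Phi> x) \<noteq> 0\<^sub>m n n" for x
  proof
    assume "map_mat \<tau> (\<Phi> x) = 0\<^sub>m n n"
    then have "map_mat \<tau> (\<Phi> x) = map_mat \<tau> (0\<^sub>m n n)" by (auto intro: eq_matI)
    then have "\<Phi> x = 0\<^sub>m n n" by (rule t.mat_hom_inj)
    then have "map_mat g (\<Phi> x) = 0\<^sub>m n n" by (auto intro: eq_matI)
    then show False using that(2) by simp
  qed
  show ?thesis
  proof (rule T.nonvanishing[OF m(1)])
    fix x assume mn: "m \<le> n" and x: "x \<in> carrier A" "map_mat g (\<Phi> x) \<noteq> 0\<^sub>m n n"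
    have "char_coeff (map_mat \<tau> (\<Phi> x)) n m \<noteq> 0"
      by (rule equivariant_char_coeff_and_det(1)[OF \<Phi>(2)[OF x(1)] nz[OF x] m(2) m(1) mn])
    then have "char_coeff (\<Phi> x) n m \<noteq> 0" unfolding t.char_coeff_hom[OF \<Phi>(1)[OF x(1)]] by auto
    then show "char_coeff (map_mat g (\<Phi> x)) n m \<noteq> 0" unfolding g.char_coeff_hom[OF \<Phi>(1)[OF x(1)]] by simp
  next
    fix xs assume xs: "length xs = m" "set xs \<subseteq> carrier A" "\<forall>x\<in>set xs. map_mat g (\<Phi> x) \<noteq> 0\<^sub>m n n"
      and dets: "\<forall>x\<in>set xs. \<forall>y\<in>set xs. det (map_mat g (\<Phi> x)) = det (map_mat g (\<Phi> y))"
    let ?L = "map \<Phi> xs"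
    have L: "set ?L \<subseteq> carrier_mat n n" using \<Phi>(1) xs(2) by auto
    have "mat_tr (foldr (*) (map (map_mat \<tau>) ?L) (1\<^sub>m n)) \<noteq> 0"
    proof (rule equivariant_trace_prod[OF _ _ _ m(2) m(1)])
      show "length (map (map_mat \<tau>) ?L) = m" using xs(1) by simp
      show "equivariant M \<and> M \<noteq> 0\<^sub>m n n" if M: "M \<in> set (map (map_mat \<tau>) ?L)" for M
      proof -
        obtain x where x: "x \<in> set xs" "M = map_mat \<tau> (\<Phi> x)" using M by auto
        then have "x \<in> carrier A" "map_mat g (\<Phi> x) \<noteq> 0\<^sub>m n n" using xs by blast+
        then show ?thesis unfolding x(2) using \<Phi>(2) nz by blast
      qed
      fix M M' assume "M \<in> set (map (map_mat \<tau>) ?L)" "M' \<in> set (map (map_mat \<tau>) ?L)"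
      then obtain x y where xy: "x \<in> set xs" "y \<in> set xs" "M = map_mat \<tau> (\<Phi> x)" "M' = map_mat \<tau> (\<Phi> y)" by auto
      have "det (map_mat g (\<Phi> x)) = det (map_mat g (\<Phi> y))" using dets xy(1,2) by blast
      then have "g (det (\<Phi> x)) = g (det (\<Phi> y))" by (simp only: g.hom_det)
      then have "det (\<Phi> x) = det (\<Phi> y)" by simp
      then show "det M = det M'" unfolding xy(3,4) by (simp only: t.hom_det)
    qed
    then have "mat_tr (map_mat \<tau> (foldr (*) ?L (1\<^sub>m n))) \<noteq> 0"
      using map_mat_foldr[OF t' L] by simp
    then have "mat_tr (foldr (*) ?L (1\<^sub>m n)) \<noteq> 0"
      unfolding t.mat_tr_hom[OF conjunct1[OF map_mat_foldr[OF t' L]]] by auto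
    then have "mat_tr (map_mat g (foldr (*) ?L (1\<^sub>m n))) \<noteq> 0"
      unfolding g.mat_tr_hom[OF conjunct1[OF map_mat_foldr[OF g' L]]] by simp
    moreover have "map (map_mat g) ?L = map (\<lambda>x. map_mat g (\<Phi> x)) xs" by simp
    ultimately show "mat_tr (foldr (*) (map (\<lambda>x. map_mat g (\<Phi> x)) xs) (1\<^sub>m n)) \<noteq> 0"
      using map_mat_foldr[OF g' L] by (simp add: comp_def)
  qed
qed

section \<open>Generic matrices\<close>

lemma UD_set_carrier: "M \<in> UD_set n \<Longrightarrow> M \<in> carrier_mat n n"
  by (induction rule: UD_set.induct)
    (auto simp: generic_mat_s_def generic_mat_t_def intro: mult_carrier_mat)

lemma UD_set_one: "1\<^sub>m n \<in> (UD_set n :: 'k::field ratfun mat set)"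
proof -
  interpret r: field_hom "rconst :: 'k \<Rightarrow> _" by (rule field_hom_rconst)
  show ?thesis using UD_set.scalar[of "1 :: 'k" n] unfolding r.hom_one smult_one_mat' .
qed

lemma UD_set_uminus: "M \<in> UD_set n \<Longrightarrow> - M \<in> (UD_set n :: 'k::field ratfun mat set)"
proof -
  assume M: "M \<in> UD_set n"
  interpret r: field_hom "rconst :: 'k \<Rightarrow> _" by (rule field_hom_rconst)
  have "(rconst (- 1) \<cdot>\<^sub>m 1\<^sub>m n) * M = rconst (- 1) \<cdot>\<^sub>m M"
    unfolding mult_smult_assoc_mat[OF one_carrier_mat UD_set_carrier[OF M]] left_mult_one_mat[OF UD_set_carrier[OF M]] ..
  also have "\<dots> = - M"
    by (intro eq_matI) (simp_all add: r.hom_uminus)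
  finally show ?thesis using UD_set.mult[OF UD_set.scalar[of "- 1" n] M] by simp
qed

lemma UD_set_pow: "M \<in> UD_set n \<Longrightarrow> M ^\<^sub>m k \<in> UD_set n"
proof (induction k)
  case 0
  then show ?case using UD_set_one UD_set_carrier[of M n] by auto
qed (auto intro: UD_set.mult)

lemma lincomb_lspan:
  assumes "T \<subseteq> carrier_mat n n"
  shows "(\<And>k. k < r \<Longrightarrow> d k \<in> T) \<Longrightarrow> lincomb n r e d \<in> lspan n T"
proof (induction r)
  case 0
  have "lincomb n 0 e d = 0\<^sub>m n n" by (intro eq_matI) (auto simp: lincomb_def)
  then show ?case using lspan_zero by metis
next
  case (Suc r)
  have "d r \<in> carrier_mat n n" using Suc.prems[of r] assms by auto
  then show ?case
    using lspan_step[OF Suc.IH Suc.prems[of r]] Suc.prems by (simp add: lincomb_Suc)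
qed

text \<open>The words \<open>s\<^sup>a t s\<^sup>n\<^sup>-\<^sup>b\<close> in the generic matrices specialize to the matrix units when \<open>s\<close> becomes a
  cyclic permutation and \<open>t\<close> a matrix unit, so the generic words are linearly independent.\<close>

lemma UD_set_span:
  assumes n: "0 < n"
  shows "carrier_mat n n \<subseteq> lspan n (UD_set n :: 'k::field ratfun mat set)"
proof -
  define F where "F = (\<lambda>p :: 'k mvpoly. Fract p 1)"
  interpret F: inj_comm_ring_hom F unfolding F_def by (rule inj_comm_ring_hom_Fract)
  have F': "comm_ring_hom F" by unfold_locales
  \<comment> \<open>The specialization of the variables: index 2 (i n + j) is the entry s_ij, sent
    to the entry of a cyclic permutation matrix, and the following odd index is t_ij, sent to the
    entry of the matrix unit at (0, 0).\<close>
  define v :: "nat \<Rightarrow> 'k" where "v k = (let i = k div 2 div n; j = k div 2 mod n in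
      if even k then (if i = Suc j mod n then 1 else 0) else (if i = 0 \<and> j = 0 then 1 else 0))" for k
  define ev where "ev = mp_eval (\<lambda>c :: 'k. c) v"
  interpret ev: comm_ring_hom ev unfolding ev_def by (rule comm_ring_hom_mp_eval[OF comm_ring_hom_id])
  have ev_var: "ev (mp_var k) = v k" for k by (simp add: ev_def mp_eval_single)
  define Sp :: "'k mvpoly mat" where "Sp = mat n n (\<lambda>(i, j). mp_var (2 * (i * n + j)))"
  define Tp :: "'k mvpoly mat" where "Tp = mat n n (\<lambda>(i, j). mp_var (2 * (i * n + j) + 1))"
  define P :: "'k mat" where "P = mat n n (\<lambda>(i, j). if i = Suc j mod n then 1 else 0)"
  have carr: "Sp \<in> carrier_mat n n" "Tp \<in> carrier_mat n n" "P \<in> carrier_mat n n"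
    by (simp_all add: Sp_def Tp_def P_def)
  have FS: "map_mat F Sp = generic_mat_s n" "map_mat F Tp = generic_mat_t n"
    by (auto intro!: eq_matI simp: Sp_def Tp_def generic_mat_s_def generic_mat_t_def F_def rvar_def)
  have evS: "map_mat ev Sp = P"
  proof (rule eq_matI)
    fix i j assume "i < dim_row P" "j < dim_col P"
    then have "i < n" "j < n" by (auto simp: P_def)
    then show "map_mat ev Sp $$ (i, j) = P $$ (i, j)" by (simp add: Sp_def P_def ev_var v_def del: One_nat_def)
  qed (simp_all add: Sp_def P_def)
  have evT: "map_mat ev Tp = mat_unit n 0 0"
  proof (rule eq_matI)
    fix i j assume "i < dim_row (mat_unit n 0 0 :: 'k mat)" "j < dim_col (mat_unit n 0 0 :: 'k mat)"
    then have "i < n" "j < n" by (auto simp: mat_unit_def)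
    moreover have "(2 * (i * n + j) + 1) div 2 = i * n + j" by simp
    ultimately show "map_mat ev Tp $$ (i, j) = mat_unit n 0 0 $$ (i, j)"
      by (simp add: Tp_def mat_unit_def ev_var v_def Let_def del: One_nat_def)
  qed (simp_all add: Tp_def mat_unit_def)
  have P_pow: "(P ^\<^sub>m k) $$ (i, j) = (if i = (j + k) mod n then 1 else 0)" if "i < n" "j < n" for i j k
    using that
  proof (induction k arbitrary: j)
    case (Suc k)
    have "(P ^\<^sub>m Suc k) $$ (i, j) = (\<Sum>c<n. (P ^\<^sub>m k) $$ (i, c) * P $$ (c, j))"
      using mat_mult_entry[OF pow_carrier_mat[OF carr(3)] carr(3) Suc.prems] by simp
    also have "\<dots> = (\<Sum>c<n. if c = Suc j mod n then (P ^\<^sub>m k) $$ (i, c) else 0)"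
      by (intro sum.cong refl) (use Suc.prems in \<open>simp add: P_def\<close>)
    also have "\<dots> = (P ^\<^sub>m k) $$ (i, Suc j mod n)" using n by simp
    also have "\<dots> = (if i = (j + Suc k) mod n then 1 else 0)"
      using Suc.IH[of "Suc j mod n"] Suc.prems n by (simp add: mod_add_left_eq)
    finally show ?case .
  qed (simp add: P_def)
  \<comment> \<open>The exponent n - b stands for - b: the n-th power of the cyclic permutation P is
    the identity, so the specialized word is P^a E_00 P^(-b).\<close>
  define wd where "wd a b = Sp ^\<^sub>m a * Tp * Sp ^\<^sub>m (n - b)" for a b
  have wd_carr: "wd a b \<in> carrier_mat n n" for a b
    unfolding wd_def
    by (rule mult_carrier_mat[OF mult_carrier_mat[OF pow_carrier_mat[OF carr(1)] carr(2)] pow_carrier_mat[OF carr(1)]])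
  have wd_UD: "map_mat F (wd a b) \<in> UD_set n" for a b
  proof -
    have "map_mat F (wd a b) = generic_mat_s n ^\<^sub>m a * generic_mat_t n * generic_mat_s n ^\<^sub>m (n - b)"
      unfolding wd_def F.mat_hom_mult[OF mult_carrier_mat[OF pow_carrier_mat[OF carr(1)] carr(2)] pow_carrier_mat[OF carr(1)]]
        F.mat_hom_mult[OF pow_carrier_mat[OF carr(1)] carr(2)] F.mat_hom_pow[OF carr(1)] FS ..
    then show ?thesis by (simp add: UD_set.mult UD_set_pow UD_set.gen_s UD_set.gen_t)
  qed
  have ev_wd: "map_mat ev (wd a b) = mat_unit n a b" if ab: "a < n" "b < n" for a b
  proof -
    have e: "map_mat ev (wd a b) = P ^\<^sub>m a * mat_unit n 0 0 * P ^\<^sub>m (n - b)"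
      unfolding wd_def ev.mat_hom_mult[OF mult_carrier_mat[OF pow_carrier_mat[OF carr(1)] carr(2)] pow_carrier_mat[OF carr(1)]]
        ev.mat_hom_mult[OF pow_carrier_mat[OF carr(1)] carr(2)] ev.mat_hom_pow[OF carr(1)] evS evT ..
    have "P ^\<^sub>m a * mat_unit n 0 0 = mat_unit n a 0"
    proof (rule eq_matI)
      fix i j assume "i < dim_row (mat_unit n a 0 :: 'k mat)" "j < dim_col (mat_unit n a 0 :: 'k mat)"
      then have ij: "i < n" "j < n" by (auto simp: mat_unit_def)
      show "(P ^\<^sub>m a * mat_unit n 0 0) $$ (i, j) = mat_unit n a 0 $$ (i, j)"
        unfolding mult_mat_unit_entry[OF pow_carrier_mat[OF carr(3)] ij n] P_pow[OF ij(1) n]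
        using ij ab by (simp add: mat_unit_def)
    qed (use carr(3) in \<open>auto simp: mat_unit_def\<close>)
    moreover have "mat_unit n a 0 * P ^\<^sub>m (n - b) = mat_unit n a b"
    proof (rule eq_matI)
      fix i j assume "i < dim_row (mat_unit n a b :: 'k mat)" "j < dim_col (mat_unit n a b :: 'k mat)"
      then have ij: "i < n" "j < n" by (auto simp: mat_unit_def)
      have "0 = (j + (n - b)) mod n \<longleftrightarrow> j = b"
      proof (cases "j < b")
        case True
        then show ?thesis using ab by simp
      next
        case False
        then have "j + (n - b) = (j - b) + n" using ab by simp
        then have "(j + (n - b)) mod n = (j - b + n) mod n" by (simp only:)
        also have "\<dots> = j - b" using ij by simp
        finally have "(j + (n - b)) mod n = j - b" .
        then show ?thesis using False by auto
      qed
      then show "(mat_unit n a 0 * P ^\<^sub>m (n - b)) $$ (i, j) = mat_unit n a b $$ (i, j)"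
        unfolding mat_unit_mult_entry[OF pow_carrier_mat[OF carr(3)] ij n] P_pow[OF n ij(2)]
        using ij ab by (simp add: mat_unit_def)
    qed (use carr(3) in \<open>auto simp: mat_unit_def\<close>)
    ultimately show ?thesis unfolding e by simp
  qed
  define N where "N = n * n"
  have div_mod: "t div n < n" "t mod n < n" if "t < N" for t
    using that n by (simp_all add: N_def less_mult_imp_div_less)
  \<comment> \<open>Column t lists the n^2 entries of word t. The determinant is a polynomial that
    specializes to 1, hence is nonzero, so the words are a basis of the matrices over the field of
    rational functions.\<close>
  define W where "W = mat N N (\<lambda>(r, t). wd (t div n) (t mod n) $$ (r div n, r mod n))"
  have W: "W \<in> carrier_mat N N" by (simp add: W_def)
  have "map_mat ev W = 1\<^sub>m N"
  proof (rule eq_matI)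
    fix r t assume "r < dim_row (1\<^sub>m N :: 'k mat)" "t < dim_col (1\<^sub>m N :: 'k mat)"
    then have rt: "r < N" "t < N" by auto
    have "map_mat ev W $$ (r, t) = map_mat ev (wd (t div n) (t mod n)) $$ (r div n, r mod n)"
      using rt div_mod[OF rt(1)] wd_carr[of "t div n" "t mod n"] by (simp add: W_def)
    also have "\<dots> = (if r div n = t div n \<and> r mod n = t mod n then 1 else 0)"
      unfolding ev_wd[OF div_mod[OF rt(2)]] using div_mod[OF rt(1)] by (simp add: mat_unit_def)
    also have "\<dots> = (1\<^sub>m N :: 'k mat) $$ (r, t)"
      using rt by (metis index_one_mat(1) div_mult_mod_eq)
    finally show "map_mat ev W $$ (r, t) = (1\<^sub>m N :: 'k mat) $$ (r, t)" .
  qed (simp_all add: W_def)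
  then have "ev (det W) = 1" using ev.hom_det[of W] by simp
  then have "det W \<noteq> 0" by auto
  then have "F (det W) \<noteq> 0" using F.hom_0 by blast
  then have "det (map_mat F W) \<noteq> 0" unfolding F.hom_det .
  then obtain V where V: "V \<in> carrier_mat N N" "map_mat F W * V = 1\<^sub>m N"
    using mat_inverse_of_det[of "map_mat F W" N] W by auto
  have units: "mat_unit n a b \<in> lspan n (UD_set n :: 'k ratfun mat set)" if ab: "a < n" "b < n" for a b
  proof -
    define u where "u = a * n + b"
    have u: "u < N" "u div n = a" "u mod n = b"
    proof -
      have "a * n + b < Suc a * n" using ab by simp
      also have "\<dots> \<le> n * n" using ab by (intro mult_le_mono1) simp
      finally show "u < N" by (simp add: u_def N_def)
    qed (use ab in \<open>simp_all add: u_def\<close>)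
    \<comment> \<open>Column u of the inverse V holds the coordinates of this matrix unit with
      respect to the words.\<close>
    have "mat_unit n a b = lincomb n N (\<lambda>t. V $$ (t, u)) (\<lambda>t. map_mat F (wd (t div n) (t mod n)))"
    proof (rule eq_matI)
      fix i j
      assume "i < dim_row (lincomb n N (\<lambda>t. V $$ (t, u)) (\<lambda>t. map_mat F (wd (t div n) (t mod n))))"
        "j < dim_col (lincomb n N (\<lambda>t. V $$ (t, u)) (\<lambda>t. map_mat F (wd (t div n) (t mod n))))"
      then have ij: "i < n" "j < n" by (auto simp: lincomb_def)
      define r where "r = i * n + j"
      have r: "r < N" "r div n = i" "r mod n = j"
      proof -
        have "i * n + j < Suc i * n" using ij by simp
        also have "\<dots> \<le> n * n" using ij by (intro mult_le_mono1) simp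
        finally show "r < N" by (simp add: r_def N_def)
      qed (use ij in \<open>simp_all add: r_def\<close>)
      have "(map_mat F W * V) $$ (r, u) = (\<Sum>t<N. map_mat F W $$ (r, t) * V $$ (t, u))"
        by (rule mat_mult_entry[OF _ V(1) r(1) u(1)]) (use W in simp)
      also have "\<dots> = (\<Sum>t<N. V $$ (t, u) * map_mat F (wd (t div n) (t mod n)) $$ (i, j))"
      proof (intro sum.cong refl)
        fix t assume "t \<in> {..<N}"
        then have "map_mat F W $$ (r, t) = map_mat F (wd (t div n) (t mod n)) $$ (i, j)"
          using r ij wd_carr[of "t div n" "t mod n"] by (simp add: W_def)
        then show "map_mat F W $$ (r, t) * V $$ (t, u) = V $$ (t, u) * map_mat F (wd (t div n) (t mod n)) $$ (i, j)"
          by (simp only: mult.commute)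
      qed
      finally have "lincomb n N (\<lambda>t. V $$ (t, u)) (\<lambda>t. map_mat F (wd (t div n) (t mod n))) $$ (i, j) = (1\<^sub>m N :: 'k ratfun mat) $$ (r, u)"
        unfolding lincomb_entry[OF ij] V(2) by simp
      also have "\<dots> = mat_unit n a b $$ (i, j)"
      proof -
        have "r = u \<longleftrightarrow> i = a \<and> j = b"
          using r(2,3) u(2,3) unfolding r_def u_def by metis
        then show ?thesis using r(1) u(1) ij by (simp add: mat_unit_def)
      qed
      finally show "mat_unit n a b $$ (i, j) = lincomb n N (\<lambda>t. V $$ (t, u)) (\<lambda>t. map_mat F (wd (t div n) (t mod n))) $$ (i, j)"
        by (rule sym)
    qed (simp_all add: lincomb_def mat_unit_def)
    moreover have "lincomb n N (\<lambda>t. V $$ (t, u)) (\<lambda>t. map_mat F (wd (t div n) (t mod n))) \<in> lspan n (UD_set n)"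
      by (rule lincomb_lspan) (use UD_set_carrier wd_UD in auto)
    ultimately show ?thesis by simp
  qed
  have T: "UD_set n \<subseteq> (carrier_mat n n :: 'k ratfun mat set)" using UD_set_carrier by blast
  show ?thesis
    using mat_unit_generate[of n "lspan n (UD_set n :: 'k ratfun mat set)",
        OF units lspan_add[OF _ T] lspan_smult[OF _ T] lspan_zero] by auto
qed

text \<open>The base field may lack roots of unity, so the constants of the equivariant matrices are
  taken from an algebraic closure of the rational functions. It contains the entries of the generic
  matrices as well, which can therefore be lifted as constant matrices.\<close>

locale weyl_UD = weyl_char ps n s w for ps n s and w :: "nat \<Rightarrow> 'k::field ratfun alg_closure"
begin

text \<open>The entries of the generic matrices are replaced by the entries of equivariant
  polynomial matrices S and T that specialize to them when all variables are set to 1. That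
  specialization undoes the substitution t up to the inclusion into the closure, so t is injective
  and extends to fractions. Equivariance then passes from the two generators to all of
  \<open>UD_set n\<close>, inverses included.\<close>

lemma UD_embedding:
  obtains \<tau> :: "'k ratfun \<Rightarrow> 'k ratfun alg_closure ratfun" where
    "field_hom \<tau>" "\<And>M. M \<in> UD_set n \<Longrightarrow> equivariant (map_mat \<tau> M)"
proof -
  interpret ac: field_hom "to_ac :: 'k ratfun \<Rightarrow> _" by standard simp_all
  interpret rk: field_hom "rconst :: 'k \<Rightarrow> _" by (rule field_hom_rconst)
  interpret re: field_hom "rconst :: 'k ratfun alg_closure \<Rightarrow> _" by (rule field_hom_rconst)
  have carr: "map_mat to_ac (generic_mat_s n :: 'k ratfun mat) \<in> carrier_mat n n"
    "map_mat to_ac (generic_mat_t n :: 'k ratfun mat) \<in> carrier_mat n n"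
    by (simp_all add: generic_mat_s_def generic_mat_t_def)
  obtain S where S: "S \<in> carrier_mat n n" "equivariant (map_mat (\<lambda>p. Fract p 1) S)"
    "map_mat at_one S = map_mat to_ac (generic_mat_s n :: 'k ratfun mat)"
    using equivariant_lift[OF carr(1)] by blast
  obtain T where T: "T \<in> carrier_mat n n" "equivariant (map_mat (\<lambda>p. Fract p 1) T)"
    "map_mat at_one T = map_mat to_ac (generic_mat_t n :: 'k ratfun mat)"
    using equivariant_lift[OF carr(2)] by blast
  define \<iota> :: "'k \<Rightarrow> 'k ratfun alg_closure mvpoly" where "\<iota> c = mp_const (to_ac (rconst c))" for c
  \<comment> \<open>Variables beyond the 2 n^2 entries do not occur in the generic matrices; they
    are sent to themselves as constants, which keeps the substitution injective on the whole
    polynomial ring.\<close>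
  define v where "v k = (let i = k div 2 div n; j = k div 2 mod n in
      if i < n then (if even k then S else T) $$ (i, j) else mp_const (to_ac (rvar k :: 'k ratfun)))" for k
  have \<iota>: "comm_ring_hom \<iota>"
    by standard (simp_all add: \<iota>_def rk.hom_add rk.hom_mult single_add mult_single)
  define t where "t = mp_eval \<iota> v"
  interpret t: comm_ring_hom t unfolding t_def by (rule comm_ring_hom_mp_eval[OF \<iota>])
  interpret o: comm_ring_hom at_one by (rule at_one_hom)
  have entry: "map_mat at_one S $$ (i, j) = to_ac (rvar (2 * (i * n + j)))"
    "map_mat at_one T $$ (i, j) = to_ac (rvar (2 * (i * n + j) + 1))" if "i < n" "j < n" for i j
    unfolding S(3) T(3) using that by (simp_all add: generic_mat_s_def generic_mat_t_def)
  have v_one: "at_one (v k) = to_ac (rvar k)" for k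
  proof (cases "k div 2 div n < n")
    case True
    let ?i = "k div 2 div n" and ?j = "k div 2 mod n"
    have j: "?j < n" using n_pos by simp
    show ?thesis
    proof (cases "even k")
      case even: True
      then have "at_one (v k) = map_mat at_one S $$ (?i, ?j)"
        using True j S(1) by (simp add: v_def Let_def)
      also have "\<dots> = to_ac (rvar k)"
        unfolding entry(1)[OF True j] div_mult_mod_eq using even by simp
      finally show ?thesis .
    next
      case odd: False
      then have "at_one (v k) = map_mat at_one T $$ (?i, ?j)"
        using True j T(1) by (simp add: v_def Let_def)
      also have "\<dots> = to_ac (rvar k)"
        unfolding entry(2)[OF True j] div_mult_mod_eq using odd by simp
      finally show ?thesis .
    qed
  qed (simp add: v_def at_one_const)
  have F: "comm_ring_hom (\<lambda>p :: 'k mvpoly. to_ac (Fract p 1))"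
  proof -
    interpret F: inj_comm_ring_hom "\<lambda>p :: 'k mvpoly. Fract p 1" by (rule inj_comm_ring_hom_Fract)
    show ?thesis by standard (simp_all only: F.hom_zero F.hom_one F.hom_add F.hom_mult ac.hom_zero ac.hom_one ac.hom_add ac.hom_mult)
  qed
  have comp: "at_one (t p) = to_ac (Fract p 1)" for p
  proof -
    have "at_one (t p) = mp_eval (\<lambda>c. at_one (\<iota> c)) (\<lambda>i. at_one (v i)) p"
      unfolding t_def by (rule mp_eval_comp[OF at_one_hom])
    also have "\<dots> = mp_eval (\<lambda>c. to_ac (Fract (mp_const c) 1)) (\<lambda>i. to_ac (Fract (mp_var i) 1)) p"
      unfolding v_one \<iota>_def at_one_const unfolding rvar_def rconst_def ..
    also have "\<dots> = to_ac (Fract p 1)" by (rule hom_eq_mp_eval[OF F, symmetric])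
    finally show ?thesis .
  qed
  have "p = 0" if "t p = 0" for p
  proof -
    have "to_ac (Fract p 1) = 0" unfolding comp[symmetric] that by simp
    then show ?thesis by (simp add: Zero_fract_def eq_fract)
  qed
  then have inj: "inj_comm_ring_hom t" by unfold_locales
  define \<tau> where "\<tau> = fract_map t"
  interpret \<tau>: field_hom \<tau> unfolding \<tau>_def by (rule field_hom_fract_map[OF inj])
  have \<tau>F: "\<tau> (Fract p 1) = Fract (t p) 1" for p
    unfolding \<tau>_def by (simp add: fract_map_Fract[OF inj])
  have t_var: "t (mp_var k) = v k" for k
    unfolding t_def by (subst mp_eval_single) (simp_all add: \<iota>_def single_one)
  have \<tau>_const: "\<tau> (rconst c) = rconst (to_ac (rconst c))" for c
  proof -
    have "t (mp_const c) = \<iota> c" unfolding t_def by (subst mp_eval_single) (simp_all add: \<iota>_def)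
    then show ?thesis unfolding rconst_def[of c] \<tau>F by (simp add: \<iota>_def rconst_def)
  qed
  have \<tau>_var: "\<tau> (rvar k) = Fract (v k) 1" for k
    unfolding rvar_def \<tau>F t_var ..
  have \<tau>S: "map_mat \<tau> (generic_mat_s n) = map_mat (\<lambda>p. Fract p 1) S"
  proof (rule eq_matI)
    fix i j assume "i < dim_row (map_mat (\<lambda>p. Fract p 1) S)" "j < dim_col (map_mat (\<lambda>p. Fract p 1) S)"
    then have ij: "i < n" "j < n" using S(1) by auto
    then have "v (2 * (i * n + j)) = S $$ (i, j)" by (simp add: v_def Let_def)
    then show "map_mat \<tau> (generic_mat_s n) $$ (i, j) = map_mat (\<lambda>p. Fract p 1) S $$ (i, j)"
      using ij S(1) by (simp add: generic_mat_s_def \<tau>_var)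
  qed (use S(1) in \<open>auto simp: generic_mat_s_def\<close>)
  have \<tau>T: "map_mat \<tau> (generic_mat_t n) = map_mat (\<lambda>p. Fract p 1) T"
  proof (rule eq_matI)
    fix i j assume "i < dim_row (map_mat (\<lambda>p. Fract p 1) T)" "j < dim_col (map_mat (\<lambda>p. Fract p 1) T)"
    then have ij: "i < n" "j < n" using T(1) by auto
    have "(2 * (i * n + j) + 1) div 2 = i * n + j" by simp
    then have "v (2 * (i * n + j) + 1) = T $$ (i, j)" using ij by (simp add: v_def Let_def)
    then show "map_mat \<tau> (generic_mat_t n) $$ (i, j) = map_mat (\<lambda>p. Fract p 1) T $$ (i, j)"
      using ij T(1) by (simp add: generic_mat_t_def \<tau>_var)
  qed (use T(1) in \<open>auto simp: generic_mat_t_def\<close>)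
  have \<tau>': "comm_ring_hom \<tau>" by unfold_locales
  have "equivariant (map_mat \<tau> M)" if "M \<in> UD_set n" for M
    using that
  proof (induction rule: UD_set.induct)
    case (scalar c)
    show ?case unfolding map_mat_smult_one[OF \<tau>'] \<tau>_const by (rule equivariant_rconst[OF equivariant_one])
  next
    case gen_s
    show ?case unfolding \<tau>S by (rule S(2))
  next
    case gen_t
    show ?case unfolding \<tau>T by (rule T(2))
  next
    case (add A B)
    then show ?case using map_mat_add[OF \<tau>' UD_set_carrier UD_set_carrier] equivariant_add by metis
  next
    case (mult A B)
    then show ?case using \<tau>.mat_hom_mult[OF UD_set_carrier UD_set_carrier] equivariant_mult by metis
  next
    case (inverse A B)
    have "map_mat \<tau> A * map_mat \<tau> B = 1\<^sub>m n"
      unfolding \<tau>.mat_hom_mult[OF UD_set_carrier[OF inverse.hyps(1)] inverse.hyps(2), symmetric] inverse.hyps(3)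
      by (rule \<tau>.mat_hom_one)
    moreover have "map_mat \<tau> B * map_mat \<tau> A = 1\<^sub>m n"
      unfolding \<tau>.mat_hom_mult[OF inverse.hyps(2) UD_set_carrier[OF inverse.hyps(1)], symmetric] inverse.hyps(4)
      by (rule \<tau>.mat_hom_one)
    moreover have "map_mat \<tau> B \<in> carrier_mat n n" using inverse.hyps(2) by simp
    ultimately show ?case using equivariant_inverse[OF inverse.IH] by blast
  qed
  with \<tau>.field_hom_axioms show thesis by (rule that)
qed

text \<open>Invertibility of nonzero elements, Amitsur's theorem in this setting: the embedding
  turns a nonzero element into a nonzero equivariant matrix, which has nonzero determinant. The
  inverse lies in the set by its closure rule for inverses.\<close>

lemma division_UD: "division_matrices (UD_set n :: 'k ratfun mat set) n"
proof -
  obtain \<tau> :: "'k ratfun \<Rightarrow> 'k ratfun alg_closure ratfun" where \<tau>: "field_hom \<tau>"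
    "\<And>M. M \<in> UD_set n \<Longrightarrow> equivariant (map_mat \<tau> M)"
    using UD_embedding by blast
  interpret \<tau>: field_hom \<tau> by (rule \<tau>(1))
  show ?thesis
  proof
    show "0 < n" by (rule n_pos)
    show "of_nat n \<noteq> (0 :: 'k ratfun)"
    proof
      assume "of_nat n = (0 :: 'k ratfun)"
      then have "to_ac (of_nat n :: 'k ratfun) = 0" by simp
      then have "of_nat n = (0 :: 'k ratfun alg_closure)" by simp
      then show False using char[of n] n_pos by simp
    qed
    show "UD_set n \<subseteq> (carrier_mat n n :: 'k ratfun mat set)" using UD_set_carrier by blast
    show "1\<^sub>m n \<in> (UD_set n :: 'k ratfun mat set)" by (rule UD_set_one)
    show "carrier_mat n n \<subseteq> lspan n (UD_set n :: 'k ratfun mat set)" by (rule UD_set_span[OF n_pos])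
    fix M :: "'k ratfun mat" assume M: "M \<in> UD_set n"
    show "- M \<in> UD_set n" by (rule UD_set_uminus[OF M])
    show "\<exists>N\<in>UD_set n. M * N = 1\<^sub>m n \<and> N * M = 1\<^sub>m n" if nz: "M \<noteq> 0\<^sub>m n n"
    proof -
      have "map_mat \<tau> M \<noteq> 0\<^sub>m n n"
      proof
        assume "map_mat \<tau> M = 0\<^sub>m n n"
        then have "map_mat \<tau> M = map_mat \<tau> (0\<^sub>m n n)" by (auto intro: eq_matI)
        then show False using \<tau>.mat_hom_inj nz by blast
      qed
      from equivariant_char_coeff_and_det(2)[OF \<tau>(2)[OF M] this] have "det M \<noteq> 0"
        unfolding \<tau>.hom_det by auto
      then obtain N where "N \<in> carrier_mat n n" "M * N = 1\<^sub>m n" "N * M = 1\<^sub>m n"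
        using mat_inverse_of_det[OF UD_set_carrier[OF M]] by blast
      then show ?thesis using UD_set.inverse[OF M] by blast
    qed
    fix N :: "'k ratfun mat" assume N: "N \<in> UD_set n"
    show "M + N \<in> UD_set n" "M * N \<in> UD_set n" using M N by (auto intro: UD_set.add UD_set.mult)
  qed
qed

lemma UD_nonvanishing:
  assumes m: "1 \<le> m" "\<And>i. i < s \<Longrightarrow> ps ! i dvd m"
  shows "let D = UD_algebra n :: 'k ratfun mat ring;
          \<sigma> = red_sigma TYPE('k ratfun alg_closure) D n;
          nrd = red_norm TYPE('k ratfun alg_closure) D n;
          trd = red_trace TYPE('k ratfun alg_closure) D n
      in (m \<le> n \<longrightarrow> (\<forall>x\<in>carrier D - {\<zero>\<^bsub>D\<^esub>}. \<sigma> m x \<noteq> \<zero>\<^bsub>D\<^esub>)) \<and>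
         (\<forall>xs. length xs = m \<and> set xs \<subseteq> carrier D - {\<zero>\<^bsub>D\<^esub>} \<and>
               (\<forall>x\<in>set xs. \<forall>y\<in>set xs. nrd x = nrd y) \<longrightarrow>
               trd (list_mult D xs) \<noteq> \<zero>\<^bsub>D\<^esub>) \<and>
         \<not> (\<exists>x\<in>carrier D. nrd x = \<one>\<^bsub>D\<^esub> \<and> trd x = \<zero>\<^bsub>D\<^esub>)"
proof -
  interpret D: division_matrices "UD_set n :: 'k ratfun mat set" n by (rule division_UD)
  have D_eq: "UD_algebra n = D.mat_ring" by (simp add: UD_algebra_def D.mat_ring_def)
  obtain \<tau> :: "'k ratfun \<Rightarrow> 'k ratfun alg_closure ratfun" where \<tau>: "field_hom \<tau>"
    "\<And>M. M \<in> UD_set n \<Longrightarrow> equivariant (map_mat \<tau> M)"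
    using UD_embedding by blast
  have ac: "field_hom (to_ac :: 'k ratfun \<Rightarrow> _)" by standard simp_all
  have "trace_algebra D.mat_ring n ((\<lambda>c. c \<cdot>\<^sub>m 1\<^sub>m n) ` D.scal) (\<lambda>x. map_mat to_ac x)"
    by (rule D.trace_algebra_mat_ring[OF ac char])
  from nonvanishing_transfer[OF this ac \<tau>(1) _ _ m] \<tau>(2) D.carrD
  show ?thesis unfolding Let_def D_eq D.mat_ring_simps(1) by blast
qed

end

section \<open>Monoid algebras and their quotients\<close>

locale field_set =
  fixes K :: "'f::field set"
  assumes zero: "0 \<in> K" and one: "1 \<in> K"
    and add: "\<And>a b. a \<in> K \<Longrightarrow> b \<in> K \<Longrightarrow> a + b \<in> K"
    and mult: "\<And>a b. a \<in> K \<Longrightarrow> b \<in> K \<Longrightarrow> a * b \<in> K"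
    and uminus: "\<And>a. a \<in> K \<Longrightarrow> - a \<in> K"
    and inverse: "\<And>a. a \<in> K \<Longrightarrow> inverse a \<in> K"
begin

lemma diff: "a \<in> K \<Longrightarrow> b \<in> K \<Longrightarrow> a - b \<in> K"
  using add[of a "- b"] uminus by simp

lemma power: "a \<in> K \<Longrightarrow> a ^ k \<in> K"
  by (induction k) (auto intro: one mult)

lemma sum: "(\<And>i. i \<in> S \<Longrightarrow> f i \<in> K) \<Longrightarrow> sum f S \<in> K"
  by (induction S rule: infinite_finite_induct) (auto intro: zero add)

end

text \<open>The linear extension of \<open>\<rho>\<close> to the finitely supported functions, semilinear along \<open>\<theta>\<close>.
  Elements of a monoid algebra are determined by these values, which turns identities in the
  algebra into manipulations of iterated sums.\<close>

definition lin_ext :: "('f::zero \<Rightarrow> 'l::comm_ring_1) \<Rightarrow> ('g \<Rightarrow> 'f) \<Rightarrow> ('g \<Rightarrow> 'l) \<Rightarrow> 'l" where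
  "lin_ext \<theta> f \<rho> = (\<Sum>a | f a \<noteq> 0. \<theta> (f a) * \<rho> a)"

lemma lin_ext_superset:
  assumes "finite S" "\<And>a. f a \<noteq> 0 \<Longrightarrow> a \<in> S" "\<theta> 0 = 0"
  shows "lin_ext \<theta> f \<rho> = (\<Sum>a\<in>S. \<theta> (f a) * \<rho> a)"
  unfolding lin_ext_def using assms by (intro sum.mono_neutral_left) auto

lemma lin_ext_cong: "(\<And>a. f a \<noteq> 0 \<Longrightarrow> \<rho> a = \<sigma> a) \<Longrightarrow> lin_ext \<theta> f \<rho> = lin_ext \<theta> f \<sigma>"
  by (simp add: lin_ext_def)

lemma lin_ext_mono_term: "\<theta> 0 = 0 \<Longrightarrow> lin_ext \<theta> (mono_term c g) \<rho> = \<theta> c * \<rho> g"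
  by (subst lin_ext_superset[of "{g}"]) (auto simp: mono_term_def split: if_splits)

lemma lin_ext_mult_left: "c * lin_ext \<theta> f \<rho> = lin_ext \<theta> f (\<lambda>a. c * \<rho> a)"
  by (simp add: lin_ext_def sum_distrib_left mult_ac)

lemma lin_ext_sum: "(\<Sum>i\<in>I. lin_ext \<theta> f (\<rho> i)) = lin_ext \<theta> f (\<lambda>a. \<Sum>i\<in>I. \<rho> i a)"
  unfolding lin_ext_def by (subst sum.swap) (simp add: sum_distrib_left)

lemma lin_ext_swap:
  "lin_ext \<theta> f (\<lambda>a. lin_ext \<theta> h (\<lambda>b. \<rho> a b)) = lin_ext \<theta> h (\<lambda>b. lin_ext \<theta> f (\<lambda>a. \<rho> a b))"
  unfolding lin_ext_def sum_distrib_left by (subst sum.swap) (simp add: mult_ac)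

lemma lin_ext_eqI:
  fixes f h :: "'g \<Rightarrow> 'f::field"
  assumes "finite {a. f a \<noteq> 0}" "finite {a. h a \<noteq> 0}"
    and "\<And>\<rho>. lin_ext (\<lambda>c. c) f \<rho> = lin_ext (\<lambda>c. c) h \<rho>"
  shows "f = h"
proof
  fix g
  have *: "lin_ext (\<lambda>c. c) u (\<lambda>a. if a = g then 1 else 0) = u g" if "finite {a. u a \<noteq> 0}"
    for u :: "'g \<Rightarrow> 'f"
    by (subst lin_ext_superset[of "insert g {a. u a \<noteq> 0}"])
      (use that in \<open>auto simp: sum.insert_remove if_distrib cong: if_cong\<close>)
  show "f g = h g" using *[OF assms(1)] *[OF assms(2)] assms(3) by simp
qed

locale monoid_alg = field_set K + G: Group.monoid G
  for K :: "'f::field set" and G (structure)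
begin

abbreviation R where "R \<equiv> monoid_algebra K G"

lemma R_simps:
  "f \<in> carrier R \<longleftrightarrow> finite {g. f g \<noteq> 0} \<and> (\<forall>g. f g \<in> K) \<and> (\<forall>g. g \<notin> carrier G \<longrightarrow> f g = 0)"
  "f \<oplus>\<^bsub>R\<^esub> h = (\<lambda>g. f g + h g)" "\<zero>\<^bsub>R\<^esub> = (\<lambda>g. 0)" "\<one>\<^bsub>R\<^esub> = mono_term 1 \<one>"
  "(f \<otimes>\<^bsub>R\<^esub> h) g = (\<Sum>(a, b) | f a \<noteq> 0 \<and> h b \<noteq> 0 \<and> a \<otimes> b = g. f a * h b)"
  by (simp_all add: monoid_algebra_def mono_term_def)

lemma mono_term_closed: "c \<in> K \<Longrightarrow> g \<in> carrier G \<Longrightarrow> mono_term c g \<in> carrier R"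
proof -
  assume "c \<in> K" "g \<in> carrier G"
  moreover have "{a. mono_term c g a \<noteq> 0} \<subseteq> {g}" by (auto simp: mono_term_def)
  then have "finite {a. mono_term c g a \<noteq> 0}" by (rule finite_subset) simp
  ultimately show ?thesis unfolding R_simps(1) using zero by (auto simp: mono_term_def)
qed

lemma diff_closed: "f \<in> carrier R \<Longrightarrow> h \<in> carrier R \<Longrightarrow> (\<lambda>g. f g - h g) \<in> carrier R"
proof -
  assume *: "f \<in> carrier R" "h \<in> carrier R"
  have "finite {g. f g - h g \<noteq> 0}"
    by (rule finite_subset[of _ "{g. f g \<noteq> 0} \<union> {g. h g \<noteq> 0}"]) (use * in \<open>auto simp: R_simps\<close>)
  with * show ?thesis unfolding R_simps(1) by (auto intro: diff)
qed

lemma add_closed: "f \<in> carrier R \<Longrightarrow> h \<in> carrier R \<Longrightarrow> (\<lambda>g. f g + h g) \<in> carrier R"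
proof -
  assume *: "f \<in> carrier R" "h \<in> carrier R"
  have "finite {g. f g + h g \<noteq> 0}"
    by (rule finite_subset[of _ "{g. f g \<noteq> 0} \<union> {g. h g \<noteq> 0}"]) (use * in \<open>auto simp: R_simps\<close>)
  with * show ?thesis unfolding R_simps(1) by (auto intro: add)
qed

lemma zero_closed: "(\<lambda>g. 0) \<in> carrier R"
  unfolding R_simps(1) using zero by simp

lemma lin_ext_add:
  assumes \<theta>: "comm_ring_hom \<theta>" and "f \<in> carrier R" "h \<in> carrier R"
  shows "lin_ext \<theta> (\<lambda>g. f g + h g) \<rho> = lin_ext \<theta> f \<rho> + lin_ext \<theta> h \<rho>"
proof -
  interpret comm_ring_hom \<theta> by fact
  let ?S = "{g. f g \<noteq> 0} \<union> {g. h g \<noteq> 0}"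
  have fin: "finite ?S" using assms by (simp add: R_simps)
  show ?thesis
    by (subst (1 2 3) lin_ext_superset[OF fin]) (auto simp: hom_add distrib_right sum.distrib)
qed

lemma lin_ext_diff:
  assumes \<theta>: "comm_ring_hom \<theta>" and "f \<in> carrier R" "h \<in> carrier R"
  shows "lin_ext \<theta> (\<lambda>g. f g - h g) \<rho> = lin_ext \<theta> f \<rho> - lin_ext \<theta> h \<rho>"
  using lin_ext_add[OF \<theta> diff_closed[OF assms(2,3)] assms(3), of \<rho>] by simp

lemma mult_closed_aux:
  assumes "f \<in> carrier R" "h \<in> carrier R"
  shows "finite {g. (f \<otimes>\<^bsub>R\<^esub> h) g \<noteq> 0}"
    "{g. (f \<otimes>\<^bsub>R\<^esub> h) g \<noteq> 0} \<subseteq> (\<lambda>(a, b). a \<otimes> b) ` ({a. f a \<noteq> 0} \<times> {b. h b \<noteq> 0})"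
proof -
  show sub: "{g. (f \<otimes>\<^bsub>R\<^esub> h) g \<noteq> 0} \<subseteq> (\<lambda>(a, b). a \<otimes> b) ` ({a. f a \<noteq> 0} \<times> {b. h b \<noteq> 0})"
  proof
    fix g assume "g \<in> {g. (f \<otimes>\<^bsub>R\<^esub> h) g \<noteq> 0}"
    then have "(\<Sum>(a, b) | f a \<noteq> 0 \<and> h b \<noteq> 0 \<and> a \<otimes> b = g. f a * h b) \<noteq> 0" by (simp add: R_simps)
    then have "{(a, b). f a \<noteq> 0 \<and> h b \<noteq> 0 \<and> a \<otimes> b = g} \<noteq> {}" by (metis sum.empty)
    then show "g \<in> (\<lambda>(a, b). a \<otimes> b) ` ({a. f a \<noteq> 0} \<times> {b. h b \<noteq> 0})" by force
  qed
  show "finite {g. (f \<otimes>\<^bsub>R\<^esub> h) g \<noteq> 0}"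
    by (rule finite_subset[OF sub]) (use assms in \<open>simp add: R_simps\<close>)
qed

lemma mult_closed:
  assumes f: "f \<in> carrier R" and h: "h \<in> carrier R"
  shows "f \<otimes>\<^bsub>R\<^esub> h \<in> carrier R"
  unfolding R_simps(1)
proof (intro conjI allI impI)
  show "finite {g. (f \<otimes>\<^bsub>R\<^esub> h) g \<noteq> 0}" by (rule mult_closed_aux(1)[OF f h])
  fix g
  show "(f \<otimes>\<^bsub>R\<^esub> h) g \<in> K"
    unfolding R_simps(5) by (rule sum) (use f h in \<open>auto simp: R_simps intro: mult\<close>)
  assume g: "g \<notin> carrier G"
  show "(f \<otimes>\<^bsub>R\<^esub> h) g = 0"
  proof (rule ccontr)
    assume "(f \<otimes>\<^bsub>R\<^esub> h) g \<noteq> 0"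
    then obtain a b where "f a \<noteq> 0" "h b \<noteq> 0" "g = a \<otimes> b" using mult_closed_aux(2)[OF f h] by auto
    moreover have "a \<in> carrier G" "b \<in> carrier G" using calculation f h by (auto simp: R_simps)
    ultimately show False using g by simp
  qed
qed

text \<open>Grouping the pairs (a, b) by their product turns the convolution into an iterated sum.
  The ring laws of the algebra then follow from the monoid laws under the sums.\<close>

lemma lin_ext_mult:
  assumes \<theta>: "comm_ring_hom \<theta>" and f: "f \<in> carrier R" and h: "h \<in> carrier R"
  shows "lin_ext \<theta> (f \<otimes>\<^bsub>R\<^esub> h) \<rho> = lin_ext \<theta> f (\<lambda>a. lin_ext \<theta> h (\<lambda>b. \<rho> (a \<otimes> b)))"
proof -
  interpret comm_ring_hom \<theta> by fact
  let ?P = "{a. f a \<noteq> 0} \<times> {b. h b \<noteq> 0}" and ?m = "\<lambda>(a, b). a \<otimes> b"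
  have fin: "finite ?P" using f h by (simp add: R_simps)
  have "lin_ext \<theta> (f \<otimes>\<^bsub>R\<^esub> h) \<rho> = (\<Sum>g\<in>?m ` ?P. \<theta> ((f \<otimes>\<^bsub>R\<^esub> h) g) * \<rho> g)"
    by (rule lin_ext_superset) (use fin mult_closed_aux(2)[OF f h] in auto)
  also have "\<dots> = (\<Sum>g\<in>?m ` ?P. \<Sum>x | x \<in> ?P \<and> ?m x = g. \<theta> (f (fst x)) * (\<theta> (h (snd x)) * \<rho> (?m x)))"
  proof (intro sum.cong refl)
    fix g
    have "{(a, b). f a \<noteq> 0 \<and> h b \<noteq> 0 \<and> a \<otimes> b = g} = {x \<in> ?P. ?m x = g}" by auto
    then have "\<theta> ((f \<otimes>\<^bsub>R\<^esub> h) g) * \<rho> g = (\<Sum>x | x \<in> ?P \<and> ?m x = g. \<theta> (f (fst x)) * \<theta> (h (snd x)) * \<rho> g)"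
      unfolding R_simps(5) by (simp add: hom_sum hom_mult sum_distrib_right case_prod_beta)
    also have "\<dots> = (\<Sum>x | x \<in> ?P \<and> ?m x = g. \<theta> (f (fst x)) * (\<theta> (h (snd x)) * \<rho> (?m x)))"
      by (intro sum.cong refl) (auto simp: mult.assoc)
    finally show "\<theta> ((f \<otimes>\<^bsub>R\<^esub> h) g) * \<rho> g =
      (\<Sum>x | x \<in> ?P \<and> ?m x = g. \<theta> (f (fst x)) * (\<theta> (h (snd x)) * \<rho> (?m x)))" .
  qed
  also have "\<dots> = (\<Sum>x\<in>?P. \<theta> (f (fst x)) * (\<theta> (h (snd x)) * \<rho> (?m x)))"
    by (rule sum.image_gen[OF fin, symmetric])
  also have "\<dots> = lin_ext \<theta> f (\<lambda>a. lin_ext \<theta> h (\<lambda>b. \<rho> (a \<otimes> b)))"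
    unfolding lin_ext_def sum_distrib_left by (subst sum.cartesian_product) (simp add: case_prod_beta)
  finally show ?thesis .
qed

lemma R_eqI:
  assumes "f \<in> carrier R" "h \<in> carrier R" "\<And>\<rho>. lin_ext (\<lambda>c. c) f \<rho> = lin_ext (\<lambda>c. c) h \<rho>"
  shows "f = h"
  by (rule lin_ext_eqI[OF _ _ assms(3)]) (use assms(1,2) in \<open>simp_all add: R_simps\<close>)

lemma in_carrier: "f \<in> carrier R \<Longrightarrow> f a \<noteq> 0 \<Longrightarrow> a \<in> carrier G"
  by (auto simp: R_simps)

lemma ring_R: "ring R"
proof (rule ringI)
  note id = comm_ring_hom_id
  note mult_ext = lin_ext_mult[OF id]
  show "abelian_group R"
  proof (rule abelian_groupI)
    fix f h u assume "f \<in> carrier R" "h \<in> carrier R" "u \<in> carrier R"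
    then show "f \<oplus>\<^bsub>R\<^esub> h \<in> carrier R" "f \<oplus>\<^bsub>R\<^esub> h = h \<oplus>\<^bsub>R\<^esub> f" "f \<oplus>\<^bsub>R\<^esub> h \<oplus>\<^bsub>R\<^esub> u = f \<oplus>\<^bsub>R\<^esub> (h \<oplus>\<^bsub>R\<^esub> u)"
      "\<zero>\<^bsub>R\<^esub> \<oplus>\<^bsub>R\<^esub> f = f"
      unfolding R_simps(2,3) by (simp_all add: add_closed add_ac)
    show "\<exists>y\<in>carrier R. y \<oplus>\<^bsub>R\<^esub> f = \<zero>\<^bsub>R\<^esub>"
      unfolding R_simps(2,3) by (rule bexI[OF _ diff_closed[OF zero_closed \<open>f \<in> carrier R\<close>]]) simp
  qed (simp add: R_simps(3) zero_closed)
  show "Group.monoid R"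
  proof (rule monoidI)
    show "\<one>\<^bsub>R\<^esub> \<in> carrier R" unfolding R_simps(4) by (rule mono_term_closed[OF one]) simp
    fix f h u assume f: "f \<in> carrier R" and h: "h \<in> carrier R" and u: "u \<in> carrier R"
    show fh: "f \<otimes>\<^bsub>R\<^esub> h \<in> carrier R" by (rule mult_closed[OF f h])
    have hu: "h \<otimes>\<^bsub>R\<^esub> u \<in> carrier R" by (rule mult_closed[OF h u])
    show "f \<otimes>\<^bsub>R\<^esub> h \<otimes>\<^bsub>R\<^esub> u = f \<otimes>\<^bsub>R\<^esub> (h \<otimes>\<^bsub>R\<^esub> u)"
    proof (rule R_eqI[OF mult_closed[OF fh u] mult_closed[OF f hu]])
      fix \<rho>
      have "lin_ext (\<lambda>c. c) f (\<lambda>a. lin_ext (\<lambda>c. c) h (\<lambda>b. lin_ext (\<lambda>c. c) u (\<lambda>d. \<rho> (a \<otimes> b \<otimes> d)))) =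
        lin_ext (\<lambda>c. c) f (\<lambda>a. lin_ext (\<lambda>c. c) h (\<lambda>b. lin_ext (\<lambda>c. c) u (\<lambda>d. \<rho> (a \<otimes> (b \<otimes> d)))))"
        by (intro lin_ext_cong) (simp add: G.m_assoc in_carrier[OF f] in_carrier[OF h] in_carrier[OF u])
      then show "lin_ext (\<lambda>c. c) (f \<otimes>\<^bsub>R\<^esub> h \<otimes>\<^bsub>R\<^esub> u) \<rho> = lin_ext (\<lambda>c. c) (f \<otimes>\<^bsub>R\<^esub> (h \<otimes>\<^bsub>R\<^esub> u)) \<rho>"
        unfolding mult_ext[OF fh u] mult_ext[OF f h] mult_ext[OF f hu] mult_ext[OF h u] .
    qed
  next
    fix f assume f: "f \<in> carrier R"
    have 1: "\<one>\<^bsub>R\<^esub> \<in> carrier R" unfolding R_simps(4) by (rule mono_term_closed[OF one]) simp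
    show "\<one>\<^bsub>R\<^esub> \<otimes>\<^bsub>R\<^esub> f = f"
    proof (rule R_eqI[OF mult_closed[OF 1 f] f])
      fix \<rho>
      have "lin_ext (\<lambda>c. c) f (\<lambda>a. \<rho> (\<one> \<otimes> a)) = lin_ext (\<lambda>c. c) f \<rho>"
        by (intro lin_ext_cong) (simp add: in_carrier[OF f])
      then show "lin_ext (\<lambda>c. c) (\<one>\<^bsub>R\<^esub> \<otimes>\<^bsub>R\<^esub> f) \<rho> = lin_ext (\<lambda>c. c) f \<rho>"
        unfolding mult_ext[OF 1 f] unfolding R_simps(4) by (simp add: lin_ext_mono_term)
    qed
    show "f \<otimes>\<^bsub>R\<^esub> \<one>\<^bsub>R\<^esub> = f"
    proof (rule R_eqI[OF mult_closed[OF f 1] f])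
      fix \<rho>
      have "lin_ext (\<lambda>c. c) f (\<lambda>a. \<rho> (a \<otimes> \<one>)) = lin_ext (\<lambda>c. c) f \<rho>"
        by (intro lin_ext_cong) (simp add: in_carrier[OF f])
      then show "lin_ext (\<lambda>c. c) (f \<otimes>\<^bsub>R\<^esub> \<one>\<^bsub>R\<^esub>) \<rho> = lin_ext (\<lambda>c. c) f \<rho>"
        unfolding mult_ext[OF f 1] unfolding R_simps(4) by (simp add: lin_ext_mono_term)
    qed
  qed
  fix f h u assume f: "f \<in> carrier R" and h: "h \<in> carrier R" and u: "u \<in> carrier R"
  have fh: "(\<lambda>g. f g + h g) \<in> carrier R" by (rule add_closed[OF f h])
  note fu = mult_closed[OF f u] and hu = mult_closed[OF h u] and uf = mult_closed[OF u f] and uh = mult_closed[OF u h]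
  have add_in: "lin_ext (\<lambda>c. c) u (\<lambda>a. \<rho> a + \<sigma> a) = lin_ext (\<lambda>c. c) u \<rho> + lin_ext (\<lambda>c. c) u \<sigma>" for \<rho> \<sigma>
    by (simp add: lin_ext_def distrib_left sum.distrib)
  show "(f \<oplus>\<^bsub>R\<^esub> h) \<otimes>\<^bsub>R\<^esub> u = f \<otimes>\<^bsub>R\<^esub> u \<oplus>\<^bsub>R\<^esub> h \<otimes>\<^bsub>R\<^esub> u"
    unfolding R_simps(2)
    by (rule R_eqI[OF mult_closed[OF fh u] add_closed[OF fu hu]])
      (simp only: mult_ext[OF fh u] mult_ext[OF f u] mult_ext[OF h u] lin_ext_add[OF id fu hu] lin_ext_add[OF id f h])
  show "u \<otimes>\<^bsub>R\<^esub> (f \<oplus>\<^bsub>R\<^esub> h) = u \<otimes>\<^bsub>R\<^esub> f \<oplus>\<^bsub>R\<^esub> u \<otimes>\<^bsub>R\<^esub> h"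
    unfolding R_simps(2)
    by (rule R_eqI[OF mult_closed[OF u fh] add_closed[OF uf uh]])
      (simp only: mult_ext[OF u fh] mult_ext[OF u f] mult_ext[OF u h] lin_ext_add[OF id uf uh] lin_ext_add[OF id f h] add_in)
qed

lemma mono_term_mult:
  assumes "c \<in> K" "d \<in> K" "a \<in> carrier G" "b \<in> carrier G"
  shows "mono_term c a \<otimes>\<^bsub>R\<^esub> mono_term d b = mono_term (c * d) (a \<otimes> b)"
proof -
  note ca = mono_term_closed[OF assms(1,3)] and db = mono_term_closed[OF assms(2,4)]
  show ?thesis
    by (rule R_eqI[OF mult_closed[OF ca db] mono_term_closed])
      (use assms in \<open>simp_all add: lin_ext_mult[OF comm_ring_hom_id ca db] lin_ext_mono_term mult mult.assoc\<close>)
qed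

lemma R_induct [consumes 1, case_names zero add mono]:
  assumes f: "f \<in> carrier R" and zero: "P (\<lambda>g. 0)"
    and add: "\<And>f h. f \<in> carrier R \<Longrightarrow> h \<in> carrier R \<Longrightarrow> P f \<Longrightarrow> P h \<Longrightarrow> P (\<lambda>g. f g + h g)"
    and mono: "\<And>c g. c \<in> K \<Longrightarrow> g \<in> carrier G \<Longrightarrow> P (mono_term c g)"
  shows "P f"
proof -
  have "P f" if "f \<in> carrier R" "{g. f g \<noteq> 0} \<subseteq> S" "finite S" for f S
    using that(3,1,2)
  proof (induction S arbitrary: f)
    case empty
    then have "f = (\<lambda>g. 0)" by auto
    then show ?case using zero by simp
  next
    case (insert g S)
    show ?case
    proof (cases "f g = 0")
      case True
      then show ?thesis using insert by blast
    next
      case False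
      then have g: "f g \<in> K" "g \<in> carrier G" using insert.prems(1) by (auto simp: R_simps)
      note m = mono_term_closed[OF g]
      have h: "(\<lambda>a. f a - mono_term (f g) g a) \<in> carrier R" by (rule diff_closed[OF insert.prems(1) m])
      have "P (\<lambda>a. f a - mono_term (f g) g a)"
        using insert.prems(2) by (intro insert.IH[OF h]) (auto simp: mono_term_def)
      then have "P (\<lambda>a. (f a - mono_term (f g) g a) + mono_term (f g) g a)" by (rule add[OF h m _ mono[OF g]])
      then show ?thesis by simp
    qed
  qed
  from this[OF f order_refl] f show ?thesis by (simp add: R_simps(1))
qed

end

text \<open>Meant for an F that takes one value on each coset, as it does when its kernel contains
  the ideal: the image of a coset is then a singleton, and no representative has to be
  chosen.\<close>

definition quot_map :: "('a \<Rightarrow> 'b) \<Rightarrow> 'a set \<Rightarrow> 'b" where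
  "quot_map F U = the_elem (F ` U)"

lemma
  assumes R: "ring R" and T: "ring T" and F: "F \<in> Ring.ring_hom R T"
    and S: "S \<subseteq> carrier R" "\<And>p. p \<in> S \<Longrightarrow> F p = \<zero>\<^bsub>T\<^esub>"
  shows quot_map_coset: "r \<in> carrier R \<Longrightarrow> quot_map F (genideal R S +>\<^bsub>R\<^esub> r) = F r"
    and quot_map_hom: "quot_map F \<in> Ring.ring_hom (R Quot genideal R S) T"
proof -
  interpret R: ring R by (rule R)
  interpret T: ring T by (rule T)
  interpret F: ring_hom_ring R T F by (rule ring_hom_ringI2[OF R T F])
  interpret I: ideal "genideal R S" R by (rule R.genideal_ideal[OF S(1)])
  have "S \<subseteq> a_kernel R T F"
  proof
    fix p assume "p \<in> S"
    then have "p \<in> carrier R \<and> F p = \<zero>\<^bsub>T\<^esub>" using S(1) S(2)[of p] by blast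
    then show "p \<in> a_kernel R T F" unfolding a_kernel_def' by (rule CollectI)
  qed
  then have sub: "genideal R S \<subseteq> a_kernel R T F"
    by (rule R.genideal_minimal[OF F.kernel_is_ideal])
  show val: "quot_map F (genideal R S +>\<^bsub>R\<^esub> r) = F r" if r: "r \<in> carrier R" for r
  proof -
    have "F ` (genideal R S +>\<^bsub>R\<^esub> r) = {F r}"
    proof
      show "F ` (genideal R S +>\<^bsub>R\<^esub> r) \<subseteq> {F r}"
      proof (rule image_subsetI)
        fix y assume "y \<in> genideal R S +>\<^bsub>R\<^esub> r"
        then obtain i where i: "i \<in> genideal R S" "y = i \<oplus>\<^bsub>R\<^esub> r" unfolding a_r_coset_def' by blast
        have "i \<in> a_kernel R T F" by (rule subsetD[OF sub i(1)])
        then have "i \<in> carrier R \<and> F i = \<zero>\<^bsub>T\<^esub>" unfolding a_kernel_def' by (rule CollectD)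
        then have i': "i \<in> carrier R" "F i = \<zero>\<^bsub>T\<^esub>" using conjunct1 conjunct2 by blast+
        show "F y \<in> {F r}" unfolding i(2) F.hom_add[OF i'(1) r] i'(2) using F.hom_closed[OF r] by simp
      qed
      show "{F r} \<subseteq> F ` (genideal R S +>\<^bsub>R\<^esub> r)"
        using I.a_rcos_self[OF r] by blast
    qed
    then show ?thesis by (simp add: quot_map_def)
  qed
  have coset: "\<exists>r\<in>carrier R. U = genideal R S +>\<^bsub>R\<^esub> r" if "U \<in> carrier (R Quot genideal R S)" for U
    using that by (auto simp: FactRing_def A_RCOSETS_def')
  show "quot_map F \<in> Ring.ring_hom (R Quot genideal R S) T"
  proof (rule ring_hom_memI)
    fix U assume "U \<in> carrier (R Quot genideal R S)"
    then obtain r where r: "r \<in> carrier R" "U = genideal R S +>\<^bsub>R\<^esub> r" using coset by blast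
    show "quot_map F U \<in> carrier T" unfolding r(2) val[OF r(1)] by (rule F.hom_closed[OF r(1)])
    fix Y assume "Y \<in> carrier (R Quot genideal R S)"
    then obtain u where u: "u \<in> carrier R" "Y = genideal R S +>\<^bsub>R\<^esub> u" using coset by blast
    note h = I.rcos_ring_hom
    show "quot_map F (U \<otimes>\<^bsub>R Quot genideal R S\<^esub> Y) = quot_map F U \<otimes>\<^bsub>T\<^esub> quot_map F Y"
      unfolding r(2) u(2) ring_hom_mult[OF h r(1) u(1), symmetric] val[OF r(1)] val[OF u(1)]
      using r(1) u(1) by (simp add: val)
    show "quot_map F (U \<oplus>\<^bsub>R Quot genideal R S\<^esub> Y) = quot_map F U \<oplus>\<^bsub>T\<^esub> quot_map F Y"
      unfolding r(2) u(2) ring_hom_add[OF h r(1) u(1), symmetric] val[OF r(1)] val[OF u(1)]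
      using r(1) u(1) by (simp add: val)
  next
    show "quot_map F \<one>\<^bsub>R Quot genideal R S\<^esub> = \<one>\<^bsub>T\<^esub>"
      unfolding ring_hom_one[OF I.rcos_ring_hom, symmetric] by (simp add: val)
  qed
qed

locale monoid_alg_quot = monoid_alg K G for K :: "'f::field set" and G (structure) +
  fixes S :: "('a \<Rightarrow> 'f) set"
  assumes S_carrier: "S \<subseteq> carrier (monoid_algebra K G)"
begin

abbreviation Q where "Q \<equiv> R Quot genideal R S"

definition cls where "cls f = genideal R S +>\<^bsub>R\<^esub> f"
definition sc where "sc c = cls (mono_term c \<one>)"
definition gen where "gen g = cls (mono_term 1 g)"

sublocale R: ring R by (rule ring_R)
sublocale I: ideal "genideal R S" R by (rule R.genideal_ideal[OF S_carrier])
sublocale Q: ring Q by (rule I.quotient_is_ring)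

lemma cls_hom: "cls \<in> Ring.ring_hom R Q"
  unfolding cls_def[abs_def] by (rule I.rcos_ring_hom)

lemma cls_closed: "f \<in> carrier R \<Longrightarrow> cls f \<in> carrier Q"
  by (rule ring_hom_closed[OF cls_hom])

lemma cls_add: "f \<in> carrier R \<Longrightarrow> h \<in> carrier R \<Longrightarrow> cls (\<lambda>g. f g + h g) = cls f \<oplus>\<^bsub>Q\<^esub> cls h"
  using ring_hom_add[OF cls_hom] unfolding R_simps(2) .

lemma cls_mult: "f \<in> carrier R \<Longrightarrow> h \<in> carrier R \<Longrightarrow> cls (f \<otimes>\<^bsub>R\<^esub> h) = cls f \<otimes>\<^bsub>Q\<^esub> cls h"
  by (rule ring_hom_mult[OF cls_hom])

lemma cls_zero: "cls (\<lambda>g. 0) = \<zero>\<^bsub>Q\<^esub>"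
proof -
  interpret h: ring_hom_ring R Q cls by (rule ring_hom_ringI2[OF R.ring_axioms Q.ring_axioms cls_hom])
  show ?thesis using h.hom_zero unfolding R_simps(3) .
qed

lemma carrier_Q: "U \<in> carrier Q \<Longrightarrow> \<exists>f\<in>carrier R. U = cls f"
  by (auto simp: FactRing_def A_RCOSETS_def' cls_def)

lemma cls_eq:
  assumes p: "p \<in> carrier R" and q: "q \<in> carrier R" and "p - q \<in> S"
  shows "cls p = cls q"
proof -
  have pq: "p - q \<in> carrier R" using diff_closed[OF p q] by (simp add: fun_diff_def)
  have "p - q \<in> genideal R S" using R.genideal_self[OF S_carrier] assms(3) by blast
  then have "cls (p - q) = \<zero>\<^bsub>Q\<^esub>" unfolding cls_def FactRing_def by (simp add: I.a_rcos_const)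
  moreover have "cls p = cls (p - q) \<oplus>\<^bsub>Q\<^esub> cls q"
    using cls_add[OF pq q] by simp
  ultimately show ?thesis using cls_closed[OF q] by simp
qed

lemma sc_closed [simp]: "c \<in> K \<Longrightarrow> sc c \<in> carrier Q"
  unfolding sc_def by (rule cls_closed[OF mono_term_closed]) simp_all

lemma gen_closed [simp]: "g \<in> carrier G \<Longrightarrow> gen g \<in> carrier Q"
  unfolding gen_def by (rule cls_closed[OF mono_term_closed]) (simp_all add: one)

lemma cls_mono_term: "c \<in> K \<Longrightarrow> g \<in> carrier G \<Longrightarrow> cls (mono_term c g) = sc c \<otimes>\<^bsub>Q\<^esub> gen g"
  unfolding sc_def gen_def by (subst cls_mult[symmetric]) (simp_all add: mono_term_closed mono_term_mult one)

lemma sc_one: "sc 1 = \<one>\<^bsub>Q\<^esub>"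
  unfolding sc_def R_simps(4)[symmetric] by (rule ring_hom_one[OF cls_hom])

lemma gen_one: "gen \<one> = \<one>\<^bsub>Q\<^esub>"
  using sc_one by (simp add: sc_def gen_def)

lemma sc_zero: "sc 0 = \<zero>\<^bsub>Q\<^esub>"
  unfolding sc_def cls_zero[symmetric] by (simp add: mono_term_def)

lemma sc_add: "c \<in> K \<Longrightarrow> d \<in> K \<Longrightarrow> sc (c + d) = sc c \<oplus>\<^bsub>Q\<^esub> sc d"
proof -
  assume cd: "c \<in> K" "d \<in> K"
  have "mono_term (c + d) \<one> = (\<lambda>g. mono_term c \<one> g + mono_term d \<one> g)" by (auto simp: mono_term_def)
  then show ?thesis unfolding sc_def using cls_add[OF mono_term_closed[OF cd(1)] mono_term_closed[OF cd(2)]] by simp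
qed

lemma sc_mult: "c \<in> K \<Longrightarrow> d \<in> K \<Longrightarrow> sc (c * d) = sc c \<otimes>\<^bsub>Q\<^esub> sc d"
  unfolding sc_def by (subst cls_mult[symmetric]) (simp_all add: mono_term_closed mono_term_mult)

lemma gen_mult: "g \<in> carrier G \<Longrightarrow> h \<in> carrier G \<Longrightarrow> gen (g \<otimes> h) = gen g \<otimes>\<^bsub>Q\<^esub> gen h"
  unfolding gen_def by (subst cls_mult[symmetric]) (simp_all add: mono_term_closed mono_term_mult one)

lemma Q_induct [consumes 1, case_names zero add mono]:
  assumes x: "x \<in> carrier Q" and zero: "P \<zero>\<^bsub>Q\<^esub>"
    and add: "\<And>x y. x \<in> carrier Q \<Longrightarrow> y \<in> carrier Q \<Longrightarrow> P x \<Longrightarrow> P y \<Longrightarrow> P (x \<oplus>\<^bsub>Q\<^esub> y)"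
    and mono: "\<And>c g. c \<in> K \<Longrightarrow> g \<in> carrier G \<Longrightarrow> P (sc c \<otimes>\<^bsub>Q\<^esub> gen g)"
  shows "P x"
proof -
  obtain f where f: "f \<in> carrier R" "x = cls f" using carrier_Q[OF x] by blast
  from f(1) have "P (cls f)"
  proof (induction f rule: R_induct)
    case zero
    show ?case unfolding cls_zero by (rule assms(2))
  next
    case (add f h)
    then show ?case unfolding cls_add[OF add(1,2)] by (intro assms(3) cls_closed)
  next
    case (mono c g)
    then show ?case unfolding cls_mono_term[OF mono] by (rule assms(4))
  qed
  then show ?thesis by (simp add: f(2))
qed

lemma sc_central: "c \<in> K \<Longrightarrow> x \<in> carrier Q \<Longrightarrow> sc c \<otimes>\<^bsub>Q\<^esub> x = x \<otimes>\<^bsub>Q\<^esub> sc c"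
proof -
  assume c: "c \<in> K" and "x \<in> carrier Q"
  then obtain f where f: "f \<in> carrier R" "x = cls f" using carrier_Q by blast
  have m: "mono_term c \<one> \<in> carrier R" by (rule mono_term_closed[OF c]) simp
  have "mono_term c \<one> \<otimes>\<^bsub>R\<^esub> f = f \<otimes>\<^bsub>R\<^esub> mono_term c \<one>"
  proof (rule R_eqI[OF mult_closed[OF m f(1)] mult_closed[OF f(1) m]])
    fix \<rho>
    have "lin_ext (\<lambda>c. c) f (\<lambda>b. c * \<rho> (\<one> \<otimes> b)) = lin_ext (\<lambda>c. c) f (\<lambda>a. c * \<rho> (a \<otimes> \<one>))"
      by (intro lin_ext_cong) (simp add: in_carrier[OF f(1)])
    then show "lin_ext (\<lambda>c. c) (mono_term c \<one> \<otimes>\<^bsub>R\<^esub> f) \<rho> = lin_ext (\<lambda>c. c) (f \<otimes>\<^bsub>R\<^esub> mono_term c \<one>) \<rho>"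
      unfolding lin_ext_mult[OF comm_ring_hom_id m f(1)] lin_ext_mult[OF comm_ring_hom_id f(1) m]
      by (simp add: lin_ext_mono_term lin_ext_mult_left)
  qed
  then show ?thesis unfolding f(2) sc_def cls_mult[OF m f(1), symmetric] cls_mult[OF f(1) m, symmetric] by simp
qed

definition lin_mat :: "('f \<Rightarrow> 'l::comm_ring_1) \<Rightarrow> nat \<Rightarrow> ('a \<Rightarrow> 'l mat) \<Rightarrow> ('a \<Rightarrow> 'f) \<Rightarrow> 'l mat" where
  "lin_mat \<theta> n \<rho> f = mat n n (\<lambda>x. lin_ext \<theta> f (\<lambda>a. \<rho> a $$ x))"

lemma lin_mat_mono_term:
  assumes "comm_ring_hom \<theta>" "\<rho> g \<in> carrier_mat n n"
  shows "lin_mat \<theta> n \<rho> (mono_term c g) = \<theta> c \<cdot>\<^sub>m \<rho> g"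
proof -
  interpret comm_ring_hom \<theta> by fact
  show ?thesis unfolding lin_mat_def using assms(2) by (intro eq_matI) (auto simp: lin_ext_mono_term)
qed

lemma lin_mat_diff:
  assumes "comm_ring_hom \<theta>" "f \<in> carrier R" "h \<in> carrier R"
  shows "lin_mat \<theta> n \<rho> (f - h) = lin_mat \<theta> n \<rho> f - lin_mat \<theta> n \<rho> h"
  unfolding lin_mat_def using lin_ext_diff[OF assms] by (intro eq_matI) (auto simp: fun_diff_def)

text \<open>The universal property: a matrix representation of the monoid extends linearly along
  \<open>\<theta>\<close> to the monoid algebra, and it factors through the quotient once the
  relations act as zero.\<close>

lemma representation:
  fixes \<rho> :: "'a \<Rightarrow> 'l::comm_ring_1 mat"
  assumes \<theta>: "comm_ring_hom \<theta>"
    and \<rho>: "\<And>a. a \<in> carrier G \<Longrightarrow> \<rho> a \<in> carrier_mat n n" "\<rho> \<one> = 1\<^sub>m n"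
      "\<And>a b. a \<in> carrier G \<Longrightarrow> b \<in> carrier G \<Longrightarrow> \<rho> (a \<otimes> b) = \<rho> a * \<rho> b"
    and rel: "\<And>p. p \<in> S \<Longrightarrow> lin_mat \<theta> n \<rho> p = 0\<^sub>m n n"
  shows "\<exists>\<Psi>. \<Psi> \<in> Ring.ring_hom Q (ring_mat TYPE('l) n ()) \<and>
    (\<forall>c\<in>K. \<forall>g\<in>carrier G. \<Psi> (sc c \<otimes>\<^bsub>Q\<^esub> gen g) = \<theta> c \<cdot>\<^sub>m \<rho> g)"
proof -
  interpret t: comm_ring_hom \<theta> by fact
  let ?F = "lin_mat \<theta> n \<rho>" and ?T = "ring_mat TYPE('l) n ()"
  have T: "ring ?T" by (rule ring_mat)
  have F: "?F \<in> Ring.ring_hom R ?T"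
  proof (rule ring_hom_memI)
    fix f h assume f: "f \<in> carrier R" and h: "h \<in> carrier R"
    show "?F (f \<oplus>\<^bsub>R\<^esub> h) = ?F f \<oplus>\<^bsub>?T\<^esub> ?F h"
      unfolding R_simps(2) ring_mat_simps lin_mat_def lin_ext_add[OF \<theta> f h] by (intro eq_matI) auto
    show "?F (f \<otimes>\<^bsub>R\<^esub> h) = ?F f \<otimes>\<^bsub>?T\<^esub> ?F h"
      unfolding ring_mat_simps
    proof (rule eq_matI)
      fix i j assume "i < dim_row (?F f * ?F h)" "j < dim_col (?F f * ?F h)"
      then have ij: "i < n" "j < n" by (auto simp: lin_mat_def)
      have "(?F f * ?F h) $$ (i, j) = (\<Sum>k<n. ?F f $$ (i, k) * ?F h $$ (k, j))"
        by (rule mat_mult_entry[OF _ _ ij]) (simp_all add: lin_mat_def)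
      also have "\<dots> = (\<Sum>k<n. lin_ext \<theta> h (\<lambda>b. lin_ext \<theta> f (\<lambda>a. \<rho> a $$ (i, k) * \<rho> b $$ (k, j))))"
        using ij by (intro sum.cong refl)
          (simp add: lin_mat_def lin_ext_mult_left mult.commute)
      also have "\<dots> = lin_ext \<theta> f (\<lambda>a. lin_ext \<theta> h (\<lambda>b. \<Sum>k<n. \<rho> a $$ (i, k) * \<rho> b $$ (k, j)))"
        unfolding lin_ext_sum by (rule lin_ext_swap)
      also have "\<dots> = lin_ext \<theta> f (\<lambda>a. lin_ext \<theta> h (\<lambda>b. \<rho> (a \<otimes> b) $$ (i, j)))"
      proof (intro lin_ext_cong)
        fix a b assume "f a \<noteq> 0" "h b \<noteq> 0"
        then have ab: "a \<in> carrier G" "b \<in> carrier G" using in_carrier f h by auto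
        show "(\<Sum>k<n. \<rho> a $$ (i, k) * \<rho> b $$ (k, j)) = \<rho> (a \<otimes> b) $$ (i, j)"
          unfolding \<rho>(3)[OF ab] by (rule mat_mult_entry[OF \<rho>(1)[OF ab(1)] \<rho>(1)[OF ab(2)] ij, symmetric])
      qed
      also have "\<dots> = ?F (f \<otimes>\<^bsub>R\<^esub> h) $$ (i, j)"
        using ij by (simp add: lin_mat_def lin_ext_mult[OF \<theta> f h])
      finally show "?F (f \<otimes>\<^bsub>R\<^esub> h) $$ (i, j) = (?F f * ?F h) $$ (i, j)" by (rule sym)
    qed (simp_all add: lin_mat_def)
  next
    show "?F \<one>\<^bsub>R\<^esub> = \<one>\<^bsub>?T\<^esub>"
      unfolding R_simps(4) ring_mat_simps using \<rho>(1,2) by (simp add: lin_mat_mono_term[OF \<theta>] smult_one_mat')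
  qed (simp add: lin_mat_def ring_mat_simps)
  have rel': "?F p = \<zero>\<^bsub>?T\<^esub>" if "p \<in> S" for p using rel[OF that] by (simp add: ring_mat_simps)
  show ?thesis
  proof (intro exI conjI ballI)
    show "quot_map ?F \<in> Ring.ring_hom Q ?T" by (rule quot_map_hom[OF ring_R T F S_carrier rel'])
    fix c g assume cg: "c \<in> K" "g \<in> carrier G"
    have "quot_map ?F (genideal R S +>\<^bsub>R\<^esub> mono_term c g) = ?F (mono_term c g)"
      by (rule quot_map_coset[OF ring_R T F S_carrier rel' mono_term_closed[OF cg]])
    then show "quot_map ?F (sc c \<otimes>\<^bsub>Q\<^esub> gen g) = \<theta> c \<cdot>\<^sub>m \<rho> g"
      unfolding cls_mono_term[OF cg, symmetric] cls_def lin_mat_mono_term[where \<rho> = \<rho>, OF \<theta> \<rho>(1)[OF cg(2)]] .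
  qed
qed

end

section \<open>Symbol algebras\<close>

locale scalar_alg = ring A + K: field_set K for A (structure) and K :: "'f::field set" +
  fixes \<iota> :: "'f \<Rightarrow> 'a"
  assumes \<iota>_closed [simp]: "c \<in> K \<Longrightarrow> \<iota> c \<in> carrier A"
    and \<iota>_add: "c \<in> K \<Longrightarrow> d \<in> K \<Longrightarrow> \<iota> (c + d) = \<iota> c \<oplus> \<iota> d"
    and \<iota>_mult: "c \<in> K \<Longrightarrow> d \<in> K \<Longrightarrow> \<iota> (c * d) = \<iota> c \<otimes> \<iota> d"
    and \<iota>_one: "\<iota> 1 = \<one>"
    and \<iota>_central: "c \<in> K \<Longrightarrow> x \<in> carrier A \<Longrightarrow> \<iota> c \<otimes> x = x \<otimes> \<iota> c"
begin

lemma \<iota>_zero: "\<iota> 0 = \<zero>"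
proof -
  have "\<iota> 0 \<oplus> \<iota> 0 = \<iota> 0" using \<iota>_add[OF K.zero K.zero] by simp
  then show ?thesis using K.zero by simp
qed

lemma \<iota>_left: "c \<in> K \<Longrightarrow> d \<in> K \<Longrightarrow> x \<in> carrier A \<Longrightarrow> \<iota> c \<otimes> (\<iota> d \<otimes> x) = \<iota> (c * d) \<otimes> x"
  by (simp add: \<iota>_mult m_assoc)

lemma \<iota>_pull: "c \<in> K \<Longrightarrow> x \<in> carrier A \<Longrightarrow> y \<in> carrier A \<Longrightarrow> x \<otimes> (\<iota> c \<otimes> y) = \<iota> c \<otimes> (x \<otimes> y)"
proof -
  assume *: "c \<in> K" "x \<in> carrier A" "y \<in> carrier A"
  have "x \<otimes> (\<iota> c \<otimes> y) = (x \<otimes> \<iota> c) \<otimes> y" using * by (simp add: m_assoc)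
  also have "\<dots> = (\<iota> c \<otimes> x) \<otimes> y" by (simp only: \<iota>_central[OF *(1,2)])
  also have "\<dots> = \<iota> c \<otimes> (x \<otimes> y)" using * by (simp add: m_assoc)
  finally show ?thesis .
qed

end

lemma (in monoid_alg_quot) scalar_alg_Q: "scalar_alg Q K sc"
  by (intro scalar_alg.intro scalar_alg_axioms.intro Q.ring_axioms field_set_axioms
      sc_closed sc_add sc_mult sc_one sc_central)

text \<open>An abstract form of the symbol algebra that hides the cosets. Generation is phrased as
  an induction principle with left multiplications by x and y, matching words read from the left.
  Independence of the monomials is obtained only later, from traces.\<close>

locale symbol_presentation = scalar_alg A K \<iota> for A (structure) and K :: "'f::field set" and \<iota> +
  fixes x y and r :: nat and \<zeta> z w :: 'f
  assumes xy [simp]: "x \<in> carrier A" "y \<in> carrier A"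
    and r: "0 < r" and coeffs [simp]: "\<zeta> \<in> K" "z \<in> K" "w \<in> K"
    and x_pow: "x [^] r = \<iota> z" and y_pow: "y [^] r = \<iota> w"
    and yx: "y \<otimes> x = \<iota> \<zeta> \<otimes> (x \<otimes> y)"
    and generated: "\<And>V b. \<lbrakk>b \<in> carrier A; \<one> \<in> V;
      \<And>a b. a \<in> V \<Longrightarrow> b \<in> V \<Longrightarrow> a \<oplus> b \<in> V; \<And>c b. c \<in> K \<Longrightarrow> b \<in> V \<Longrightarrow> \<iota> c \<otimes> b \<in> V;
      \<And>b. b \<in> V \<Longrightarrow> x \<otimes> b \<in> V; \<And>b. b \<in> V \<Longrightarrow> y \<otimes> b \<in> V\<rbrakk> \<Longrightarrow> b \<in> V"
begin

definition mon where "mon e f = x [^] (e :: nat) \<otimes> y [^] (f :: nat)"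

lemma mon_closed [simp]: "mon e f \<in> carrier A"
  by (simp add: mon_def)

lemma y_x_pow: "y \<otimes> x [^] (e :: nat) = \<iota> (\<zeta> ^ e) \<otimes> (x [^] e \<otimes> y)"
proof (induction e)
  case (Suc e)
  have k: "\<zeta> ^ e \<in> K" by (rule K.power) simp
  have "y \<otimes> x [^] Suc e = (y \<otimes> x [^] e) \<otimes> x" by (simp add: m_assoc)
  also have "\<dots> = \<iota> (\<zeta> ^ e) \<otimes> (x [^] e \<otimes> (y \<otimes> x))" unfolding Suc using k by (simp add: m_assoc)
  also have "\<dots> = \<iota> (\<zeta> ^ e) \<otimes> (\<iota> \<zeta> \<otimes> (x [^] e \<otimes> (x \<otimes> y)))" unfolding yx by (simp add: \<iota>_pull)
  also have "\<dots> = \<iota> (\<zeta> ^ Suc e) \<otimes> (x [^] Suc e \<otimes> y)"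
    using k by (simp add: \<iota>_left m_assoc mult.commute)
  finally show ?case .
qed (simp add: \<iota>_one)

lemma y_pow_x: "y [^] (f :: nat) \<otimes> x = \<iota> (\<zeta> ^ f) \<otimes> (x \<otimes> y [^] f)"
proof (induction f)
  case (Suc f)
  have k: "\<zeta> ^ f \<in> K" by (rule K.power) simp
  have "y [^] Suc f \<otimes> x = y [^] f \<otimes> (\<iota> \<zeta> \<otimes> (x \<otimes> y))" by (simp add: m_assoc yx)
  also have "\<dots> = \<iota> \<zeta> \<otimes> ((y [^] f \<otimes> x) \<otimes> y)" by (simp add: \<iota>_pull m_assoc)
  also have "\<dots> = \<iota> \<zeta> \<otimes> (\<iota> (\<zeta> ^ f) \<otimes> (x \<otimes> y [^] Suc f))" unfolding Suc using k by (simp add: m_assoc)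
  also have "\<dots> = \<iota> (\<zeta> ^ Suc f) \<otimes> (x \<otimes> y [^] Suc f)" using k by (simp add: \<iota>_left)
  finally show ?case .
qed (simp add: \<iota>_one)

lemma y_mon: "y \<otimes> mon e f = \<iota> (\<zeta> ^ e) \<otimes> (mon e f \<otimes> y)"
proof -
  have k: "\<zeta> ^ e \<in> K" by (rule K.power) simp
  have "y \<otimes> mon e f = (y \<otimes> x [^] e) \<otimes> y [^] f" by (simp add: mon_def m_assoc)
  also have "\<dots> = \<iota> (\<zeta> ^ e) \<otimes> (x [^] e \<otimes> (y \<otimes> y [^] f))" unfolding y_x_pow using k by (simp add: m_assoc)
  also have "y \<otimes> y [^] f = y [^] f \<otimes> y" using nat_pow_Suc2[of y f] by simp
  also have "x [^] e \<otimes> (y [^] f \<otimes> y) = mon e f \<otimes> y" by (simp add: mon_def m_assoc)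
  finally show ?thesis .
qed

lemma mon_x: "mon e f \<otimes> x = \<iota> (\<zeta> ^ f) \<otimes> (x \<otimes> mon e f)"
proof -
  have k: "\<zeta> ^ f \<in> K" by (rule K.power) simp
  have "mon e f \<otimes> x = x [^] e \<otimes> (y [^] f \<otimes> x)" by (simp add: mon_def m_assoc)
  also have "\<dots> = \<iota> (\<zeta> ^ f) \<otimes> ((x [^] e \<otimes> x) \<otimes> y [^] f)" unfolding y_pow_x using k by (simp add: \<iota>_pull m_assoc)
  also have "x [^] e \<otimes> x = x \<otimes> x [^] e" using nat_pow_Suc2[of x e] by simp
  also have "(x \<otimes> x [^] e) \<otimes> y [^] f = x \<otimes> mon e f" by (simp add: mon_def m_assoc)
  finally show ?thesis .
qed

text \<open>The span of the r^2 normal-ordered monomials. It is stable under left multiplication by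
  x and y because an exponent that reaches r wraps around to 0 through the relations for
  \<open>x [^] r\<close> and \<open>y [^] r\<close>.\<close>

inductive_set mon_span where
  mon: "e < r \<Longrightarrow> f < r \<Longrightarrow> mon e f \<in> mon_span"
| add: "a \<in> mon_span \<Longrightarrow> b \<in> mon_span \<Longrightarrow> a \<oplus> b \<in> mon_span"
| scale: "c \<in> K \<Longrightarrow> b \<in> mon_span \<Longrightarrow> \<iota> c \<otimes> b \<in> mon_span"

lemma mon_span_closed: "b \<in> mon_span \<Longrightarrow> b \<in> carrier A"
  by (induction rule: mon_span.induct) auto

lemma x_mon_span: "b \<in> mon_span \<Longrightarrow> x \<otimes> b \<in> mon_span"
proof (induction rule: mon_span.induct)
  case (mon e f)
  have *: "x \<otimes> mon e f = mon (Suc e) f"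
    unfolding mon_def nat_pow_Suc2[OF xy(1)] by (simp add: m_assoc)
  show ?case
  proof (cases "Suc e < r")
    case True
    then show ?thesis unfolding * using mon by (intro mon_span.mon) auto
  next
    case False
    then have "Suc e = r" using mon by simp
    then have "x \<otimes> mon e f = \<iota> z \<otimes> mon 0 f" unfolding * by (simp add: mon_def x_pow)
    then show ?thesis using mon r by (simp add: mon_span.mon mon_span.scale)
  qed
next
  case (add a b)
  then show ?case using mon_span_closed[of a] mon_span_closed[of b] by (simp add: r_distr mon_span.add)
next
  case (scale c b)
  then show ?case using mon_span_closed[of b] by (simp add: \<iota>_pull mon_span.scale)
qed

lemma y_mon_span: "b \<in> mon_span \<Longrightarrow> y \<otimes> b \<in> mon_span"
proof (induction rule: mon_span.induct)
  case (mon e f)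
  have k: "\<zeta> ^ e \<in> K" by (rule K.power) simp
  have *: "y \<otimes> mon e f = \<iota> (\<zeta> ^ e) \<otimes> mon e (Suc f)"
    unfolding y_mon by (simp add: mon_def m_assoc)
  show ?case
  proof (cases "Suc f < r")
    case True
    then show ?thesis unfolding * using mon k by (intro mon_span.scale mon_span.mon) auto
  next
    case False
    then have "Suc f = r" using mon by simp
    then have "mon e (Suc f) = \<iota> w \<otimes> mon e 0" by (simp add: mon_def y_pow \<iota>_central)
    then show ?thesis unfolding * using mon r k by (simp add: mon_span.mon mon_span.scale)
  qed
next
  case (add a b)
  then show ?case using mon_span_closed[of a] mon_span_closed[of b] by (simp add: r_distr mon_span.add)
next
  case (scale c b)
  then show ?case using mon_span_closed[of b] by (simp add: \<iota>_pull mon_span.scale)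
qed

lemma span [consumes 1, case_names mon add scale]:
  assumes b: "b \<in> carrier A" and mon: "\<And>e f. e < r \<Longrightarrow> f < r \<Longrightarrow> P (mon e f)"
    and add: "\<And>a b. a \<in> carrier A \<Longrightarrow> b \<in> carrier A \<Longrightarrow> P a \<Longrightarrow> P b \<Longrightarrow> P (a \<oplus> b)"
    and scale: "\<And>c b. c \<in> K \<Longrightarrow> b \<in> carrier A \<Longrightarrow> P b \<Longrightarrow> P (\<iota> c \<otimes> b)"
  shows "P b"
proof -
  have "\<one> = mon 0 0" by (simp add: mon_def)
  then have 1: "\<one> \<in> mon_span" using mon_span.mon[OF r r] by simp
  have "b \<in> mon_span"
  proof (rule generated[OF b 1])
    show "a \<oplus> c \<in> mon_span" if "a \<in> mon_span" "c \<in> mon_span" for a c using that by (rule mon_span.add)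
    show "\<iota> c \<otimes> a \<in> mon_span" if "c \<in> K" "a \<in> mon_span" for c a using that by (rule mon_span.scale)
    show "x \<otimes> a \<in> mon_span" if "a \<in> mon_span" for a using that by (rule x_mon_span)
    show "y \<otimes> a \<in> mon_span" if "a \<in> mon_span" for a using that by (rule y_mon_span)
  qed
  then show ?thesis
  proof (induction rule: mon_span.induct)
    case (mon e f)
    then show ?case by (rule assms(2))
  next
    case (add a b)
    show ?case by (rule assms(3)[OF mon_span_closed[OF add(1)] mon_span_closed[OF add(2)] add(3,4)])
  next
    case (scale c b)
    show ?case by (rule assms(4)[OF scale(1) mon_span_closed[OF scale(2)] scale(3)])
  qed
qed

text \<open>The inverse is \<open>u [^] (r - 1)\<close> divided by the scalar c.\<close>

lemma unit_of_pow:
  assumes "u \<in> carrier A" "u [^] r = \<iota> c" "c \<in> K" "c \<noteq> 0"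
  shows "u \<in> Units A"
proof -
  have k: "inverse c \<in> K" by (rule K.inverse[OF assms(3)])
  obtain r' where r': "r = Suc r'" using r gr0_implies_Suc by blast
  let ?v = "\<iota> (inverse c) \<otimes> u [^] r'"
  have inv: "\<iota> (inverse c) \<otimes> \<iota> c = \<one>" using assms(3,4) k by (simp flip: \<iota>_mult add: \<iota>_one)
  have "u \<otimes> ?v = \<iota> (inverse c) \<otimes> (u \<otimes> u [^] r')" using assms k by (simp add: \<iota>_pull)
  also have "u \<otimes> u [^] r' = \<iota> c" using assms(2) unfolding r' nat_pow_Suc2[OF assms(1)] .
  finally have 1: "u \<otimes> ?v = \<one>" unfolding inv .
  have "?v \<otimes> u = \<iota> (inverse c) \<otimes> (u [^] r' \<otimes> u)" using assms k by (simp add: m_assoc)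
  also have "u [^] r' \<otimes> u = \<iota> c" using assms(2) unfolding r' by simp
  finally have 2: "?v \<otimes> u = \<one>" unfolding inv .
  have "?v \<in> carrier A" using assms(1) k by simp
  then show ?thesis unfolding Units_def by (intro CollectI conjI assms(1) bexI[of _ ?v] 1 2)
qed

lemma xy_units:
  assumes "z \<noteq> 0" "w \<noteq> 0"
  shows "x \<in> Units A" "y \<in> Units A" "mon e f \<in> Units A"
proof -
  show *: "x \<in> Units A" "y \<in> Units A"
    by (rule unit_of_pow[OF xy(1) x_pow coeffs(2) assms(1)], rule unit_of_pow[OF xy(2) y_pow coeffs(3) assms(2)])
  then show "mon e f \<in> Units A" unfolding mon_def by (intro Units_m_closed Units_pow_closed)
qed

end

locale symbol_alg = field_set K for K :: "'f::field set" +
  fixes r :: nat and \<zeta> z w :: 'f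
  assumes r: "0 < r" and coeffs: "\<zeta> \<in> K" "z \<in> K" "w \<in> K"
begin

lemma word_simps:
  "carrier word_monoid = UNIV" "v \<otimes>\<^bsub>word_monoid\<^esub> v' = v @ v'" "\<one>\<^bsub>word_monoid\<^esub> = []"
  by (simp_all add: word_monoid_def)

sublocale W: monoid_alg K "word_monoid :: sym_gen list monoid"
  by unfold_locales (simp_all add: word_monoid_def)

lemma relations_carrier: "symbol_relations r \<zeta> z w \<subseteq> carrier (monoid_algebra K word_monoid)"
proof -
  have m: "mono_term c v \<in> carrier (monoid_algebra K (word_monoid :: sym_gen list monoid))" if "c \<in> K" for c v
    by (rule W.mono_term_closed[OF that]) (simp add: word_simps)
  show ?thesis
    unfolding symbol_relations_def fun_diff_def
    by (intro insert_subsetI W.diff_closed m one coeffs empty_subsetI)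
qed

sublocale monoid_alg_quot K word_monoid "symbol_relations r \<zeta> z w"
  by unfold_locales (rule relations_carrier)

lemma symbol_algebra_eq: "symbol_algebra K r \<zeta> z w = Q"
  by (simp add: symbol_algebra_def symbol_ideal_def)

lemma symbol_scalar_eq: "symbol_scalar K r \<zeta> z w = sc"
  by (rule ext) (simp add: symbol_scalar_def symbol_ideal_def sc_def cls_def word_simps)

lemma gen_append: "gen (v @ v') = gen v \<otimes>\<^bsub>Q\<^esub> gen v'"
  using gen_mult[of v v'] by (simp add: word_simps)

lemma gen_Nil: "gen [] = \<one>\<^bsub>Q\<^esub>"
  using gen_one by (simp add: word_simps)

lemma gen_in [simp]: "gen v \<in> carrier Q"
  by (rule gen_closed) (simp add: word_simps)

lemma gen_replicate: "gen (replicate k a) = gen [a] [^]\<^bsub>Q\<^esub> k"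
proof (induction k)
  case (Suc k)
  have "gen (replicate (Suc k) a) = gen ([a] @ replicate k a)" by simp
  also have "\<dots> = gen [a] \<otimes>\<^bsub>Q\<^esub> gen [a] [^]\<^bsub>Q\<^esub> k" unfolding gen_append Suc ..
  also have "\<dots> = gen [a] [^]\<^bsub>Q\<^esub> Suc k" by (rule Q.nat_pow_Suc2[symmetric]) simp
  finally show ?case .
qed (simp add: gen_Nil)

lemma cls_word: "c \<in> K \<Longrightarrow> cls (mono_term c v) = sc c \<otimes>\<^bsub>Q\<^esub> gen v"
  by (rule cls_mono_term) (simp_all add: word_simps)

lemma word_closed: "c \<in> K \<Longrightarrow> mono_term c v \<in> carrier W.R"
  by (rule W.mono_term_closed) (simp_all add: word_simps)

lemma presentation: "symbol_presentation Q K sc (gen [GenX]) (gen [GenY]) r \<zeta> z w"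
proof -
  interpret scalar_alg Q K sc by (rule scalar_alg_Q)
  have rel: "sc c \<otimes>\<^bsub>Q\<^esub> gen v = sc d \<otimes>\<^bsub>Q\<^esub> gen v'"
    if "c \<in> K" "d \<in> K" "mono_term c v - mono_term d v' \<in> symbol_relations r \<zeta> z w" for c d v v'
    using cls_eq[OF word_closed[OF that(1)] word_closed[OF that(2)] that(3)] by (simp only: cls_word[OF that(1)] cls_word[OF that(2)])
  show ?thesis
  proof
    show "gen [GenX] \<in> carrier Q" "gen [GenY] \<in> carrier Q" by simp_all
    show "0 < r" "\<zeta> \<in> K" "z \<in> K" "w \<in> K" using r coeffs by auto
    have mem: "mono_term 1 (replicate r GenX) - mono_term z [] \<in> symbol_relations r \<zeta> z w"
      "mono_term 1 (replicate r GenY) - mono_term w [] \<in> symbol_relations r \<zeta> z w"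
      "mono_term 1 [GenY, GenX] - mono_term \<zeta> [GenX, GenY] \<in> symbol_relations r \<zeta> z w"
      by (simp_all add: symbol_relations_def)
    show "gen [GenX] [^]\<^bsub>Q\<^esub> r = sc z" "gen [GenY] [^]\<^bsub>Q\<^esub> r = sc w"
      using rel[OF one coeffs(2) mem(1)] rel[OF one coeffs(3) mem(2)] coeffs
      by (simp_all add: sc_one gen_Nil gen_replicate)
    show "gen [GenY] \<otimes>\<^bsub>Q\<^esub> gen [GenX] = sc \<zeta> \<otimes>\<^bsub>Q\<^esub> (gen [GenX] \<otimes>\<^bsub>Q\<^esub> gen [GenY])"
      using rel[OF one coeffs(1) mem(3)] coeffs by (simp add: sc_one flip: gen_append)
    fix V b
    assume b: "b \<in> carrier Q" and V1: "\<one>\<^bsub>Q\<^esub> \<in> V" and Va: "\<And>a b. a \<in> V \<Longrightarrow> b \<in> V \<Longrightarrow> a \<oplus>\<^bsub>Q\<^esub> b \<in> V"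
      and Vc: "\<And>c b. c \<in> K \<Longrightarrow> b \<in> V \<Longrightarrow> sc c \<otimes>\<^bsub>Q\<^esub> b \<in> V"
      and Vx: "\<And>b. b \<in> V \<Longrightarrow> gen [GenX] \<otimes>\<^bsub>Q\<^esub> b \<in> V" and Vy: "\<And>b. b \<in> V \<Longrightarrow> gen [GenY] \<otimes>\<^bsub>Q\<^esub> b \<in> V"
    have word: "gen v \<in> V" for v
    proof (induction v)
      case Nil
      then show ?case using V1 by (simp add: gen_Nil)
    next
      case (Cons a v)
      have "gen (a # v) = gen [a] \<otimes>\<^bsub>Q\<^esub> gen v" using gen_append[of "[a]" v] by simp
      then show ?case using Cons Vx Vy by (cases a) auto
    qed
    have K0: "0 \<in> K" by (rule zero)
    from b show "b \<in> V"
    proof (induction b rule: Q_induct)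
      case zero
      have "\<zero>\<^bsub>Q\<^esub> = sc 0 \<otimes>\<^bsub>Q\<^esub> \<one>\<^bsub>Q\<^esub>" by (simp add: sc_zero)
      then show ?case using Vc[OF K0 V1] by simp
    next
      case (add x y)
      then show ?case using Va by blast
    next
      case (mono c v)
      then show ?case using Vc word by blast
    qed
  qed
qed

lemma symbol_representation:
  fixes Mx My :: "'l::comm_ring_1 mat"
  assumes \<theta>: "comm_ring_hom \<theta>" and carr: "Mx \<in> carrier_mat n n" "My \<in> carrier_mat n n"
    and pow: "Mx ^\<^sub>m r = \<theta> z \<cdot>\<^sub>m 1\<^sub>m n" "My ^\<^sub>m r = \<theta> w \<cdot>\<^sub>m 1\<^sub>m n"
    and comm: "My * Mx = \<theta> \<zeta> \<cdot>\<^sub>m (Mx * My)"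
  shows "\<exists>\<Psi>. \<Psi> \<in> Ring.ring_hom Q (ring_mat TYPE('l) n ()) \<and>
    (\<forall>c\<in>K. \<Psi> (sc c) = \<theta> c \<cdot>\<^sub>m 1\<^sub>m n) \<and> \<Psi> (gen [GenX]) = Mx \<and> \<Psi> (gen [GenY]) = My"
proof -
  interpret t: comm_ring_hom \<theta> by (rule \<theta>)
  define m where "m a = (case a of GenX \<Rightarrow> Mx | GenY \<Rightarrow> My)" for a
  define \<rho> where "\<rho> v = foldr (*) (map m v) (1\<^sub>m n)" for v
  have m: "m a \<in> carrier_mat n n" for a using carr by (cases a) (auto simp: m_def)
  have \<rho>_carr: "\<rho> v \<in> carrier_mat n n" for v
  proof (induction v)
    case (Cons a v)
    then show ?case using mult_carrier_mat[OF m Cons] by (simp add: \<rho>_def)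
  qed (simp add: \<rho>_def)
  have \<rho>_Cons: "\<rho> (a # v) = m a * \<rho> v" for a v by (simp add: \<rho>_def)
  have \<rho>_append: "\<rho> (v @ v') = \<rho> v * \<rho> v'" for v v'
  proof (induction v)
    case Nil
    then show ?case using left_mult_one_mat[OF \<rho>_carr[of v']] by (simp add: \<rho>_def)
  next
    case (Cons a v)
    then show ?case using assoc_mult_mat[OF m[of a] \<rho>_carr[of v] \<rho>_carr[of v']] by (simp add: \<rho>_Cons)
  qed
  have \<rho>_single: "\<rho> [a] = m a" for a using right_mult_one_mat[OF m[of a]] by (simp add: \<rho>_def)
  have \<rho>_pow: "\<rho> (replicate k a) = m a ^\<^sub>m k" for k a
  proof (induction k)
    case 0
    then show ?case using m[of a] by (simp add: \<rho>_def)
  next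
    case (Suc k)
    have "\<rho> (replicate (Suc k) a) = \<rho> (replicate k a @ [a])" by (simp only: replicate_Suc replicate_append_same)
    then show ?case unfolding \<rho>_append Suc \<rho>_single by simp
  qed
  have lm: "lin_mat \<theta> n \<rho> (mono_term c v - mono_term d v') = \<theta> c \<cdot>\<^sub>m \<rho> v - \<theta> d \<cdot>\<^sub>m \<rho> v'" if "c \<in> K" "d \<in> K" for c d v v'
    unfolding lin_mat_diff[OF \<theta> word_closed[OF that(1)] word_closed[OF that(2)]]
      lin_mat_mono_term[where \<rho> = \<rho>, OF \<theta> \<rho>_carr] ..
  have minus_self: "M - M = 0\<^sub>m n n" if "M \<in> carrier_mat n n" for M :: "'l mat" using that by (intro eq_matI) auto
  have \<rho>_Nil: "\<rho> [] = 1\<^sub>m n" by (simp add: \<rho>_def)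
  have "\<exists>\<Psi>. \<Psi> \<in> Ring.ring_hom Q (ring_mat TYPE('l) n ()) \<and>
    (\<forall>c\<in>K. \<forall>g\<in>carrier word_monoid. \<Psi> (sc c \<otimes>\<^bsub>Q\<^esub> gen g) = \<theta> c \<cdot>\<^sub>m \<rho> g)"
  proof (rule representation[OF \<theta>])
    fix p assume "p \<in> symbol_relations r \<zeta> z w"
    then consider "p = mono_term 1 (replicate r GenX) - mono_term z []"
      | "p = mono_term 1 (replicate r GenY) - mono_term w []"
      | "p = mono_term 1 [GenY, GenX] - mono_term \<zeta> [GenX, GenY]"
      by (auto simp: symbol_relations_def)
    then show "lin_mat \<theta> n \<rho> p = 0\<^sub>m n n"
    proof cases
      case 1
      show ?thesis unfolding 1 lm[OF one coeffs(2)] \<rho>_pow \<rho>_Nil m_def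
        by (simp add: pow smult_one_mat' minus_self)
    next
      case 2
      show ?thesis unfolding 2 lm[OF one coeffs(3)] \<rho>_pow \<rho>_Nil m_def
        by (simp add: pow smult_one_mat' minus_self)
    next
      case 3
      have p: "\<rho> [GenY, GenX] = My * Mx" "\<rho> [GenX, GenY] = Mx * My"
        using \<rho>_Cons[of GenY "[GenX]"] \<rho>_Cons[of GenX "[GenY]"] by (simp_all add: \<rho>_single m_def)
      have "My * Mx \<in> carrier_mat n n" by (rule mult_carrier_mat[OF carr(2,1)])
      then show ?thesis unfolding 3 lm[OF one coeffs(1)] p comm[symmetric]
        by (simp add: smult_one_mat' minus_self)
    qed
  qed (simp_all add: \<rho>_carr \<rho>_append \<rho>_Nil word_simps)
  then obtain \<Psi> where \<Psi>: "\<Psi> \<in> Ring.ring_hom Q (ring_mat TYPE('l) n ())"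
    "\<And>c g. c \<in> K \<Longrightarrow> \<Psi> (sc c \<otimes>\<^bsub>Q\<^esub> gen g) = \<theta> c \<cdot>\<^sub>m \<rho> g"
    by (auto simp: word_simps)
  have "\<Psi> (sc c) = \<theta> c \<cdot>\<^sub>m 1\<^sub>m n" if "c \<in> K" for c
    using \<Psi>(2)[OF that, of "[]"] that by (simp add: gen_Nil \<rho>_Nil)
  moreover have "\<Psi> (gen [a]) = m a" for a
    using \<Psi>(2)[OF one, of "[a]"] by (simp add: sc_one \<rho>_single smult_one_mat')
  ultimately show ?thesis using \<Psi>(1) by (intro exI[of _ \<Psi>]) (simp add: m_def)
qed

end

section \<open>Tensor products\<close>

fun iter_prod :: "nat \<Rightarrow> (nat \<Rightarrow> 'l::comm_ring_1 mat) \<Rightarrow> nat \<Rightarrow> 'l mat" where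
  "iter_prod n M 0 = 1\<^sub>m n"
| "iter_prod n M (Suc k) = iter_prod n M k * M k"

lemma iter_prod_carrier: "(\<And>i. i < k \<Longrightarrow> M i \<in> carrier_mat n n) \<Longrightarrow> iter_prod n M k \<in> carrier_mat n n"
proof (induction k)
  case (Suc k)
  then show ?case using mult_carrier_mat[of "iter_prod n M k" n n "M k" n] by simp
qed simp

lemma iter_prod_cong: "(\<And>i. i < k \<Longrightarrow> M i = N i) \<Longrightarrow> iter_prod n M k = iter_prod n N k"
  by (induction k) auto

lemma iter_prod_one: "(\<And>i. i < k \<Longrightarrow> M i = 1\<^sub>m n) \<Longrightarrow> iter_prod n M k = 1\<^sub>m n"
  by (induction k) auto

lemma iter_prod_commute:
  assumes "U \<in> carrier_mat n n" "\<And>i. i < k \<Longrightarrow> M i \<in> carrier_mat n n" "\<And>i. i < k \<Longrightarrow> U * M i = M i * U"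
  shows "U * iter_prod n M k = iter_prod n M k * U"
  using assms(2,3)
proof (induction k)
  case 0
  then show ?case using assms(1) by simp
next
  case (Suc k)
  have P: "iter_prod n M k \<in> carrier_mat n n" using Suc.prems(1) by (intro iter_prod_carrier) simp
  have Mk: "M k \<in> carrier_mat n n" using Suc.prems(1) by simp
  have "U * iter_prod n M (Suc k) = (U * iter_prod n M k) * M k"
    using assoc_mult_mat[OF assms(1) P Mk] by simp
  also have "\<dots> = iter_prod n M k * (U * M k)" using Suc assoc_mult_mat[OF P assms(1) Mk] by simp
  also have "\<dots> = iter_prod n M (Suc k) * U" using Suc.prems(2) assoc_mult_mat[OF P Mk assms(1)] by simp
  finally show ?case .
qed

lemma iter_prod_mult:
  assumes "\<And>i. i < k \<Longrightarrow> M i \<in> carrier_mat n n" "\<And>i. i < k \<Longrightarrow> N i \<in> carrier_mat n n"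
    and "\<And>i j. i < k \<Longrightarrow> j < k \<Longrightarrow> i \<noteq> j \<Longrightarrow> M i * N j = N j * M i"
  shows "iter_prod n (\<lambda>i. M i * N i) k = iter_prod n M k * iter_prod n N k"
  using assms
proof (induction k)
  case (Suc k)
  have P: "iter_prod n M k \<in> carrier_mat n n" "iter_prod n N k \<in> carrier_mat n n" "M k \<in> carrier_mat n n" "N k \<in> carrier_mat n n"
    using Suc.prems(1,2) by (auto intro!: iter_prod_carrier)
  have c: "M k * iter_prod n N k = iter_prod n N k * M k"
    by (rule iter_prod_commute) (use Suc.prems in auto)
  have "iter_prod n (\<lambda>i. M i * N i) (Suc k) = (iter_prod n M k * iter_prod n N k) * (M k * N k)"
    using Suc.IH Suc.prems by simp
  also have "\<dots> = iter_prod n M k * ((iter_prod n N k * M k) * N k)"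
    unfolding assoc_mult_mat[OF P(1,2) mult_carrier_mat[OF P(3,4)]] assoc_mult_mat[OF P(2,3,4)] ..
  also have "\<dots> = (iter_prod n M k * M k) * (iter_prod n N k * N k)"
    unfolding c[symmetric] assoc_mult_mat[OF P(3,2,4)] assoc_mult_mat[OF P(1,3) mult_carrier_mat[OF P(2,4)]] ..
  finally show ?case by simp
qed simp

lemma
  assumes "i < k" "\<And>j. j < k \<Longrightarrow> M j \<in> carrier_mat n n" "B \<in> carrier_mat n n" "C \<in> carrier_mat n n"
  shows iter_prod_add: "iter_prod n (M(i := B + C)) k = iter_prod n (M(i := B)) k + iter_prod n (M(i := C)) k"
    and iter_prod_smult: "iter_prod n (M(i := c \<cdot>\<^sub>m B)) k = c \<cdot>\<^sub>m iter_prod n (M(i := B)) k"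
proof -
  have "iter_prod n (M(i := B + C)) k = iter_prod n (M(i := B)) k + iter_prod n (M(i := C)) k \<and>
    iter_prod n (M(i := c \<cdot>\<^sub>m B)) k = c \<cdot>\<^sub>m iter_prod n (M(i := B)) k"
    using assms(1,2)
  proof (induction k)
    case (Suc k)
    have P: "iter_prod n (M(i := U)) k \<in> carrier_mat n n" if "U \<in> carrier_mat n n" for U
      using Suc.prems(2) that by (intro iter_prod_carrier) auto
    have Mk: "M k \<in> carrier_mat n n" using Suc.prems(2) by simp
    show ?case
    proof (cases "i = k")
      case True
      have eq: "iter_prod n (M(i := U)) k = iter_prod n M k" for U
        by (rule iter_prod_cong) (use True in auto)
      have Pk: "iter_prod n M k \<in> carrier_mat n n" using Suc.prems(2) by (intro iter_prod_carrier) simp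
      show ?thesis
        unfolding iter_prod.simps eq using True mult_add_distrib_mat[OF Pk assms(3,4)] mult_smult_distrib[OF Pk assms(3)]
        by simp
    next
      case False
      then have ik: "i < k" using Suc.prems(1) by simp
      have "M j \<in> carrier_mat n n" if "j < k" for j using Suc.prems(2) that by simp
      note IH = Suc.IH[OF ik this]
      have IH1: "iter_prod n (M(i := B + C)) k = iter_prod n (M(i := B)) k + iter_prod n (M(i := C)) k"
        and IH2: "iter_prod n (M(i := c \<cdot>\<^sub>m B)) k = c \<cdot>\<^sub>m iter_prod n (M(i := B)) k"
        using IH by blast+
      have upd: "(M(i := U)) k = M k" for U using False by simp
      show ?thesis
        unfolding iter_prod.simps upd IH1 IH2
          add_mult_distrib_mat[OF P[OF assms(3)] P[OF assms(4)] Mk] mult_smult_assoc_mat[OF P[OF assms(3)] Mk]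
        by (intro conjI refl)
    qed
  qed simp
  then show "iter_prod n (M(i := B + C)) k = iter_prod n (M(i := B)) k + iter_prod n (M(i := C)) k"
    "iter_prod n (M(i := c \<cdot>\<^sub>m B)) k = c \<cdot>\<^sub>m iter_prod n (M(i := B)) k" by auto
qed

locale tensor_alg = field_set K for K :: "'f::field set" +
  fixes s :: nat and A :: "nat \<Rightarrow> ('a, 'b) ring_scheme" and \<iota> :: "nat \<Rightarrow> 'f \<Rightarrow> 'a"
  assumes alg: "\<And>i. i < s \<Longrightarrow> scalar_alg (A i) K (\<iota> i)"
begin

abbreviation G where "G \<equiv> product_group {..<s} A"

lemma ring_A: "i < s \<Longrightarrow> ring (A i)"
  by (rule scalar_alg.axioms(1)[OF alg])

lemma monoid_A: "i < s \<Longrightarrow> Group.monoid (A i)"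
  using ring_A by (rule ring.is_monoid)

lemma G_simps:
  "a \<in> carrier G \<longleftrightarrow> (\<forall>i<s. a i \<in> carrier (A i)) \<and> a \<in> extensional {..<s}"
  "a \<otimes>\<^bsub>G\<^esub> b = (\<lambda>i\<in>{..<s}. a i \<otimes>\<^bsub>A i\<^esub> b i)" "\<one>\<^bsub>G\<^esub> = (\<lambda>i\<in>{..<s}. \<one>\<^bsub>A i\<^esub>)"
  by (auto simp: product_group_def PiE_iff)

lemma G_app: "a \<in> carrier G \<Longrightarrow> i < s \<Longrightarrow> a i \<in> carrier (A i)"
  by (auto simp: PiE_iff)

lemma G_upd: "a \<in> carrier G \<Longrightarrow> i < s \<Longrightarrow> b \<in> carrier (A i) \<Longrightarrow> a(i := b) \<in> carrier G"
  unfolding G_simps(1) by (auto simp: extensional_def)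

lemma monoid_G: "Group.monoid G"
proof (rule monoidI)
  show "\<one>\<^bsub>G\<^esub> \<in> carrier G" unfolding G_simps using monoid.one_closed[OF monoid_A] by simp
  fix a b c assume a: "a \<in> carrier G" and b: "b \<in> carrier G" and c: "c \<in> carrier G"
  show "a \<otimes>\<^bsub>G\<^esub> b \<in> carrier G"
    using a b monoid.m_closed[OF monoid_A] unfolding G_simps by simp
  show "a \<otimes>\<^bsub>G\<^esub> b \<otimes>\<^bsub>G\<^esub> c = a \<otimes>\<^bsub>G\<^esub> (b \<otimes>\<^bsub>G\<^esub> c)"
    using a b c monoid.m_assoc[OF monoid_A] unfolding G_simps by (intro restrict_ext) simp
next
  fix a assume a: "a \<in> carrier G"
  show "\<one>\<^bsub>G\<^esub> \<otimes>\<^bsub>G\<^esub> a = a" "a \<otimes>\<^bsub>G\<^esub> \<one>\<^bsub>G\<^esub> = a"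
    using a monoid.l_one[OF monoid_A] monoid.r_one[OF monoid_A] unfolding G_simps
    by (auto intro!: extensionalityI[of _ "{..<s}"])
qed

sublocale G: monoid_alg K G
  by (rule monoid_alg.intro[OF field_set_axioms monoid_G])

lemma tensor_relations_cases:
  assumes "p \<in> tensor_relations K s A \<iota>"
  obtains (add) a i b c where "i < s" "a \<in> carrier G" "b \<in> carrier (A i)" "c \<in> carrier (A i)"
      "p = mono_term 1 (a(i := b \<oplus>\<^bsub>A i\<^esub> c)) - mono_term 1 (a(i := b)) - mono_term 1 (a(i := c))"
    | (scale) a i b c where "i < s" "a \<in> carrier G" "b \<in> carrier (A i)" "c \<in> K"
      "p = mono_term 1 (a(i := \<iota> i c \<otimes>\<^bsub>A i\<^esub> b)) - mono_term c (a(i := b))"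
  using assms unfolding tensor_relations_def carrier_product_group by blast

lemma add_closed_A: "i < s \<Longrightarrow> b \<in> carrier (A i) \<Longrightarrow> c \<in> carrier (A i) \<Longrightarrow> b \<oplus>\<^bsub>A i\<^esub> c \<in> carrier (A i)"
  using abelian_monoid.a_closed[OF abelian_group.axioms(1)[OF ring.is_abelian_group[OF ring_A]]] .

lemma scale_closed_A: "i < s \<Longrightarrow> b \<in> carrier (A i) \<Longrightarrow> c \<in> K \<Longrightarrow> \<iota> i c \<otimes>\<^bsub>A i\<^esub> b \<in> carrier (A i)"
  using monoid.m_closed[OF monoid_A] scalar_alg.\<iota>_closed[OF alg] by metis

lemma tensor_relations_carrier: "tensor_relations K s A \<iota> \<subseteq> carrier G.R"
proof
  fix p assume "p \<in> tensor_relations K s A \<iota>"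
  then show "p \<in> carrier G.R"
  proof (cases rule: tensor_relations_cases)
    case (add a i b c)
    show ?thesis unfolding add(5) fun_diff_def
      by (intro G.diff_closed G.mono_term_closed one G_upd add add_closed_A)
  next
    case (scale a i b c)
    show ?thesis unfolding scale(5) fun_diff_def
      by (intro G.diff_closed G.mono_term_closed one G_upd scale scale_closed_A)
  qed
qed

sublocale monoid_alg_quot K G "tensor_relations K s A \<iota>"
  by unfold_locales (rule tensor_relations_carrier)

lemma tensor_algebra_eq: "tensor_algebra K s A \<iota> = Q"
  by (simp add: tensor_algebra_def Let_def)

lemma gen_add:
  assumes "i < s" "a \<in> carrier G" "b \<in> carrier (A i)" "c \<in> carrier (A i)"
  shows "gen (a(i := b \<oplus>\<^bsub>A i\<^esub> c)) = gen (a(i := b)) \<oplus>\<^bsub>Q\<^esub> gen (a(i := c))"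
proof -
  let ?u = "mono_term 1 (a(i := b \<oplus>\<^bsub>A i\<^esub> c))" and ?v = "mono_term 1 (a(i := b))" and ?v' = "mono_term 1 (a(i := c))"
  note u = G.mono_term_closed[OF one G_upd[OF assms(2,1) add_closed_A[OF assms(1,3,4)]]]
  note v = G.mono_term_closed[OF one G_upd[OF assms(2,1,3)]] and v' = G.mono_term_closed[OF one G_upd[OF assms(2,1,4)]]
  have uv: "(\<lambda>g. ?u g - ?v g) \<in> carrier G.R" by (rule G.diff_closed[OF u v])
  have "(\<lambda>g. ?u g - ?v g) - ?v' \<in> tensor_relations K s A \<iota>"
    unfolding tensor_relations_def carrier_product_group[symmetric] using assms
    by (intro UnI1 CollectI exI[of _ a] exI[of _ i] exI[of _ b] exI[of _ c]) (simp add: fun_diff_def)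
  then have "cls (\<lambda>g. ?u g - ?v g) = cls ?v'" by (rule cls_eq[OF uv v'])
  moreover have "cls ?u = cls (\<lambda>g. ?u g - ?v g) \<oplus>\<^bsub>Q\<^esub> cls ?v" using cls_add[OF uv v] by simp
  ultimately show ?thesis unfolding gen_def using cls_closed[OF v] cls_closed[OF v'] by (simp add: Q.a_comm)
qed

lemma gen_scale:
  assumes "i < s" "a \<in> carrier G" "b \<in> carrier (A i)" "c \<in> K"
  shows "gen (a(i := \<iota> i c \<otimes>\<^bsub>A i\<^esub> b)) = sc c \<otimes>\<^bsub>Q\<^esub> gen (a(i := b))"
proof -
  have "mono_term 1 (a(i := \<iota> i c \<otimes>\<^bsub>A i\<^esub> b)) - mono_term c (a(i := b)) \<in> tensor_relations K s A \<iota>"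
    unfolding tensor_relations_def carrier_product_group[symmetric] using assms by blast
  then have "cls (mono_term 1 (a(i := \<iota> i c \<otimes>\<^bsub>A i\<^esub> b))) = cls (mono_term c (a(i := b)))"
    by (rule cls_eq[rotated 2]) (intro G.mono_term_closed one G_upd assms scale_closed_A)+
  then show ?thesis unfolding cls_mono_term[OF assms(4) G_upd[OF assms(2,1,3)]] by (simp add: gen_def)
qed

text \<open>Multilinearity allows the tensor factors to be replaced by elements of the spanning sets
  \<open>M i\<close> one at a time. In the induction, k is the number of leading factors that are
  still arbitrary.\<close>

lemma tensor_span:
  assumes M: "\<And>i. i < s \<Longrightarrow> M i \<subseteq> carrier (A i)"
    and span: "\<And>i b V. \<lbrakk>i < s; b \<in> carrier (A i); M i \<subseteq> V;
      \<And>a b. a \<in> carrier (A i) \<Longrightarrow> b \<in> carrier (A i) \<Longrightarrow> a \<in> V \<Longrightarrow> b \<in> V \<Longrightarrow> a \<oplus>\<^bsub>A i\<^esub> b \<in> V;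
      \<And>c b. c \<in> K \<Longrightarrow> b \<in> carrier (A i) \<Longrightarrow> b \<in> V \<Longrightarrow> \<iota> i c \<otimes>\<^bsub>A i\<^esub> b \<in> V\<rbrakk> \<Longrightarrow> b \<in> V"
    and x: "x \<in> carrier Q"
    and add: "\<And>x y. x \<in> carrier Q \<Longrightarrow> y \<in> carrier Q \<Longrightarrow> P x \<Longrightarrow> P y \<Longrightarrow> P (x \<oplus>\<^bsub>Q\<^esub> y)"
    and scale: "\<And>c x. c \<in> K \<Longrightarrow> x \<in> carrier Q \<Longrightarrow> P x \<Longrightarrow> P (sc c \<otimes>\<^bsub>Q\<^esub> x)"
    and gen: "\<And>a. a \<in> (\<Pi>\<^sub>E i\<in>{..<s}. M i) \<Longrightarrow> P (gen a)"
  shows "P x"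
proof -
  have claim: "P (gen a)" if "k \<le> s" "a \<in> carrier G" "\<And>i. k \<le> i \<Longrightarrow> i < s \<Longrightarrow> a i \<in> M i" for k a
    using that
  proof (induction k arbitrary: a)
    case 0
    then show ?case by (intro gen) (auto simp: G_simps PiE_iff)
  next
    case (Suc k)
    have k: "k < s" using Suc.prems(1) by simp
    have ak: "a k \<in> carrier (A k)" by (rule G_app[OF Suc.prems(2) k])
    let ?V = "{b. P (gen (a(k := b)))}"
    have "a k \<in> ?V"
    proof (rule span[OF k ak])
      show "M k \<subseteq> ?V"
      proof
        fix b assume b: "b \<in> M k"
        have "P (gen (a(k := b)))"
        proof (rule Suc.IH)
          show "a(k := b) \<in> carrier G" using b M[OF k] by (intro G_upd Suc.prems k) auto
          show "(a(k := b)) i \<in> M i" if "k \<le> i" "i < s" for i using that b Suc.prems(3)[of i] by auto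
        qed (use k in simp)
        then show "b \<in> ?V" by simp
      qed
      show "b \<oplus>\<^bsub>A k\<^esub> c \<in> ?V" if "b \<in> carrier (A k)" "c \<in> carrier (A k)" "b \<in> ?V" "c \<in> ?V" for b c
        using that by (simp add: gen_add[OF k Suc.prems(2)] add gen_closed[OF G_upd[OF Suc.prems(2) k]])
      show "\<iota> k c \<otimes>\<^bsub>A k\<^esub> b \<in> ?V" if "c \<in> K" "b \<in> carrier (A k)" "b \<in> ?V" for c b
        using that by (simp add: gen_scale[OF k Suc.prems(2)] scale gen_closed[OF G_upd[OF Suc.prems(2) k]])
    qed
    then show ?case by simp
  qed
  have gen': "P (gen a)" if "a \<in> carrier G" for a by (rule claim[OF order_refl that]) simp
  have K0: "0 \<in> K" by (rule zero)
  have G1: "\<one>\<^bsub>G\<^esub> \<in> carrier G" by (rule monoid.one_closed[OF monoid_G])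
  from x show ?thesis
  proof (induction x rule: Q_induct)
    case zero
    have "P (sc 0 \<otimes>\<^bsub>Q\<^esub> gen \<one>\<^bsub>G\<^esub>)" by (rule scale[OF K0 gen_closed[OF G1] gen'[OF G1]])
    then show ?case unfolding sc_zero Q.l_null[OF gen_closed[OF G1]] .
  next
    case (add x y)
    then show ?case by (rule assms(4))
  next
    case (mono c g)
    show ?case by (rule scale[OF mono(1) gen_closed[OF mono(2)] gen'[OF mono(2)]])
  qed
qed

definition single where "single j b = (\<lambda>i\<in>{..<s}. if i = j then b else \<one>\<^bsub>A i\<^esub>)"

lemma single_closed: "j < s \<Longrightarrow> b \<in> carrier (A j) \<Longrightarrow> single j b \<in> carrier G"
  unfolding single_def G_simps using monoid.one_closed[OF monoid_A] by simp

lemma single_mult: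
  assumes "j < s" "b \<in> carrier (A j)" "a \<in> carrier G"
  shows "gen (single j b) \<otimes>\<^bsub>Q\<^esub> gen a = gen (a(j := b \<otimes>\<^bsub>A j\<^esub> a j))"
    and "gen a \<otimes>\<^bsub>Q\<^esub> gen (single j b) = gen (a(j := a j \<otimes>\<^bsub>A j\<^esub> b))"
proof -
  have a: "a i \<in> carrier (A i)" if "i < s" for i by (rule G_app[OF assms(3) that])
  have ext: "a i = undefined" if "\<not> i < s" for i using assms(3) that by (auto simp: PiE_iff extensional_def)
  have unit: "\<one>\<^bsub>A i\<^esub> \<otimes>\<^bsub>A i\<^esub> a i = a i" "a i \<otimes>\<^bsub>A i\<^esub> \<one>\<^bsub>A i\<^esub> = a i" if "i < s" for i
    using monoid.l_one[OF monoid_A[OF that] a[OF that]] monoid.r_one[OF monoid_A[OF that] a[OF that]] by auto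
  have "single j b \<otimes>\<^bsub>G\<^esub> a = a(j := b \<otimes>\<^bsub>A j\<^esub> a j)" "a \<otimes>\<^bsub>G\<^esub> single j b = a(j := a j \<otimes>\<^bsub>A j\<^esub> b)"
    unfolding G_simps single_def
    using assms(1) ext unit by (auto simp: fun_eq_iff)
  then show "gen (single j b) \<otimes>\<^bsub>Q\<^esub> gen a = gen (a(j := b \<otimes>\<^bsub>A j\<^esub> a j))"
    "gen a \<otimes>\<^bsub>Q\<^esub> gen (single j b) = gen (a(j := a j \<otimes>\<^bsub>A j\<^esub> b))"
    by (simp_all add: gen_mult[OF single_closed[OF assms(1,2)] assms(3), symmetric]
        gen_mult[OF assms(3) single_closed[OF assms(1,2)], symmetric])
qed

lemma gen_unit:
  assumes a: "a \<in> carrier G" and units: "\<And>i. i < s \<Longrightarrow> a i \<in> Units (A i)"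
  shows "gen a \<in> Units Q"
proof -
  define b where "b = (\<lambda>i\<in>{..<s}. inv\<^bsub>A i\<^esub> a i)"
  have b: "b \<in> carrier G" unfolding G_simps b_def using monoid.Units_inv_closed[OF monoid_A units] by simp
  have "a \<otimes>\<^bsub>G\<^esub> b = \<one>\<^bsub>G\<^esub>" "b \<otimes>\<^bsub>G\<^esub> a = \<one>\<^bsub>G\<^esub>"
    unfolding G_simps b_def using monoid.Units_r_inv[OF monoid_A units] monoid.Units_l_inv[OF monoid_A units]
    by (auto intro!: restrict_ext)
  then have "gen a \<otimes>\<^bsub>Q\<^esub> gen b = \<one>\<^bsub>Q\<^esub>" "gen b \<otimes>\<^bsub>Q\<^esub> gen a = \<one>\<^bsub>Q\<^esub>"
    unfolding gen_mult[OF a b, symmetric] gen_mult[OF b a, symmetric] by (simp_all only: gen_one)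
  then show ?thesis
    unfolding Units_def by (intro CollectI conjI gen_closed[OF a] bexI[of _ "gen b"] gen_closed[OF b])
qed

text \<open>Commuting representations of the factors multiply to a representation of the tensor
  product: commutation gives multiplicativity on pure tensors, and multilinearity of the product
  kills the relations.\<close>

lemma tensor_representation:
  fixes \<Psi> :: "nat \<Rightarrow> 'a \<Rightarrow> 'l::comm_ring_1 mat"
  assumes \<theta>: "comm_ring_hom \<theta>"
    and \<Psi>: "\<And>i. i < s \<Longrightarrow> \<Psi> i \<in> Ring.ring_hom (A i) (ring_mat TYPE('l) n ())"
      "\<And>i c. i < s \<Longrightarrow> c \<in> K \<Longrightarrow> \<Psi> i (\<iota> i c) = \<theta> c \<cdot>\<^sub>m 1\<^sub>m n"
    and comm: "\<And>i j a b. i < s \<Longrightarrow> j < s \<Longrightarrow> i \<noteq> j \<Longrightarrow> a \<in> carrier (A i) \<Longrightarrow> b \<in> carrier (A j) \<Longrightarrow>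
      \<Psi> i a * \<Psi> j b = \<Psi> j b * \<Psi> i a"
  shows "\<exists>\<Phi>. \<Phi> \<in> Ring.ring_hom Q (ring_mat TYPE('l) n ()) \<and>
    (\<forall>c\<in>K. \<forall>a\<in>carrier G. \<Phi> (sc c \<otimes>\<^bsub>Q\<^esub> gen a) = \<theta> c \<cdot>\<^sub>m iter_prod n (\<lambda>i. \<Psi> i (a i)) s)"
proof (rule representation[OF \<theta>])
  let ?\<rho> = "\<lambda>a. iter_prod n (\<lambda>i. \<Psi> i (a i)) s"
  have c: "\<Psi> i b \<in> carrier_mat n n" if "i < s" "b \<in> carrier (A i)" for i b
    using ring_hom_closed[OF \<Psi>(1)[OF that(1)] that(2)] by (simp add: ring_mat_simps)
  have ca: "a i \<in> carrier (A i)" if "a \<in> carrier G" "i < s" for a i by (rule G_app[OF that])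
  show \<rho>_carr: "?\<rho> a \<in> carrier_mat n n" if "a \<in> carrier G" for a
    by (rule iter_prod_carrier) (rule c[OF _ ca[OF that]])
  show "?\<rho> \<one>\<^bsub>G\<^esub> = 1\<^sub>m n"
    by (rule iter_prod_one) (use ring_hom_one[OF \<Psi>(1)] in \<open>simp add: G_simps(3) ring_mat_simps\<close>)
  show "?\<rho> (a \<otimes>\<^bsub>G\<^esub> b) = ?\<rho> a * ?\<rho> b" if ab: "a \<in> carrier G" "b \<in> carrier G" for a b
  proof -
    have "?\<rho> (a \<otimes>\<^bsub>G\<^esub> b) = iter_prod n (\<lambda>i. \<Psi> i (a i) * \<Psi> i (b i)) s"
      by (rule iter_prod_cong) (use ring_hom_mult[OF \<Psi>(1)] ca ab in \<open>simp add: G_simps(2) ring_mat_simps\<close>)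
    also have "\<dots> = ?\<rho> a * ?\<rho> b"
    proof (rule iter_prod_mult)
      show "\<Psi> i (a i) \<in> carrier_mat n n" "\<Psi> i (b i) \<in> carrier_mat n n" if "i < s" for i
        using c[OF that ca[OF ab(1) that]] c[OF that ca[OF ab(2) that]] by simp_all
      show "\<Psi> i (a i) * \<Psi> j (b j) = \<Psi> j (b j) * \<Psi> i (a i)" if "i < s" "j < s" "i \<noteq> j" for i j
        by (rule comm[OF that ca[OF ab(1) that(1)] ca[OF ab(2) that(2)]])
    qed
    finally show ?thesis .
  qed
  have upd: "?\<rho> (a(i := b)) = iter_prod n ((\<lambda>j. \<Psi> j (a j))(i := \<Psi> i b)) s" for a i b
    by (rule iter_prod_cong) auto
  fix p assume "p \<in> tensor_relations K s A \<iota>"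
  then show "lin_mat \<theta> n ?\<rho> p = 0\<^sub>m n n"
  proof (cases rule: tensor_relations_cases)
    case (add a i b c')
    let ?u = "mono_term 1 (a(i := b \<oplus>\<^bsub>A i\<^esub> c'))" and ?v = "mono_term 1 (a(i := b))" and ?v' = "mono_term 1 (a(i := c'))"
    note u = G.mono_term_closed[OF one G_upd[OF add(2,1) add_closed_A[OF add(1,3,4)]]]
    note v = G.mono_term_closed[OF one G_upd[OF add(2,1,3)]] and v' = G.mono_term_closed[OF one G_upd[OF add(2,1,4)]]
    have uv: "?u - ?v \<in> carrier G.R" using G.diff_closed[OF u v] by (simp add: fun_diff_def)
    interpret t: comm_ring_hom \<theta> by (rule \<theta>)
    have lm: "lin_mat \<theta> n ?\<rho> (mono_term 1 g) = ?\<rho> g" if "g \<in> carrier G" for g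
      using lin_mat_mono_term[where \<rho> = ?\<rho>, OF \<theta> \<rho>_carr[OF that], of 1] by (simp add: smult_one_mat')
    have bc: "\<Psi> i b \<in> carrier_mat n n" "\<Psi> i c' \<in> carrier_mat n n" using c[OF add(1,3)] c[OF add(1,4)] by simp_all
    have sum: "\<Psi> i (b \<oplus>\<^bsub>A i\<^esub> c') = \<Psi> i b + \<Psi> i c'"
      using ring_hom_add[OF \<Psi>(1)[OF add(1)] add(3,4)] by (simp add: ring_mat_simps)
    have "?\<rho> (a(i := b \<oplus>\<^bsub>A i\<^esub> c')) = ?\<rho> (a(i := b)) + ?\<rho> (a(i := c'))"
      unfolding upd sum by (rule iter_prod_add[OF add(1) _ bc]) (rule c[OF _ ca[OF add(2)]])
    then show ?thesis
      unfolding add(5) lin_mat_diff[OF \<theta> uv v'] lin_mat_diff[OF \<theta> u v]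
        lm[OF G_upd[OF add(2,1,3)]] lm[OF G_upd[OF add(2,1,4)]] lm[OF G_upd[OF add(2,1) add_closed_A[OF add(1,3,4)]]]
      using \<rho>_carr[OF G_upd[OF add(2,1,3)]] \<rho>_carr[OF G_upd[OF add(2,1,4)]] by (intro eq_matI) auto
  next
    case (scale a i b c')
    let ?u = "mono_term 1 (a(i := \<iota> i c' \<otimes>\<^bsub>A i\<^esub> b))" and ?v = "mono_term c' (a(i := b))"
    have cb: "\<iota> i c' \<otimes>\<^bsub>A i\<^esub> b \<in> carrier (A i)" by (rule scale_closed_A[OF scale(1,3,4)])
    note u = G.mono_term_closed[OF one G_upd[OF scale(2,1) cb]]
      and v = G.mono_term_closed[OF scale(4) G_upd[OF scale(2,1,3)]]
    interpret t: comm_ring_hom \<theta> by (rule \<theta>)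
    have b: "\<Psi> i b \<in> carrier_mat n n" by (rule c[OF scale(1,3)])
    have "\<Psi> i (\<iota> i c' \<otimes>\<^bsub>A i\<^esub> b) = (\<theta> c' \<cdot>\<^sub>m 1\<^sub>m n) * \<Psi> i b"
      using ring_hom_mult[OF \<Psi>(1)[OF scale(1)] scalar_alg.\<iota>_closed[OF alg[OF scale(1)] scale(4)] scale(3)] \<Psi>(2)[OF scale(1,4)]
      by (simp add: ring_mat_simps)
    also have "\<dots> = \<theta> c' \<cdot>\<^sub>m \<Psi> i b"
      unfolding mult_smult_assoc_mat[OF one_carrier_mat b] left_mult_one_mat[OF b] ..
    finally have prod: "\<Psi> i (\<iota> i c' \<otimes>\<^bsub>A i\<^esub> b) = \<theta> c' \<cdot>\<^sub>m \<Psi> i b" .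
    have eq: "?\<rho> (a(i := \<iota> i c' \<otimes>\<^bsub>A i\<^esub> b)) = \<theta> c' \<cdot>\<^sub>m ?\<rho> (a(i := b))"
      unfolding upd prod by (rule iter_prod_smult[OF scale(1) _ b b]) (rule c[OF _ ca[OF scale(2)]])
    have "lin_mat \<theta> n ?\<rho> ?u = \<theta> 1 \<cdot>\<^sub>m ?\<rho> (a(i := \<iota> i c' \<otimes>\<^bsub>A i\<^esub> b))"
      by (rule lin_mat_mono_term[where \<rho> = ?\<rho>, OF \<theta> \<rho>_carr[OF G_upd[OF scale(2,1) cb]]])
    moreover have "lin_mat \<theta> n ?\<rho> ?v = \<theta> c' \<cdot>\<^sub>m ?\<rho> (a(i := b))"
      by (rule lin_mat_mono_term[where \<rho> = ?\<rho>, OF \<theta> \<rho>_carr[OF G_upd[OF scale(2,1,3)]]])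
    ultimately show ?thesis
      unfolding scale(5) lin_mat_diff[OF \<theta> u v] eq using \<rho>_carr[OF G_upd[OF scale(2,1,3)]]
      by (intro eq_matI) auto
  qed
qed

end

section \<open>The algebra \<open>D\<^sub>n\<close>\<close>

lemma field_set_ratfun_field: "field_set (ratfun_field V :: 'k::field ratfun set)"
proof -
  define P where "P = (polys_in V :: 'k mvpoly set)"
  have P0: "0 \<in> P" and P1: "1 \<in> P" by (auto simp: P_def polys_in_def simp flip: single_one)
  have Padd: "p + q \<in> P" if "p \<in> P" "q \<in> P" for p q
    using that Poly_Mapping.keys_add[of p q] unfolding P_def polys_in_def by blast
  have Pminus: "- p \<in> P" if "p \<in> P" for p using that by (simp add: P_def polys_in_def in_keys_iff)
  have Pmult: "p * q \<in> P" if "p \<in> P" "q \<in> P" for p q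
    unfolding P_def polys_in_def
  proof (intro CollectI ballI)
    fix \<mu> assume "\<mu> \<in> Poly_Mapping.keys (p * q)"
    then obtain \<alpha> \<beta> where "\<mu> = \<alpha> + \<beta>" "\<alpha> \<in> Poly_Mapping.keys p" "\<beta> \<in> Poly_Mapping.keys q"
      using keys_mult[of p q] by blast
    then show "Poly_Mapping.keys \<mu> \<subseteq> V"
      using that Poly_Mapping.keys_add[of \<alpha> \<beta>] unfolding P_def polys_in_def by blast
  qed
  have mem: "c \<in> ratfun_field V \<longleftrightarrow> (\<exists>p q. c = Fract p q \<and> p \<in> P \<and> q \<in> P \<and> q \<noteq> 0)" for c
    unfolding ratfun_field_def P_def by blast
  show ?thesis
  proof
    show "(0 :: 'k ratfun) \<in> ratfun_field V" unfolding mem Zero_fract_def using P0 P1 by (intro exI[of _ 0] exI[of _ 1]) simp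
    show "(1 :: 'k ratfun) \<in> ratfun_field V" unfolding mem One_fract_def using P1 by (intro exI[of _ 1]) simp
    fix a assume "a \<in> (ratfun_field V :: 'k ratfun set)"
    then obtain p q where a: "a = Fract p q" "p \<in> P" "q \<in> P" "q \<noteq> 0" unfolding mem by blast
    show "- a \<in> ratfun_field V"
      unfolding mem by (rule exI[of _ "- p"], rule exI[of _ q]) (simp add: a Pminus)
    show "inverse a \<in> ratfun_field V"
    proof (cases "p = 0")
      case True
      then have "a = 0" unfolding a(1) Zero_fract_def using a(4) by (simp add: eq_fract)
      then have "inverse a = Fract 0 1" by (simp add: Zero_fract_def[symmetric])
      then show ?thesis unfolding mem using P0 P1 by (intro exI[of _ 0] exI[of _ 1]) simp
    next
      case False
      then show ?thesis unfolding mem by (intro exI[of _ q] exI[of _ p]) (simp add: a)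
    qed
    fix b assume "b \<in> (ratfun_field V :: 'k ratfun set)"
    then obtain p' q' where b: "b = Fract p' q'" "p' \<in> P" "q' \<in> P" "q' \<noteq> 0" unfolding mem by blast
    show "a + b \<in> ratfun_field V"
      unfolding mem by (rule exI[of _ "p * q' + p' * q"], rule exI[of _ "q * q'"]) (simp add: a b Padd Pmult)
    show "a * b \<in> ratfun_field V"
      unfolding mem by (rule exI[of _ "p * p'"], rule exI[of _ "q * q'"]) (simp add: a b Pmult)
  qed
qed

lemma rconst_in_ratfun_field: "rconst (c :: 'k::field) \<in> ratfun_field V"
proof -
  have "Poly_Mapping.single 0 c \<in> polys_in V" "(1 :: 'k mvpoly) \<in> polys_in V"
    by (auto simp: polys_in_def simp flip: single_one)
  then show ?thesis unfolding rconst_def ratfun_field_def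
    by (intro CollectI exI[of _ "Poly_Mapping.single 0 c"] exI[of _ 1]) simp
qed

lemma rvar_in_ratfun_field: "i \<in> V \<Longrightarrow> (rvar i :: 'k::field ratfun) \<in> ratfun_field V"
proof -
  assume "i \<in> V"
  then have "(mp_var i :: 'k mvpoly) \<in> polys_in V" "(1 :: 'k mvpoly) \<in> polys_in V"
    by (auto simp: polys_in_def simp flip: single_one)
  then show ?thesis unfolding rvar_def ratfun_field_def
    by (intro CollectI exI[of _ "mp_var i"] exI[of _ 1]) simp
qed

lemma rvar_nonzero: "rvar i \<noteq> (0 :: 'k::field ratfun)"
proof
  assume "rvar i = (0 :: 'k ratfun)"
  then have "mp_var i = (0 :: 'k mvpoly)" by (simp add: rvar_def Zero_fract_def eq_fract)
  then have "Poly_Mapping.lookup (mp_var i) (Poly_Mapping.single i 1) = (0 :: 'k)" by simp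
  then show False by simp
qed

lemma ratfun_hom_eq:
  fixes f g :: "'k::field ratfun \<Rightarrow> 'l::field"
  assumes f: "field_hom f" and g: "field_hom g"
    and eq: "\<And>c. f (rconst c) = g (rconst c)" "\<And>i. f (rvar i) = g (rvar i)"
  shows "f c = g c"
proof -
  interpret f: field_hom f by fact
  interpret g: field_hom g by fact
  have hom: "comm_ring_hom (\<lambda>p :: 'k mvpoly. h (Fract p 1))" if "field_hom h" for h :: "'k ratfun \<Rightarrow> 'l"
  proof -
    interpret F: inj_comm_ring_hom "\<lambda>p :: 'k mvpoly. Fract p 1" by (rule inj_comm_ring_hom_Fract)
    interpret h: field_hom h by fact
    show ?thesis
      by standard (simp_all only: F.hom_zero F.hom_one F.hom_add F.hom_mult h.hom_zero h.hom_one h.hom_add h.hom_mult)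
  qed
  have poly: "f (Fract p 1) = g (Fract p 1)" for p
    using hom_eq_mp_eval[OF hom[OF f], of p] hom_eq_mp_eval[OF hom[OF g], of p] eq
    unfolding rconst_def rvar_def by simp
  obtain p q where c: "c = Fract p q" "q \<noteq> 0" by (cases c rule: Fract_cases)
  then have c': "c = Fract p 1 / Fract q 1" by simp
  show ?thesis unfolding c' f.hom_div g.hom_div poly by (rule refl)
qed

section \<open>Traces of elements that transform under conjugation\<close>

lemma commutes_add:
  fixes U :: "'a::comm_ring_1 mat"
  assumes "U \<in> carrier_mat n n" "M \<in> carrier_mat n n" "N \<in> carrier_mat n n" "U * M = M * U" "U * N = N * U"
  shows "U * (M + N) = (M + N) * U"
  unfolding mult_add_distrib_mat[OF assms(1-3)] add_mult_distrib_mat[OF assms(2,3,1)] assms(4,5) ..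

lemma commutes_mult:
  fixes U :: "'a::comm_ring_1 mat"
  assumes "U \<in> carrier_mat n n" "M \<in> carrier_mat n n" "N \<in> carrier_mat n n" "U * M = M * U" "U * N = N * U"
  shows "U * (M * N) = (M * N) * U"
proof -
  have "U * (M * N) = M * (U * N)"
    unfolding assoc_mult_mat[OF assms(1-3), symmetric] assms(4) by (rule assoc_mult_mat[OF assms(2,1,3)])
  also have "\<dots> = (M * N) * U"
    unfolding assms(5) by (rule assoc_mult_mat[OF assms(2,3,1), symmetric])
  finally show ?thesis .
qed

lemma commutes_smult:
  fixes U :: "'a::comm_ring_1 mat"
  assumes "U \<in> carrier_mat n n" "M \<in> carrier_mat n n" "U * M = M * U"
  shows "U * (c \<cdot>\<^sub>m M) = (c \<cdot>\<^sub>m M) * U"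
  unfolding mult_smult_distrib[OF assms(1,2)] mult_smult_assoc_mat[OF assms(2,1)] assms(3) ..

context scalar_alg
begin

text \<open>If \<open>u\<close> and \<open>u'\<close> transform under conjugation by \<open>g\<close> with different factors, then
  \<open>u u'\<^sup>-\<^sup>1\<close> transforms with a factor different from \<open>1\<close>, and so has trace zero in every
  representation.\<close>

lemma twist_left:
  assumes carr [simp]: "u \<in> carrier A" "g \<in> carrier A" "\<alpha> \<in> K" "\<beta> \<in> K" and u': "u' \<in> Units A"
    and u: "g \<otimes> u = \<iota> \<alpha> \<otimes> (u \<otimes> g)" and gu': "g \<otimes> u' = \<iota> \<beta> \<otimes> (u' \<otimes> g)"
  shows "\<iota> \<beta> \<otimes> (g \<otimes> (u \<otimes> inv u')) = \<iota> \<alpha> \<otimes> ((u \<otimes> inv u') \<otimes> g)"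
proof -
  note [simp] = Units_closed[OF u'] Units_inv_closed[OF u']
  have "inv u' \<otimes> g = inv u' \<otimes> (g \<otimes> u') \<otimes> inv u'" using u' by (simp add: m_assoc)
  also have "\<dots> = \<iota> \<beta> \<otimes> ((inv u' \<otimes> u') \<otimes> g \<otimes> inv u')" unfolding gu' by (simp add: \<iota>_pull m_assoc)
  also have "\<dots> = \<iota> \<beta> \<otimes> (g \<otimes> inv u')" using u' by simp
  finally have v: "inv u' \<otimes> g = \<iota> \<beta> \<otimes> (g \<otimes> inv u')" .
  have ab: "\<alpha> * \<beta> \<in> K" by (intro K.mult carr)
  have "\<iota> \<alpha> \<otimes> ((u \<otimes> inv u') \<otimes> g) = \<iota> \<alpha> \<otimes> (u \<otimes> (\<iota> \<beta> \<otimes> (g \<otimes> inv u')))" by (simp add: m_assoc v)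
  also have "\<dots> = \<iota> (\<alpha> * \<beta>) \<otimes> (u \<otimes> g \<otimes> inv u')" 
  proof -
    have Y: "u \<otimes> g \<otimes> inv u' \<in> carrier A" by simp
    have "u \<otimes> (\<iota> \<beta> \<otimes> (g \<otimes> inv u')) = \<iota> \<beta> \<otimes> (u \<otimes> g \<otimes> inv u')" by (simp add: \<iota>_pull m_assoc)
    then show ?thesis by (simp only: \<iota>_left[OF carr(3,4) Y])
  qed
  also have "\<dots> = \<iota> \<beta> \<otimes> ((\<iota> \<alpha> \<otimes> (u \<otimes> g)) \<otimes> inv u')"
    by (simp add: m_assoc \<iota>_left mult.commute[of \<beta> \<alpha>])
  also have "\<dots> = \<iota> \<beta> \<otimes> (g \<otimes> (u \<otimes> inv u'))" unfolding u[symmetric] by (simp add: m_assoc)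
  finally show ?thesis by (rule sym)
qed

text \<open>The mirror image of \<open>twist_left\<close>, for commutation relations that move g
  from the right to the left. The relation of a monomial with the generator x has this form, so no
  inverse of the root of unity is needed.\<close>

lemma twist_right:
  assumes carr [simp]: "u \<in> carrier A" "g \<in> carrier A" "\<alpha> \<in> K" "\<beta> \<in> K" and u': "u' \<in> Units A"
    and u: "u \<otimes> g = \<iota> \<alpha> \<otimes> (g \<otimes> u)" and gu': "u' \<otimes> g = \<iota> \<beta> \<otimes> (g \<otimes> u')"
  shows "\<iota> \<alpha> \<otimes> (g \<otimes> (u \<otimes> inv u')) = \<iota> \<beta> \<otimes> ((u \<otimes> inv u') \<otimes> g)"
proof -
  note [simp] = Units_closed[OF u'] Units_inv_closed[OF u']
  have "g \<otimes> inv u' = inv u' \<otimes> (u' \<otimes> g) \<otimes> inv u'" using u' by (simp add: m_assoc[symmetric])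
  also have "\<dots> = \<iota> \<beta> \<otimes> (inv u' \<otimes> g \<otimes> (u' \<otimes> inv u'))" unfolding gu' by (simp add: \<iota>_pull m_assoc)
  also have "\<dots> = \<iota> \<beta> \<otimes> (inv u' \<otimes> g)" using u' by simp
  finally have v: "g \<otimes> inv u' = \<iota> \<beta> \<otimes> (inv u' \<otimes> g)" .
  have "\<iota> \<alpha> \<otimes> (g \<otimes> (u \<otimes> inv u')) = (\<iota> \<alpha> \<otimes> (g \<otimes> u)) \<otimes> inv u'" by (simp add: m_assoc)
  also have "\<dots> = u \<otimes> (g \<otimes> inv u')" unfolding u[symmetric] by (simp add: m_assoc)
  also have "\<dots> = \<iota> \<beta> \<otimes> ((u \<otimes> inv u') \<otimes> g)" unfolding v by (simp add: \<iota>_pull m_assoc)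
  finally show ?thesis .
qed

text \<open>Weaker than what a splitting provides, so that the trace computations apply both to an
  arbitrary splitting and to the concrete representation before it is known to be injective and to
  span.\<close>

definition scalar_hom :: "nat \<Rightarrow> ('a \<Rightarrow> 'e::field mat) \<Rightarrow> bool" where
  "scalar_hom n \<psi> \<longleftrightarrow> \<psi> \<in> Ring.ring_hom A (ring_mat TYPE('e) n ()) \<and> (\<forall>c\<in>K. \<exists>k. \<psi> (\<iota> c) = k \<cdot>\<^sub>m 1\<^sub>m n)"

lemma scalar_homD:
  fixes \<psi> :: "'a \<Rightarrow> 'e::field mat"
  assumes "scalar_hom n \<psi>"
  shows "\<And>x. x \<in> carrier A \<Longrightarrow> \<psi> x \<in> carrier_mat n n"
    "\<And>x y. x \<in> carrier A \<Longrightarrow> y \<in> carrier A \<Longrightarrow> \<psi> (x \<otimes> y) = \<psi> x * \<psi> y"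
    "\<And>x y. x \<in> carrier A \<Longrightarrow> y \<in> carrier A \<Longrightarrow> \<psi> (x \<oplus> y) = \<psi> x + \<psi> y"
    "\<psi> \<one> = 1\<^sub>m n" "\<psi> \<zero> = 0\<^sub>m n n"
    "\<And>c. c \<in> K \<Longrightarrow> \<exists>k. \<psi> (\<iota> c) = k \<cdot>\<^sub>m 1\<^sub>m n"
proof -
  have h: "\<psi> \<in> Ring.ring_hom A (ring_mat TYPE('e) n ())" using assms by (simp add: scalar_hom_def)
  interpret h: ring_hom_ring A "ring_mat TYPE('e) n ()" \<psi> by (rule ring_hom_ringI2[OF ring_axioms ring_mat h])
  show "\<psi> x \<in> carrier_mat n n" if "x \<in> carrier A" for x
    using ring_hom_closed[OF h that] by (simp add: ring_mat_simps)
  show "\<psi> (x \<otimes> y) = \<psi> x * \<psi> y" "\<psi> (x \<oplus> y) = \<psi> x + \<psi> y" if "x \<in> carrier A" "y \<in> carrier A" for x y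
    using ring_hom_mult[OF h that] ring_hom_add[OF h that] by (simp_all add: ring_mat_simps)
  show "\<psi> \<one> = 1\<^sub>m n" "\<psi> \<zero> = 0\<^sub>m n n" using ring_hom_one[OF h] h.hom_zero by (simp_all add: ring_mat_simps)
  show "\<exists>k. \<psi> (\<iota> c) = k \<cdot>\<^sub>m 1\<^sub>m n" if "c \<in> K" for c using assms that by (simp add: scalar_hom_def)
qed

lemma scalar_hom_smult:
  assumes \<psi>: "scalar_hom n \<psi>" and k: "\<psi> (\<iota> c) = k \<cdot>\<^sub>m 1\<^sub>m n" and c: "c \<in> K" and x: "x \<in> carrier A"
  shows "\<psi> (\<iota> c \<otimes> x) = k \<cdot>\<^sub>m \<psi> x"
  unfolding scalar_homD(2)[OF \<psi> \<iota>_closed[OF c] x] k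
    mult_smult_assoc_mat[OF one_carrier_mat scalar_homD(1)[OF \<psi> x]] left_mult_one_mat[OF scalar_homD(1)[OF \<psi> x]] ..

text \<open>Up to central scalars, conjugation by g multiplies t by a factor. The trace is invariant
  under conjugation, so the difference of the images of \<open>\<alpha>\<close> and
  \<open>\<beta>\<close> annihilates it.\<close>

lemma trace_zero:
  fixes \<psi> :: "'a \<Rightarrow> 'e::field mat"
  assumes \<psi>: "scalar_hom n \<psi>" and n: "0 < n" and t: "t \<in> carrier A" and g: "g \<in> Units A"
    and ab: "\<alpha> \<in> K" "\<beta> \<in> K" "\<alpha> \<noteq> \<beta>" and eq: "\<iota> \<alpha> \<otimes> (g \<otimes> t) = \<iota> \<beta> \<otimes> (t \<otimes> g)"
  shows "mat_tr (\<psi> t) = 0"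
proof -
  note d = scalar_homD[OF \<psi>]
  have gc: "g \<in> carrier A" and gi: "inv g \<in> carrier A" using g by auto
  obtain a b where a: "\<psi> (\<iota> \<alpha>) = a \<cdot>\<^sub>m 1\<^sub>m n" and b: "\<psi> (\<iota> \<beta>) = b \<cdot>\<^sub>m 1\<^sub>m n" using d(6) ab by blast
  \<comment> \<open>\<open>\<alpha> - \<beta>\<close> is invertible in K, and a unital map cannot
    send an invertible element to zero.\<close>
  have "a \<noteq> b"
  proof
    assume "a = b"
    let ?c = "\<alpha> - \<beta>"
    have c: "?c \<in> K" "inverse ?c \<in> K" using ab K.diff K.inverse by auto
    have "\<iota> \<alpha> = \<iota> ?c \<oplus> \<iota> \<beta>" using \<iota>_add[OF c(1) ab(2)] by simp
    then have "\<psi> (\<iota> \<alpha>) = \<psi> (\<iota> ?c) + \<psi> (\<iota> \<beta>)" using d(3) c ab by simp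
    moreover obtain k where k: "\<psi> (\<iota> ?c) = k \<cdot>\<^sub>m 1\<^sub>m n" using d(6) c(1) by blast
    ultimately have "a \<cdot>\<^sub>m 1\<^sub>m n = k \<cdot>\<^sub>m 1\<^sub>m n + b \<cdot>\<^sub>m (1\<^sub>m n :: 'e mat)" by (simp only: a b)
    then have "(a \<cdot>\<^sub>m 1\<^sub>m n) $$ (0, 0) = (k \<cdot>\<^sub>m 1\<^sub>m n + b \<cdot>\<^sub>m (1\<^sub>m n :: 'e mat)) $$ (0, 0)" by simp
    then have "k = 0" using n \<open>a = b\<close> by simp
    have "\<iota> ?c \<otimes> \<iota> (inverse ?c) = \<one>" using \<iota>_mult[OF c] ab(3) by (simp add: \<iota>_one)
    then have "1\<^sub>m n = \<psi> (\<iota> ?c \<otimes> \<iota> (inverse ?c))" using d(4) by simp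
    also have "\<dots> = 0 \<cdot>\<^sub>m \<psi> (\<iota> (inverse ?c))" using scalar_hom_smult[OF \<psi> k c(1)] c(2) \<open>k = 0\<close> by simp
    finally have "(1\<^sub>m n :: 'e mat) = 0 \<cdot>\<^sub>m \<psi> (\<iota> (inverse ?c))" .
    then have "(1\<^sub>m n :: 'e mat) $$ (0, 0) = (0 \<cdot>\<^sub>m \<psi> (\<iota> (inverse ?c))) $$ (0, 0)" by simp
    then show False using n d(1)[of "\<iota> (inverse ?c)"] c(2) by simp
  qed
  have carr: "\<psi> g \<in> carrier_mat n n" "\<psi> t \<in> carrier_mat n n" "\<psi> (inv g) \<in> carrier_mat n n"
    using d(1) gc gi t by auto
  have one: "\<psi> (inv g) * \<psi> g = 1\<^sub>m n" "\<psi> g * \<psi> (inv g) = 1\<^sub>m n"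
    using d(2,4) gc gi g by (metis Units_l_inv, metis Units_r_inv)
  have eq': "a \<cdot>\<^sub>m (\<psi> g * \<psi> t) = b \<cdot>\<^sub>m (\<psi> t * \<psi> g)"
    using arg_cong[OF eq, of \<psi>] scalar_hom_smult[OF \<psi> a ab(1)] scalar_hom_smult[OF \<psi> b ab(2)] d(2) gc t by simp
  note gt = mult_carrier_mat[OF carr(1,2)] and tg = mult_carrier_mat[OF carr(2,1)]
  have "a * mat_tr (\<psi> t) = a * mat_tr ((\<psi> t * \<psi> (inv g)) * \<psi> g)"
    unfolding assoc_mult_mat[OF carr(2,3,1)] one right_mult_one_mat[OF carr(2)] ..
  also have "mat_tr ((\<psi> t * \<psi> (inv g)) * \<psi> g) = mat_tr ((\<psi> g * \<psi> t) * \<psi> (inv g))"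
    unfolding mat_tr_mult_comm[OF mult_carrier_mat[OF carr(2,3)] carr(1)] assoc_mult_mat[OF carr(1,2,3)] ..
  also have "a * \<dots> = mat_tr ((a \<cdot>\<^sub>m (\<psi> g * \<psi> t)) * \<psi> (inv g))"
    unfolding mult_smult_assoc_mat[OF gt carr(3)] by (rule mat_tr_smult[OF mult_carrier_mat[OF gt carr(3)], symmetric])
  also have "\<dots> = b * mat_tr ((\<psi> t * \<psi> g) * \<psi> (inv g))"
    unfolding eq' mult_smult_assoc_mat[OF tg carr(3)] by (rule mat_tr_smult[OF mult_carrier_mat[OF tg carr(3)]])
  also have "(\<psi> t * \<psi> g) * \<psi> (inv g) = \<psi> t"
    unfolding assoc_mult_mat[OF carr(2,1,3)] one right_mult_one_mat[OF carr(2)] ..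
  finally show ?thesis using \<open>a \<noteq> b\<close> by (simp add: algebra_simps)
qed

text \<open>Orthogonality of the basis elements \<open>u a\<close> for the trace form; the sum is the expansion of
  an arbitrary element.\<close>

lemma trace_orthogonal:
  fixes \<psi> :: "'a \<Rightarrow> 'e::field mat"
  assumes \<psi>: "scalar_hom n \<psi>" and n: "0 < n" and fin: "finite B"
    and u: "\<And>a. a \<in> B \<Longrightarrow> u a \<in> Units A" and h: "\<And>a. a \<in> B \<Longrightarrow> h a \<in> K"
    and sep: "\<And>a b. a \<in> B \<Longrightarrow> b \<in> B \<Longrightarrow> a \<noteq> b \<Longrightarrow> \<exists>g\<in>Units A. \<exists>\<alpha>\<in>K. \<exists>\<beta>\<in>K. \<alpha> \<noteq> \<beta> \<and>
      \<iota> \<alpha> \<otimes> (g \<otimes> (u a \<otimes> inv (u b))) = \<iota> \<beta> \<otimes> ((u a \<otimes> inv (u b)) \<otimes> g)"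
    and b: "b \<in> B"
  shows "mat_tr (\<psi> ((\<Oplus>a\<in>B. \<iota> (h a) \<otimes> u a) \<otimes> inv (u b))) = mat_tr (\<psi> (\<iota> (h b)))"
proof -
  note d = scalar_homD[OF \<psi>]
  define T where "T x = mat_tr (\<psi> (x \<otimes> inv (u b)))" for x
  have ub: "u b \<in> carrier A" "inv (u b) \<in> carrier A" using u[OF b] by auto
  have T_add: "T (x \<oplus> y) = T x + T y" if "x \<in> carrier A" "y \<in> carrier A" for x y
  proof -
    have xy: "x \<otimes> inv (u b) \<in> carrier A" "y \<otimes> inv (u b) \<in> carrier A" using that ub by auto
    show ?thesis unfolding T_def l_distr[OF that ub(2)] d(3)[OF xy] by (rule mat_tr_add[OF d(1)[OF xy(1)] d(1)[OF xy(2)]])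
  qed
  have T_zero: "T \<zero> = 0" unfolding T_def using ub d(5) by (simp add: mat_tr_def)
  have uc: "\<iota> (h a) \<otimes> u a \<in> carrier A" if "a \<in> B" for a using u[OF that] h[OF that] by auto
  have sum: "T (\<Oplus>a\<in>C. \<iota> (h a) \<otimes> u a) = (\<Sum>a\<in>C. T (\<iota> (h a) \<otimes> u a))" if "C \<subseteq> B" for C
    using finite_subset[OF that fin] that
  proof induction
    case (insert a C)
    then have *: "(\<lambda>a. \<iota> (h a) \<otimes> u a) \<in> C \<rightarrow> carrier A" "\<iota> (h a) \<otimes> u a \<in> carrier A" using uc by auto
    have "T (\<Oplus>a\<in>insert a C. \<iota> (h a) \<otimes> u a) = T ((\<iota> (h a) \<otimes> u a) \<oplus> (\<Oplus>a\<in>C. \<iota> (h a) \<otimes> u a))"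
      by (simp only: finsum_insert[OF insert.hyps *])
    also have "\<dots> = T (\<iota> (h a) \<otimes> u a) + T (\<Oplus>a\<in>C. \<iota> (h a) \<otimes> u a)"
      by (rule T_add[OF *(2) finsum_closed[OF *(1)]])
    finally show ?case using insert by simp
  qed (simp add: T_zero)
  have zero: "T (\<iota> (h a) \<otimes> u a) = 0" if a: "a \<in> B" "a \<noteq> b" for a
  proof -
    have ua: "u a \<in> carrier A" using u[OF a(1)] by auto
    obtain k where k: "\<psi> (\<iota> (h a)) = k \<cdot>\<^sub>m 1\<^sub>m n" using d(6) h[OF a(1)] by blast
    have t: "u a \<otimes> inv (u b) \<in> carrier A" using ua ub by simp
    have "T (\<iota> (h a) \<otimes> u a) = mat_tr (\<psi> (\<iota> (h a) \<otimes> (u a \<otimes> inv (u b))))"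
      unfolding T_def using h[OF a(1)] ua ub by (simp add: m_assoc)
    also have "\<dots> = k * mat_tr (\<psi> (u a \<otimes> inv (u b)))"
      unfolding scalar_hom_smult[OF \<psi> k h[OF a(1)] t] by (rule mat_tr_smult[OF d(1)[OF t]])
    also have "mat_tr (\<psi> (u a \<otimes> inv (u b))) = 0"
      using sep[OF a(1) b a(2)] trace_zero[OF \<psi> n t] by blast
    finally show ?thesis by simp
  qed
  have "T (\<Oplus>a\<in>B. \<iota> (h a) \<otimes> u a) = (\<Sum>a\<in>B. if a = b then T (\<iota> (h b) \<otimes> u b) else 0)"
    unfolding sum[OF order_refl] by (intro sum.cong refl) (auto simp: zero)
  also have "\<dots> = T (\<iota> (h b) \<otimes> u b)" using fin b by simp
  also have "\<dots> = mat_tr (\<psi> (\<iota> (h b)))"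
    unfolding T_def using h[OF b] ub u[OF b] by (simp add: m_assoc)
  finally show ?thesis by (simp add: T_def)
qed

lemma expansion:
  assumes fin: "finite B" and u': "u \<in> B \<rightarrow> carrier A"
  shows "h \<in> B \<rightarrow> K \<Longrightarrow> h' \<in> B \<rightarrow> K \<Longrightarrow>
      (\<Oplus>a\<in>B. \<iota> (h a) \<otimes> u a) \<oplus> (\<Oplus>a\<in>B. \<iota> (h' a) \<otimes> u a) = (\<Oplus>a\<in>B. \<iota> (h a + h' a) \<otimes> u a)"
    and "h \<in> B \<rightarrow> K \<Longrightarrow> c \<in> K \<Longrightarrow> \<iota> c \<otimes> (\<Oplus>a\<in>B. \<iota> (h a) \<otimes> u a) = (\<Oplus>a\<in>B. \<iota> (c * h a) \<otimes> u a)"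
    and "b \<in> B \<Longrightarrow> u b = (\<Oplus>a\<in>B. \<iota> (if a = b then 1 else 0) \<otimes> u a)"
proof -
  note u = funcset_mem[OF u']
  assume h: "h \<in> B \<rightarrow> K"
  then have hK: "h a \<in> K" if "a \<in> B" for a using that by blast
  then have H: "(\<lambda>a. \<iota> (h a) \<otimes> u a) \<in> B \<rightarrow> carrier A" using u by simp
  {
    assume h': "h' \<in> B \<rightarrow> K"
    then have hK': "h' a \<in> K" if "a \<in> B" for a using that by blast
    then have H': "(\<lambda>a. \<iota> (h' a) \<otimes> u a) \<in> B \<rightarrow> carrier A" using u by simp
    show "(\<Oplus>a\<in>B. \<iota> (h a) \<otimes> u a) \<oplus> (\<Oplus>a\<in>B. \<iota> (h' a) \<otimes> u a) = (\<Oplus>a\<in>B. \<iota> (h a + h' a) \<otimes> u a)"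
      unfolding finsum_addf[OF H H', symmetric]
      by (rule finsum_cong') (use hK hK' u K.add in \<open>simp_all add: \<iota>_add l_distr\<close>)
  }
  {
    assume c: "c \<in> K"
    show "\<iota> c \<otimes> (\<Oplus>a\<in>B. \<iota> (h a) \<otimes> u a) = (\<Oplus>a\<in>B. \<iota> (c * h a) \<otimes> u a)"
      unfolding finsum_rdistr[OF fin \<iota>_closed[OF c] H]
      by (rule finsum_cong') (use hK c u K.mult in \<open>simp_all add: \<iota>_left\<close>)
  }
next
  note u = funcset_mem[OF u']
  assume b: "b \<in> B"
  have "(\<Oplus>a\<in>B. \<iota> (if a = b then 1 else 0) \<otimes> u a) = (\<Oplus>a\<in>B. if b = a then u a else \<zero>)"
    by (rule finsum_cong') (use u in \<open>auto simp: \<iota>_one \<iota>_zero\<close>)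
  also have "\<dots> = u b" by (rule finsum_singleton[OF b fin]) (use u in auto)
  finally show "u b = (\<Oplus>a\<in>B. \<iota> (if a = b then 1 else 0) \<otimes> u a)" by (rule sym)
qed

end

lemma smult_mult_smult_mat:
  fixes M N :: "'a::comm_ring_1 mat"
  assumes "M \<in> carrier_mat n n" "N \<in> carrier_mat n n"
  shows "(c \<cdot>\<^sub>m M) * (d \<cdot>\<^sub>m N) = (c * d) \<cdot>\<^sub>m (M * N)"
proof -
  have "(c \<cdot>\<^sub>m M) * (d \<cdot>\<^sub>m N) = c \<cdot>\<^sub>m (d \<cdot>\<^sub>m (M * N))"
    unfolding mult_smult_assoc_mat[OF assms(1) smult_carrier_mat[OF assms(2)]] mult_smult_distrib[OF assms] ..
  also have "\<dots> = (c * d) \<cdot>\<^sub>m (M * N)" by (intro eq_matI) (auto simp: mult.assoc)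
  finally show ?thesis .
qed

lemma iter_prod_single:
  assumes "i < k" "M i \<in> carrier_mat n n" "\<And>j. j < k \<Longrightarrow> j \<noteq> i \<Longrightarrow> M j = 1\<^sub>m n"
  shows "iter_prod n M k = M i"
  using assms
proof (induction k)
  case (Suc k)
  show ?case
  proof (cases "i = k")
    case True
    then have "iter_prod n M k = 1\<^sub>m n" using Suc.prems(3) by (intro iter_prod_one) auto
    then show ?thesis using True left_mult_one_mat[OF Suc.prems(2)] by simp
  next
    case False
    then have "iter_prod n M k = M i" "M k = 1\<^sub>m n" using Suc by auto
    then show ?thesis using right_mult_one_mat[OF Suc.prems(2)] by simp
  qed
qed simp

lemma lspan_mult:
  assumes T: "T \<subseteq> carrier_mat n n" "\<And>x y. x \<in> T \<Longrightarrow> y \<in> T \<Longrightarrow> x * y \<in> T"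
    and M: "M \<in> lspan n T" and N: "N \<in> lspan n T"
  shows "M * N \<in> lspan n T"
proof -
  have one: "x * N \<in> lspan n T" if x: "x \<in> T" for x
    using N
  proof (induction rule: lspan.induct)
    case lspan_zero
    have "x * 0\<^sub>m n n = 0\<^sub>m n n" using x T(1) by (intro right_mult_zero_mat) auto
    then show ?case by (simp add: lspan.lspan_zero)
  next
    case (lspan_step N y c)
    have carr: "x \<in> carrier_mat n n" "N \<in> carrier_mat n n" "y \<in> carrier_mat n n"
      using x T(1) lspan_carrier[OF lspan_step.hyps(1) T(1)] lspan_step.hyps(2) by auto
    have "x * (N + c \<cdot>\<^sub>m y) = x * N + c \<cdot>\<^sub>m (x * y)"
      unfolding mult_add_distrib_mat[OF carr(1,2) smult_carrier_mat[OF carr(3)]] mult_smult_distrib[OF carr(1,3)] ..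
    then show ?case using lspan.lspan_step[OF lspan_step.IH T(2)[OF x lspan_step.hyps(2)]] by simp
  qed
  note Nc = lspan_carrier[OF N T(1)]
  from M show ?thesis
  proof (induction rule: lspan.induct)
    case lspan_zero
    then show ?case using left_mult_zero_mat[OF Nc, of n] by (simp add: lspan.lspan_zero)
  next
    case (lspan_step M x c)
    have carr: "M \<in> carrier_mat n n" "x \<in> carrier_mat n n"
      using T(1) lspan_carrier[OF lspan_step.hyps(1) T(1)] lspan_step.hyps(2) by auto
    have "(M + c \<cdot>\<^sub>m x) * N = M * N + c \<cdot>\<^sub>m (x * N)"
      unfolding add_mult_distrib_mat[OF carr(1) smult_carrier_mat[OF carr(2)] Nc] mult_smult_assoc_mat[OF carr(2) Nc] ..
    then show ?case
      using lspan_add[OF lspan_smult[OF one[OF lspan_step.hyps(2)] T(1)] T(1) lspan_step.IH] by simp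
  qed
qed

section \<open>Symbol algebras as algebras of equivariant matrices\<close>

context weyl_char
begin

definition base_field :: "'e ratfun set" where
  "base_field = ratfun_field {..<2 * s}"

definition symb where
  "symb i = symbol_algebra base_field (ps ! i) (rconst (w i)) (rvar (2 * i)) (rvar (2 * i + 1))"

definition symb_scalar where
  "symb_scalar i = symbol_scalar base_field (ps ! i) (rconst (w i)) (rvar (2 * i)) (rvar (2 * i + 1))"

text \<open>The substitution \<open>z\<^sub>i \<mapsto> z\<^sub>i\<^sup>p, w\<^sub>i \<mapsto> w\<^sub>i\<^sup>p\<close> adjoins the \<open>p\<close>-th roots over which the symbol
  algebra becomes a matrix algebra, without leaving the field of rational functions.\<close>

definition frob_exp :: "nat \<Rightarrow> nat" where
  "frob_exp v = (if v < 2 * s then ps ! (v div 2) else 1)"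

definition frob :: "'e ratfun \<Rightarrow> 'e ratfun" where
  "frob = fract_map (mp_frob frob_exp)"

definition gen_x :: "nat \<Rightarrow> 'e ratfun mat" where "gen_x i = rvar (2 * i) \<cdot>\<^sub>m shift_mat ps i"
definition gen_y :: "nat \<Rightarrow> 'e ratfun mat" where "gen_y i = rvar (2 * i + 1) \<cdot>\<^sub>m rclock i"

lemma frob_exp_pos: "0 < frob_exp v"
  unfolding frob_exp_def by (auto intro!: nth_pos)

lemma frob_exp_eq: "i < s \<Longrightarrow> frob_exp (2 * i) = ps ! i" "i < s \<Longrightarrow> frob_exp (2 * i + 1) = ps ! i"
  by (simp_all add: frob_exp_def)

lemma inj_frob: "inj_comm_ring_hom (mp_frob frob_exp :: 'e mvpoly \<Rightarrow> _)"
proof -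
  interpret comm_ring_hom "mp_frob frob_exp :: 'e mvpoly \<Rightarrow> _"
    unfolding mp_frob_def by (rule comm_ring_hom_mp_eval[OF comm_ring_hom_mp_const])
  show ?thesis by unfold_locales (rule inj_mp_frob[OF frob_exp_pos])
qed

lemma frob_hom: "field_hom frob"
  unfolding frob_def by (rule field_hom_fract_map[OF inj_frob])

lemma frob_rconst: "frob (rconst c) = rconst c"
proof -
  interpret m: inj_comm_ring_hom "mp_frob frob_exp :: 'e mvpoly \<Rightarrow> _" by (rule inj_frob)
  have "mp_frob frob_exp (mp_const c) = mp_const c"
    unfolding mp_frob_def by (subst mp_eval_single) simp_all
  then show ?thesis unfolding frob_def rconst_def by (subst fract_map_Fract[OF inj_frob]) simp_all
qed

lemma frob_rvar: "frob (rvar v) = rvar v ^ frob_exp v"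
proof -
  interpret m: inj_comm_ring_hom "mp_frob frob_exp :: 'e mvpoly \<Rightarrow> _" by (rule inj_frob)
  interpret F: inj_comm_ring_hom "\<lambda>p :: 'e mvpoly. Fract p 1" by (rule inj_comm_ring_hom_Fract)
  have "mp_frob frob_exp (mp_var v) = (mp_var v ^ frob_exp v :: 'e mvpoly)"
    unfolding mp_frob_def by (subst mp_eval_single) (simp_all add: single_one)
  then have "frob (rvar v) = Fract (mp_var v ^ frob_exp v) 1"
    unfolding frob_def rvar_def by (subst fract_map_Fract[OF inj_frob]) simp_all
  then show ?thesis unfolding F.hom_power rvar_def .
qed

text \<open>In the image of \<open>frob\<close> variable j enters only through its power with
  exponent \<open>frob_exp j\<close>, in which the root of unity d disappears; it suffices to check
  this on constants and variables. Hence multiplication by scalars of the center preserves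
  equivariance.\<close>

lemma chi_frob_aux:
  assumes d: "d \<noteq> 0" and j: "d ^ frob_exp j = 1"
  shows "chi j d (frob c) = frob c"
proof (rule ratfun_hom_eq[OF _ frob_hom])
  interpret x: field_hom "chi j d" by (rule field_hom_chi[OF d])
  interpret f: field_hom frob by (rule frob_hom)
  interpret r: field_hom "rconst :: 'e \<Rightarrow> _" by (rule field_hom_rconst)
  show "field_hom (\<lambda>c. chi j d (frob c))"
    by standard (simp_all only: f.hom_zero f.hom_one f.hom_add f.hom_mult x.hom_zero x.hom_one x.hom_add x.hom_mult)
  show "chi j d (frob (rconst c)) = frob (rconst c)" for c
    unfolding frob_rconst chi_rconst[OF d] ..
  show "chi j d (frob (rvar i)) = frob (rvar i)" for i
  proof (cases "i = j")
    case True
    then show ?thesis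
      unfolding frob_rvar x.hom_power chi_rvar[OF d] power_mult_distrib
      using j by (simp flip: r.hom_power)
  next
    case False
    then show ?thesis unfolding frob_rvar x.hom_power chi_rvar[OF d] by simp
  qed
qed

lemma equivariant_frob: "equivariant M \<Longrightarrow> equivariant (frob c \<cdot>\<^sub>m M)"
proof (erule equivariant_smult)
  fix i assume i: "i < s"
  show "chi (2 * i) (w i) (frob c) = frob c"
    by (rule chi_frob_aux[OF w_nonzero[OF i]]) (simp add: frob_exp_eq[OF i] w_pow[OF i])
  show "chi (2 * i + 1) (inverse (w i)) (frob c) = frob c"
    by (rule chi_frob_aux) (use frob_exp_eq(2)[OF i] w_nonzero[OF i] w_pow[OF i] in \<open>simp_all add: power_inverse\<close>)
qed

lemma gen_carrier: "gen_x i \<in> carrier_mat n n" "gen_y i \<in> carrier_mat n n"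
  by (simp_all add: gen_x_def gen_y_def smult_carrier_mat)

lemma gen_pow:
  assumes i: "i < s"
  shows "gen_x i ^\<^sub>m (ps ! i) = frob (rvar (2 * i)) \<cdot>\<^sub>m 1\<^sub>m n"
    "gen_y i ^\<^sub>m (ps ! i) = frob (rvar (2 * i + 1)) \<cdot>\<^sub>m 1\<^sub>m n"
  unfolding gen_x_def gen_y_def pow_smult_mat[OF shift_mat_carrier] pow_smult_mat[OF clock_mat_carrier]
    shift_pow_order[OF i] clock_pow_order[of "\<lambda>i. rconst (w i)" i, OF rconst_w_pow[OF i]] frob_rvar frob_exp_eq[OF i]
  by (rule refl)+

lemma gen_comm:
  assumes i: "i < s" and j: "j < s"
  shows "gen_y i * gen_x j = (if i = j then rconst (w i) else 1) \<cdot>\<^sub>m (gen_x j * gen_y i)"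
    "gen_x i * gen_x j = gen_x j * gen_x i" "gen_y i * gen_y j = gen_y j * gen_y i"
proof -
  show "gen_y i * gen_x j = (if i = j then rconst (w i) else 1) \<cdot>\<^sub>m (gen_x j * gen_y i)"
    unfolding gen_x_def gen_y_def smult_mult_smult_mat[OF shift_mat_carrier clock_mat_carrier]
      smult_mult_smult_mat[OF clock_mat_carrier shift_mat_carrier] rclock_shift_comm[OF i j]
    by (intro eq_matI) (auto simp: mult_ac)
  show "gen_x i * gen_x j = gen_x j * gen_x i"
    unfolding gen_x_def smult_mult_smult_mat[OF shift_mat_carrier shift_mat_carrier] shift_shift_comm[OF i j]
    by (simp add: mult.commute)
  show "gen_y i * gen_y j = gen_y j * gen_y i"
    unfolding gen_y_def smult_mult_smult_mat[OF clock_mat_carrier clock_mat_carrier]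
      clock_clock_comm[of "\<lambda>i. rconst (w i)" i j] by (simp add: mult.commute)
qed

lemma base_field: "field_set base_field"
  unfolding base_field_def by (rule field_set_ratfun_field)

lemma rconst_base: "rconst c \<in> base_field"
  unfolding base_field_def by (rule rconst_in_ratfun_field)

lemma symbol_alg_symb:
  assumes i: "i < s"
  shows "symbol_alg base_field (ps ! i) (rconst (w i)) (rvar (2 * i)) (rvar (2 * i + 1))"
proof -
  interpret field_set base_field by (rule base_field)
  show ?thesis
    by unfold_locales
      (use nth_pos[OF i] i rconst_base in \<open>auto simp: base_field_def intro!: rvar_in_ratfun_field\<close>)
qed

text \<open>Collects the presentation and the matrix representation on the same two generators,
  after which the construction as a quotient of the free algebra can be forgotten.\<close>

lemma symb_exists:
  assumes i: "i < s"
  shows "\<exists>x y \<Psi>. symbol_presentation (symb i) base_field (symb_scalar i) x y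
      (ps ! i) (rconst (w i)) (rvar (2 * i)) (rvar (2 * i + 1)) \<and>
    \<Psi> \<in> Ring.ring_hom (symb i) (ring_mat TYPE('e ratfun) n ()) \<and>
    (\<forall>c\<in>base_field. \<Psi> (symb_scalar i c) = frob c \<cdot>\<^sub>m 1\<^sub>m n) \<and> \<Psi> x = gen_x i \<and> \<Psi> y = gen_y i"
proof -
  interpret S: symbol_alg base_field "ps ! i" "rconst (w i)" "rvar (2 * i)" "rvar (2 * i + 1)"
    by (rule symbol_alg_symb[OF i])
  interpret f: field_hom frob by (rule frob_hom)
  have f: "comm_ring_hom frob" by unfold_locales
  have comm: "gen_y i * gen_x i = frob (rconst (w i)) \<cdot>\<^sub>m (gen_x i * gen_y i)"
    using gen_comm(1)[OF i i] by (simp add: frob_rconst)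
  obtain \<Psi> where "\<Psi> \<in> Ring.ring_hom S.Q (ring_mat TYPE('e ratfun) n ())"
    "\<forall>c\<in>base_field. \<Psi> (S.sc c) = frob c \<cdot>\<^sub>m 1\<^sub>m n" "\<Psi> (S.gen [GenX]) = gen_x i" "\<Psi> (S.gen [GenY]) = gen_y i"
    using S.symbol_representation[OF f gen_carrier gen_pow[OF i] comm] by blast
  then show ?thesis
    unfolding symb_def symb_scalar_def S.symbol_algebra_eq S.symbol_scalar_eq
    using S.presentation by blast
qed

end

locale weyl_D = weyl_char ps n s w for ps n s and w :: "nat \<Rightarrow> 'e::field" +
  fixes xs ys :: "nat \<Rightarrow> (sym_gen list \<Rightarrow> 'e ratfun) set"
    and \<Psi> :: "nat \<Rightarrow> (sym_gen list \<Rightarrow> 'e ratfun) set \<Rightarrow> 'e ratfun mat"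
  assumes pres: "\<And>i. i < s \<Longrightarrow> symbol_presentation (symb i) base_field (symb_scalar i) (xs i) (ys i)
      (ps ! i) (rconst (w i)) (rvar (2 * i)) (rvar (2 * i + 1))"
    and \<Psi>_hom: "\<And>i. i < s \<Longrightarrow> \<Psi> i \<in> Ring.ring_hom (symb i) (ring_mat TYPE('e ratfun) n ())"
    and \<Psi>_sc: "\<And>i c. i < s \<Longrightarrow> c \<in> base_field \<Longrightarrow> \<Psi> i (symb_scalar i c) = frob c \<cdot>\<^sub>m 1\<^sub>m n"
    and \<Psi>_x: "\<And>i. i < s \<Longrightarrow> \<Psi> i (xs i) = gen_x i" and \<Psi>_y: "\<And>i. i < s \<Longrightarrow> \<Psi> i (ys i) = gen_y i"
begin

sublocale T: tensor_alg base_field s symb symb_scalar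
  by (intro tensor_alg.intro base_field tensor_alg_axioms.intro symbol_presentation.axioms(1)[OF pres])

sublocale TS: scalar_alg T.Q base_field T.sc
  by (rule T.scalar_alg_Q)

lemma \<Psi>_simps:
  assumes i: "i < s"
  shows "\<And>b. b \<in> carrier (symb i) \<Longrightarrow> \<Psi> i b \<in> carrier_mat n n"
    "\<And>a b. a \<in> carrier (symb i) \<Longrightarrow> b \<in> carrier (symb i) \<Longrightarrow> \<Psi> i (a \<oplus>\<^bsub>symb i\<^esub> b) = \<Psi> i a + \<Psi> i b"
    "\<And>a b. a \<in> carrier (symb i) \<Longrightarrow> b \<in> carrier (symb i) \<Longrightarrow> \<Psi> i (a \<otimes>\<^bsub>symb i\<^esub> b) = \<Psi> i a * \<Psi> i b"
    "\<Psi> i \<one>\<^bsub>symb i\<^esub> = 1\<^sub>m n"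
  using ring_hom_closed[OF \<Psi>_hom[OF i]] ring_hom_add[OF \<Psi>_hom[OF i]] ring_hom_mult[OF \<Psi>_hom[OF i]]
    ring_hom_one[OF \<Psi>_hom[OF i]] by (simp_all add: ring_mat_simps)

lemma \<Psi>_induct:
  assumes i: "i < s" and b: "b \<in> carrier (symb i)" and one: "P (1\<^sub>m n)"
    and add: "\<And>M N. M \<in> carrier_mat n n \<Longrightarrow> N \<in> carrier_mat n n \<Longrightarrow> P M \<Longrightarrow> P N \<Longrightarrow> P (M + N)"
    and smult: "\<And>c M. M \<in> carrier_mat n n \<Longrightarrow> P M \<Longrightarrow> P (frob c \<cdot>\<^sub>m M)"
    and x: "\<And>M. M \<in> carrier_mat n n \<Longrightarrow> P M \<Longrightarrow> P (gen_x i * M)"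
    and y: "\<And>M. M \<in> carrier_mat n n \<Longrightarrow> P M \<Longrightarrow> P (gen_y i * M)"
  shows "P (\<Psi> i b)"
proof -
  interpret S: symbol_presentation "symb i" base_field "symb_scalar i" "xs i" "ys i"
    "ps ! i" "rconst (w i)" "rvar (2 * i)" "rvar (2 * i + 1)" by (rule pres[OF i])
  note p = \<Psi>_simps[OF i]
  have "b \<in> {b \<in> carrier (symb i). P (\<Psi> i b)}"
  proof (rule S.generated[OF b])
    show "\<one>\<^bsub>symb i\<^esub> \<in> {b \<in> carrier (symb i). P (\<Psi> i b)}" using one by (simp add: p(4))
    fix a assume a: "a \<in> {b \<in> carrier (symb i). P (\<Psi> i b)}"
    show "xs i \<otimes>\<^bsub>symb i\<^esub> a \<in> {b \<in> carrier (symb i). P (\<Psi> i b)}"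
      "ys i \<otimes>\<^bsub>symb i\<^esub> a \<in> {b \<in> carrier (symb i). P (\<Psi> i b)}"
      using a x[OF p(1)] y[OF p(1)] by (simp_all add: p(3) \<Psi>_x[OF i] \<Psi>_y[OF i])
    show "a \<oplus>\<^bsub>symb i\<^esub> b \<in> {b \<in> carrier (symb i). P (\<Psi> i b)}" if "b \<in> {b \<in> carrier (symb i). P (\<Psi> i b)}" for b
      using a that add[OF p(1) p(1)] by (simp add: p(2))
    show "symb_scalar i c \<otimes>\<^bsub>symb i\<^esub> a \<in> {b \<in> carrier (symb i). P (\<Psi> i b)}" if c: "c \<in> base_field" for c
    proof -
      have a': "a \<in> carrier (symb i)" "P (\<Psi> i a)" using a by auto
      have "\<Psi> i (symb_scalar i c \<otimes>\<^bsub>symb i\<^esub> a) = frob c \<cdot>\<^sub>m \<Psi> i a"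
        unfolding p(3)[OF S.\<iota>_closed[OF c] a'(1)] \<Psi>_sc[OF i c]
          mult_smult_assoc_mat[OF one_carrier_mat p(1)[OF a'(1)]] left_mult_one_mat[OF p(1)[OF a'(1)]] ..
      then show ?thesis using smult[OF p(1)[OF a'(1)] a'(2)] a' c by simp
    qed
  qed
  then show ?thesis by simp
qed

text \<open>Commuting with a fixed matrix is preserved by the operations that generate a factor, so
  it need only be checked on the generators, once for each of the two arguments.\<close>

lemma \<Psi>_commute:
  assumes ij: "i < s" "j < s" "i \<noteq> j" and a: "a \<in> carrier (symb i)" and b: "b \<in> carrier (symb j)"
  shows "\<Psi> i a * \<Psi> j b = \<Psi> j b * \<Psi> i a"
proof -
  have ind: "U * \<Psi> k d = \<Psi> k d * U"
    if k: "k < s" "d \<in> carrier (symb k)" and U: "U \<in> carrier_mat n n" "U * gen_x k = gen_x k * U" "U * gen_y k = gen_y k * U"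
    for U k d
  proof (rule \<Psi>_induct[OF k])
    show "U * 1\<^sub>m n = 1\<^sub>m n * U" using U(1) by simp
  qed (use U gen_carrier in \<open>auto intro: commutes_add commutes_mult commutes_smult\<close>)
  have c: "gen_y i * gen_x j = gen_x j * gen_y i" "gen_y j * gen_x i = gen_x i * gen_y j"
    using gen_comm(1)[OF ij(1,2)] gen_comm(1)[OF ij(2,1)] ij(3) by (simp_all add: smult_one_mat')
  have "gen_x i * \<Psi> j b = \<Psi> j b * gen_x i" "gen_y i * \<Psi> j b = \<Psi> j b * gen_y i"
    by (rule ind[OF ij(2) b]; simp only: gen_carrier gen_comm(2,3)[OF ij(1,2)] c)+
  then show ?thesis
    using ind[OF ij(1) a \<Psi>_simps(1)[OF ij(2) b]] by simp
qed

lemma \<Psi>_equivariant: "i < s \<Longrightarrow> b \<in> carrier (symb i) \<Longrightarrow> equivariant (\<Psi> i b)"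
proof (rule \<Psi>_induct)
  assume i: "i < s"
  show "equivariant (gen_x i * M)" "equivariant (gen_y i * M)" if "equivariant M" for M
    unfolding gen_x_def gen_y_def
    by (rule equivariant_mult[OF equivariant_shift[OF i] that], rule equivariant_mult[OF equivariant_clock[OF i] that])
qed (auto intro: equivariant_one equivariant_add equivariant_frob)

lemma iter_prod_equivariant: "(\<And>i. i < k \<Longrightarrow> equivariant (M i)) \<Longrightarrow> equivariant (iter_prod n M k)"
  by (induction k) (auto intro: equivariant_one equivariant_mult)

definition mons where
  "mons i = {symbol_presentation.mon (symb i) (xs i) (ys i) e f | e f. e < ps ! i \<and> f < ps ! i}"

text \<open>Called a basis in anticipation: \<open>basis_expansion\<close> shows that it spans, and
  independence comes from recovering the coordinates by traces.\<close>

definition basis where "basis = (\<Pi>\<^sub>E i\<in>{..<s}. mons i)"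

lemma mons:
  assumes i: "i < s"
  shows "finite (mons i)" "mons i \<subseteq> carrier (symb i)" "mons i \<subseteq> Units (symb i)" "\<one>\<^bsub>symb i\<^esub> \<in> mons i"
proof -
  interpret S: symbol_presentation "symb i" base_field "symb_scalar i" "xs i" "ys i"
    "ps ! i" "rconst (w i)" "rvar (2 * i)" "rvar (2 * i + 1)" by (rule pres[OF i])
  have "mons i = (\<lambda>(e, f). S.mon e f) ` ({..<ps ! i} \<times> {..<ps ! i})" by (auto simp: mons_def)
  then show "finite (mons i)" by simp
  show "mons i \<subseteq> carrier (symb i)" "mons i \<subseteq> Units (symb i)"
    unfolding mons_def using S.xy_units(3)[OF rvar_nonzero rvar_nonzero] by auto
  have "\<one>\<^bsub>symb i\<^esub> = S.mon 0 0" by (simp add: S.mon_def)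
  then show "\<one>\<^bsub>symb i\<^esub> \<in> mons i" unfolding mons_def using nth_pos[OF i] by blast
qed

lemma basis_app: "a \<in> basis \<Longrightarrow> i < s \<Longrightarrow> a i \<in> mons i"
  by (auto simp: basis_def PiE_iff)

lemma basis_carrier: "a \<in> basis \<Longrightarrow> a \<in> carrier T.G"
  using mons(2) by (auto simp: basis_def PiE_iff)

lemma basis_unit: "a \<in> basis \<Longrightarrow> T.gen a \<in> Units T.Q"
  using basis_app mons(3) by (intro T.gen_unit basis_carrier) blast+

lemma finite_basis: "finite basis"
  unfolding basis_def by (intro finite_PiE) (auto intro: mons(1))

lemma one_basis: "\<one>\<^bsub>T.G\<^esub> \<in> basis"
  unfolding basis_def T.G_simps(3) using mons(4) by auto

text \<open>Two different basis elements differ in some factor i, where they are x^e y^f and x^(e')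
  y^(f'). If e and e' differ, conjugation by y distinguishes them through powers of the root of
  unity; otherwise f and f' differ, and conjugation by x does.\<close>

lemma separate:
  assumes a: "a \<in> basis" and b: "b \<in> basis" and ne: "a \<noteq> b"
  shows "\<exists>g\<in>Units T.Q. \<exists>\<alpha>\<in>base_field. \<exists>\<beta>\<in>base_field. \<alpha> \<noteq> \<beta> \<and>
    T.sc \<alpha> \<otimes>\<^bsub>T.Q\<^esub> (g \<otimes>\<^bsub>T.Q\<^esub> (T.gen a \<otimes>\<^bsub>T.Q\<^esub> inv\<^bsub>T.Q\<^esub> (T.gen b))) =
    T.sc \<beta> \<otimes>\<^bsub>T.Q\<^esub> ((T.gen a \<otimes>\<^bsub>T.Q\<^esub> inv\<^bsub>T.Q\<^esub> (T.gen b)) \<otimes>\<^bsub>T.Q\<^esub> g)"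
proof -
  obtain i where i: "i < s" "a i \<noteq> b i"
    using PiE_ext[of a "{..<s}" mons b] a b ne unfolding basis_def by auto
  interpret S: symbol_presentation "symb i" base_field "symb_scalar i" "xs i" "ys i"
    "ps ! i" "rconst (w i)" "rvar (2 * i)" "rvar (2 * i + 1)" by (rule pres[OF i(1)])
  interpret r: field_hom "rconst :: 'e \<Rightarrow> _" by (rule field_hom_rconst)
  obtain e f where ef: "e < ps ! i" "f < ps ! i" "a i = S.mon e f"
    using basis_app[OF a i(1)] unfolding mons_def by blast
  obtain e' f' where ef': "e' < ps ! i" "f' < ps ! i" "b i = S.mon e' f'"
    using basis_app[OF b i(1)] unfolding mons_def by blast
  have k: "rconst (w i) ^ l \<in> base_field" for l by (rule T.power[OF rconst_base])
  have dist: "rconst (w i) ^ l \<noteq> rconst (w i) ^ l'" if "l < ps ! i" "l' < ps ! i" "l \<noteq> l'" for l l'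
  proof
    assume "rconst (w i) ^ l = rconst (w i) ^ l'"
    then have "rconst (w i ^ l) = rconst (w i ^ l')" by (simp only: r.hom_power)
    then have "w i ^ l = w i ^ l'" by (rule r.injectivity)
    then show False using primitive_root_distinct[OF w[OF i(1)] that(1,2)] that(3) by blast
  qed
  define gx where "gx = T.gen (T.single i (xs i))"
  define gy where "gy = T.gen (T.single i (ys i))"
  have unit: "T.gen (T.single i u) \<in> Units T.Q" if u: "u \<in> Units (symb i)" for u
  proof (rule T.gen_unit)
    show "T.single i u \<in> carrier T.G" by (rule T.single_closed[OF i(1) S.Units_closed[OF u]])
    show "T.single i u j \<in> Units (symb j)" if "j < s" for j
      using u that monoid.Units_one_closed[OF T.monoid_A[OF that]] by (simp add: T.single_def)
  qed
  have gU: "gx \<in> Units T.Q" "gy \<in> Units T.Q"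
    unfolding gx_def gy_def using unit S.xy_units[OF rvar_nonzero rvar_nonzero] by auto
  have ty: "gy \<otimes>\<^bsub>T.Q\<^esub> T.gen d = T.sc (rconst (w i) ^ l) \<otimes>\<^bsub>T.Q\<^esub> (T.gen d \<otimes>\<^bsub>T.Q\<^esub> gy)"
    if "d \<in> basis" "d i = S.mon l l'" for d l l'
    unfolding gy_def T.single_mult[OF i(1) S.xy(2) basis_carrier[OF that(1)]] that(2) S.y_mon
    by (rule T.gen_scale[OF i(1) basis_carrier[OF that(1)] _ k]) simp
  have tx: "T.gen d \<otimes>\<^bsub>T.Q\<^esub> gx = T.sc (rconst (w i) ^ l') \<otimes>\<^bsub>T.Q\<^esub> (gx \<otimes>\<^bsub>T.Q\<^esub> T.gen d)"
    if "d \<in> basis" "d i = S.mon l l'" for d l l'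
    unfolding gx_def T.single_mult[OF i(1) S.xy(1) basis_carrier[OF that(1)]] that(2) S.mon_x
    by (rule T.gen_scale[OF i(1) basis_carrier[OF that(1)] _ k]) simp
  have carr: "T.gen a \<in> carrier T.Q" "gx \<in> carrier T.Q" "gy \<in> carrier T.Q"
    using T.Q.Units_closed[OF basis_unit[OF a]] T.Q.Units_closed[OF gU(1)] T.Q.Units_closed[OF gU(2)] by auto
  show ?thesis
  proof (cases "e = e'")
    case False
    have "T.sc (rconst (w i) ^ e') \<otimes>\<^bsub>T.Q\<^esub> (gy \<otimes>\<^bsub>T.Q\<^esub> (T.gen a \<otimes>\<^bsub>T.Q\<^esub> inv\<^bsub>T.Q\<^esub> (T.gen b))) =
        T.sc (rconst (w i) ^ e) \<otimes>\<^bsub>T.Q\<^esub> ((T.gen a \<otimes>\<^bsub>T.Q\<^esub> inv\<^bsub>T.Q\<^esub> (T.gen b)) \<otimes>\<^bsub>T.Q\<^esub> gy)"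
      by (rule TS.twist_left[OF carr(1,3) k k basis_unit[OF b] ty[OF a ef(3)] ty[OF b ef'(3)]])
    then show ?thesis using gU(2) k dist[OF ef'(1) ef(1)] False by metis
  next
    case True
    then have "f \<noteq> f'" using i(2) ef(3) ef'(3) by auto
    moreover have "T.sc (rconst (w i) ^ f) \<otimes>\<^bsub>T.Q\<^esub> (gx \<otimes>\<^bsub>T.Q\<^esub> (T.gen a \<otimes>\<^bsub>T.Q\<^esub> inv\<^bsub>T.Q\<^esub> (T.gen b))) =
        T.sc (rconst (w i) ^ f') \<otimes>\<^bsub>T.Q\<^esub> ((T.gen a \<otimes>\<^bsub>T.Q\<^esub> inv\<^bsub>T.Q\<^esub> (T.gen b)) \<otimes>\<^bsub>T.Q\<^esub> gx)"
      by (rule TS.twist_right[OF carr(1,2) k k basis_unit[OF b] tx[OF a ef(3)] tx[OF b ef'(3)]])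
    ultimately show ?thesis using gU(1) k dist[OF ef(2) ef'(2)] by metis
  qed
qed

lemma basis_expansion:
  assumes x: "x \<in> carrier T.Q"
  shows "\<exists>h\<in>basis \<rightarrow> base_field. x = (\<Oplus>\<^bsub>T.Q\<^esub>a\<in>basis. T.sc (h a) \<otimes>\<^bsub>T.Q\<^esub> T.gen a)"
proof (rule T.tensor_span[where M = mons, OF mons(2) _ x])
  fix i b V
  assume i: "i < s" and b: "b \<in> carrier (symb i)" and V: "mons i \<subseteq> V"
    "\<And>a b. a \<in> carrier (symb i) \<Longrightarrow> b \<in> carrier (symb i) \<Longrightarrow> a \<in> V \<Longrightarrow> b \<in> V \<Longrightarrow> a \<oplus>\<^bsub>symb i\<^esub> b \<in> V"
    "\<And>c b. c \<in> base_field \<Longrightarrow> b \<in> carrier (symb i) \<Longrightarrow> b \<in> V \<Longrightarrow> symb_scalar i c \<otimes>\<^bsub>symb i\<^esub> b \<in> V"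
  interpret S: symbol_presentation "symb i" base_field "symb_scalar i" "xs i" "ys i"
    "ps ! i" "rconst (w i)" "rvar (2 * i)" "rvar (2 * i + 1)" by (rule pres[OF i])
  from b show "b \<in> V"
  proof (induction b rule: S.span)
    case (mon e f)
    then show ?case using V(1) unfolding mons_def by blast
  next
    case (add a b)
    then show ?case by (rule V(2))
  next
    case (scale c b)
    then show ?case by (rule V(3))
  qed
next
  have u: "T.gen \<in> basis \<rightarrow> carrier T.Q" using T.gen_closed[OF basis_carrier] by blast
  note e = TS.expansion[where u = T.gen, OF finite_basis u]
  {
    fix x y
    assume "\<exists>h\<in>basis \<rightarrow> base_field. x = (\<Oplus>\<^bsub>T.Q\<^esub>a\<in>basis. T.sc (h a) \<otimes>\<^bsub>T.Q\<^esub> T.gen a)"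
      "\<exists>h\<in>basis \<rightarrow> base_field. y = (\<Oplus>\<^bsub>T.Q\<^esub>a\<in>basis. T.sc (h a) \<otimes>\<^bsub>T.Q\<^esub> T.gen a)"
    then obtain h h' where h: "h \<in> basis \<rightarrow> base_field" "x = (\<Oplus>\<^bsub>T.Q\<^esub>a\<in>basis. T.sc (h a) \<otimes>\<^bsub>T.Q\<^esub> T.gen a)"
      and h': "h' \<in> basis \<rightarrow> base_field" "y = (\<Oplus>\<^bsub>T.Q\<^esub>a\<in>basis. T.sc (h' a) \<otimes>\<^bsub>T.Q\<^esub> T.gen a)" by blast
    show "\<exists>h\<in>basis \<rightarrow> base_field. x \<oplus>\<^bsub>T.Q\<^esub> y = (\<Oplus>\<^bsub>T.Q\<^esub>a\<in>basis. T.sc (h a) \<otimes>\<^bsub>T.Q\<^esub> T.gen a)"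
      unfolding h(2) h'(2) e(1)[OF h(1) h'(1)]
      by (rule bexI[of _ "\<lambda>a. h a + h' a"], rule refl) (use h(1) h'(1) T.add in auto)
  next
    fix c x
    assume c: "c \<in> base_field"
      and "\<exists>h\<in>basis \<rightarrow> base_field. x = (\<Oplus>\<^bsub>T.Q\<^esub>a\<in>basis. T.sc (h a) \<otimes>\<^bsub>T.Q\<^esub> T.gen a)"
    then obtain h where h: "h \<in> basis \<rightarrow> base_field" "x = (\<Oplus>\<^bsub>T.Q\<^esub>a\<in>basis. T.sc (h a) \<otimes>\<^bsub>T.Q\<^esub> T.gen a)" by blast
    show "\<exists>h\<in>basis \<rightarrow> base_field. T.sc c \<otimes>\<^bsub>T.Q\<^esub> x = (\<Oplus>\<^bsub>T.Q\<^esub>a\<in>basis. T.sc (h a) \<otimes>\<^bsub>T.Q\<^esub> T.gen a)"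
      unfolding h(2) e(2)[OF h(1) c]
      by (rule bexI[of _ "\<lambda>a. c * h a"], rule refl) (use h(1) c T.mult in auto)
  next
    fix b assume "b \<in> (\<Pi>\<^sub>E i\<in>{..<s}. mons i)"
    then have b: "b \<in> basis" by (simp add: basis_def)
    show "\<exists>h\<in>basis \<rightarrow> base_field. T.gen b = (\<Oplus>\<^bsub>T.Q\<^esub>a\<in>basis. T.sc (h a) \<otimes>\<^bsub>T.Q\<^esub> T.gen a)"
      by (rule bexI[of _ "\<lambda>a. if a = b then 1 else 0"], rule e(3)[OF b]) (auto intro: T.zero T.one)
  }
qed

lemma trace_coefficient:
  fixes \<psi> :: "_ \<Rightarrow> 'l::field mat"
  assumes "TS.scalar_hom n \<psi>" "h \<in> basis \<rightarrow> base_field" "b \<in> basis"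
  shows "mat_tr (\<psi> ((\<Oplus>\<^bsub>T.Q\<^esub>a\<in>basis. T.sc (h a) \<otimes>\<^bsub>T.Q\<^esub> T.gen a) \<otimes>\<^bsub>T.Q\<^esub> inv\<^bsub>T.Q\<^esub> (T.gen b))) =
    mat_tr (\<psi> (T.sc (h b)))"
  by (rule TS.trace_orthogonal[OF assms(1) n_pos finite_basis basis_unit _ separate assms(3)])
    (use assms(2) in auto)

end

lemma field_hom_to_ac: "field_hom (to_ac :: 'a::field \<Rightarrow> _)"
  by standard simp_all

context weyl_D
begin

lemma representation_exists:
  "\<exists>\<Phi>. \<Phi> \<in> Ring.ring_hom T.Q (ring_mat TYPE('e ratfun) n ()) \<and>
    (\<forall>c\<in>base_field. \<forall>a\<in>carrier T.G.
      \<Phi> (T.sc c \<otimes>\<^bsub>T.Q\<^esub> T.gen a) = frob c \<cdot>\<^sub>m iter_prod n (\<lambda>i. \<Psi> i (a i)) s)"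
proof -
  interpret f: field_hom frob by (rule frob_hom)
  have f: "comm_ring_hom frob" by unfold_locales
  show ?thesis by (rule T.tensor_representation[OF f \<Psi>_hom \<Psi>_sc \<Psi>_commute])
qed

lemma D_nonvanishing:
  assumes m: "1 \<le> m" "\<And>i. i < s \<Longrightarrow> ps ! i dvd m"
  shows "(m \<le> n \<longrightarrow> (\<forall>x\<in>carrier T.Q - {\<zero>\<^bsub>T.Q\<^esub>}.
      red_sigma TYPE('e ratfun alg_closure) T.Q n m x \<noteq> \<zero>\<^bsub>T.Q\<^esub>)) \<and>
    (\<forall>xs. length xs = m \<and> set xs \<subseteq> carrier T.Q - {\<zero>\<^bsub>T.Q\<^esub>} \<and>
       (\<forall>x\<in>set xs. \<forall>y\<in>set xs. red_norm TYPE('e ratfun alg_closure) T.Q n x =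
         red_norm TYPE('e ratfun alg_closure) T.Q n y) \<longrightarrow>
       red_trace TYPE('e ratfun alg_closure) T.Q n (list_mult T.Q xs) \<noteq> \<zero>\<^bsub>T.Q\<^esub>) \<and>
    \<not> (\<exists>x\<in>carrier T.Q. red_norm TYPE('e ratfun alg_closure) T.Q n x = \<one>\<^bsub>T.Q\<^esub> \<and>
      red_trace TYPE('e ratfun alg_closure) T.Q n x = \<zero>\<^bsub>T.Q\<^esub>)"
proof -
  obtain \<Phi> where \<Phi>_hom: "\<Phi> \<in> Ring.ring_hom T.Q (ring_mat TYPE('e ratfun) n ())"
    and \<Phi>_val: "\<And>c a. c \<in> base_field \<Longrightarrow> a \<in> carrier T.G \<Longrightarrow>
      \<Phi> (T.sc c \<otimes>\<^bsub>T.Q\<^esub> T.gen a) = frob c \<cdot>\<^sub>m iter_prod n (\<lambda>i. \<Psi> i (a i)) s"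
    using representation_exists by blast
  interpret f: field_hom frob by (rule frob_hom)
  interpret ac: field_hom "to_ac :: 'e ratfun \<Rightarrow> _" by (rule field_hom_to_ac)
  interpret r: field_hom "rconst :: 'e \<Rightarrow> _" by (rule field_hom_rconst)
  have ac': "comm_ring_hom (to_ac :: 'e ratfun \<Rightarrow> _)" by unfold_locales
  have \<Psi>_app: "\<Psi> i (a i) \<in> carrier_mat n n \<and> equivariant (\<Psi> i (a i))" if "a \<in> carrier T.G" "i < s" for a i
    using \<Psi>_simps(1)[OF that(2) T.G_app[OF that]] \<Psi>_equivariant[OF that(2) T.G_app[OF that]] by blast
  have G1: "\<one>\<^bsub>T.G\<^esub> \<in> carrier T.G" by (rule monoid.one_closed[OF T.monoid_G])
  have \<Phi>_gen: "\<Phi> (T.gen a) = iter_prod n (\<lambda>i. \<Psi> i (a i)) s" if "a \<in> carrier T.G" for a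
    using \<Phi>_val[OF T.one that] T.gen_closed[OF that] by (simp add: T.sc_one smult_one_mat')
  have \<Phi>_one: "\<Phi> \<one>\<^bsub>T.Q\<^esub> = 1\<^sub>m n" using ring_hom_one[OF \<Phi>_hom] by (simp add: ring_mat_simps)
  have \<Phi>_sc: "\<Phi> (T.sc c) = frob c \<cdot>\<^sub>m 1\<^sub>m n" if "c \<in> base_field" for c
  proof -
    have "T.sc c \<otimes>\<^bsub>T.Q\<^esub> T.gen \<one>\<^bsub>T.G\<^esub> = T.sc c"
      unfolding T.gen_one by (rule T.Q.r_one[OF T.sc_closed[OF that]])
    then have "\<Phi> (T.sc c) = frob c \<cdot>\<^sub>m iter_prod n (\<lambda>i. \<Psi> i (\<one>\<^bsub>T.G\<^esub> i)) s"
      using \<Phi>_val[OF that G1] by (simp only:)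
    also have "iter_prod n (\<lambda>i. \<Psi> i (\<one>\<^bsub>T.G\<^esub> i)) s = 1\<^sub>m n"
      unfolding \<Phi>_gen[OF G1, symmetric] T.gen_one by (rule \<Phi>_one)
    finally show ?thesis .
  qed
  have scalar: "TS.scalar_hom n \<Phi>" unfolding TS.scalar_hom_def using \<Phi>_hom \<Phi>_sc by blast
  note \<Phi> = TS.scalar_homD[OF scalar]
  have \<Phi>_smult: "\<Phi> (T.sc c \<otimes>\<^bsub>T.Q\<^esub> x) = frob c \<cdot>\<^sub>m \<Phi> x" if "c \<in> base_field" "x \<in> carrier T.Q" for c x
    by (rule TS.scalar_hom_smult[OF scalar \<Phi>_sc[OF that(1)] that])
  have equiv: "equivariant (\<Phi> x)" if "x \<in> carrier T.Q" for x
    using that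
  proof (induction x rule: T.Q_induct)
    case zero
    have "frob 0 \<cdot>\<^sub>m 1\<^sub>m n = 0\<^sub>m n n" by (intro eq_matI) auto
    then show ?case using equivariant_frob[OF equivariant_one, of 0] by (simp only: \<Phi>(5))
  next
    case (add x y)
    show ?case unfolding \<Phi>(3)[OF add(1,2)] by (rule equivariant_add[OF add(3,4)])
  next
    case (mono c g)
    show ?case unfolding \<Phi>_val[OF mono]
      by (intro equivariant_frob iter_prod_equivariant) (use \<Psi>_app[OF mono(2)] in blast)
  qed
  \<comment> \<open>The trace of x times the inverse of a basis element is n times the image of its
    coordinate. It vanishes when x is in the kernel, and therefore so do all coordinates.\<close>
  have kernel: "x = \<zero>\<^bsub>T.Q\<^esub>" if x: "x \<in> carrier T.Q" "\<Phi> x = 0\<^sub>m n n" for x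
  proof -
    obtain h where h: "h \<in> basis \<rightarrow> base_field" "x = (\<Oplus>\<^bsub>T.Q\<^esub>a\<in>basis. T.sc (h a) \<otimes>\<^bsub>T.Q\<^esub> T.gen a)"
      using basis_expansion[OF x(1)] by blast
    have h0: "h b = 0" if b: "b \<in> basis" for b
    proof -
      have ib: "inv\<^bsub>T.Q\<^esub> (T.gen b) \<in> carrier T.Q" by (rule T.Q.Units_inv_closed[OF basis_unit[OF b]])
      have "mat_tr (\<Phi> (T.sc (h b))) = mat_tr (\<Phi> (x \<otimes>\<^bsub>T.Q\<^esub> inv\<^bsub>T.Q\<^esub> (T.gen b)))"
        unfolding h(2) by (rule trace_coefficient[OF scalar h(1) b, symmetric])
      also have "\<dots> = 0"
        unfolding \<Phi>(2)[OF x(1) ib] x(2) left_mult_zero_mat[OF \<Phi>(1)[OF ib]] by (simp add: mat_tr_def)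
      finally have "of_nat n * frob (h b) = 0"
        unfolding \<Phi>_sc[OF funcset_mem[OF h(1) b]] mat_tr_scalar .
      then show ?thesis using char_ratfun[of n] n_pos by simp
    qed
    have "x = (\<Oplus>\<^bsub>T.Q\<^esub>a\<in>basis. \<zero>\<^bsub>T.Q\<^esub>)"
      unfolding h(2)
      by (rule T.Q.finsum_cong') (simp_all add: h0 T.sc_zero T.gen_closed[OF basis_carrier])
    then show ?thesis by simp
  qed
  interpret \<Phi>r: ring_hom_ring T.Q "ring_mat TYPE('e ratfun) n ()" \<Phi>
    by (rule ring_hom_ringI2[OF T.Q.ring_axioms ring_mat \<Phi>_hom])
  have inj: "inj_on \<Phi> (carrier T.Q)"
  proof (rule \<Phi>r.trivial_ker_imp_inj, rule equalityI)
    show "a_kernel T.Q (ring_mat TYPE('e ratfun) n ()) \<Phi> \<subseteq> {\<zero>\<^bsub>T.Q\<^esub>}"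
    proof
      fix x assume "x \<in> a_kernel T.Q (ring_mat TYPE('e ratfun) n ()) \<Phi>"
      then have "x \<in> carrier T.Q \<and> \<Phi> x = \<zero>\<^bsub>ring_mat TYPE('e ratfun) n ()\<^esub>" unfolding a_kernel_def' by (rule CollectD)
      then show "x \<in> {\<zero>\<^bsub>T.Q\<^esub>}" using kernel[of x] by (simp add: ring_mat_simps)
    qed
    show "{\<zero>\<^bsub>T.Q\<^esub>} \<subseteq> a_kernel T.Q (ring_mat TYPE('e ratfun) n ()) \<Phi>"
      unfolding a_kernel_def' using \<Phi>(5) by (simp add: ring_mat_simps)
  qed
  define V where "V = lspan n (\<Phi> ` carrier T.Q)"
  have TV: "\<Phi> ` carrier T.Q \<subseteq> carrier_mat n n" using \<Phi>(1) by blast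
  \<comment> \<open>Over the field of rational functions the variables in front of the generators
    can be divided out, which leaves the clock and shift matrices; these generate all
    matrices.\<close>
  have span: "M \<in> V" if "M \<in> carrier_mat n n" for M
  proof -
    interpret wr: weyl ps n s "\<lambda>i. rconst (w i)"
    proof
      fix i assume i: "i < s"
      have "rconst (w i) ^ j \<noteq> 1" if "w i ^ j \<noteq> 1" for j
        using that r.hom_power[of "w i" j] r.hom_one r.injectivity[of "w i ^ j" 1] by metis
      then show "primitive_root_of_unity (ps ! i) (rconst (w i))"
        using w[OF i] rconst_w_pow[OF i] unfolding primitive_root_of_unity_def by blast
    qed
    have single: "\<Psi> i u \<in> V" if i: "i < s" and u: "u \<in> carrier (symb i)" for i u
    proof -
      note s = T.single_closed[OF i u]
      have "\<Phi> (T.gen (T.single i u)) = \<Psi> i (T.single i u i)"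
        unfolding \<Phi>_gen[OF s]
        by (rule iter_prod_single[OF i]) (use \<Psi>_app[OF s i] \<Psi>_simps(4) in \<open>simp_all add: T.single_def\<close>)
      also have "\<dots> = \<Psi> i u" using i by (simp add: T.single_def)
      finally show ?thesis unfolding V_def using lspan_base[OF _ TV] T.gen_closed[OF s] by (metis imageI)
    qed
    have gens: "gen_x i \<in> V" "gen_y i \<in> V" if i: "i < s" for i
      using single[OF i, of "xs i"] single[OF i, of "ys i"]
        symbol_presentation.xy[OF pres[OF i]] \<Psi>_x[OF i] \<Psi>_y[OF i] by simp_all
    have scale: "c \<cdot>\<^sub>m M \<in> V" if "M \<in> V" for c M
      using that unfolding V_def by (rule lspan_smult[OF _ TV])
    have unscale: "M \<in> V" if "rvar v \<cdot>\<^sub>m M \<in> V" for v and M :: "'e ratfun mat"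
    proof -
      have "inverse (rvar v) \<cdot>\<^sub>m (rvar v \<cdot>\<^sub>m M) = M" by (intro eq_matI) (auto simp: rvar_nonzero)
      then show ?thesis using scale[OF that, of "inverse (rvar v)"] by simp
    qed
    show ?thesis
    proof (rule wr.generation[OF _ _ _ _ _ scale that])
      show "rclock i \<in> V" "shift_mat ps i \<in> V" if "i < s" for i
        using gens[OF that] unfolding gen_x_def gen_y_def by (auto intro: unscale)
      show "1\<^sub>m n \<in> V" unfolding V_def using lspan_base[OF _ TV] \<Phi>_one T.Q.one_closed by (metis imageI)
      show "M + N \<in> V" if "M \<in> V" "N \<in> V" for M N
        using that unfolding V_def by (intro lspan_add[OF _ TV])
      show "M * N \<in> V" if "M \<in> V" "N \<in> V" for M N
      proof -
        have "x * y \<in> \<Phi> ` carrier T.Q" if xy: "x \<in> \<Phi> ` carrier T.Q" "y \<in> \<Phi> ` carrier T.Q" for x y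
        proof -
          obtain a b where ab: "a \<in> carrier T.Q" "b \<in> carrier T.Q" "x = \<Phi> a" "y = \<Phi> b" using xy by blast
          show ?thesis unfolding ab(3,4) \<Phi>(2)[OF ab(1,2), symmetric]
            by (rule imageI[OF T.Q.m_closed[OF ab(1,2)]])
        qed
        then show ?thesis using that unfolding V_def by (intro lspan_mult[OF TV])
      qed
    qed
  qed
  define \<phi> where "\<phi> x = (map_mat to_ac (\<Phi> x) :: 'e ratfun alg_closure mat)" for x
  have \<phi>_hom: "\<phi> \<in> Ring.ring_hom T.Q (ring_mat TYPE('e ratfun alg_closure) n ())"
  proof (rule ring_hom_memI)
    fix x y assume x: "x \<in> carrier T.Q" and y: "y \<in> carrier T.Q"
    show "\<phi> (x \<otimes>\<^bsub>T.Q\<^esub> y) = \<phi> x \<otimes>\<^bsub>ring_mat TYPE('e ratfun alg_closure) n ()\<^esub> \<phi> y"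
      unfolding \<phi>_def \<Phi>(2)[OF x y] ring_mat_simps by (rule ac.mat_hom_mult[OF \<Phi>(1)[OF x] \<Phi>(1)[OF y]])
    show "\<phi> (x \<oplus>\<^bsub>T.Q\<^esub> y) = \<phi> x \<oplus>\<^bsub>ring_mat TYPE('e ratfun alg_closure) n ()\<^esub> \<phi> y"
      unfolding \<phi>_def \<Phi>(3)[OF x y] ring_mat_simps by (rule map_mat_add[OF ac' \<Phi>(1)[OF x] \<Phi>(1)[OF y]])
  next
    show "\<phi> \<one>\<^bsub>T.Q\<^esub> = \<one>\<^bsub>ring_mat TYPE('e ratfun alg_closure) n ()\<^esub>"
      unfolding \<phi>_def \<Phi>_one ring_mat_simps by (rule ac.mat_hom_one)
  qed (use \<Phi>(1) in \<open>simp add: \<phi>_def ring_mat_simps\<close>)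
  have split: "splitting T.Q n \<phi>"
  proof (rule splittingI[OF \<phi>_hom])
    fix z assume "z \<in> ring_center T.Q"
    then have z: "z \<in> carrier T.Q" "\<And>x. x \<in> carrier T.Q \<Longrightarrow> z \<otimes>\<^bsub>T.Q\<^esub> x = x \<otimes>\<^bsub>T.Q\<^esub> z"
      unfolding ring_center_def by auto
    have comm: "\<Phi> z * N = N * \<Phi> z" if "N \<in> carrier_mat n n" for N
    proof -
      have "N \<in> {N \<in> carrier_mat n n. \<Phi> z * N = N * \<Phi> z}"
      proof (rule lspan_induct_closed[OF span[OF that, unfolded V_def]])
        show "\<Phi> ` carrier T.Q \<subseteq> {N \<in> carrier_mat n n. \<Phi> z * N = N * \<Phi> z}"
        proof
          fix y assume "y \<in> \<Phi> ` carrier T.Q"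
          then obtain x where x: "x \<in> carrier T.Q" "y = \<Phi> x" by blast
          have "\<Phi> z * \<Phi> x = \<Phi> x * \<Phi> z"
            unfolding \<Phi>(2)[OF z(1) x(1), symmetric] \<Phi>(2)[OF x(1) z(1), symmetric] z(2)[OF x(1)] ..
          then show "y \<in> {N \<in> carrier_mat n n. \<Phi> z * N = N * \<Phi> z}" using \<Phi>(1)[OF x(1)] x(2) by blast
        qed
        show "0\<^sub>m n n \<in> {N \<in> carrier_mat n n. \<Phi> z * N = N * \<Phi> z}"
          using left_mult_zero_mat[OF \<Phi>(1)[OF z(1)], of n] right_mult_zero_mat[OF \<Phi>(1)[OF z(1)], of n] by simp
      qed (use \<Phi>(1)[OF z(1)] in \<open>auto intro: commutes_add commutes_smult\<close>)
      then show ?thesis by blast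
    qed
    obtain c where "\<Phi> z = c \<cdot>\<^sub>m 1\<^sub>m n" using commutes_all_scalar[OF \<Phi>(1)[OF z(1)] n_pos comm] by blast
    then show "\<exists>c. \<phi> z = c \<cdot>\<^sub>m 1\<^sub>m n" unfolding \<phi>_def by (metis map_mat_smult_one[OF ac'])
  next
    fix a b assume ab: "a < n" "b < n"
    have "mat_unit n a b \<in> V" by (rule span) (simp add: mat_unit_def)
    then have "map_mat to_ac (mat_unit n a b) \<in> lspan n (map_mat to_ac ` \<Phi> ` carrier T.Q)"
      unfolding V_def by (rule lspan_hom[OF ac' _ TV])
    moreover have "map_mat to_ac ` \<Phi> ` carrier T.Q = \<phi> ` carrier T.Q" unfolding \<phi>_def image_image ..
    ultimately show "mat_unit n a b \<in> lspan n (\<phi> ` carrier T.Q)" by (simp only: map_mat_unit[OF ac'])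
  qed
  have center: "T.sc c \<in> ring_center T.Q" if "c \<in> base_field" for c
    unfolding ring_center_def using T.sc_closed[OF that] T.sc_central[OF that] by blast
  have alg: "trace_algebra T.Q n (T.sc ` base_field) \<phi>"
  proof (intro trace_algebra.intro T.Q.ring_axioms trace_algebra_axioms.intro split)
    show "1 \<le> n" using n_pos by simp
    show "of_nat i \<noteq> (0 :: 'e ratfun alg_closure)" if "1 \<le> i" "i \<le> n" for i
    proof
      assume "of_nat i = (0 :: 'e ratfun alg_closure)"
      then have "to_ac (of_nat i :: 'e ratfun) = to_ac 0" by simp
      then have "of_nat i = (0 :: 'e ratfun)" by (rule ac.injectivity)
      with char_ratfun[OF that] show False by (rule notE)
    qed
    show "T.sc ` base_field \<subseteq> ring_center T.Q" using center by blast
    show "\<zero>\<^bsub>T.Q\<^esub> \<in> T.sc ` base_field" "\<one>\<^bsub>T.Q\<^esub> \<in> T.sc ` base_field"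
      using T.sc_zero T.zero T.sc_one T.one by (metis imageI)+
    show "x \<oplus>\<^bsub>T.Q\<^esub> y \<in> T.sc ` base_field" "x \<otimes>\<^bsub>T.Q\<^esub> y \<in> T.sc ` base_field"
      if xy: "x \<in> T.sc ` base_field" "y \<in> T.sc ` base_field" for x y
    proof -
      obtain c d where cd: "c \<in> base_field" "d \<in> base_field" "x = T.sc c" "y = T.sc d" using xy by blast
      show "x \<oplus>\<^bsub>T.Q\<^esub> y \<in> T.sc ` base_field" "x \<otimes>\<^bsub>T.Q\<^esub> y \<in> T.sc ` base_field"
        unfolding cd(3,4) T.sc_add[OF cd(1,2), symmetric] T.sc_mult[OF cd(1,2), symmetric]
        by (rule imageI[OF T.add[OF cd(1,2)]], rule imageI[OF T.mult[OF cd(1,2)]])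
    qed
    show "\<ominus>\<^bsub>T.Q\<^esub> x \<in> T.sc ` base_field" if x: "x \<in> T.sc ` base_field" for x
    proof -
      obtain c where c: "c \<in> base_field" "x = T.sc c" using x by blast
      note c' = T.uminus[OF c(1)]
      have "T.sc (- c) \<oplus>\<^bsub>T.Q\<^esub> T.sc c = \<zero>\<^bsub>T.Q\<^esub>"
        unfolding T.sc_add[OF c' c(1), symmetric] by (simp add: T.sc_zero)
      then have "\<ominus>\<^bsub>T.Q\<^esub> x = T.sc (- c)"
        unfolding c(2) by (rule T.Q.minus_equality[OF _ T.sc_closed[OF c(1)] T.sc_closed[OF c']])
      then show ?thesis using c' by simp
    qed
    show "\<exists>y\<in>T.sc ` base_field. x \<otimes>\<^bsub>T.Q\<^esub> y = \<one>\<^bsub>T.Q\<^esub>" if x: "x \<in> T.sc ` base_field" "x \<noteq> \<zero>\<^bsub>T.Q\<^esub>" for x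
    proof -
      obtain c where c: "c \<in> base_field" "x = T.sc c" using x(1) by blast
      then have "c \<noteq> 0" using x(2) T.sc_zero by auto
      note c' = T.inverse[OF c(1)]
      have "x \<otimes>\<^bsub>T.Q\<^esub> T.sc (inverse c) = \<one>\<^bsub>T.Q\<^esub>"
        unfolding c(2) T.sc_mult[OF c(1) c', symmetric] right_inverse[OF \<open>c \<noteq> 0\<close>] by (rule T.sc_one)
      then show ?thesis using c' by blast
    qed
    show "\<exists>f\<in>T.sc ` base_field. \<forall>\<psi> :: _ \<Rightarrow> 'e ratfun alg_closure mat. splitting T.Q n \<psi> \<longrightarrow> mat_tr (\<psi> x) = mat_tr (\<psi> f)"
      if x: "x \<in> carrier T.Q" for x
    proof -
      obtain h where h: "h \<in> basis \<rightarrow> base_field" "x = (\<Oplus>\<^bsub>T.Q\<^esub>a\<in>basis. T.sc (h a) \<otimes>\<^bsub>T.Q\<^esub> T.gen a)"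
        using basis_expansion[OF x] by blast
      have x1: "x \<otimes>\<^bsub>T.Q\<^esub> inv\<^bsub>T.Q\<^esub> (T.gen \<one>\<^bsub>T.G\<^esub>) = x"
        unfolding T.gen_one T.Q.inv_one by (rule T.Q.r_one[OF x])
      \<comment> \<open>The central part of x is its coordinate at the identity; all other basis
        elements have trace zero under every splitting.\<close>
      have "mat_tr (\<psi> x) = mat_tr (\<psi> (T.sc (h \<one>\<^bsub>T.G\<^esub>)))" if \<psi>: "splitting T.Q n \<psi>"
        for \<psi> :: "_ \<Rightarrow> 'e ratfun alg_closure mat"
      proof -
        have "TS.scalar_hom n \<psi>"
          unfolding TS.scalar_hom_def
        proof (intro conjI ballI)
          show "\<psi> \<in> Ring.ring_hom T.Q (ring_mat TYPE('e ratfun alg_closure) n ())"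
            using \<psi> unfolding splitting_def by (rule conjunct1)
          show "\<exists>k. \<psi> (T.sc c) = k \<cdot>\<^sub>m 1\<^sub>m n" if "c \<in> base_field" for c
            by (rule splitting_hom(8)[OF T.Q.ring_axioms \<psi> center[OF that]])
        qed
        from trace_coefficient[OF this h(1) one_basis] show ?thesis unfolding h(2)[symmetric] x1 .
      qed
      then show ?thesis using funcset_mem[OF h(1) one_basis] by blast
    qed
    show "inj_on \<phi> (carrier T.Q)"
    proof (rule inj_onI)
      fix x y assume xy: "x \<in> carrier T.Q" "y \<in> carrier T.Q" and "\<phi> x = \<phi> y"
      then have "\<Phi> x = \<Phi> y" unfolding \<phi>_def by (intro ac.mat_hom_inj)
      then show "x = y" by (rule inj_onD[OF inj _ xy])
    qed
  qed
  \<comment> \<open>The matrices \<open>\<Phi> x\<close> are equivariant as they stand, so the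
    embedding into the field of equivariance is the identity.\<close>
  have id: "field_hom (\<lambda>c :: 'e ratfun. c)" by standard simp_all
  have map_id: "map_mat (\<lambda>c :: 'e ratfun. c) M = M" for M by (intro eq_matI) auto
  show ?thesis
    by (rule nonvanishing_transfer[OF alg[unfolded \<phi>_def[abs_def]] field_hom_to_ac id \<Phi>(1) _ m])
      (simp_all only: map_id equiv)
qed

end

lemma (in weyl_char) D_algebra_nonvanishing:
  assumes w: "\<And>i. w i = \<zeta> (ps ! i)" and m: "1 \<le> m" "\<And>i. i < s \<Longrightarrow> ps ! i dvd m"
  shows "let D = D_algebra ps \<zeta>;
          \<sigma> = red_sigma TYPE('e ratfun alg_closure) D n;
          nrd = red_norm TYPE('e ratfun alg_closure) D n;
          trd = red_trace TYPE('e ratfun alg_closure) D n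
      in (m \<le> n \<longrightarrow> (\<forall>x\<in>carrier D - {\<zero>\<^bsub>D\<^esub>}. \<sigma> m x \<noteq> \<zero>\<^bsub>D\<^esub>)) \<and>
         (\<forall>xs. length xs = m \<and> set xs \<subseteq> carrier D - {\<zero>\<^bsub>D\<^esub>} \<and>
               (\<forall>x\<in>set xs. \<forall>y\<in>set xs. nrd x = nrd y) \<longrightarrow>
               trd (list_mult D xs) \<noteq> \<zero>\<^bsub>D\<^esub>) \<and>
         \<not> (\<exists>x\<in>carrier D. nrd x = \<one>\<^bsub>D\<^esub> \<and> trd x = \<zero>\<^bsub>D\<^esub>)"
proof -
  let ?P = "\<lambda>i x y \<Psi>. symbol_presentation (symb i) base_field (symb_scalar i) x y
      (ps ! i) (rconst (w i)) (rvar (2 * i)) (rvar (2 * i + 1)) \<and>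
    \<Psi> \<in> Ring.ring_hom (symb i) (ring_mat TYPE('e ratfun) n ()) \<and>
    (\<forall>c\<in>base_field. \<Psi> (symb_scalar i c) = frob c \<cdot>\<^sub>m 1\<^sub>m n) \<and> \<Psi> x = gen_x i \<and> \<Psi> y = gen_y i"
  \<comment> \<open>The two generators and the representation are packed into a triple t so that one
    choice function serves all factors.\<close>
  have "\<forall>i. \<exists>t. i < s \<longrightarrow> ?P i (fst t) (fst (snd t)) (snd (snd t))"
    using symb_exists by fastforce
  from choice[OF this] obtain t where t: "\<forall>i. i < s \<longrightarrow> ?P i (fst (t i)) (fst (snd (t i))) (snd (snd (t i)))" ..
  interpret D: weyl_D ps n s w "\<lambda>i. fst (t i)" "\<lambda>i. fst (snd (t i))" "\<lambda>i. snd (snd (t i))"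
  proof (intro weyl_D.intro weyl_D_axioms.intro weyl_char_axioms)
    fix i assume i: "i < s"
    note p = t[rule_format, OF i]
    show "symbol_presentation (symb i) base_field (symb_scalar i) (fst (t i)) (fst (snd (t i)))
      (ps ! i) (rconst (w i)) (rvar (2 * i)) (rvar (2 * i + 1))" using p by (rule conjunct1)
    show "snd (snd (t i)) \<in> Ring.ring_hom (symb i) (ring_mat TYPE('e ratfun) n ())" using p by blast
    show "snd (snd (t i)) (symb_scalar i c) = frob c \<cdot>\<^sub>m 1\<^sub>m n" if "c \<in> base_field" for c using p that by blast
    show "snd (snd (t i)) (fst (t i)) = gen_x i" "snd (snd (t i)) (fst (snd (t i))) = gen_y i" using p by blast+
  qed
  have "tensor_algebra base_field s symb symb_scalar = D_algebra ps \<zeta>"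
    unfolding symb_def[abs_def] symb_scalar_def[abs_def] base_field_def
    unfolding w s_def D_algebra_def Let_def ..
  then have D: "D_algebra ps \<zeta> = D.T.Q" unfolding D.T.tensor_algebra_eq by (rule sym)
  show ?thesis unfolding Let_def D by (rule D.D_nonvanishing[OF m])
qed

section \<open>Arithmetic of the hypotheses on n, m and the characteristic\<close>

lemma dvd_prod_list_nat: "p \<in> set ps \<Longrightarrow> p dvd (prod_list ps :: nat)"
  by (induction ps) auto

lemma prime_dvd_of_sqf_dvd:
  assumes "prime p" "p dvd n" "0 < n" "sqf n dvd m"
  shows "p dvd m"
proof -
  have "p \<in> prime_factors n" using assms by (simp add: prime_factors_dvd)
  then have "p dvd sqf n" unfolding sqf_def by (intro dvd_prodI) auto
  then show ?thesis using assms(4) by (rule dvd_trans)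
qed

lemma of_nat_nonzero_field_hom:
  assumes "field_hom (h :: 'a::field \<Rightarrow> 'b::field)" and "of_nat i \<noteq> (0 :: 'a)"
  shows "of_nat i \<noteq> (0 :: 'b)"
proof
  interpret h: field_hom h by fact
  assume "of_nat i = (0 :: 'b)"
  then have "h (of_nat i) = h 0" by (simp only: h.hom_of_nat h.hom_zero)
  then have "of_nat i = (0 :: 'a)" by (rule h.injectivity)
  with assms(2) show False by (rule notE)
qed

theorem corollary1p6:
  fixes n m :: nat
  assumes "n \<ge> 1"
    and "\<not> CHAR('k::field) dvd fact n"
    and "m \<ge> 1"
    and "sqf n dvd m"
  shows
    "(\<forall>ps (\<zeta> :: nat \<Rightarrow> 'k).
        prod_list ps = n \<and> (\<forall>p\<in>set ps. prime p \<and> primitive_root_of_unity p (\<zeta> p)) \<longrightarrow>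
        (let D = D_algebra ps \<zeta>;
             \<sigma> = red_sigma TYPE('k ratfun alg_closure) D n;
             nrd = red_norm TYPE('k ratfun alg_closure) D n;
             trd = red_trace TYPE('k ratfun alg_closure) D n
         in (m \<le> n \<longrightarrow> (\<forall>x\<in>carrier D - {\<zero>\<^bsub>D\<^esub>}. \<sigma> m x \<noteq> \<zero>\<^bsub>D\<^esub>)) \<and>
            (\<forall>xs. length xs = m \<and> set xs \<subseteq> carrier D - {\<zero>\<^bsub>D\<^esub>} \<and>
                  (\<forall>x\<in>set xs. \<forall>y\<in>set xs. nrd x = nrd y) \<longrightarrow>
                  trd (list_mult D xs) \<noteq> \<zero>\<^bsub>D\<^esub>) \<and>
            \<not> (\<exists>x\<in>carrier D. nrd x = \<one>\<^bsub>D\<^esub> \<and> trd x = \<zero>\<^bsub>D\<^esub>))) \<and>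
     (let D = UD_algebra n :: 'k ratfun mat ring;
          \<sigma> = red_sigma TYPE('k ratfun alg_closure) D n;
          nrd = red_norm TYPE('k ratfun alg_closure) D n;
          trd = red_trace TYPE('k ratfun alg_closure) D n
      in (m \<le> n \<longrightarrow> (\<forall>x\<in>carrier D - {\<zero>\<^bsub>D\<^esub>}. \<sigma> m x \<noteq> \<zero>\<^bsub>D\<^esub>)) \<and>
         (\<forall>xs. length xs = m \<and> set xs \<subseteq> carrier D - {\<zero>\<^bsub>D\<^esub>} \<and>
               (\<forall>x\<in>set xs. \<forall>y\<in>set xs. nrd x = nrd y) \<longrightarrow>
               trd (list_mult D xs) \<noteq> \<zero>\<^bsub>D\<^esub>) \<and>
         \<not> (\<exists>x\<in>carrier D. nrd x = \<one>\<^bsub>D\<^esub> \<and> trd x = \<zero>\<^bsub>D\<^esub>))"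
proof (intro conjI allI impI)
  \<comment> \<open>Each i between 1 and n divides n!, so the characteristic divides none of them;
    this includes characteristic 0, since 0 divides only 0.\<close>
  have char: "of_nat i \<noteq> (0 :: 'k)" if "1 \<le> i" "i \<le> n" for i
    using that assms(2) dvd_fact[OF that] dvd_trans unfolding of_nat_eq_0_iff_char_dvd by blast
  fix ps and \<zeta> :: "nat \<Rightarrow> 'k"
  assume ps: "prod_list ps = n \<and> (\<forall>p\<in>set ps. prime p \<and> primitive_root_of_unity p (\<zeta> p))"
  interpret weyl_char ps n "length ps" "\<lambda>i. \<zeta> (ps ! i)"
    by unfold_locales (use ps char in auto)
  have dvd: "ps ! i dvd m" if "i < length ps" for i
    using prime_dvd_of_sqf_dvd[of "ps ! i" n m] dvd_prod_list_nat[of "ps ! i" ps] nth_mem[OF that] ps assms(1,4) by auto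
  show "let D = D_algebra ps \<zeta>;
             \<sigma> = red_sigma TYPE('k ratfun alg_closure) D n;
             nrd = red_norm TYPE('k ratfun alg_closure) D n;
             trd = red_trace TYPE('k ratfun alg_closure) D n
         in (m \<le> n \<longrightarrow> (\<forall>x\<in>carrier D - {\<zero>\<^bsub>D\<^esub>}. \<sigma> m x \<noteq> \<zero>\<^bsub>D\<^esub>)) \<and>
            (\<forall>xs. length xs = m \<and> set xs \<subseteq> carrier D - {\<zero>\<^bsub>D\<^esub>} \<and>
                  (\<forall>x\<in>set xs. \<forall>y\<in>set xs. nrd x = nrd y) \<longrightarrow>
                  trd (list_mult D xs) \<noteq> \<zero>\<^bsub>D\<^esub>) \<and>
            \<not> (\<exists>x\<in>carrier D. nrd x = \<one>\<^bsub>D\<^esub> \<and> trd x = \<zero>\<^bsub>D\<^esub>)"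
    by (rule D_algebra_nonvanishing[OF refl assms(3) dvd])
next
  have char: "of_nat i \<noteq> (0 :: 'k ratfun alg_closure)" if "1 \<le> i" "i \<le> n" for i
  proof -
    have "of_nat i \<noteq> (0 :: 'k)"
      using that assms(2) dvd_fact[OF that] dvd_trans unfolding of_nat_eq_0_iff_char_dvd by blast
    then have "of_nat i \<noteq> (0 :: 'k ratfun)" by (rule of_nat_nonzero_field_hom[OF field_hom_rconst])
    then show ?thesis by (rule of_nat_nonzero_field_hom[OF field_hom_to_ac])
  qed
  \<comment> \<open>UD(n) comes without a factorization of n; any enumeration of the prime factors
    with multiplicity provides the clock and shift matrices for its embedding.\<close>
  obtain ps where mset: "mset ps = prime_factorization n" using ex_mset by blast
  have prod: "n = prod_list ps"
    unfolding prod_mset_prod_list[symmetric] mset using assms(1) by (simp add: prod_mset_prime_factorization_nat)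
  have set: "set ps = prime_factors n" unfolding set_mset_mset[symmetric] mset ..
  have primes: "prime p" if "p \<in> set ps" for p using that set by auto
  \<comment> \<open>Nothing is assumed here about roots of unity in k, so they are chosen in the
    algebraic closure.\<close>
  define w :: "nat \<Rightarrow> 'k ratfun alg_closure" where "w i = (SOME w. primitive_root_of_unity (ps ! i) w)" for i
  have w: "primitive_root_of_unity (ps ! i) (w i)" if i: "i < length ps" for i
  proof -
    have p: "prime (ps ! i)" using primes nth_mem[OF i] by blast
    have "ps ! i \<le> n" using dvd_prod_list_nat[OF nth_mem[OF i]] assms(1) prod by (auto intro: dvd_imp_le)
    then have "of_nat (ps ! i) \<noteq> (0 :: 'k ratfun alg_closure)" using prime_ge_1_nat[OF p] by (intro char)
    from exists_primitive_root[OF p this] show ?thesis unfolding w_def by (rule someI_ex)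
  qed
  interpret weyl_UD ps n "length ps" w
    by unfold_locales (use prod primes w char in auto)
  have dvd: "ps ! i dvd m" if "i < length ps" for i
    using prime_dvd_of_sqf_dvd[of "ps ! i" n m] dvd_prod_list_nat[of "ps ! i" ps] nth_mem[OF that] primes prod assms(1,4) by auto
  show "let D = UD_algebra n :: 'k ratfun mat ring;
          \<sigma> = red_sigma TYPE('k ratfun alg_closure) D n;
          nrd = red_norm TYPE('k ratfun alg_closure) D n;
          trd = red_trace TYPE('k ratfun alg_closure) D n
      in (m \<le> n \<longrightarrow> (\<forall>x\<in>carrier D - {\<zero>\<^bsub>D\<^esub>}. \<sigma> m x \<noteq> \<zero>\<^bsub>D\<^esub>)) \<and>
         (\<forall>xs. length xs = m \<and> set xs \<subseteq> carrier D - {\<zero>\<^bsub>D\<^esub>} \<and>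
               (\<forall>x\<in>set xs. \<forall>y\<in>set xs. nrd x = nrd y) \<longrightarrow>
               trd (list_mult D xs) \<noteq> \<zero>\<^bsub>D\<^esub>) \<and>
         \<not> (\<exists>x\<in>carrier D. nrd x = \<one>\<^bsub>D\<^esub> \<and> trd x = \<zero>\<^bsub>D\<^esub>)"
    by (rule UD_nonvanishing[OF assms(3) dvd])
qed

end
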